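(* The finite satisfiability problem for two-variable $\mathrm{UNFO}{+}\mathcal{S}$ (given a two-variable $\mathrm{UNFO}{+}\mathcal{S}$ sentence, decide whether it has a finite admissible model) is $2\text{-}\textsc{ExpTime}$-complete.
   Context: Signatures are purely relational, $\sigma=\sigma_{\mathrm{base}}\cup\sigma_{\mathrm{dist}}$ with $\sigma_{\mathrm{dist}}=\{T_1,\dots,T_{2k}\}$ binary. $\mathrm{UNFO}$ formulas are given by $\phi ::= B\bar x \mid x=y \mid \phi\wedge\phi \mid \phi\vee\phi \mid \exists x\,\phi \mid \neg\phi(x)$, where in the last clause $\phi$ has at most the free variable $x$. $\mathrm{UNFO}{+}\mathcal{S}$ has the same syntax, but admissible structures must interpret each $T_u$ as a transitive relation and $T_{2u}$ as the inverse of $T_{2u-1}$ ($1\le u\le k$). Two-variable formulas use only variables $x,y$ and relation symbols of arity at most $2$. *)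

theory Defs
  imports "HOL-Computational_Algebra.Polynomial"
begin

section \<open>Unary negation first-order logic over distinguished transitive relations\<close>

text \<open>
  \<open>Base i n\<close> is the \<open>i\<close>-th base symbol of arity \<open>n\<close>; \<open>Dist u\<close> is the distinguished binary
  symbol \<open>T\<^sub>u\<close>, where \<open>u\<close> ranges over \<open>1, ..., 2k\<close>.
\<close>

datatype rsym = Base nat nat | Dist nat

fun arity :: "rsym \<Rightarrow> nat" where
  "arity (Base i n) = n"
| "arity (Dist u) = 2"

datatype fm =
    Atom rsym "nat list"
  | Eq nat nat
  | And fm fm
  | Or fm fm
  | Exists nat fm
  | Neg fm

fun fv :: "fm \<Rightarrow> nat set" where
  "fv (Atom R xs) = set xs"
| "fv (Eq x y) = {x, y}"
| "fv (And \<phi> \<psi>) = fv \<phi> \<union> fv \<psi>"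
| "fv (Or \<phi> \<psi>) = fv \<phi> \<union> fv \<psi>"
| "fv (Exists x \<phi>) = fv \<phi> - {x}"
| "fv (Neg \<phi>) = fv \<phi>"

fun vars :: "fm \<Rightarrow> nat set" where
  "vars (Atom R xs) = set xs"
| "vars (Eq x y) = {x, y}"
| "vars (And \<phi> \<psi>) = vars \<phi> \<union> vars \<psi>"
| "vars (Or \<phi> \<psi>) = vars \<phi> \<union> vars \<psi>"
| "vars (Exists x \<phi>) = insert x (vars \<phi>)"
| "vars (Neg \<phi>) = vars \<phi>"

fun syms :: "fm \<Rightarrow> rsym set" where
  "syms (Atom R xs) = {R}"
| "syms (Eq x y) = {}"
| "syms (And \<phi> \<psi>) = syms \<phi> \<union> syms \<psi>"
| "syms (Or \<phi> \<psi>) = syms \<phi> \<union> syms \<psi>"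
| "syms (Exists x \<phi>) = syms \<phi>"
| "syms (Neg \<phi>) = syms \<phi>"

fun unfo :: "fm \<Rightarrow> bool" where
  "unfo (Atom R xs) \<longleftrightarrow> length xs = arity R"
| "unfo (Eq x y) \<longleftrightarrow> True"
| "unfo (And \<phi> \<psi>) \<longleftrightarrow> unfo \<phi> \<and> unfo \<psi>"
| "unfo (Or \<phi> \<psi>) \<longleftrightarrow> unfo \<phi> \<and> unfo \<psi>"
| "unfo (Exists x \<phi>) \<longleftrightarrow> unfo \<phi>"
| "unfo (Neg \<phi>) \<longleftrightarrow> unfo \<phi> \<and> (\<exists>x. fv \<phi> \<subseteq> {x})"

text \<open>The two variables \<open>x\<close> and \<open>y\<close> are \<open>0\<close> and \<open>1\<close>.\<close>

definition two_variable :: "fm \<Rightarrow> bool" where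
  "two_variable \<phi> \<longleftrightarrow> vars \<phi> \<subseteq> {0, 1} \<and> (\<forall>R \<in> syms \<phi>. arity R \<le> 2)"

definition over_signature :: "nat \<Rightarrow> fm \<Rightarrow> bool" where
  "over_signature k \<phi> \<longleftrightarrow> (\<forall>u. Dist u \<in> syms \<phi> \<longrightarrow> u \<in> {1..2 * k})"

record 'a struct =
  universe :: "'a set"
  interp :: "rsym \<Rightarrow> 'a list set"

definition is_struct :: "'a struct \<Rightarrow> bool" where
  "is_struct A \<longleftrightarrow> universe A \<noteq> {} \<and>
     (\<forall>R. interp A R \<subseteq> {as. length as = arity R \<and> set as \<subseteq> universe A})"

fun sat :: "'a struct \<Rightarrow> (nat \<Rightarrow> 'a) \<Rightarrow> fm \<Rightarrow> bool" where
  "sat A v (Atom R xs) \<longleftrightarrow> map v xs \<in> interp A R"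
| "sat A v (Eq x y) \<longleftrightarrow> v x = v y"
| "sat A v (And \<phi> \<psi>) \<longleftrightarrow> sat A v \<phi> \<and> sat A v \<psi>"
| "sat A v (Or \<phi> \<psi>) \<longleftrightarrow> sat A v \<phi> \<or> sat A v \<psi>"
| "sat A v (Exists x \<phi>) \<longleftrightarrow> (\<exists>a \<in> universe A. sat A (v(x := a)) \<phi>)"
| "sat A v (Neg \<phi>) \<longleftrightarrow> \<not> sat A v \<phi>"

definition models :: "'a struct \<Rightarrow> fm \<Rightarrow> bool" where
  "models A \<phi> \<longleftrightarrow> (\<forall>v. range v \<subseteq> universe A \<longrightarrow> sat A v \<phi>)"

definition dist_rel :: "'a struct \<Rightarrow> nat \<Rightarrow> ('a \<times> 'a) set" where
  "dist_rel A u = {(a, b). [a, b] \<in> interp A (Dist u)}"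

definition admissible :: "nat \<Rightarrow> 'a struct \<Rightarrow> bool" where
  "admissible k A \<longleftrightarrow> is_struct A \<and>
     (\<forall>u \<in> {1..2 * k}. trans (dist_rel A u)) \<and>
     (\<forall>u \<in> {1..k}. dist_rel A (2 * u) = (dist_rel A (2 * u - 1))\<inverse>)"

text \<open>
  Every finite structure is isomorphic to one whose domain is a set of natural numbers, so
  ranging over \<^typ>\<open>nat struct\<close> loses no finite models.
\<close>

definition finitely_satisfiable :: "nat \<Rightarrow> fm \<Rightarrow> bool" where
  "finitely_satisfiable k \<phi> \<longleftrightarrow>
     (\<exists>A :: nat struct. admissible k A \<and> finite (universe A) \<and> models A \<phi>)"

definition unfo2_S_sentence :: "nat \<Rightarrow> fm \<Rightarrow> bool" where
  "unfo2_S_sentence k \<phi> \<longleftrightarrow> unfo \<phi> \<and> two_variable \<phi> \<and> over_signature k \<phi> \<and> fv \<phi> = {}"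


section \<open>Formulas as binary words\<close>

text \<open>
  Numbers are written in binary, least significant bit first; each bit is preceded by \<open>True\<close>
  and the end is marked by \<open>False\<close>, so that the code is self-delimiting and of logarithmic length.
\<close>

fun enc_nat :: "nat \<Rightarrow> bool list" where
  "enc_nat n = (if n = 0 then [False] else True # odd n # enc_nat (n div 2))"

declare enc_nat.simps [simp del]

fun enc_nats :: "nat list \<Rightarrow> bool list" where
  "enc_nats [] = [False]"
| "enc_nats (x # xs) = True # enc_nat x @ enc_nats xs"

fun enc_rsym :: "rsym \<Rightarrow> bool list" where
  "enc_rsym (Base i n) = False # enc_nat i @ enc_nat n"
| "enc_rsym (Dist u) = True # enc_nat u"

fun enc_fm :: "fm \<Rightarrow> bool list" where
  "enc_fm (Atom R xs) = [False, False, False] @ enc_rsym R @ enc_nats xs"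
| "enc_fm (Eq x y) = [False, False, True] @ enc_nat x @ enc_nat y"
| "enc_fm (And \<phi> \<psi>) = [False, True, False] @ enc_fm \<phi> @ enc_fm \<psi>"
| "enc_fm (Or \<phi> \<psi>) = [False, True, True] @ enc_fm \<phi> @ enc_fm \<psi>"
| "enc_fm (Exists x \<phi>) = [True, False, False] @ enc_nat x @ enc_fm \<phi>"
| "enc_fm (Neg \<phi>) = [True, False, True] @ enc_fm \<phi>"

lemma enc_nat_0: "enc_nat 0 = [False]"
  by (subst enc_nat.simps) simp

lemma enc_nat_pos: "n \<noteq> 0 \<Longrightarrow> enc_nat n = True # odd n # enc_nat (n div 2)"
  by (subst enc_nat.simps) simp

lemma enc_nat_append_inj: "enc_nat m @ r = enc_nat n @ s \<Longrightarrow> m = n \<and> r = s"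
proof (induction m arbitrary: n rule: less_induct)
  case (less m)
  consider "m = 0" "n = 0" | "m = 0" "n \<noteq> 0" | "m \<noteq> 0" "n = 0" | "m \<noteq> 0" "n \<noteq> 0"
    by blast
  then show ?case
  proof cases
    case 4
    then have "True # odd m # enc_nat (m div 2) @ r = True # odd n # enc_nat (n div 2) @ s"
      using less.prems by (metis enc_nat_pos append_Cons)
    then have *: "odd m = odd n" "enc_nat (m div 2) @ r = enc_nat (n div 2) @ s"
      by simp_all
    have "m div 2 < m"
      using 4 by simp
    then have "m div 2 = n div 2 \<and> r = s"
      using less.IH *(2) by blast
    moreover have "m mod 2 = n mod 2"
      using *(1) by (metis even_iff_mod_2_eq_zero odd_iff_mod_2_eq_one)
    ultimately show ?thesis
      by (metis div_mult_mod_eq)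
  qed (use less.prems in \<open>simp_all add: enc_nat_0 enc_nat_pos\<close>)
qed

lemma enc_nats_append_inj: "enc_nats xs @ r = enc_nats ys @ s \<Longrightarrow> xs = ys \<and> r = s"
proof (induction xs arbitrary: ys)
  case Nil
  then show ?case by (cases ys) auto
next
  case (Cons x xs)
  then show ?case by (cases ys) (auto dest!: enc_nat_append_inj)
qed

lemma enc_rsym_append_inj: "enc_rsym R @ r = enc_rsym R' @ s \<Longrightarrow> R = R' \<and> r = s"
  by (cases R; cases R') (auto dest!: enc_nat_append_inj)

lemma enc_fm_append_inj: "enc_fm \<phi> @ r = enc_fm \<psi> @ s \<Longrightarrow> \<phi> = \<psi> \<and> r = s"
proof (induction \<phi> arbitrary: \<psi> r s)
  case (Atom R xs)
  then show ?case by (cases \<psi>) (auto dest!: enc_rsym_append_inj enc_nats_append_inj)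
next
  case (Eq x y)
  then show ?case by (cases \<psi>) (auto dest!: enc_nat_append_inj)
next
  case (And \<phi>1 \<phi>2)
  from And.prems show ?case by (cases \<psi>) (auto dest!: And.IH)
next
  case (Or \<phi>1 \<phi>2)
  from Or.prems show ?case by (cases \<psi>) (auto dest!: Or.IH)
next
  case (Exists x \<phi>)
  from Exists.prems show ?case by (cases \<psi>) (auto dest!: enc_nat_append_inj Exists.IH)
next
  case (Neg \<phi>)
  from Neg.prems show ?case by (cases \<psi>) (auto dest!: Neg.IH)
qed

lemma inj_enc_fm: "inj enc_fm"
  by (rule injI) (metis append_Nil2 enc_fm_append_inj)

text \<open>
  The signature, and hence \<open>k\<close>, is not fixed; whether a sentence is finitely satisfiable does not
  depend on which \<open>k\<close> admitting all its symbols is chosen.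
\<close>

definition UNFO2_S_FINSAT :: "bool list set" where
  "UNFO2_S_FINSAT =
     {enc_fm \<phi> | \<phi> k. unfo2_S_sentence k \<phi> \<and> finitely_satisfiable k \<phi>}"


section \<open>Deterministic single-tape Turing machines and doubly exponential time\<close>

text \<open>
  States are \<open>0, ..., num_states - 1\<close> with initial state \<open>0\<close>.  Tape symbols are
  \<open>0, ..., num_symbols - 1\<close>, where \<open>0\<close> is the blank and \<open>1\<close>, \<open>2\<close> are the input letters
  \<^const>\<open>False\<close>, \<^const>\<open>True\<close>.  The tape is infinite in both directions.
\<close>

datatype move = Left | Stay | Right

record tm =
  num_states :: nat
  num_symbols :: nat
  trans_fun :: "nat \<Rightarrow> nat \<Rightarrow> nat \<times> nat \<times> move"
  accept_state :: nat
  reject_state :: nat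

definition is_tm :: "tm \<Rightarrow> bool" where
  "is_tm M \<longleftrightarrow> 0 < num_states M \<and> 3 \<le> num_symbols M \<and>
     accept_state M < num_states M \<and> reject_state M < num_states M \<and>
     accept_state M \<noteq> reject_state M \<and>
     (\<forall>q < num_states M. \<forall>a < num_symbols M.
        case trans_fun M q a of (q', b, d) \<Rightarrow> q' < num_states M \<and> b < num_symbols M)"

record config =
  state :: nat
  head :: int
  tape :: "int \<Rightarrow> nat"

definition word_tape :: "bool list \<Rightarrow> int \<Rightarrow> nat" where
  "word_tape w i =
     (if 0 \<le> i \<and> i < int (length w) then (if w ! nat i then 2 else 1) else 0)"

definition init_config :: "bool list \<Rightarrow> config" where
  "init_config w = \<lparr>state = 0, head = 0, tape = word_tape w\<rparr>"

definition halted :: "tm \<Rightarrow> config \<Rightarrow> bool" where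
  "halted M c \<longleftrightarrow> state c = accept_state M \<or> state c = reject_state M"

fun shift :: "move \<Rightarrow> int \<Rightarrow> int" where
  "shift Left i = i - 1"
| "shift Stay i = i"
| "shift Right i = i + 1"

definition step :: "tm \<Rightarrow> config \<Rightarrow> config" where
  "step M c =
     (if halted M c then c
      else case trans_fun M (state c) (tape c (head c)) of (q, b, d) \<Rightarrow>
        \<lparr>state = q, head = shift d (head c), tape = (tape c)(head c := b)\<rparr>)"

definition decides_in_time :: "tm \<Rightarrow> bool list set \<Rightarrow> (nat \<Rightarrow> nat) \<Rightarrow> bool" where
  "decides_in_time M X T \<longleftrightarrow>
     (\<forall>w. \<exists>t \<le> T (length w).
        state ((step M ^^ t) (init_config w)) =
          (if w \<in> X then accept_state M else reject_state M))"

definition computes_in_time :: "tm \<Rightarrow> (bool list \<Rightarrow> bool list) \<Rightarrow> (nat \<Rightarrow> nat) \<Rightarrow> bool" where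
  "computes_in_time M f T \<longleftrightarrow>
     (\<forall>w. \<exists>t \<le> T (length w).
        halted M ((step M ^^ t) (init_config w)) \<and>
        tape ((step M ^^ t) (init_config w)) = word_tape (f w))"

definition TWO_EXPTIME :: "bool list set set" where
  "TWO_EXPTIME =
     {X. \<exists>M (p :: nat poly). is_tm M \<and> decides_in_time M X (\<lambda>n. 2 ^ 2 ^ poly p n)}"

definition polytime_computable :: "(bool list \<Rightarrow> bool list) \<Rightarrow> bool" where
  "polytime_computable f \<longleftrightarrow> (\<exists>M (p :: nat poly). is_tm M \<and> computes_in_time M f (poly p))"

definition polytime_reducible :: "bool list set \<Rightarrow> bool list set \<Rightarrow> bool" where
  "polytime_reducible X Y \<longleftrightarrow> (\<exists>f. polytime_computable f \<and> (\<forall>w. w \<in> X \<longleftrightarrow> f w \<in> Y))"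

definition complete_for :: "bool list set set \<Rightarrow> bool list set \<Rightarrow> bool" where
  "complete_for C Y \<longleftrightarrow> Y \<in> C \<and> (\<forall>X \<in> C. polytime_reducible X Y)"

end

theory Submission
 imports Defs
begin

text \<open>
 Upper bound.  A finite model is described by the profiles of its elements: the type of the element, a
 covering of all its distinguished connections to other elements, and potentials that strictly
 decrease along one-way distinguished edges.  Conversely, let every existential demand of a set of
 profiles be witnessed inside the set.  A finite model is obtained as a cover of the graph of
 witnesses: a point is a profile with a set of edges, and traversing an edge toggles it in this set.  The
 potentials ensure that points connected in several transitive relations are connected by one
 common path, so that the coverings control all pairs.  There are doubly exponentially many
 profiles; eliminating those without witnesses until stability decides finite satisfiability.

 Lower bound.  A cell of the space-time diagram of a machine running in doubly exponential time is
 represented by exponentially many elements, each carrying one bit of the time and of the place of the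
 cell.  For a transitive T, mutual T-connection is an equivalence on its field; six of these
 join every cell to its three predecessors, so that the counters can be compared bit by bit.
\<close>


section \<open>Stack programs and their simulation by a single-tape machine\<close>

text \<open>Since negation is unary, the relations between two distinct points occur only positively
  in the formulas evaluated there (\<open>ev_mono\<close>). A model therefore has to bound the
  relations of every pair only from above, and a covering may list keys that do not hold. The
  obstacle is finiteness: a tree of witnesses has unique paths but may be infinite, while in a
  finite quotient two points may be joined by different paths in different transitive relations, a
  combination that no covering has foreseen. The toggled set records the use of edges modulo 2, so
  that all paths between two given points agree on the edges used an odd number of times; the
  potentials handle the remaining disagreement. Potentials read off a model grow with the model. A
  latest appearance record compresses them to a number of bits exponential in the length of the
  sentence. In the lower bound the place is a counter that wraps around, so the diagram is periodic
  in space and is compared with the machine only inside a light cone. The input is written by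
  additional states of the machine, which leaves a first row that is blank apart from the
  head.\<close>

datatype stk = IO | MN | AX | BX | CT

text \<open>
 \<open>Case j a b c\<close> pops stack \<open>j\<close> and continues with \<open>a\<close>, \<open>b\<close> or \<open>c\<close> if the stack was empty, had
 \<^const>\<open>False\<close> or had \<^const>\<open>True\<close> on top; \<open>Whl j a\<close> pops \<open>j\<close> and runs \<open>a\<close> as long as it finds \<^const>\<open>True\<close>.
 \<open>Stop\<close> never terminates in the big-step semantics: it marks the halting states of the machine.
\<close>

datatype com = Skip | Push stk bool | Seq com com (infixr \<open>;;\<close> 60) | Case stk com com com
 | Whl stk com | Stop bool

type_synonym stacks = "stk => bool list"

inductive exec :: "com => stacks => nat => stacks => bool" where
 Skip: "exec Skip S 1 S"
| Push: "exec (Push j b) S 1 (S(j := b # S j))"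
| Seq: "exec a S t S1 ==> exec b S1 u S2 ==> exec (a ;; b) S (t + u + 1) S2"
| CaseN: "S j = [] ==> exec a S t S' ==> exec (Case j a b c) S (t + 1) S'"
| CaseF: "S j = False # r ==> exec b (S(j := r)) t S' ==> exec (Case j a b c) S (t + 1) S'"
| CaseT: "S j = True # r ==> exec c (S(j := r)) t S' ==> exec (Case j a b c) S (t + 1) S'"
| WhlN: "S j = [] ==> exec (Whl j a) S 1 S"
| WhlF: "S j = False # r ==> exec (Whl j a) S 1 (S(j := r))"
| WhlT: "S j = True # r ==> exec a (S(j := r)) t S1 ==> exec (Whl j a) S1 u S2
  ==> exec (Whl j a) S (t + u + 1) S2"

text \<open>Each time unit pushes at most one letter. Hence initial height plus running time bounds
  every stack, and with it the length of a head sweep in the simulation.\<close>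

lemma exec_height: "exec c S t S' ==> length (S' j) \<le> length (S j) + t"
proof (induction arbitrary: j rule: exec.induct)
 case (Seq a S t S1 b u S2)
 from Seq.IH(1)[of j] Seq.IH(2)[of j] show ?case by linarith
next
 case (CaseF S i r b t S' a c)
 from CaseF.IH[of j] CaseF.hyps show ?case by (auto split: if_splits)
next
 case (CaseT S i r c t S' a b)
 from CaseT.IH[of j] CaseT.hyps show ?case by (auto split: if_splits)
next
 case (WhlT S i r a t S1 u S2)
 from WhlT.IH(1)[of j] WhlT.IH(2)[of j] WhlT.hyps show ?case by (auto split: if_splits)
next
 case (CaseN S j' a t S' b c)
 from CaseN.IH[of j] show ?case by linarith
qed auto

text \<open>
 Stack \<open>j\<close> is kept on track \<open>j\<close> of the tape, bottom at position \<open>0\<close>; a tape symbol is the number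
 whose base-3 digits are the entries of the tracks, so the input word is stack \<^const>\<open>IO\<close>.
\<close>

fun trk_no :: "stk => nat" where
 "trk_no IO = 0" | "trk_no MN = 1" | "trk_no AX = 2" | "trk_no BX = 3" | "trk_no CT = 4"

definition trk :: "stk => nat => nat" where
 "trk j a = a div 3 ^ trk_no j mod 3"

text \<open>The addition precedes the subtraction because subtraction of natural numbers truncates
  at 0.\<close>

definition put :: "stk => nat => nat => nat" where
 "put j d a = (a + d * 3 ^ trk_no j) - trk j a * 3 ^ trk_no j"

definition digits :: "nat => nat => nat => nat => nat => nat" where
 "digits a b c d e = a + 3 * (b + 3 * (c + 3 * (d + 3 * e)))"

lemma digits_exist:
 assumes "a < 243"
 obtains p q r s t where "a = digits p q r s t" "p < 3" "q < 3" "r < 3" "s < 3" "t < 3"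
proof -
 have 1: "a = digits (a mod 3) (a div 3 mod 3) (a div 3 div 3 mod 3) (a div 3 div 3 div 3 mod 3)
   (a div 3 div 3 div 3 div 3)"
  unfolding digits_def by simp
 have 2: "a div 3 div 3 div 3 div 3 < 3" using assms by (simp flip: div_mult2_eq add: div_less_iff_less_mult)
 show ?thesis by (rule that[OF 1 _ _ _ _ 2]) simp_all
qed

lemma trk_digits:
 assumes "p < 3" "q < 3" "r < 3" "s < 3" "t < 3"
 shows "trk j (digits p q r s t) = (case j of IO => p | MN => q | AX => r | BX => s | CT => t)"
proof -
 have d: "(x + 3 * y) div 3 = y" "(x + 3 * y) mod 3 = x" if "x < 3" for x y :: nat
  using that by simp_all
 have e: "n div 9 = n div 3 div 3" "n div 27 = n div 3 div 3 div 3"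
  "n div 81 = n div 3 div 3 div 3 div 3" for n :: nat
  by (simp_all flip: div_mult2_eq)
 show ?thesis using assms by (cases j) (simp_all add: trk_def digits_def e d del: distrib_left_numeral)
qed

lemma put_digits:
 assumes "p < 3" "q < 3" "r < 3" "s < 3" "t < 3"
 shows "put j d (digits p q r s t) = (case j of IO => digits d q r s t | MN => digits p d r s t
  | AX => digits p q d s t | BX => digits p q r d t | CT => digits p q r s d)"
 unfolding put_def trk_digits[OF assms] by (cases j) (simp_all add: digits_def)

lemma trk_put: "a < 243 ==> d < 3 ==> trk i (put j d a) = (if i = j then d else trk i a)"
 by (erule digits_exist) (cases j; cases i; simp add: put_digits trk_digits)

lemma put_less: "a < 243 ==> d < 3 ==> put j d a < 243"
 by (erule digits_exist) (cases j; simp add: put_digits; simp add: digits_def)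

text \<open>A machine computing a function has to leave exactly the tape of the output word, so
  agreement of the tracks must yield equality of tape symbols.\<close>

lemma trk_ext: "a < 243 ==> b < 243 ==> (\<And>j. trk j a = trk j b) ==> a = b"
proof (erule digits_exist, erule digits_exist)
 fix p q r s t p' q' r' s' t'
 assume *: "\<And>j. trk j a = trk j b" "a = digits p q r s t" "b = digits p' q' r' s' t'"
  "p < 3" "q < 3" "r < 3" "s < 3" "t < 3" "p' < 3" "q' < 3" "r' < 3" "s' < 3" "t' < 3"
 from *(1)[of IO] *(1)[of MN] *(1)[of AX] *(1)[of BX] *(1)[of CT] *(2-)
 show "a = b" by (simp add: trk_digits)
qed

datatype st = Init | Fetch "com list" | PushR stk bool "com list" | GoL stk "com list"
 | PopR stk "com list" "com list" "com list" | PopL stk "com list" "com list" "com list"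

text \<open>Between commands the head rests at position -1, where every track is blank: there
  \<open>GoL\<close> recognizes the end of its sweep, and a blank seen by \<open>PopL\<close> means
  that the stack was empty. The list in \<open>Fetch\<close> is the continuation still to be
  run.\<close>

fun delta :: "com => st => nat => st \<times> nat \<times> move" where
 "delta c0 Init a = (Fetch [c0], a, Left)"
| "delta c0 (Fetch []) a = (Fetch [], a, Stay)"
| "delta c0 (Fetch (Skip # K)) a = (Fetch K, a, Stay)"
| "delta c0 (Fetch (Push j b # K)) a = (PushR j b K, a, Right)"
| "delta c0 (Fetch ((c ;; d) # K)) a = (Fetch (c # d # K), a, Stay)"
| "delta c0 (Fetch (Case j c d e # K)) a = (PopR j (c # K) (d # K) (e # K), a, Right)"
| "delta c0 (Fetch (Whl j c # K)) a = (PopR j K K (c # Whl j c # K), a, Right)"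
| "delta c0 (Fetch (Stop b # K)) a = (Fetch (Stop b # K), a, Stay)"
| "delta c0 (PushR j b K) a =
   (if trk j a = 0 then (GoL j K, put j (if b then 2 else 1) a, Left) else (PushR j b K, a, Right))"
| "delta c0 (GoL j K) a = (if trk j a = 0 then (Fetch K, a, Stay) else (GoL j K, a, Left))"
| "delta c0 (PopR j K0 K1 K2) a =
   (if trk j a = 0 then (PopL j K0 K1 K2, a, Left) else (PopR j K0 K1 K2, a, Right))"
| "delta c0 (PopL j K0 K1 K2) a =
   (if trk j a = 0 then (Fetch K0, a, Stay)
   else (GoL j (if trk j a = 1 then K1 else K2), put j 0 a, Left))"

section \<open>Simulation of stack commands by head sweeps\<close>

definition astep :: "com => st \<times> int \<times> (int => nat) => st \<times> int \<times> (int => nat)" where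
 "astep c0 x = (case x of (q, h, tp) =>
   case delta c0 q (tp h) of (q', a, d) => (q', shift d h, tp(h := a)))"

definition holds_stacks :: "(int => nat) => stacks => bool" where
 "holds_stacks tp S \<longleftrightarrow> (\<forall>i. tp i < 243 \<and> (\<forall>j. trk j (tp i) = word_tape (rev (S j)) i))"

definition reaches :: "com => nat => st \<times> int \<times> (int => nat) => st \<times> int \<times> (int => nat) => bool" where
 "reaches c0 n x y \<longleftrightarrow> (\<exists>m \<le> n. (astep c0 ^^ m) x = y)"

lemma reaches_refl: "reaches c0 n x x"
 unfolding reaches_def by (rule exI[of _ 0]) simp

lemma reaches_trans: "reaches c0 m x y ==> reaches c0 n y z ==> m + n \<le> k ==> reaches c0 k x z"
 unfolding reaches_def
proof (elim exE conjE)
 fix i j assume "i \<le> m" "j \<le> n" "(astep c0 ^^ i) x = y" "(astep c0 ^^ j) y = z" "m + n \<le> k"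
 then show "\<exists>m\<le>k. (astep c0 ^^ m) x = z"
  by (intro exI[of _ "j + i"]) (simp add: funpow_add)
qed

lemma reaches_step: "reaches c0 n (astep c0 x) y ==> reaches c0 (Suc n) x y"
 unfolding reaches_def by (metis Suc_le_mono comp_apply funpow_Suc_right)

lemma reaches_step_le: "reaches c0 n (astep c0 x) y ==> Suc n \<le> k ==> reaches c0 k x y"
 using reaches_trans[OF reaches_step reaches_refl, of c0 n x y 0 k] by simp

lemma word_tape_snoc:
 "word_tape (w @ [b]) i = (if i = int (length w) then (if b then 2 else 1) else word_tape w i)"
 by (auto simp: word_tape_def nth_append)

lemma word_tape_zero_iff: "word_tape w i = 0 \<longleftrightarrow> i < 0 \<or> int (length w) \<le> i"
 by (auto simp: word_tape_def)

lemma holds_push: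
 assumes "holds_stacks tp S"
 shows "holds_stacks (tp(int (length (S j)) := put j (if b then 2 else 1) (tp (int (length (S j))))))
  (S(j := b # S j))"
 using assms by (auto simp: holds_stacks_def trk_put put_less word_tape_snoc)

lemma holds_pop:
 assumes "holds_stacks tp S" "S j = b # r"
 shows "holds_stacks (tp(int (length r) := put j 0 (tp (int (length r))))) (S(j := r))"
 using assms by (auto simp: holds_stacks_def trk_put put_less word_tape_snoc)
  (simp add: word_tape_def)

lemma move_right:
 assumes "holds_stacks tp S" "n \<le> length (S j)"
  and "\<And>a. trk j a \<noteq> 0 ==> delta c0 q a = (q, a, Right)"
 shows "reaches c0 n (q, int (length (S j) - n), tp) (q, int (length (S j)), tp)"
 using assms(2)
proof (induction n)
 case 0 then show ?case by (simp add: reaches_refl)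
next
 case (Suc n)
 have "trk j (tp (int (length (S j) - Suc n))) \<noteq> 0"
  using Suc.prems assms(1) by (auto simp: holds_stacks_def word_tape_zero_iff)
 then have "astep c0 (q, int (length (S j) - Suc n), tp) = (q, int (length (S j) - n), tp)"
  using Suc.prems by (auto simp: astep_def assms(3))
 then show ?case using Suc by (auto intro: reaches_step)
qed

lemma move_left:
 assumes "holds_stacks tp S" "n \<le> length (S j)"
 shows "reaches c0 (n + 1) (GoL j K, int n - 1, tp) (Fetch K, -1, tp)"
 using assms(2)
proof (induction n)
 case 0
 have "trk j (tp (-1)) = 0"
  using assms(1) by (auto simp: holds_stacks_def word_tape_zero_iff)
 then show ?case by (auto intro!: reaches_step simp: astep_def reaches_refl)
next
 case (Suc n)
 have "trk j (tp (int n)) \<noteq> 0"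
  using Suc.prems assms(1) by (auto simp: holds_stacks_def word_tape_zero_iff)
 then have "astep c0 (GoL j K, int n, tp) = (GoL j K, int n - 1, tp)"
  by (auto simp: astep_def)
 then show ?case using Suc by (auto intro: reaches_step)
qed

lemma push_reaches:
 assumes "holds_stacks tp S" "length (S j) \<le> H"
 obtains tp' where "holds_stacks tp' (S(j := b # S j))"
  "reaches c0 (2 * H + 4) (Fetch (Push j b # K), -1, tp) (Fetch K, -1, tp')"
proof -
 let ?h = "int (length (S j))"
 define tp' where "tp' = tp(?h := put j (if b then 2 else 1) (tp ?h))"
 have h': "holds_stacks tp' (S(j := b # S j))"
  unfolding tp'_def by (rule holds_push[OF assms(1)])
 have s1: "astep c0 (Fetch (Push j b # K), -1, tp) = (PushR j b K, 0, tp)"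
  by (simp add: astep_def fun_upd_idem)
 have s2: "reaches c0 (length (S j)) (PushR j b K, 0, tp) (PushR j b K, ?h, tp)"
  using move_right[OF assms(1), of "length (S j)" j c0 "PushR j b K"] by simp
 have "trk j (tp ?h) = 0"
  using assms(1) by (auto simp: holds_stacks_def word_tape_zero_iff)
 then have s3: "astep c0 (PushR j b K, ?h, tp) = (GoL j K, ?h - 1, tp')"
  by (auto simp: astep_def tp'_def)
 have s4: "reaches c0 (length (S j) + 1) (GoL j K, ?h - 1, tp') (Fetch K, -1, tp')"
  by (rule move_left[OF h']) simp
 have "reaches c0 (length (S j) + 2) (PushR j b K, ?h, tp) (Fetch K, -1, tp')"
  by (rule reaches_step_le[of c0 "length (S j) + 1"]) (use s3 s4 in simp_all)
 with s2 have "reaches c0 (2 * H + 3) (PushR j b K, 0, tp) (Fetch K, -1, tp')"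
  by (rule reaches_trans) (use assms(2) in simp)
 then have "reaches c0 (2 * H + 4) (Fetch (Push j b # K), -1, tp) (Fetch K, -1, tp')"
  using reaches_step_le[of c0 "2 * H + 3" "(Fetch (Push j b # K), -1, tp)" _ "2 * H + 4"] s1 by simp
 with h' show ?thesis by (rule that)
qed

lemma pop_reaches:
 assumes "holds_stacks tp S" "length (S j) \<le> H"
  and q: "delta c0 q (tp (-1)) = (PopR j K0 K1 K2, tp (-1), Right)"
 obtains tp' where
  "holds_stacks tp' (S(j := tl (S j)))"
  "reaches c0 (2 * H + 4) (q, -1, tp)
   (Fetch (case S j of [] => K0 | b # _ => if b then K2 else K1), -1, tp')"
proof -
 let ?h = "int (length (S j))"
 have s1: "astep c0 (q, -1, tp) = (PopR j K0 K1 K2, 0, tp)"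
  using q by (simp add: astep_def fun_upd_idem)
 have s2: "reaches c0 (length (S j)) (PopR j K0 K1 K2, 0, tp) (PopR j K0 K1 K2, ?h, tp)"
  using move_right[OF assms(1), of "length (S j)" j c0 "PopR j K0 K1 K2"] by simp
 have "trk j (tp ?h) = 0"
  using assms(1) by (auto simp: holds_stacks_def word_tape_zero_iff)
 then have s3: "astep c0 (PopR j K0 K1 K2, ?h, tp) = (PopL j K0 K1 K2, ?h - 1, tp)"
  by (auto simp: astep_def)
 have s: "reaches c0 (H + 2) (q, -1, tp) (PopL j K0 K1 K2, ?h - 1, tp)"
 proof -
  have "reaches c0 1 (PopR j K0 K1 K2, ?h, tp) (PopL j K0 K1 K2, ?h - 1, tp)"
   using reaches_step[of c0 0 "(PopR j K0 K1 K2, ?h, tp)"] s3 reaches_refl by simp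
  with s2 have "reaches c0 (H + 1) (PopR j K0 K1 K2, 0, tp) (PopL j K0 K1 K2, ?h - 1, tp)"
   by (rule reaches_trans) (use assms(2) in simp)
  then show ?thesis using reaches_step[of c0 "H + 1" "(q, -1, tp)"] s1 by simp
 qed
 show ?thesis
 proof (cases "S j")
  case Nil
  have "trk j (tp (-1)) = 0"
   using assms(1) by (auto simp: holds_stacks_def word_tape_zero_iff)
  then have "astep c0 (PopL j K0 K1 K2, -1, tp) = (Fetch K0, -1, tp)"
   by (auto simp: astep_def)
  then have "reaches c0 1 (PopL j K0 K1 K2, -1, tp) (Fetch K0, -1, tp)"
   using reaches_step[of c0 0 "(PopL j K0 K1 K2, -1, tp)"] reaches_refl by simp
  with s Nil have "reaches c0 (2 * H + 4) (q, -1, tp) (Fetch K0, -1, tp)"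
   by (auto intro: reaches_trans)
  with Nil show ?thesis using that[of tp] assms(1) by (simp add: fun_upd_idem)
 next
  case (Cons b r)
  define tp' where "tp' = tp(int (length r) := put j 0 (tp (int (length r))))"
  have h': "holds_stacks tp' (S(j := r))"
   unfolding tp'_def by (rule holds_pop[OF assms(1) Cons])
  let ?K = "if b then K2 else K1"
  have "trk j (tp (int (length r))) = (if b then 2 else 1)"
   using assms(1) Cons by (simp add: holds_stacks_def word_tape_snoc)
  then have "astep c0 (PopL j K0 K1 K2, ?h - 1, tp) = (GoL j ?K, int (length r) - 1, tp')"
   using Cons by (auto simp: astep_def tp'_def)
  moreover have "reaches c0 (length r + 1) (GoL j ?K, int (length r) - 1, tp') (Fetch ?K, -1, tp')"
   by (rule move_left[OF h']) simp
  ultimately have "reaches c0 (length r + 2) (PopL j K0 K1 K2, ?h - 1, tp) (Fetch ?K, -1, tp')"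
   using reaches_step[of c0 "length r + 1" "(PopL j K0 K1 K2, ?h - 1, tp)"] by simp
  with s have "reaches c0 (2 * H + 4) (q, -1, tp) (Fetch ?K, -1, tp')"
   by (rule reaches_trans) (use assms(2) Cons in simp)
  with h' Cons show ?thesis using that[of tp'] by simp
 qed
qed

text \<open>Each unit of program time pays for one sweep to the top of a stack and back, at most
  2H+4 machine steps, where H exceeds every height reached during the run.\<close>

lemma exec_reaches:
 "exec c S t S' ==> holds_stacks tp S ==> (\<And>j. length (S j) + t \<le> H) ==>
  \<exists>tp'. holds_stacks tp' S' \<and> reaches c0 (t * (2 * H + 4)) (Fetch (c # K), -1, tp) (Fetch K, -1, tp')"
proof (induction arbitrary: tp K rule: exec.induct)
 case (Skip S)
 have "astep c0 (Fetch (Skip # K), -1, tp) = (Fetch K, -1, tp)" by (simp add: astep_def)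
 then have "reaches c0 (2 * H + 4) (Fetch (Skip # K), -1, tp) (Fetch K, -1, tp)"
  using reaches_step_le[of c0 0 "(Fetch (Skip # K), -1, tp)" _ "2 * H + 4"] reaches_refl by simp
 then show ?case using Skip by auto
next
 case (Push j b S)
 from Push.prems(2)[of j] have "length (S j) \<le> H" by simp
 with Push.prems(1) obtain tp' where "holds_stacks tp' (S(j := b # S j))"
  "reaches c0 (2 * H + 4) (Fetch (Push j b # K), -1, tp) (Fetch K, -1, tp')" by (rule push_reaches)
 then show ?case unfolding mult_1 by blast
next
 case (Seq a S t S1 b u S2)
 have 1: "length (S j) + t \<le> H" "length (S1 j) + u \<le> H" for j
  using Seq.prems(2)[of j] exec_height[OF Seq.hyps(1), of j] by auto
 obtain tp1 where a: "holds_stacks tp1 S1"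
  "reaches c0 (t * (2 * H + 4)) (Fetch (a # b # K), -1, tp) (Fetch (b # K), -1, tp1)"
  using Seq.IH(1)[OF Seq.prems(1) 1(1)] by blast
 obtain tp2 where b: "holds_stacks tp2 S2"
  "reaches c0 (u * (2 * H + 4)) (Fetch (b # K), -1, tp1) (Fetch K, -1, tp2)"
  using Seq.IH(2)[OF a(1) 1(2)] by blast
 have "astep c0 (Fetch ((a ;; b) # K), -1, tp) = (Fetch (a # b # K), -1, tp)" by (simp add: astep_def)
 with reaches_trans[OF a(2) b(2) order.refl]
 have "reaches c0 (Suc (t * (2 * H + 4) + u * (2 * H + 4))) (Fetch ((a ;; b) # K), -1, tp) (Fetch K, -1, tp2)"
  by (metis reaches_step)
 then have "reaches c0 ((t + u + 1) * (2 * H + 4)) (Fetch ((a ;; b) # K), -1, tp) (Fetch K, -1, tp2)"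
  by (rule reaches_trans[OF _ reaches_refl[of c0 0]]) (simp add: algebra_simps)
 with b(1) show ?case by blast
next
 case (CaseN S j a t S' b c)
 have "length (S j) \<le> H" using CaseN.prems(2)[of j] by simp
 with CaseN.prems(1) obtain tp1 where 1: "holds_stacks tp1 S"
  "reaches c0 (2 * H + 4) (Fetch (Case j a b c # K), -1, tp) (Fetch (a # K), -1, tp1)"
  by (rule pop_reaches[where q = "Fetch (Case j a b c # K)"]) (auto simp: CaseN.hyps(1) fun_upd_idem)
 have "length (S j) + t \<le> H" for j using CaseN.prems(2)[of j] by simp
 from CaseN.IH[OF 1(1) this] obtain tp2 where 2: "holds_stacks tp2 S'"
  "reaches c0 (t * (2 * H + 4)) (Fetch (a # K), -1, tp1) (Fetch K, -1, tp2)" by blast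
 with reaches_trans[OF 1(2) 2(2)] show ?case by auto
next
 case (CaseF S j r b t S' a c)
 have "length (S j) \<le> H" using CaseF.prems(2)[of j] by simp
 with CaseF.prems(1) obtain tp1 where 1: "holds_stacks tp1 (S(j := r))"
  "reaches c0 (2 * H + 4) (Fetch (Case j a b c # K), -1, tp) (Fetch (b # K), -1, tp1)"
  by (rule pop_reaches[where q = "Fetch (Case j a b c # K)"]) (auto simp: CaseF.hyps(1))
 have "length ((S(j := r)) i) + t \<le> H" for i
  using CaseF.prems(2)[of i] CaseF.hyps(1) by (auto split: if_splits)
 from CaseF.IH[OF 1(1) this] obtain tp2 where 2: "holds_stacks tp2 S'"
  "reaches c0 (t * (2 * H + 4)) (Fetch (b # K), -1, tp1) (Fetch K, -1, tp2)" by blast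
 with reaches_trans[OF 1(2) 2(2)] show ?case by auto
next
 case (CaseT S j r c t S' a b)
 have "length (S j) \<le> H" using CaseT.prems(2)[of j] by simp
 with CaseT.prems(1) obtain tp1 where 1: "holds_stacks tp1 (S(j := r))"
  "reaches c0 (2 * H + 4) (Fetch (Case j a b c # K), -1, tp) (Fetch (c # K), -1, tp1)"
  by (rule pop_reaches[where q = "Fetch (Case j a b c # K)"]) (auto simp: CaseT.hyps(1))
 have "length ((S(j := r)) i) + t \<le> H" for i
  using CaseT.prems(2)[of i] CaseT.hyps(1) by (auto split: if_splits)
 from CaseT.IH[OF 1(1) this] obtain tp2 where 2: "holds_stacks tp2 S'"
  "reaches c0 (t * (2 * H + 4)) (Fetch (c # K), -1, tp1) (Fetch K, -1, tp2)" by blast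
 with reaches_trans[OF 1(2) 2(2)] show ?case by auto
next
 case (WhlN S j a)
 have "length (S j) \<le> H" using WhlN.prems(2)[of j] by simp
 with WhlN.prems(1) obtain tp1 where 1: "holds_stacks tp1 S"
  "reaches c0 (2 * H + 4) (Fetch (Whl j a # K), -1, tp) (Fetch K, -1, tp1)"
  by (rule pop_reaches[where q = "Fetch (Whl j a # K)"]) (auto simp: WhlN.hyps(1) fun_upd_idem)
 then show ?case by auto
next
 case (WhlF S j r a)
 have "length (S j) \<le> H" using WhlF.prems(2)[of j] by simp
 with WhlF.prems(1) obtain tp1 where 1: "holds_stacks tp1 (S(j := r))"
  "reaches c0 (2 * H + 4) (Fetch (Whl j a # K), -1, tp) (Fetch K, -1, tp1)"
  by (rule pop_reaches[where q = "Fetch (Whl j a # K)"]) (auto simp: WhlF.hyps(1))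
 then show ?case unfolding mult_1 by blast
next
 case (WhlT S j r a t S1 u S2)
 have "length (S j) \<le> H" using WhlT.prems(2)[of j] by simp
 with WhlT.prems(1) obtain tp1 where 1: "holds_stacks tp1 (S(j := r))"
  "reaches c0 (2 * H + 4) (Fetch (Whl j a # K), -1, tp) (Fetch (a # Whl j a # K), -1, tp1)"
  by (rule pop_reaches[where q = "Fetch (Whl j a # K)"]) (auto simp: WhlT.hyps(1))
 have h1: "length ((S(j := r)) i) + t \<le> H" for i
  using WhlT.prems(2)[of i] WhlT.hyps(1) by (auto split: if_splits)
 have h2: "length (S1 i) + u \<le> H" for i
  using WhlT.prems(2)[of i] WhlT.hyps(1) exec_height[OF WhlT.hyps(2), of i] by (auto split: if_splits)
 from WhlT.IH(1)[OF 1(1) h1] obtain tp2 where 2: "holds_stacks tp2 S1"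
  "reaches c0 (t * (2 * H + 4)) (Fetch (a # Whl j a # K), -1, tp1) (Fetch (Whl j a # K), -1, tp2)" by blast
 from WhlT.IH(2)[OF 2(1) h2] obtain tp3 where 3: "holds_stacks tp3 S2"
  "reaches c0 (u * (2 * H + 4)) (Fetch (Whl j a # K), -1, tp2) (Fetch K, -1, tp3)" by blast
 from reaches_trans[OF 1(2) reaches_trans[OF 2(2) 3(2) order.refl], of "(t + u + 1) * (2 * H + 4)"] 3(1)
 show ?case by (auto simp: algebra_simps)
qed

section \<open>Finiteness of the state set and the resulting machine\<close>

fun conts :: "com => com list => com list set" where
 "conts (a ;; b) K = insert ((a ;; b) # K) (conts a (b # K) \<union> conts b K)"
| "conts (Case j a b c) K = insert (Case j a b c # K) (conts a K \<union> conts b K \<union> conts c K)"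
| "conts (Whl j a) K = insert (Whl j a # K) (conts a (Whl j a # K))"
| "conts c K = {c # K}"

fun next_conts :: "com list => com list set" where
 "next_conts (Skip # K) = {K}"
| "next_conts (Push j b # K) = {K}"
| "next_conts ((c ;; d) # K) = {c # d # K}"
| "next_conts (Case j c d e # K) = {c # K, d # K, e # K}"
| "next_conts (Whl j c # K) = {K, c # Whl j c # K}"
| "next_conts K = {}"

lemma finite_conts: "finite (conts c K)"
 by (induction c K rule: conts.induct) auto

lemma conts_self: "c # K \<in> conts c K"
 by (cases c) auto

text \<open>Running a command can leave its set of continuations only by finishing, that is by
  reaching K. This makes the states built from these continuations closed under
  \<open>delta\<close>.\<close>

lemma conts_closed: "K' \<in> conts c K ==> next_conts K' \<subseteq> insert K (conts c K)"
proof (induction c arbitrary: K K')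
 case (Seq a b)
 then show ?case using conts_self[of a "b # K"] conts_self[of b K] by fastforce
next
 case (Case j a b c)
 then show ?case using conts_self[of a K] conts_self[of b K] conts_self[of c K] by fastforce
next
 case (Whl j a)
 then show ?case using conts_self[of a "Whl j a # K"] by fastforce
qed auto

text \<open>Both stop continuations are added explicitly, since the accepting and the rejecting
  state must exist and differ even if the program contains neither.\<close>

definition all_conts :: "com => com list set" where
 "all_conts c = conts c [] \<union> {[], [Stop True], [Stop False]}"

definition all_states :: "com => st set" where
 "all_states c = {Init} \<union> Fetch ` all_conts c
   \<union> {PushR j b K | j b K. K \<in> all_conts c} \<union> {GoL j K | j K. K \<in> all_conts c}
   \<union> {PopR j K K1 K2 | j K K1 K2. K \<in> all_conts c \<and> K1 \<in> all_conts c \<and> K2 \<in> all_conts c}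
   \<union> {PopL j K K1 K2 | j K K1 K2. K \<in> all_conts c \<and> K1 \<in> all_conts c \<and> K2 \<in> all_conts c}"

lemma all_conts_closed: "K \<in> all_conts c ==> next_conts K \<subseteq> all_conts c"
 using conts_closed[of K c "[]"] by (auto simp: all_conts_def)

lemma UNIV_stk: "(UNIV :: stk set) = {IO, MN, AX, BX, CT}"
 using stk.exhaust by auto

lemma finite_all_states: "finite (all_states c)"
proof -
 let ?C = "all_conts c"
 have C: "finite ?C" by (simp add: all_conts_def finite_conts)
 have S: "finite (UNIV :: stk set)" by (simp add: UNIV_stk)
 have "{PushR j b K | j b K. K \<in> ?C} = (%(j, b, K). PushR j b K) ` (UNIV \<times> UNIV \<times> ?C)"
  "{GoL j K | j K. K \<in> ?C} = (%(j, K). GoL j K) ` (UNIV \<times> ?C)"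
  "{PopR j K K1 K2 | j K K1 K2. K \<in> ?C \<and> K1 \<in> ?C \<and> K2 \<in> ?C}
   = (%(j, K, K1, K2). PopR j K K1 K2) ` (UNIV \<times> ?C \<times> ?C \<times> ?C)"
  "{PopL j K K1 K2 | j K K1 K2. K \<in> ?C \<and> K1 \<in> ?C \<and> K2 \<in> ?C}
   = (%(j, K, K1, K2). PopL j K K1 K2) ` (UNIV \<times> ?C \<times> ?C \<times> ?C)"
  by (auto simp: image_iff)
 then show ?thesis using C S by (simp add: all_states_def)
qed

lemma all_states_iff: "q \<in> all_states c \<longleftrightarrow> (case q of Init => True | Fetch K => K \<in> all_conts c
  | PushR j b K => K \<in> all_conts c | GoL j K => K \<in> all_conts c
  | PopR j K0 K1 K2 => {K0, K1, K2} \<subseteq> all_conts c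
  | PopL j K0 K1 K2 => {K0, K1, K2} \<subseteq> all_conts c)"
 by (cases q) (auto simp: all_states_def)

lemma delta_closed:
 assumes "q \<in> all_states c" "a < 243"
 shows "fst (delta c q a) \<in> all_states c \<and> fst (snd (delta c q a)) < 243"
proof -
 have K: "K' \<in> all_conts c" if "K \<in> all_conts c" "K' \<in> next_conts K" for K K'
  using all_conts_closed that by blast
 have "[c] \<in> all_conts c" using conts_self[of c "[]"] by (simp add: all_conts_def)
 then show ?thesis using assms
  by (cases "(c, q, a)" rule: delta.cases)
   (auto simp: all_states_iff put_less intro: K)
qed

lemma number_states:
 obtains h where "inj_on h (all_states c)" "h ` all_states c = {..<card (all_states c)}" "h Init = 0"
proof -
 obtain h0 where h0: "bij_betw h0 (all_states c) {0..<card (all_states c)}"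
  using ex_bij_betw_finite_nat[OF finite_all_states] by blast
 have I: "Init \<in> all_states c" by (simp add: all_states_def)
 let ?n = "card (all_states c)"
 have n: "0 < ?n" using I finite_all_states[of c] by (auto simp: card_gt_0_iff)
 \<comment> \<open>A machine starts in state 0, so the numbering is corrected by the transposition
   of 0 and the number of \<open>Init\<close>.\<close>
 define sw where "sw = (%i. if i = h0 Init then 0 else if i = 0 then h0 Init else i)"
 have "h0 Init < ?n" using h0 I by (auto simp: bij_betw_def)
 then have "bij_betw sw {0..<?n} {0..<?n}"
  using n by (intro bij_betw_byWitness[where f' = sw]) (auto simp: sw_def)
 with h0 have "bij_betw (sw \<circ> h0) (all_states c) {0..<?n}" by (rule bij_betw_trans)
 then show ?thesis
  by (intro that[of "sw \<circ> h0"]) (auto simp: bij_betw_def sw_def atLeast0LessThan)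
qed

definition machine :: "com => (st => nat) => tm" where
 "machine c h = \<lparr>num_states = card (all_states c), num_symbols = 243,
   trans_fun = (%q a. case delta c (inv_into (all_states c) h q) a of (q', b, d) => (h q', b, d)),
   accept_state = h (Fetch [Stop True]), reject_state = h (Fetch [Stop False])\<rparr>"

context
 fixes c :: com and h :: "st => nat"
 assumes inj: "inj_on h (all_states c)" and img: "h ` all_states c = {..<card (all_states c)}"
  and init: "h Init = 0"
begin

lemma stop_states: "Fetch [Stop b] \<in> all_states c"
 by (cases b) (auto simp: all_states_def all_conts_def)

lemma is_tm_machine: "is_tm (machine c h)"
proof -
 have 1: "h q < card (all_states c)" if "q \<in> all_states c" for q
  using img that by blast
 have "h (Fetch [Stop True]) \<noteq> h (Fetch [Stop False])"
  using inj stop_states by (auto dest: inj_onD)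
 moreover have "case trans_fun (machine c h) q a of (q', b, d) =>
   q' < card (all_states c) \<and> b < 243" if "q < card (all_states c)" "a < 243" for q a
 proof -
  have "inv_into (all_states c) h q \<in> all_states c"
   by (rule inv_into_into) (use img that in simp)
  from delta_closed[OF this that(2)] show ?thesis
   by (auto simp: machine_def 1 split: prod.splits)
 qed
 moreover have "0 < card (all_states c)" using 1[OF stop_states] by (rule le_less_trans[rotated]) simp
 ultimately show ?thesis
  by (auto simp: is_tm_def machine_def 1 stop_states)
qed

definition concretize :: "st \<times> int \<times> (int => nat) => config" where
 "concretize x = (case x of (q, i, tp) => \<lparr>state = h q, head = i, tape = tp\<rparr>)"

lemma step_concretize:
 assumes "q \<in> all_states c"
 shows "step (machine c h) (concretize (q, i, tp)) = concretize (astep c (q, i, tp))"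
proof (cases "q = Fetch [Stop True] \<or> q = Fetch [Stop False]")
 case True
 then show ?thesis
  by (auto simp: step_def halted_def machine_def concretize_def astep_def)
next
 case False
 then have "\<not> halted (machine c h) (concretize (q, i, tp))"
  using inj_onD[OF inj _ assms stop_states] by (auto simp: halted_def machine_def concretize_def)
 then show ?thesis using inj assms
  by (auto simp: step_def machine_def concretize_def astep_def split: prod.splits)
qed

lemma steps_concretize:
 assumes "\<And>i. tp i < 243"
 shows "\<exists>q i' tp'. (astep c ^^ n) (Init, i, tp) = (q, i', tp') \<and> q \<in> all_states c \<and> (\<forall>i. tp' i < 243)
  \<and> (step (machine c h) ^^ n) (concretize (Init, i, tp)) = concretize (q, i', tp')"
proof (induction n)
 case 0
 show ?case using assms by (auto simp: all_states_def)
next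
 case (Suc n)
 then obtain q i' tp' where *: "(astep c ^^ n) (Init, i, tp) = (q, i', tp')" "q \<in> all_states c"
  "\<forall>i. tp' i < 243" "(step (machine c h) ^^ n) (concretize (Init, i, tp)) = concretize (q, i', tp')"
  by blast
 obtain q2 i2 tp2 where s: "astep c (q, i', tp') = (q2, i2, tp2)" by (cases "astep c (q, i', tp')")
 have "q2 \<in> all_states c \<and> (\<forall>i. tp2 i < 243)"
  using delta_closed[OF *(2), of "tp' i'"] *(3) s by (auto simp: astep_def split: prod.splits)
 with * s show ?case by (auto simp: step_concretize)
qed

end

lemma machine_exists:
 obtains M h where "is_tm M" "accept_state M = h (Fetch [Stop True])"
  "reject_state M = h (Fetch [Stop False])"
  "\<forall>w n q i tp. (astep c ^^ n) (Init, 0, word_tape w) = (q, i, tp) -->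
    (step M ^^ n) (init_config w) = \<lparr>state = h q, head = i, tape = tp\<rparr>"
proof -
 obtain h where h: "inj_on h (all_states c)" "h ` all_states c = {..<card (all_states c)}" "h Init = 0"
  by (rule number_states)
 have "(step (machine c h) ^^ n) (init_config w) = \<lparr>state = h q, head = i, tape = tp\<rparr>"
  if "(astep c ^^ n) (Init, 0, word_tape w) = (q, i, tp)" for w n q i tp
 proof -
  have "word_tape w i < 243" for i by (simp add: word_tape_def)
  from steps_concretize[OF h, of "word_tape w" n 0, OF this] that h show ?thesis
   by (auto simp: concretize_def[OF h] init_config_def)
 qed
 then show ?thesis
  using is_tm_machine[OF h] by (intro that[of "machine c h" h]) (auto simp: machine_def)
qed

lemma holds_word_tape: "holds_stacks (word_tape w) ((%_. [])(IO := rev w))"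
proof -
 have "trk j (word_tape w i) = (if j = IO then word_tape w i else 0)" for i j
  by (cases j) (auto simp: trk_def word_tape_def)
 then show ?thesis by (auto simp: holds_stacks_def) (auto simp: word_tape_def)
qed

lemma program_reaches:
 assumes "exec c ((%_. [])(IO := rev w)) t S"
 obtains tp where "holds_stacks tp S"
  "reaches (c ;; d) (t * (2 * (length w + t) + 4) + 2) (Init, 0, word_tape w) (Fetch [d], -1, tp)"
proof -
 let ?c = "c ;; d"
 have h: "length (((%_. [])(IO := rev w)) j) + t \<le> length w + t" for j by simp
 obtain tp where tp: "holds_stacks tp S" "reaches ?c (t * (2 * (length w + t) + 4))
   (Fetch (c # [d]), -1, word_tape w) (Fetch [d], -1, tp)"
  using exec_reaches[OF assms holds_word_tape, of "length w + t" ?c "[d]", OF h] by blast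
 have "astep ?c (astep ?c (Init, 0, word_tape w)) = (Fetch (c # [d]), -1, word_tape w)"
  by (simp add: astep_def)
 with tp(2) have "reaches ?c (Suc (Suc (t * (2 * (length w + t) + 4))))
   (Init, 0, word_tape w) (Fetch [d], -1, tp)"
  by (metis reaches_step)
 with tp(1) show ?thesis using that by simp
qed

definition sim_time :: "(nat => nat) => nat => nat" where
 "sim_time T n = (T n + 2) * (2 * (n + T n) + 4)"

theorem stack_decider:
 assumes "\<And>w. \<exists>t S. exec c ((%_. [])(IO := rev w)) t S \<and> t \<le> T (length w) \<and> S IO = [w \<in> X]"
 shows "\<exists>M. is_tm M \<and> decides_in_time M X (sim_time T)"
proof -
 \<comment> \<open>The answer left on \<open>IO\<close> is converted into a halting state; the
   branch for an empty stack is never taken.\<close>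
 let ?d = "Case IO (Stop False) (Stop False) (Stop True)"
 obtain M h where M: "is_tm M" "accept_state M = h (Fetch [Stop True])"
  "reject_state M = h (Fetch [Stop False])"
  "\<forall>w n q i tp. (astep (c ;; ?d) ^^ n) (Init, 0, word_tape w) = (q, i, tp) -->
    (step M ^^ n) (init_config w) = \<lparr>state = h q, head = i, tape = tp\<rparr>"
  by (rule machine_exists[of "c ;; ?d"])
 have dec: "\<exists>t\<le>sim_time T (length w). state ((step M ^^ t) (init_config w)) =
   (if w \<in> X then accept_state M else reject_state M)" for w
 proof -
  obtain t S where t: "exec c ((%_. [])(IO := rev w)) t S" "t \<le> T (length w)" "S IO = [w \<in> X]"
   using assms by blast
  let ?H = "length w + t"
  obtain tp where tp: "holds_stacks tp S"
   "reaches (c ;; ?d) (t * (2 * ?H + 4) + 2) (Init, 0, word_tape w) (Fetch [?d], -1, tp)"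
   by (rule program_reaches[OF t(1), of ?d])
  have "length (S IO) \<le> ?H" using exec_height[OF t(1), of IO] by simp
  then obtain tp' where "reaches (c ;; ?d) (2 * ?H + 4) (Fetch [?d], -1, tp)
    (Fetch (case S IO of [] => [Stop False] | b # _ => if b then [Stop True] else [Stop False]), -1, tp')"
   by (rule pop_reaches[OF tp(1) _ delta.simps(6)])
  then have "reaches (c ;; ?d) (2 * ?H + 4) (Fetch [?d], -1, tp) (Fetch [Stop (w \<in> X)], -1, tp')"
   using t(3) by (simp split: if_splits)
  with tp(2) have "reaches (c ;; ?d) (t * (2 * ?H + 4) + 2 + (2 * ?H + 4)) (Init, 0, word_tape w)
    (Fetch [Stop (w \<in> X)], -1, tp')"
   by (rule reaches_trans) simp
  then obtain m where m: "m \<le> t * (2 * ?H + 4) + 2 + (2 * ?H + 4)"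
   "(astep (c ;; ?d) ^^ m) (Init, 0, word_tape w) = (Fetch [Stop (w \<in> X)], -1, tp')"
   by (auto simp: reaches_def)
  have "m \<le> (t + 2) * (2 * ?H + 4)" using m(1) by simp
  also have "\<dots> \<le> sim_time T (length w)" unfolding sim_time_def
   by (intro mult_le_mono) (use t(2) in auto)
  finally have "m \<le> sim_time T (length w)" .
  moreover have "state ((step M ^^ m) (init_config w)) = h (Fetch [Stop (w \<in> X)])"
   using M(4)[rule_format, OF m(2)] by simp
  ultimately show ?thesis using M(2,3) by (intro exI[of _ m]) (auto split: if_splits)
 qed
 show ?thesis unfolding decides_in_time_def using M(1) dec by blast
qed

text \<open>All stacks but \<open>IO\<close> must end empty: only then do the tape symbols carry
  nothing outside track 0, so that the final tape is literally that of the output word.\<close>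

theorem stack_computer:
 assumes "\<And>w. \<exists>t. exec c ((%_. [])(IO := rev w)) t ((%_. [])(IO := rev (f w))) \<and> t \<le> T (length w)"
 shows "\<exists>M. is_tm M \<and> computes_in_time M f (sim_time T)"
proof -
 let ?d = "Stop True"
 obtain M h where M: "is_tm M" "accept_state M = h (Fetch [Stop True])"
  "reject_state M = h (Fetch [Stop False])"
  "\<forall>w n q i tp. (astep (c ;; ?d) ^^ n) (Init, 0, word_tape w) = (q, i, tp) -->
    (step M ^^ n) (init_config w) = \<lparr>state = h q, head = i, tape = tp\<rparr>"
  by (rule machine_exists[of "c ;; ?d"])
 have "\<exists>t\<le>sim_time T (length w). halted M ((step M ^^ t) (init_config w)) \<and>
   tape ((step M ^^ t) (init_config w)) = word_tape (f w)" for w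
 proof -
  obtain t where t: "exec c ((%_. [])(IO := rev w)) t ((%_. [])(IO := rev (f w)))" "t \<le> T (length w)"
   using assms by blast
  let ?H = "length w + t"
  obtain tp where tp: "holds_stacks tp ((%_. [])(IO := rev (f w)))"
   "reaches (c ;; ?d) (t * (2 * ?H + 4) + 2) (Init, 0, word_tape w) (Fetch [?d], -1, tp)"
   by (rule program_reaches[OF t(1), of ?d])
  have eq: "tp = word_tape (f w)"
  proof
   fix i show "tp i = word_tape (f w) i"
    by (rule trk_ext) (use tp(1) holds_word_tape[of "f w"] in \<open>simp_all add: holds_stacks_def\<close>)
  qed
  obtain m where m: "m \<le> t * (2 * ?H + 4) + 2"
   "(astep (c ;; ?d) ^^ m) (Init, 0, word_tape w) = (Fetch [?d], -1, tp)"
   using tp(2) unfolding reaches_def by blast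
  have "m \<le> (t + 2) * (2 * ?H + 4)" using m(1) by simp
  also have "\<dots> \<le> sim_time T (length w)" unfolding sim_time_def
   by (intro mult_le_mono) (use t(2) in auto)
  finally have "m \<le> sim_time T (length w)" .
  then show ?thesis using M(2) M(4)[rule_format, OF m(2)] eq
   by (intro exI[of _ m]) (simp add: halted_def)
 qed
 with M(1) show ?thesis unfolding computes_in_time_def by blast
qed

section \<open>Polynomial-time functions on encoded data\<close>

datatype dat = Nl | Cn dat dat

text \<open>A prefix code: a value ends where its code ends, so values can be stacked on each other
  without separators.\<close>

fun bits :: "dat => bool list" where
 "bits Nl = [False]"
| "bits (Cn a b) = True # bits a @ bits b"

lemma bits_append_inj: "bits a @ r = bits b @ s ==> a = b \<and> r = s"
proof (induction a arbitrary: b r s)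
 case Nl
 then show ?case by (cases b) auto
next
 case (Cn a1 a2)
 from Cn.prems show ?case by (cases b) (auto dest!: Cn.IH)
qed

lemma bits_inj: "bits a = bits b ==> a = b"
 using bits_append_inj[of a "[]" b "[]"] by simp

lemma bits_pos: "1 \<le> length (bits d)"
 by (cases d) auto

definition runs :: "com => stacks => nat => stacks => bool" where
 "runs c S T S' \<longleftrightarrow> (\<exists>t \<le> T. exec c S t S')"

lemma runs_mono: "runs c S T S' ==> T \<le> U ==> runs c S U S'"
 unfolding runs_def using le_trans by blast

lemma runs_Skip: "1 \<le> T ==> runs Skip S T S"
 unfolding runs_def using exec.Skip by blast

lemma runs_Push: "S' = S(j := b # S j) ==> 1 \<le> T ==> runs (Push j b) S T S'"
 unfolding runs_def using exec.Push by blast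

lemma runs_Seq: "runs a S T1 S1 ==> runs b S1 T2 S2 ==> T1 + T2 + 1 \<le> T ==> runs (a ;; b) S T S2"
 unfolding runs_def by (meson add_le_mono exec.Seq le_trans order_refl)

lemma runs_CaseF: "S j = False # r ==> runs b (S(j := r)) T1 S' ==> T1 + 1 \<le> T ==> runs (Case j a b c) S T S'"
 unfolding runs_def by (meson add_le_mono exec.CaseF le_trans order_refl)

lemma runs_CaseT: "S j = True # r ==> runs c (S(j := r)) T1 S' ==> T1 + 1 \<le> T ==> runs (Case j a b c) S T S'"
 unfolding runs_def by (meson add_le_mono exec.CaseT le_trans order_refl)

lemma runs_CaseN: "S j = [] ==> runs a S T1 S' ==> T1 + 1 \<le> T ==> runs (Case j a b c) S T S'"
 unfolding runs_def by (meson add_le_mono exec.CaseN le_trans order_refl)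

lemma runs_WhlN: "S j = [] ==> 1 \<le> T ==> runs (Whl j a) S T S"
 unfolding runs_def using exec.WhlN by blast

lemma runs_WhlF: "S j = False # r ==> S' = S(j := r) ==> 1 \<le> T ==> runs (Whl j a) S T S'"
 unfolding runs_def using exec.WhlF by blast

lemma runs_WhlT: "S j = True # r ==> runs a (S(j := r)) T1 S1 ==> runs (Whl j a) S1 T2 S2
  ==> T1 + T2 + 1 \<le> T ==> runs (Whl j a) S T S2"
 unfolding runs_def by (meson add_le_mono exec.WhlT le_trans order_refl)

lemma runs_height: "runs c S T S' ==> length (S' j) \<le> length (S j) + T"
 unfolding runs_def by (meson add_left_mono exec_height le_trans)

fun pushes :: "stk list => bool => com" where
 "pushes [] b = Skip"
| "pushes (j # js) b = Push j b ;; pushes js b"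

lemma runs_pushes:
 "distinct js ==> S' = (%i. if i \<in> set js then b # S i else S i) ==> 2 * length js + 1 \<le> T
  ==> runs (pushes js b) S T S'"
proof (induction js arbitrary: S T)
 case Nil then show ?case by (simp add: runs_Skip)
next
 case (Cons j js)
 have "runs (pushes js b) (S(j := b # S j)) (2 * length js + 1) S'"
  by (rule Cons.IH) (use Cons.prems in auto)
 with runs_Push[OF refl order.refl] show ?case
  unfolding pushes.simps by (rule runs_Seq) (use Cons.prems in auto)
qed

text \<open>The counter stack holds one \<^const>\<open>True\<close> for every subtree that is still to be read.\<close>

definition mv_loop :: "stk list => com" where
 "mv_loop js = Whl CT (Case MN Skip (pushes js False) (pushes js True ;; Push CT True ;; Push CT True))"

text \<open>The remainder of the loop is a parameter (\<open>T\<close>, \<open>S3\<close>) of the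
  statement. After a node has been read, the loop goes over the left and then the right subtree, and
  the two induction hypotheses are chained from the end.\<close>

lemma runs_mv_loop:
 assumes js: "distinct js" "MN \<notin> set js" "CT \<notin> set js"
 shows "S MN = bits d @ r ==> S CT = True # n ==>
  runs (mv_loop js) (%i. if i \<in> set js then rev (bits d) @ S i else if i = MN then r else if i = CT then n else S i) T S3
  ==> runs (mv_loop js) S (T + length (bits d) * (2 * length js + 10)) S3"
proof (induction d arbitrary: S r n T)
 case Nl
 let ?S1 = "%i. if i \<in> set js then rev (bits Nl) @ S i else if i = MN then r else if i = CT then n else S i"
 have "runs (pushes js False) (S(CT := n, MN := r)) (2 * length js + 1) ?S1"
  by (rule runs_pushes) (use js in auto)
 then have 1: "runs (Case MN Skip (pushes js False) (pushes js True ;; Push CT True ;; Push CT True))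
   (S(CT := n)) (2 * length js + 2) ?S1"
  by (rule runs_CaseF[rotated]) (simp_all add: Nl.prems(1))
 show ?case unfolding mv_loop_def
  by (rule runs_WhlT[OF Nl.prems(2) 1 Nl.prems(3)[unfolded mv_loop_def]]) simp
next
 case (Cn a b)
 let ?S1 = "%i. if i \<in> set js then True # S i else if i = MN then bits a @ bits b @ r
  else if i = CT then True # True # n else S i"
 let ?Sa = "%i. if i \<in> set js then True # S i else if i = MN then bits a @ bits b @ r
  else if i = CT then n else S i"
 have "runs (pushes js True) (S(CT := n, MN := bits a @ bits b @ r)) (2 * length js + 1) ?Sa"
  by (rule runs_pushes) (use js in auto)
 moreover have "runs (Push CT True ;; Push CT True) ?Sa 3 ?S1"
  by (rule runs_Seq[OF runs_Push[OF refl order.refl] runs_Push[OF _ order.refl]]) (use js in auto)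
 ultimately have "runs (pushes js True ;; Push CT True ;; Push CT True)
   (S(CT := n, MN := bits a @ bits b @ r)) (2 * length js + 5) ?S1"
  by (rule runs_Seq) simp
 then have 1: "runs (Case MN Skip (pushes js False) (pushes js True ;; Push CT True ;; Push CT True))
   (S(CT := n)) (2 * length js + 6) ?S1"
  by (rule runs_CaseT[rotated]) (simp_all add: Cn.prems(1))
 define S2 where "S2 = (%i. if i \<in> set js then rev (bits a) @ ?S1 i else if i = MN then bits b @ r
  else if i = CT then True # n else ?S1 i)"
 have "(%i. if i \<in> set js then rev (bits b) @ S2 i else if i = MN then r else if i = CT then n else S2 i)
  = (%i. if i \<in> set js then rev (bits (Cn a b)) @ S i else if i = MN then r else if i = CT then n else S i)"
  unfolding S2_def by auto
 moreover have "S2 MN = bits b @ r" "S2 CT = True # n" using js(2,3) unfolding S2_def by simp_all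
 ultimately have "runs (mv_loop js) S2 (T + length (bits b) * (2 * length js + 10)) S3"
  using Cn.IH(2)[of S2 r n T] Cn.prems(3) by presburger
 then have 2: "runs (mv_loop js) ?S1
   (T + length (bits b) * (2 * length js + 10) + length (bits a) * (2 * length js + 10)) S3"
  unfolding S2_def using js(2,3) by (intro Cn.IH(1)[of ?S1 "bits b @ r" "True # n"]) simp_all
 show ?case unfolding mv_loop_def
  by (rule runs_WhlT[OF Cn.prems(2) 1 2[unfolded mv_loop_def]]) (simp add: algebra_simps)
qed

definition mv :: "stk list => com" where
 "mv js = Push CT True ;; mv_loop js"

lemma runs_mv:
 assumes "distinct js" "MN \<notin> set js" "CT \<notin> set js" "S MN = bits d @ r" "S CT = []"
  and "S' = (%i. if i \<in> set js then rev (bits d) @ S i else if i = MN then r else S i)"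
  and "20 * length (bits d) + 3 \<le> T" "length js \<le> 3"
 shows "runs (mv js) S T S'"
proof -
 let ?S1 = "S(CT := [True])"
 have "(%i. if i \<in> set js then rev (bits d) @ ?S1 i else if i = MN then r else if i = CT then [] else ?S1 i) = S'"
  using assms by auto
 moreover have "runs (mv_loop js) S' 1 S'"
  unfolding mv_loop_def by (rule runs_WhlN) (use assms in auto)
 ultimately have 1: "runs (mv_loop js) ?S1 (1 + length (bits d) * (2 * length js + 10)) S'"
  by (intro runs_mv_loop) (use assms in auto)
 have 2: "runs (Push CT True) S 1 ?S1"
  by (rule runs_Push) (simp_all add: assms(5))
 have "runs (mv js) S (1 + (1 + length (bits d) * (2 * length js + 10)) + 1) S'"
  unfolding mv_def by (rule runs_Seq[OF 2 1 order.refl])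
 moreover have "length (bits d) * (2 * length js + 10) \<le> length (bits d) * 20"
  using assms(8) by (intro mult_le_mono2) auto
 then have "1 + (1 + length (bits d) * (2 * length js + 10)) + 1 \<le> T"
  using assms(7) by linarith
 ultimately show ?thesis by (rule runs_mono)
qed

text \<open>A loop until \<open>j\<close> is empty, although \<open>Whl\<close> can only test for a
  letter: \<open>CT\<close> holds a flag that is renewed after every letter popped from
  \<open>j\<close> and is not renewed once \<open>j\<close> is empty.\<close>

definition drain :: "stk => com => com => com" where
 "drain j a b = Push CT True ;; Whl CT (Case j Skip (a ;; Push CT True) (b ;; Push CT True))"

lemma runs_drain_loop:
 assumes "j \<noteq> CT"
  and g: "\<And>x S. S CT = [] ==> runs (if x then b else a) S k (g x S)"
  and g_CT: "\<And>x S. S CT = [] ==> g x S CT = []" and g_j: "\<And>x S. g x S j = S j"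
  and g_upd: "\<And>x S v. g x (S(j := v)) = (g x S)(j := v)"
 shows "S CT = [] ==> runs (Whl CT (Case j Skip (a ;; Push CT True) (b ;; Push CT True)))
  (S(j := u, CT := [True])) ((k + 5) * length u + 5) (fold g u (S(j := [])))"
proof (induction u arbitrary: S)
 case Nil
 let ?body = "Case j Skip (a ;; Push CT True) (b ;; Push CT True)"
 have 1: "runs ?body (S(j := [])) 2 (S(j := []))"
  by (rule runs_CaseN[OF _ runs_Skip[OF order.refl]]) simp_all
 have 2: "(S(j := [], CT := [True]))(CT := []) = S(j := [])" using Nil assms(1) by auto
 have 3: "runs (Whl CT ?body) (S(j := [])) 1 (S(j := []))"
  by (rule runs_WhlN) (use Nil assms(1) in simp_all)
 have "runs (Whl CT ?body) (S(j := [], CT := [True])) 5 (S(j := []))"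
 proof (rule runs_WhlT[OF _ _ 3])
  show "(S(j := [], CT := [True])) CT = True # []" by simp
  show "runs ?body ((S(j := [], CT := [True]))(CT := [])) 2 (S(j := []))" unfolding 2 by (rule 1)
 qed simp
 then show ?case by (simp del: fun_upd_apply)
next
 case (Cons x u)
 let ?body = "Case j Skip (a ;; Push CT True) (b ;; Push CT True)"
 let ?S1 = "(g x S)(j := u, CT := [True])"
 have gS: "g x S CT = []" by (rule g_CT) (rule Cons.prems)
 have c1: "(S(j := u)) CT = []" using Cons.prems assms(1) by auto
 have "runs (if x then b else a) (S(j := u)) k (g x (S(j := u)))"
  by (rule g) (rule c1)
 moreover have "runs (Push CT True) (g x (S(j := u))) 1 ?S1"
  by (rule runs_Push) (simp_all only: g_upd fun_upd_other[OF assms(1)[symmetric]] gS)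
 ultimately have "runs ((if x then b else a) ;; Push CT True) (S(j := u)) (k + 2) ?S1"
  by (rule runs_Seq) simp
 moreover have e: "(S(j := x # u, CT := [])) j = x # u" "(S(j := x # u, CT := []))(j := u) = S(j := u)"
  using Cons.prems assms(1) by auto
 ultimately have st: "runs ((if x then b else a) ;; Push CT True) ((S(j := x # u, CT := []))(j := u)) (k + 2) ?S1"
  by simp
 have body: "runs ?body (S(j := x # u, CT := [])) (k + 3) ?S1"
 proof (cases x)
  case True
  show ?thesis
  proof (rule runs_CaseT[where r = u])
   show "(S(j := x # u, CT := [])) j = True # u" unfolding e(1) using True by simp
   show "runs (b ;; Push CT True) ((S(j := x # u, CT := []))(j := u)) (k + 2) ?S1"
    using st unfolding if_P[OF True] .
  qed simp
 next
  case False
  show ?thesis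
  proof (rule runs_CaseF[where r = u])
   show "(S(j := x # u, CT := [])) j = False # u" unfolding e(1) using False by simp
   show "runs (a ;; Push CT True) ((S(j := x # u, CT := []))(j := u)) (k + 2) ?S1"
    using st unfolding if_not_P[OF False] .
  qed simp
 qed
 have rest: "runs (Whl CT ?body) ?S1 ((k + 5) * length u + 5) (fold g u ((g x S)(j := [])))"
  by (rule Cons.IH) (rule gS)
 have "runs (Whl CT ?body) (S(j := x # u, CT := [True])) ((k + 5) * length (x # u) + 5)
   (fold g u ((g x S)(j := [])))"
 proof (rule runs_WhlT[OF _ _ rest])
  show "(S(j := x # u, CT := [True])) CT = True # []" by simp
  show "runs ?body ((S(j := x # u, CT := [True]))(CT := [])) (k + 3) ?S1"
   unfolding fun_upd_upd by (rule body)
 qed simp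
 then show ?case by (simp add: g_upd del: fun_upd_apply)
qed

lemma runs_drain:
 assumes "j \<noteq> CT"
  and "\<And>x S. S CT = [] ==> runs (if x then b else a) S k (g x S)"
  and "\<And>x S. S CT = [] ==> g x S CT = []" and "\<And>x S. g x S j = S j"
  and "\<And>x S v. g x (S(j := v)) = (g x S)(j := v)"
  and "S CT = []" "S' = fold g (S j) (S(j := []))" "(k + 5) * length (S j) + 7 \<le> T"
 shows "runs (drain j a b) S T S'"
proof -
 have "runs (Push CT True) S 1 (S(j := S j, CT := [True]))"
  by (rule runs_Push) (use assms in auto)
 moreover have "runs (Whl CT (Case j Skip (a ;; Push CT True) (b ;; Push CT True)))
   (S(j := S j, CT := [True])) ((k + 5) * length (S j) + 5) S'"
  unfolding assms(7) by (rule runs_drain_loop) (use assms in auto)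
 ultimately show ?thesis unfolding drain_def by (rule runs_Seq) (use assms in auto)
qed

definition restore :: "stk => com" where
 "restore j = drain j (Push MN False) (Push MN True)"

lemma runs_restore:
 assumes "j \<noteq> CT" "j \<noteq> MN" "S CT = []" "S' = S(j := [], MN := rev (S j) @ S MN)"
  "6 * length (S j) + 7 \<le> T"
 shows "runs (restore j) S T S'"
 unfolding restore_def
proof (rule runs_drain[where k = 1 and g = "%x S. S(MN := x # S MN)"])
 have "fold (%x S. S(MN := x # S MN)) u S = S(MN := rev u @ S MN)" for u and S :: stacks
  by (induction u arbitrary: S) auto
 then show "S' = fold (%x S. S(MN := x # S MN)) (S j) (S(j := []))" using assms by auto
qed (use assms in \<open>auto intro!: runs_Push\<close>)

text \<open>All stacks but the main one are empty between two operations.\<close>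

definition main :: "bool list => stacks" where
 "main r = (%_. [])(MN := r)"

definition drop_com :: com where "drop_com = mv []"
definition dup_com :: com where "dup_com = mv [AX, BX] ;; restore AX ;; restore BX"
definition swap_com :: com where "swap_com = mv [AX] ;; mv [BX] ;; restore AX ;; restore BX"

lemma runs_drop: "30 * length (bits d) \<le> T ==> runs drop_com (main (bits d @ r)) T (main r)"
 unfolding drop_com_def using bits_pos[of d] by (intro runs_mv) (auto simp: main_def)

lemma runs_dup:
 assumes "70 * length (bits d) \<le> T"
 shows "runs dup_com (main (bits d @ r)) T (main (bits d @ bits d @ r))"
proof -
 let ?n = "length (bits d)"
 let ?S1 = "(%_. [])(MN := r, AX := rev (bits d), BX := rev (bits d))"
 let ?S2 = "(%_. [])(MN := bits d @ r, BX := rev (bits d))"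
 have n: "1 \<le> ?n" by (rule bits_pos)
 have 1: "runs (mv [AX, BX]) (main (bits d @ r)) (20 * ?n + 3) ?S1"
  by (rule runs_mv) (auto simp: main_def)
 have 2: "runs (restore AX) ?S1 (6 * ?n + 7) ?S2"
  by (rule runs_restore) auto
 have 3: "runs (restore BX) ?S2 (6 * ?n + 7) (main (bits d @ bits d @ r))"
  by (rule runs_restore) (auto simp: main_def)
 show ?thesis unfolding dup_com_def
  by (rule runs_Seq[OF 1 runs_Seq[OF 2 3 order.refl]]) (use assms n in linarith)
qed

lemma runs_swap:
 assumes "50 * (length (bits d) + length (bits e)) \<le> T"
 shows "runs swap_com (main (bits d @ bits e @ r)) T (main (bits e @ bits d @ r))"
proof -
 let ?n = "length (bits d)" and ?m = "length (bits e)"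
 let ?S1 = "(%_. [])(MN := bits e @ r, AX := rev (bits d))"
 let ?S2 = "(%_. [])(MN := r, AX := rev (bits d), BX := rev (bits e))"
 let ?S3 = "(%_. [])(MN := bits d @ r, BX := rev (bits e))"
 have n: "1 \<le> ?n" "1 \<le> ?m" by (rule bits_pos)+
 have 1: "runs (mv [AX]) (main (bits d @ bits e @ r)) (20 * ?n + 3) ?S1"
  by (rule runs_mv) (auto simp: main_def)
 have 2: "runs (mv [BX]) ?S1 (20 * ?m + 3) ?S2"
  by (rule runs_mv) (auto)
 have 3: "runs (restore AX) ?S2 (6 * ?n + 7) ?S3"
  by (rule runs_restore) auto
 have 4: "runs (restore BX) ?S3 (6 * ?m + 7) (main (bits e @ bits d @ r))"
  by (rule runs_restore) (auto simp: main_def)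
 show ?thesis unfolding swap_com_def
  by (rule runs_Seq[OF 1 runs_Seq[OF 2 runs_Seq[OF 3 4 order.refl] order.refl]])
   (rule order.trans[OF _ assms], use n in simp)
qed

definition fst_com :: com where
 "fst_com = Case MN Skip Skip (mv [AX] ;; drop_com ;; restore AX)"
definition snd_com :: com where
 "snd_com = Case MN Skip Skip drop_com"

lemma runs_fst:
 assumes "80 * length (bits (Cn d e)) \<le> T"
 shows "runs fst_com (main (bits (Cn d e) @ r)) T (main (bits d @ r))"
proof -
 let ?n = "length (bits d)" and ?m = "length (bits e)"
 let ?S0 = "main (bits d @ bits e @ r)"
 let ?S1 = "(%_. [])(MN := bits e @ r, AX := rev (bits d))"
 let ?S2 = "(%_. [])(MN := r, AX := rev (bits d))"
 have n: "1 \<le> ?n" "1 \<le> ?m" by (rule bits_pos)+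
 have 1: "runs (mv [AX]) ?S0 (20 * ?n + 3) ?S1"
  by (rule runs_mv) (auto simp: main_def)
 have 2: "runs drop_com ?S1 (20 * ?m + 3) ?S2" unfolding drop_com_def
  by (rule runs_mv) (auto)
 have 3: "runs (restore AX) ?S2 (6 * ?n + 7) (main (bits d @ r))"
  by (rule runs_restore) (auto simp: main_def)
 have "runs (mv [AX] ;; drop_com ;; restore AX) ?S0 (26 * ?n + 20 * ?m + 15) (main (bits d @ r))"
  by (rule runs_Seq[OF 1 runs_Seq[OF 2 3 order.refl]]) simp
 then have "runs (mv [AX] ;; drop_com ;; restore AX)
   ((main (bits (Cn d e) @ r))(MN := bits d @ bits e @ r)) (26 * ?n + 20 * ?m + 15) (main (bits d @ r))"
  unfolding main_def fun_upd_upd .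
 then show ?thesis unfolding fst_com_def
  by (rule runs_CaseT[rotated]) (use assms in \<open>simp_all add: main_def\<close>)
qed

lemma runs_snd:
 assumes "80 * length (bits (Cn d e)) \<le> T"
 shows "runs snd_com (main (bits (Cn d e) @ r)) T (main (bits e @ r))"
proof -
 have "runs drop_com (main (bits d @ bits e @ r)) (30 * length (bits d)) (main (bits e @ r))"
  by (rule runs_drop) simp
 then have "runs drop_com ((main (bits (Cn d e) @ r))(MN := bits d @ bits e @ r)) (30 * length (bits d)) (main (bits e @ r))"
  unfolding main_def fun_upd_upd .
 then show ?thesis unfolding snd_com_def
  by (rule runs_CaseT[rotated]) (use assms in \<open>simp_all add: main_def\<close>)
qed

lemma runs_case_main:
 "runs a (main r) T1 S' ==> T1 + 1 \<le> T ==> runs (Case MN e a b) (main (False # r)) T S'"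
 "runs b (main r) T1 S' ==> T1 + 1 \<le> T ==> runs (Case MN e a b) (main (True # r)) T S'"
 unfolding main_def
 by (rule runs_CaseF[where r = r]; simp only: fun_upd_upd fun_upd_same)
  (rule runs_CaseT[where r = r]; simp only: fun_upd_upd fun_upd_same)

lemma runs_push_main: "1 \<le> T ==> runs (Push MN b) (main r) T (main (b # r))"
 by (rule runs_Push) (auto simp: main_def)

section \<open>Encodings of data types and polynomial bounds in their size\<close>

class enc =
 fixes ec :: "'a => dat"
 assumes ec_inj: "ec x = ec y ==> x = y"

instantiation dat :: enc
begin
definition ec_dat :: "dat => dat" where "ec_dat d = d"
instance by standard (simp add: ec_dat_def)
end

instantiation unit :: enc
begin
definition ec_unit :: "unit => dat" where "ec_unit d = Nl"
instance by standard simp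
end

instantiation bool :: enc
begin
definition ec_bool :: "bool => dat" where "ec_bool b = (if b then Cn Nl Nl else Nl)"
instance by standard (auto simp: ec_bool_def split: if_splits)
end

instantiation prod :: (enc, enc) enc
begin
definition ec_prod :: "'a \<times> 'b => dat" where "ec_prod p = Cn (ec (fst p)) (ec (snd p))"
instance by standard (auto simp: ec_prod_def dest: ec_inj intro: prod_eqI)
end

instantiation list :: (enc) enc
begin
primrec ec_list :: "'a list => dat" where
 "ec_list [] = Nl"
| "ec_list (x # xs) = Cn (ec x) (ec_list xs)"
instance
proof
 show "ec xs = ec ys ==> xs = ys" for xs ys :: "'a list"
 proof (induction xs arbitrary: ys)
  case Nil then show ?case by (cases ys) auto
 next
  case (Cons x xs) then show ?case by (cases ys) (auto dest: ec_inj)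
 qed
qed
end

text \<open>Numbers are unary: a number has the same code as a list of units of that length
  (\<open>ec_replicate\<close>). Arithmetic thus becomes list processing, and running times are
  polynomial in the values.\<close>

instantiation nat :: enc
begin
primrec ec_nat :: "nat => dat" where
 "ec_nat 0 = Nl"
| "ec_nat (Suc n) = Cn Nl (ec_nat n)"
instance
proof
 show "ec m = ec n ==> m = n" for m n :: nat
 proof (induction m arbitrary: n)
  case 0 then show ?case by (cases n) auto
 next
  case (Suc m) then show ?case by (cases n) auto
 qed
qed
end

definition sz :: "'a::enc => nat" where "sz x = length (bits (ec x))"

lemma sz_pos: "1 \<le> sz x"
 unfolding sz_def by (rule bits_pos)

lemma sz_simps [simp]:
 "sz (x, y) = 1 + sz x + sz y" "sz () = 1" "sz True = 3" "sz False = 1"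
 "sz ([] :: 'a::enc list) = 1" "sz (z # zs) = 1 + sz z + sz zs" "sz (0::nat) = 1" "sz (Suc n) = 2 + sz n"
 by (auto simp: sz_def ec_prod_def ec_unit_def ec_bool_def)

lemma sz_nat: "sz (n::nat) = 2 * n + 1"
 by (induction n) auto

lemma sz_append: "sz (xs @ ys) + 1 = sz xs + sz ys"
 by (induction xs) auto

lemma sz_bool: "sz (b::bool) \<le> 3"
 by (cases b) auto

lemma length_le_sz: "length xs \<le> sz xs"
 by (induction xs) auto

lemma sz_list_le: "(\<And>x. x \<in> set xs ==> sz x \<le> b) ==> sz xs \<le> length xs * (b + 1) + 1"
 by (induction xs) fastforce+

lemma sz_mem: "x \<in> set xs ==> sz x \<le> sz xs"
 by (induction xs) auto

text \<open>Adding 2 to the size keeps the base of the power above 1, so that powers of it absorb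
  constants and these bounds are closed under sums.\<close>

definition pbound :: "('a::enc => nat) => bool" where
 "pbound T \<longleftrightarrow> (\<exists>k. \<forall>x. T x \<le> (sz x + 2) ^ k)"

lemma pow_ge: "k \<le> j ==> (n + 2 :: nat) ^ k \<le> (n + 2) ^ j"
 by (rule power_increasing) auto

lemma le_pow: "(c::nat) \<le> (n + 2) ^ c"
 by (metis less_exp less_imp_le_nat add.commute le_add1 order.trans power_mono zero_le)

lemma pbound_mono: "pbound U ==> (\<And>x. T x \<le> U x) ==> pbound T"
 unfolding pbound_def by (meson le_trans)

lemma pbound_const: "pbound (%x. c)"
 unfolding pbound_def using le_pow by blast

lemma pbound_sz: "pbound (%x. sz x)"
 unfolding pbound_def by (rule exI[of _ 1]) auto

lemma pbound_add:
 assumes "pbound T" "pbound U" shows "pbound (%x. T x + U x)"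
proof -
 obtain j k where jk: "\<And>x. T x \<le> (sz x + 2) ^ j" "\<And>x. U x \<le> (sz x + 2) ^ k"
  using assms unfolding pbound_def by blast
 have "T x + U x \<le> (sz x + 2) ^ (max j k + 1)" for x
 proof -
  have "T x \<le> (sz x + 2) ^ max j k" "U x \<le> (sz x + 2) ^ max j k"
   using order.trans[OF jk(1) pow_ge[of j "max j k" "sz x"]]
    order.trans[OF jk(2) pow_ge[of k "max j k" "sz x"]] by simp_all
  then have "T x + U x \<le> 2 * (sz x + 2) ^ max j k" by simp
  also have "\<dots> \<le> (sz x + 2) * (sz x + 2) ^ max j k" by (intro mult_le_mono1) simp
  finally show ?thesis by simp
 qed
 then show ?thesis unfolding pbound_def by blast
qed

lemma pbound_mult:
 assumes "pbound T" "pbound U" shows "pbound (%x. T x * U x)"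
proof -
 obtain j k where "\<And>x. T x \<le> (sz x + 2) ^ j" "\<And>x. U x \<le> (sz x + 2) ^ k"
  using assms unfolding pbound_def by blast
 then have "T x * U x \<le> (sz x + 2) ^ (j + k)" for x
  unfolding power_add by (intro mult_le_mono)
 then show ?thesis unfolding pbound_def by blast
qed

lemma pbound_power: "pbound T ==> pbound (%x. T x ^ k)"
 by (induction k) (auto intro: pbound_const pbound_mult)

lemma pbound_comp:
 assumes "pbound T" "pbound (%x. sz (f x))" shows "pbound (%x. T (f x))"
proof -
 obtain k where k: "\<And>x. T x \<le> (sz x + 2) ^ k" using assms(1) unfolding pbound_def by blast
 have "pbound (%x. (sz (f x) + 2) ^ k)"
  by (intro pbound_power pbound_add assms(2) pbound_const)
 then show ?thesis by (rule pbound_mono) (rule k)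
qed

lemmas pbound_intros = pbound_const pbound_sz pbound_add pbound_mult pbound_power

text \<open>The arbitrary rest \<open>r\<close> below the argument is what allows a program to be
  run inside another one that keeps further values on the stack.\<close>

definition computes :: "com => ('a::enc => 'b::enc) => ('a => nat) => bool" where
 "computes c f T \<longleftrightarrow> (\<forall>x r. runs c (main (bits (ec x) @ r)) (T x) (main (bits (ec (f x)) @ r)))"

definition FP :: "('a::enc => 'b::enc) => bool" where
 "FP f \<longleftrightarrow> (\<exists>c T. computes c f T \<and> pbound T)"

lemma computes_size: "computes c f T ==> sz (f x) \<le> sz x + T x"
 using runs_height[of c "main (bits (ec x) @ [])" "T x" "main (bits (ec (f x)) @ [])" MN]
 unfolding computes_def sz_def main_def by fastforce

lemma FP_size: "FP f ==> pbound (%x. sz (f x))"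
proof -
 assume "FP f"
 then obtain c T where c: "computes c f T" "pbound T" unfolding FP_def by blast
 show ?thesis by (rule pbound_mono[OF pbound_add[OF pbound_sz c(2)]]) (rule computes_size[OF c(1)])
qed

text \<open>Programs act on codes only, so a function may be exchanged for one into another type
  with the same codes.\<close>

lemma FP_coerce: "FP f ==> (\<And>x. ec (f x) = ec (g x)) ==> FP g"
 unfolding FP_def computes_def by simp

lemma FP_id: "FP (%x. x)"
proof -
 have "computes Skip (%x. x) (%x. 1)" unfolding computes_def by (simp add: runs_Skip)
 then show ?thesis unfolding FP_def using pbound_const by blast
qed

lemma FP_comp:
 assumes "FP f" "FP g" shows "FP (%x. f (g x))"
proof -
 obtain c T d U where c: "computes c f T" "pbound T" and d: "computes d g U" "pbound U"
  using assms unfolding FP_def by blast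
 have "computes (d ;; c) (%x. f (g x)) (%x. U x + T (g x) + 1)"
  unfolding computes_def
 proof (intro allI)
  fix x r
  have "runs d (main (bits (ec x) @ r)) (U x) (main (bits (ec (g x)) @ r))"
   "runs c (main (bits (ec (g x)) @ r)) (T (g x)) (main (bits (ec (f (g x))) @ r))"
   using c(1) d(1) unfolding computes_def by auto
  then show "runs (d ;; c) (main (bits (ec x) @ r)) (U x + T (g x) + 1) (main (bits (ec (f (g x))) @ r))"
   by (rule runs_Seq) simp
 qed
 moreover have "pbound (%x. U x + T (g x) + 1)"
  by (intro pbound_intros d(2) pbound_comp[OF c(2)] FP_size assms)
 ultimately show ?thesis unfolding FP_def by blast
qed

lemma FP_pair:
 assumes "FP f" "FP g" shows "FP (%x. (f x, g x))"
proof -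
 obtain c T d U where c: "computes c f T" "pbound T" and d: "computes d g U" "pbound U"
  using assms unfolding FP_def by blast
 let ?c = "dup_com ;; c ;; swap_com ;; d ;; swap_com ;; Push MN True"
 let ?T = "%x. 200 * (sz x + sz (f x) + sz (g x)) + T x + U x + 10"
 have "computes ?c (%x. (f x, g x)) ?T"
  unfolding computes_def
 proof (intro allI)
  fix x r
  let ?x = "bits (ec x)" and ?f = "bits (ec (f x))" and ?g = "bits (ec (g x))"
  have 1: "runs dup_com (main (?x @ r)) (70 * sz x) (main (?x @ ?x @ r))"
   by (rule runs_dup) (simp add: sz_def)
  have 2: "runs c (main (?x @ ?x @ r)) (T x) (main (?f @ ?x @ r))"
   using c(1) unfolding computes_def by blast
  have 3: "runs swap_com (main (?f @ ?x @ r)) (50 * (sz (f x) + sz x)) (main (?x @ ?f @ r))"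
   by (rule runs_swap) (simp add: sz_def)
  have 4: "runs d (main (?x @ ?f @ r)) (U x) (main (?g @ ?f @ r))"
   using d(1) unfolding computes_def by blast
  have 5: "runs swap_com (main (?g @ ?f @ r)) (50 * (sz (g x) + sz (f x))) (main (?f @ ?g @ r))"
   by (rule runs_swap) (simp add: sz_def)
  have 6: "runs (Push MN True) (main (?f @ ?g @ r)) 1 (main (bits (ec (f x, g x)) @ r))"
   using runs_push_main[of 1 True "?f @ ?g @ r"] by (simp add: ec_prod_def)
  show "runs ?c (main (?x @ r)) (?T x) (main (bits (ec (f x, g x)) @ r))"
   by (rule runs_Seq[OF 1 runs_Seq[OF 2 runs_Seq[OF 3 runs_Seq[OF 4 runs_Seq[OF 5 6 order.refl]
     order.refl] order.refl] order.refl]]) simp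
 qed
 moreover have "pbound ?T"
  by (intro pbound_intros c(2) d(2) FP_size assms)
 ultimately show ?thesis unfolding FP_def by blast
qed

lemma FP_fst: "FP f ==> FP (%x. fst (f x))"
proof -
 have "computes fst_com (%p. fst p) (%x. 80 * sz x)"
  unfolding computes_def ec_prod_def sz_def by (intro allI runs_fst order.refl)
 moreover have "pbound (%x. 80 * sz x)" by (intro pbound_intros)
 ultimately have "FP (%p. fst p)" unfolding FP_def by blast
 then show "FP f ==> FP (%x. fst (f x))" by (rule FP_comp)
qed

lemma FP_snd: "FP f ==> FP (%x. snd (f x))"
proof -
 have "computes snd_com (%p. snd p) (%x. 80 * sz x)"
  unfolding computes_def ec_prod_def sz_def by (intro allI runs_snd order.refl)
 moreover have "pbound (%x. 80 * sz x)" by (intro pbound_intros)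
 ultimately have "FP (%p. snd p)" unfolding FP_def by blast
 then show "FP f ==> FP (%x. snd (f x))" by (rule FP_comp)
qed

fun push_word :: "bool list => com" where
 "push_word [] = Skip"
| "push_word (b # bs) = push_word bs ;; Push MN b"

lemma runs_push_word: "runs (push_word w) (main r) (2 * length w + 1) (main (w @ r))"
proof (induction w)
 case Nil then show ?case by (simp add: runs_Skip)
next
 case (Cons b w)
 from runs_Seq[OF Cons.IH runs_push_main[OF order.refl]] show ?case by simp
qed

lemma FP_const: "FP (%x. k)"
proof -
 have "computes (drop_com ;; push_word (bits (ec k))) (%x. k)
   (%x. 30 * sz x + (2 * length (bits (ec k)) + 1) + 1)"
  unfolding computes_def sz_def
  by (intro allI runs_Seq[OF runs_drop[OF order.refl] runs_push_word order.refl])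
 moreover have "pbound (%x. 30 * sz x + (2 * length (bits (ec k)) + 1) + 1)"
  by (intro pbound_intros)
 ultimately show ?thesis unfolding FP_def by blast
qed

text \<open>
 Case distinction on the unary number \<open>i\<close> on top of the stack; the other two values on
 the stack, a payload \<open>p\<close> and the argument \<open>x\<close>, are passed as the pair \<open>(x, p)\<close> to the \<open>i\<close>-th branch.
\<close>

fun branch :: "com list => com" where
 "branch [] = Skip"
| "branch (c # cs) = Case MN Skip (swap_com ;; Push MN True ;; c) (drop_com ;; branch cs)"

lemma runs_branch:
 assumes "i < length cs" "runs (cs ! i) (main (bits (Cn x p) @ r)) T S'"
 shows "runs (branch cs) (main (bits (ec i) @ bits p @ bits x @ r))
  (50 * (length (bits p) + length (bits x)) + 40 * i + T + 4) S'"
 using assms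
proof (induction cs arbitrary: i)
 case Nil then show ?case by simp
next
 case (Cons c cs)
 show ?case
 proof (cases i)
  case 0
  have 1: "runs swap_com (main (bits p @ bits x @ r)) (50 * (length (bits p) + length (bits x)))
    (main (bits x @ bits p @ r))" by (rule runs_swap) simp
  have 2: "runs (Push MN True) (main (bits x @ bits p @ r)) 1 (main (bits (Cn x p) @ r))"
   using runs_push_main[of 1 True] by simp
  have 3: "runs c (main (bits (Cn x p) @ r)) T S'" using Cons.prems 0 by simp
  have "runs (swap_com ;; Push MN True ;; c) (main (bits p @ bits x @ r))
    (50 * (length (bits p) + length (bits x)) + T + 3) S'"
   by (rule runs_Seq[OF 1 runs_Seq[OF 2 3 order.refl]]) simp
  then show ?thesis unfolding branch.simps 0 ec_nat.simps bits.simps append_Cons append_Nil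
   by (rule runs_case_main) simp
 next
  case (Suc m)
  have "runs (branch cs) (main (bits (ec m) @ bits p @ bits x @ r))
    (50 * (length (bits p) + length (bits x)) + 40 * m + T + 4) S'"
   by (rule Cons.IH) (use Cons.prems Suc in auto)
  with runs_drop[of Nl 30 "bits (ec m) @ bits p @ bits x @ r"]
  have "runs (drop_com ;; branch cs) (main (bits Nl @ bits (ec m) @ bits p @ bits x @ r))
    (30 + (50 * (length (bits p) + length (bits x)) + 40 * m + T + 4) + 1) S'"
   by (intro runs_Seq[OF _ _ order.refl]) auto
  then show ?thesis unfolding branch.simps Suc ec_nat.simps bits.simps(2) append_Cons append_assoc
   by (rule runs_case_main) simp
 qed
qed

lemma FP_branch:
 fixes f :: "'a::enc => 'b::enc" and g :: "'a => 'c::enc"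
 assumes "FP f" "pbound U"
  and br: "\<And>x. \<exists>i p. i < length cs \<and> ec (f x) = Cn (ec i) p \<and>
   (\<forall>r. runs (cs ! i) (main (bits (Cn (ec x) p) @ r)) (U x) (main (bits (ec (g x)) @ r)))"
 shows "FP g"
proof -
 obtain c T where c: "computes c f T" "pbound T" using assms(1) unfolding FP_def by blast
 let ?c = "dup_com ;; c ;; Case MN Skip Skip (branch cs)"
 let ?T = "%x. 120 * sz x + T x + 60 * sz (f x) + 40 * length cs + U x + 10"
 have "computes ?c g ?T"
  unfolding computes_def
 proof (intro allI)
  fix x r
  let ?x = "bits (ec x)" and ?f = "bits (ec (f x))"
  obtain i p where i: "i < length cs" "ec (f x) = Cn (ec i) p"
   "\<And>r. runs (cs ! i) (main (bits (Cn (ec x) p) @ r)) (U x) (main (bits (ec (g x)) @ r))"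
   using br by blast
  have 1: "runs dup_com (main (?x @ r)) (70 * sz x) (main (?x @ ?x @ r))"
   by (rule runs_dup) (simp add: sz_def)
  have 2: "runs c (main (?x @ ?x @ r)) (T x) (main (?f @ ?x @ r))"
   using c(1) unfolding computes_def by blast
  have 3: "runs (Case MN Skip Skip (branch cs)) (main (?f @ ?x @ r))
    (50 * (length (bits p) + length ?x) + 40 * i + U x + 5) (main (bits (ec (g x)) @ r))"
   unfolding i(2) bits.simps append_Cons append_assoc
   by (rule runs_case_main(2)[OF runs_branch[OF i(1) i(3)]]) simp
  have "length (bits p) \<le> sz (f x)" using i(2) by (simp add: sz_def)
  then show "runs ?c (main (?x @ r)) (?T x) (main (bits (ec (g x)) @ r))"
   by (intro runs_Seq[OF 1 runs_Seq[OF 2 3 order.refl]]) (use i(1) in \<open>simp add: sz_def\<close>)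
 qed
 moreover have "pbound ?T"
  by (intro pbound_intros c(2) FP_size assms)
 ultimately show ?thesis unfolding FP_def by blast
qed

text \<open>Monotone form of a time bound: n may be the size of enclosing data, so that one bound
  serves all values that arise inside a larger computation.\<close>

lemma FP_bounded_program:
 assumes "FP h"
 obtains c k where "\<forall>y r n. sz y \<le> n --> runs c (main (bits (ec y) @ r)) ((n + 2) ^ k) (main (bits (ec (h y)) @ r))"
proof -
 obtain c T k where c: "computes c h T" "\<And>y. T y \<le> (sz y + 2) ^ k"
  using assms unfolding FP_def pbound_def by blast
 have "runs c (main (bits (ec y) @ r)) ((n + 2) ^ k) (main (bits (ec (h y)) @ r))" if "sz y \<le> n" for y r n
 proof (rule runs_mono)
  show "runs c (main (bits (ec y) @ r)) (T y) (main (bits (ec (h y)) @ r))"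
   using c(1) unfolding computes_def by blast
  show "T y \<le> (n + 2) ^ k" using c(2)[of y] power_mono[of "sz y + 2" "n + 2" k] that by simp
 qed
 then show ?thesis using that by blast
qed

lemma FP_case_list:
 fixes l :: "'a::enc => 'b::enc list" and e :: "'a => 'c::enc"
 assumes "FP l" "FP e" "FP (%p. h (fst p) (fst (snd p)) (snd (snd p)))"
 shows "FP (%x. case l x of [] => e x | y # ys => h x y ys)"
proof -
 let ?g = "%x. case l x of [] => e x | y # ys => h x y ys"
 obtain c T d U where c: "computes c l T" "pbound T" and d: "computes d e U" "pbound U"
  using assms unfolding FP_def by blast
 obtain b k where b: "\<forall>y r n. sz y \<le> n -->
   runs b (main (bits (ec y) @ r)) ((n + 2) ^ k) (main (bits (ec (h (fst y) (fst (snd y)) (snd (snd y)))) @ r))"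
  by (rule FP_bounded_program[OF assms(3)])
 let ?c = "dup_com ;; c ;; Case MN Skip d (Push MN True ;; swap_com ;; Push MN True ;; b)"
 let ?V = "%x. (sz x + sz (l x) + 1 + 2) ^ k"
 let ?T = "%x. 120 * sz x + T x + 60 * sz (l x) + U x + ?V x + 10"
 have "computes ?c ?g ?T"
  unfolding computes_def
 proof (intro allI)
  fix x r
  let ?x = "bits (ec x)" and ?l = "bits (ec (l x))"
  have 1: "runs dup_com (main (?x @ r)) (70 * sz x) (main (?x @ ?x @ r))"
   by (rule runs_dup) (simp add: sz_def)
  have 2: "runs c (main (?x @ ?x @ r)) (T x) (main (?l @ ?x @ r))"
   using c(1) unfolding computes_def by blast
  have 3: "runs (Case MN Skip d (Push MN True ;; swap_com ;; Push MN True ;; b)) (main (?l @ ?x @ r))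
    (50 * sz x + 60 * sz (l x) + U x + ?V x + 6) (main (bits (ec (?g x)) @ r))"
  proof (cases "l x")
   case Nil
   have "runs d (main (?x @ r)) (U x) (main (bits (ec (e x)) @ r))"
    using d(1) unfolding computes_def by blast
   then show ?thesis unfolding Nil ec_list.simps bits.simps append_Cons append_Nil list.case
    by (rule runs_case_main) simp
  next
   case (Cons y ys)
   let ?p = "(x, (y, ys))"
   have l: "?l = True # bits (ec y) @ bits (ec ys)" by (simp add: Cons)
   have 4: "runs (Push MN True) (main (bits (ec y) @ bits (ec ys) @ ?x @ r)) 1 (main (?l @ ?x @ r))"
    using runs_push_main[of 1 True] by (simp add: l)
   have 5: "runs swap_com (main (?l @ ?x @ r)) (50 * (sz (l x) + sz x)) (main (?x @ ?l @ r))"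
    by (rule runs_swap) (simp add: sz_def)
   have 6: "runs (Push MN True) (main (?x @ ?l @ r)) 1 (main (bits (ec ?p) @ r))"
    using runs_push_main[of 1 True] by (simp add: l ec_prod_def)
   have 7: "runs b (main (bits (ec ?p) @ r)) (?V x) (main (bits (ec (h x y ys)) @ r))"
    using b[rule_format, of ?p "sz x + sz (l x) + 1" r] by (simp add: Cons)
   have 8: "runs (Push MN True ;; swap_com ;; Push MN True ;; b) (main (bits (ec y) @ bits (ec ys) @ ?x @ r))
     (50 * (sz (l x) + sz x) + ?V x + 5) (main (bits (ec (h x y ys)) @ r))"
    by (rule runs_Seq[OF 4 runs_Seq[OF 5 runs_Seq[OF 6 7 order.refl] order.refl]]) simp
   show ?thesis unfolding l append_Cons append_assoc
    by (rule runs_case_main(2)[where ?T1.0 = "50 * (sz (l x) + sz x) + ?V x + 5"]) (use 8 Cons in simp_all)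
  qed
  show "runs ?c (main (?x @ r)) (?T x) (main (bits (ec (?g x)) @ r))"
   by (rule runs_Seq[OF 1 runs_Seq[OF 2 3 order.refl]]) simp
 qed
 moreover have "pbound ?T"
  by (intro pbound_intros c(2) d(2) FP_size assms)
 ultimately show ?thesis unfolding FP_def by blast
qed

text \<open>A truth value has the code of a list of at most one unit, so a conditional is a case
  distinction on a list.\<close>

lemma FP_if:
 assumes "FP P" "FP f" "FP g" shows "FP (%x. if P x then f x else g x)"
proof -
 have "FP (%x. if P x then [()] else [])"
  by (rule FP_coerce[OF assms(1)]) (simp add: ec_bool_def ec_unit_def)
 then have "FP (%x. case if P x then [()] else [] of [] => g x | y # ys => f x)"
  by (rule FP_case_list[OF _ assms(3)]) (rule FP_comp[OF assms(2) FP_fst[OF FP_id]])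
 moreover have "(%x. case if P x then [()] else [] of [] => g x | y # ys => f x) = (%x. if P x then f x else g x)"
  by auto
 ultimately show ?thesis by simp
qed

text \<open>
 The general loop: only the sizes of the intermediate states have to be bounded, the running
 time of a step being polynomial in them.
\<close>

lemma while_computes:
 fixes f :: "'s::enc => 's" and s0 :: "'a::enc => 's"
 assumes "FP f" "FP P" "FP s0"
  and P: "\<And>x i. i < n x ==> P ((f ^^ i) (s0 x))" "\<And>x. \<not> P ((f ^^ n x) (s0 x))"
  and B: "\<And>x i. i \<le> n x ==> sz ((f ^^ i) (s0 x)) \<le> B x"
 shows "\<exists>c T l k. pbound T \<and> computes c (%x. (f ^^ n x) (s0 x))
  (%x. T x + (n x + 1) * (70 * B x + (B x + 2) ^ l + (B x + 2) ^ k + 70 + 2) + 3)"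
proof -
 obtain c k where c: "\<forall>y r n. sz y \<le> n --> runs c (main (bits (ec y) @ r)) ((n + 2) ^ k) (main (bits (ec (f y)) @ r))"
  by (rule FP_bounded_program[OF assms(1)])
 obtain d l where d: "\<forall>y r n. sz y \<le> n --> runs d (main (bits (ec y) @ r)) ((n + 2) ^ l) (main (bits (ec (P y)) @ r))"
  by (rule FP_bounded_program[OF assms(2)])
 let ?body = "dup_com ;; d ;; Case MN Skip Skip (drop_com ;; drop_com ;; c ;; Push CT True)"
 let ?c = "Push CT True ;; Whl CT ?body"
 let ?V = "%b. 70 * b + (b + 2) ^ l + (b + 2) ^ k + 70"
 define S1 where "S1 r = (main r)(CT := [True])" for r
 have S1: "S1 r CT = True # []" "(S1 r)(CT := []) = main r" for r
  by (auto simp: S1_def main_def)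
 have body1: "runs ?body (main (bits (ec y) @ r)) (?V b) (S1 (bits (ec (f y)) @ r))" if "P y" "sz y \<le> b" for y r b
 proof -
  let ?y = "bits (ec y)"
  have 1: "runs dup_com (main (?y @ r)) (70 * b) (main (?y @ ?y @ r))"
   by (rule runs_dup) (use that in \<open>simp add: sz_def\<close>)
  have 2: "runs d (main (?y @ ?y @ r)) ((b + 2) ^ l) (main (True # bits Nl @ bits Nl @ ?y @ r))"
   using d[rule_format, OF that(2), of "?y @ r"] that(1) by (simp add: ec_bool_def)
  have 3: "runs drop_com (main (bits Nl @ bits Nl @ ?y @ r)) 30 (main (bits Nl @ ?y @ r))"
   "runs drop_com (main (bits Nl @ ?y @ r)) 30 (main (?y @ r))"
   by (rule runs_drop; simp)+
  have 4: "runs c (main (?y @ r)) ((b + 2) ^ k) (main (bits (ec (f y)) @ r))" by (rule c[rule_format, OF that(2)])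
  have 5: "runs (Push CT True) (main (bits (ec (f y)) @ r)) 1 (S1 (bits (ec (f y)) @ r))"
   by (rule runs_Push) (simp_all add: S1_def main_def)
  have "runs (Case MN Skip Skip (drop_com ;; drop_com ;; c ;; Push CT True))
    (main (True # bits Nl @ bits Nl @ ?y @ r)) ((b + 2) ^ k + 65) (S1 (bits (ec (f y)) @ r))"
   by (rule runs_case_main(2)[OF runs_Seq[OF 3(1) runs_Seq[OF 3(2) runs_Seq[OF 4 5 order.refl] order.refl] order.refl]]) simp
  then show ?thesis by (rule runs_Seq[OF 1 runs_Seq[OF 2 _ order.refl]]) simp
 qed
 have body2: "runs ?body (main (bits (ec y) @ r)) (?V b) (main (bits (ec y) @ r))" if "\<not> P y" "sz y \<le> b" for y r b
 proof -
  let ?y = "bits (ec y)"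
  have 1: "runs dup_com (main (?y @ r)) (70 * b) (main (?y @ ?y @ r))"
   by (rule runs_dup) (use that in \<open>simp add: sz_def\<close>)
  have 2: "runs d (main (?y @ ?y @ r)) ((b + 2) ^ l) (main (False # ?y @ r))"
   using d[rule_format, OF that(2), of "?y @ r"] that(1) by (simp add: ec_bool_def)
  have "runs (Case MN Skip Skip (drop_com ;; drop_com ;; c ;; Push CT True)) (main (False # ?y @ r)) 2 (main (?y @ r))"
   by (rule runs_case_main(1)[OF runs_Skip[OF order.refl]]) simp
  then show ?thesis by (rule runs_Seq[OF 1 runs_Seq[OF 2 _ order.refl]]) simp
 qed
 have loop: "runs (Whl CT ?body) (S1 (bits (ec ((f ^^ i) (s0 x))) @ r)) ((n x - i + 1) * (?V (B x) + 2))
   (main (bits (ec ((f ^^ n x) (s0 x))) @ r))" if "i \<le> n x" for x i r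
  using that
 proof (induction i rule: inc_induct)
  case base
  have "runs ?body ((S1 (bits (ec ((f ^^ n x) (s0 x))) @ r))(CT := [])) (?V (B x)) (main (bits (ec ((f ^^ n x) (s0 x))) @ r))"
   unfolding S1 by (rule body2[OF P(2) B[OF order.refl]])
  moreover have "runs (Whl CT ?body) (main (bits (ec ((f ^^ n x) (s0 x))) @ r)) 1 (main (bits (ec ((f ^^ n x) (s0 x))) @ r))"
   by (rule runs_WhlN) (simp_all add: main_def)
  moreover have "?V (B x) + 1 + 1 \<le> (n x - n x + 1) * (?V (B x) + 2)" by simp
  moreover note S1(1)[of "bits (ec ((f ^^ n x) (s0 x))) @ r"]
  ultimately show ?case by (rule runs_WhlT[rotated 1])
 next
  case (step i)
  have "runs ?body ((S1 (bits (ec ((f ^^ i) (s0 x))) @ r))(CT := [])) (?V (B x)) (S1 (bits (ec (f ((f ^^ i) (s0 x)))) @ r))"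
   unfolding S1 by (rule body1) (use step.hyps P(1) B in auto)
  moreover have "runs (Whl CT ?body) (S1 (bits (ec (f ((f ^^ i) (s0 x)))) @ r)) ((n x - Suc i + 1) * (?V (B x) + 2))
   (main (bits (ec ((f ^^ n x) (s0 x))) @ r))" using step.IH by simp
  moreover have "?V (B x) + (n x - Suc i + 1) * (?V (B x) + 2) + 1 \<le> (n x - i + 1) * (?V (B x) + 2)"
  proof -
   have "n x - i + 1 = Suc (n x - Suc i + 1)" using step.hyps by simp
   then show ?thesis unfolding \<open>n x - i + 1 = _\<close> mult_Suc by linarith
  qed
  moreover note S1(1)[of "bits (ec ((f ^^ i) (s0 x))) @ r"]
  ultimately show ?case by (rule runs_WhlT[rotated 1])
 qed
 obtain e T where e: "computes e s0 T" "pbound T" using assms(3) unfolding FP_def by blast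
 have "computes (e ;; ?c) (%x. (f ^^ n x) (s0 x)) (%x. T x + (n x + 1) * (?V (B x) + 2) + 3)"
  unfolding computes_def
 proof (intro allI)
  fix x :: 'a and r
  have "runs (Push CT True) (main (bits (ec (s0 x)) @ r)) 1 (S1 (bits (ec (s0 x)) @ r))"
   by (rule runs_Push) (simp_all add: S1_def main_def)
  moreover have "runs (Whl CT ?body) (S1 (bits (ec (s0 x)) @ r)) ((n x + 1) * (?V (B x) + 2))
   (main (bits (ec ((f ^^ n x) (s0 x))) @ r))" using loop[of 0 x r] by simp
  ultimately have 1: "runs ?c (main (bits (ec (s0 x)) @ r)) ((n x + 1) * (?V (B x) + 2) + 2)
   (main (bits (ec ((f ^^ n x) (s0 x))) @ r))" by (rule runs_Seq) simp
  have 2: "runs e (main (bits (ec x) @ r)) (T x) (main (bits (ec (s0 x)) @ r))"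
   using e(1) unfolding computes_def by blast
  show "runs (e ;; ?c) (main (bits (ec x) @ r)) (T x + (n x + 1) * (?V (B x) + 2) + 3)
   (main (bits (ec ((f ^^ n x) (s0 x))) @ r))" by (rule runs_Seq[OF 2 1]) simp
 qed
 then show ?thesis using e(2) by blast
qed

lemma FP_while:
 fixes f :: "'s::enc => 's" and s0 :: "'a::enc => 's"
 assumes "FP f" "FP P" "FP s0" "pbound B" "pbound n"
  and P: "\<And>x i. i < n x ==> P ((f ^^ i) (s0 x))" "\<And>x. \<not> P ((f ^^ n x) (s0 x))"
  and B: "\<And>x i. i \<le> n x ==> sz ((f ^^ i) (s0 x)) \<le> B x"
 shows "FP (%x. (f ^^ n x) (s0 x))"
proof -
 obtain c T l k where T: "pbound T" "computes c (%x. (f ^^ n x) (s0 x))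
  (%x. T x + (n x + 1) * (70 * B x + (B x + 2) ^ l + (B x + 2) ^ k + 70 + 2) + 3)"
  using while_computes[OF assms(1-3) P B] by blast
 have "pbound (%x. T x + (n x + 1) * (70 * B x + (B x + 2) ^ l + (B x + 2) ^ k + 70 + 2) + 3)"
  by (intro pbound_intros assms T)
 with T(2) show ?thesis unfolding FP_def by blast
qed

lemma ec_pair: "ec (a, b) = Cn (ec a) (ec b)"
 by (simp add: ec_prod_def)

lemma FP_comp2: "FP (%p. f (fst p) (snd p)) ==> FP a ==> FP b ==> FP (%x. f (a x) (b x))"
 using FP_comp[OF _ FP_pair[of a b], of "%p. f (fst p) (snd p)"] by simp

lemma FP_comp3: "FP (%p. f (fst p) (fst (snd p)) (snd (snd p))) ==> FP a ==> FP b ==> FP c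
  ==> FP (%x. f (a x) (b x) (c x))"
 using FP_comp[OF _ FP_pair[OF _ FP_pair, of a b c], of "%p. f (fst p) (fst (snd p)) (snd (snd p))"] by simp

lemma FP_comp4: "FP (%p. f (fst p) (fst (snd p)) (fst (snd (snd p))) (snd (snd (snd p))))
  ==> FP a ==> FP b ==> FP c ==> FP d ==> FP (%x. f (a x) (b x) (c x) (d x))"
 using FP_comp[OF _ FP_pair[OF _ FP_pair[OF _ FP_pair], of a b c d],
   of "%p. f (fst p) (fst (snd p)) (fst (snd (snd p))) (snd (snd (snd p)))"] by simp

lemma FP_Cons: "FP f ==> FP g ==> FP (%x. f x # g x)"
 by (rule FP_coerce[OF FP_pair]) (simp_all add: ec_prod_def)

lemma FP_not: "FP P ==> FP (%x. \<not> P x)"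
proof -
 assume "FP P"
 then have "FP (%x. if P x then False else True)" by (intro FP_if FP_const)
 moreover have "(%x. if P x then False else True) = (%x. \<not> P x)" by auto
 ultimately show ?thesis by simp
qed

lemma FP_conj: "FP P ==> FP Q ==> FP (%x. P x \<and> Q x)"
proof -
 assume "FP P" "FP Q"
 then have "FP (%x. if P x then Q x else False)" by (intro FP_if FP_const)
 moreover have "(%x. if P x then Q x else False) = (%x. P x \<and> Q x)" by auto
 ultimately show ?thesis by simp
qed

lemma FP_disj: "FP P ==> FP Q ==> FP (%x. P x \<or> Q x)"
 using FP_not[OF FP_conj[OF FP_not FP_not], of P Q] by simp

lemma FP_imp: "FP P ==> FP Q ==> FP (%x. P x --> Q x)"
 unfolding imp_conv_disj by (intro FP_disj FP_not)

text \<open>The loop state consists of the rest of the list, the parameter and the accumulator. A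
  size bound is demanded for every prefix, because a polynomial-time step alone could let the
  accumulator grow exponentially under iteration.\<close>

lemma FP_foldl:
 fixes l :: "'a::enc => 'b::enc list" and a :: "'a => 'c::enc"
 assumes "FP l" "FP a" and h: "FP (%p. h (fst p) (fst (snd p)) (snd (snd p)))"
  and "pbound B" and B: "\<And>x ys zs. l x = ys @ zs ==> sz (foldl (h x) (a x) ys) \<le> B x"
 shows "FP (%x. foldl (h x) (a x) (l x))"
proof -
 let ?f = "%s. case fst s of [] => s | y # ys => (ys, (fst (snd s), h (fst (snd s)) (snd (snd s)) y))"
 let ?s0 = "%x. (l x, (x, a x))"
 have 1: "(?f ^^ length ys) (ys @ zs, (x, c)) = (zs, (x, foldl (h x) c ys))" for x c ys zs
  by (induction ys arbitrary: c) (simp_all add: funpow_Suc_right del: funpow.simps(2))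
 have it: "(?f ^^ i) (?s0 x) = (drop i (l x), (x, foldl (h x) (a x) (take i (l x))))" if "i \<le> length (l x)" for x i
  using 1[of "take i (l x)" "drop i (l x)" x "a x"] that by simp
 have "FP (%p. h (fst (snd (fst p))) (snd (snd (fst p))) (fst (snd p)))"
  by (intro FP_comp3[OF h] FP_fst FP_snd FP_id)
 then have f: "FP ?f"
  by (intro FP_case_list FP_fst FP_id FP_pair FP_snd)
 have P: "FP (%s. case fst s of [] => False | y # ys => True)"
  by (intro FP_case_list FP_fst FP_id FP_const)
 have "FP (%x. (?f ^^ length (l x)) (?s0 x))"
 proof (rule FP_while[OF f P, where B = "%x. sz (l x) + sz x + B x + 2"])
  show "FP ?s0" by (intro FP_pair assms FP_id)
  show "pbound (%x. sz (l x) + sz x + B x + 2)" by (intro pbound_intros FP_size assms)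
  show "pbound (%x. length (l x))"
   by (rule pbound_mono[OF FP_size[OF assms(1)]]) (rule length_le_sz)
  show "case fst ((?f ^^ i) (?s0 x)) of [] => False | y # ys => True" if "i < length (l x)" for x i
   using that by (subst it) (auto split: list.split)
  show "\<not> (case fst ((?f ^^ length (l x)) (?s0 x)) of [] => False | y # ys => True)" for x
   by (subst it) auto
  show "sz ((?f ^^ i) (?s0 x)) \<le> sz (l x) + sz x + B x + 2" if "i \<le> length (l x)" for x i
  proof -
   have "sz (drop i (l x)) \<le> sz (l x)"
    using sz_append[of "take i (l x)" "drop i (l x)"] sz_pos[of "take i (l x)"] by simp
   moreover have "sz (foldl (h x) (a x) (take i (l x))) \<le> B x"
    by (rule B[of x _ "drop i (l x)"]) simp
   ultimately show ?thesis by (subst it[OF that]) simp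
  qed
 qed
 then have "FP (%x. snd (snd ((?f ^^ length (l x)) (?s0 x))))" by (intro FP_snd)
 then show ?thesis by (subst (asm) it) auto
qed

lemma FP_size2: "FP (%p. h (fst p) (snd p)) ==> \<exists>k. \<forall>x y. sz (h x y) \<le> (sz x + sz y + 3) ^ k"
proof -
 assume "FP (%p. h (fst p) (snd p))"
 then obtain k where k: "\<And>p. sz (h (fst p) (snd p)) \<le> (sz p + 2) ^ k"
  using FP_size unfolding pbound_def by blast
 have "sz (h x y) \<le> (sz x + sz y + 3) ^ k" for x y
  using k[of "(x, y)"] by (simp add: eval_nat_numeral)
 then show ?thesis by blast
qed

lemma FP_rev: "FP l ==> FP (%x. rev (l x))"
proof -
 assume l: "FP l"
 have sz: "sz (rev ys) = sz ys" for ys :: "'b list"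
 proof (induction ys)
  case (Cons a ys) then show ?case using sz_append[of "rev ys" "[a]"] by simp
 qed simp
 have "FP (%x. foldl (%acc y. y # acc) [] (l x))"
 proof (rule FP_foldl[OF l FP_const, where B = "%x. sz (l x)"])
  fix x ys zs assume "l x = ys @ zs"
  then show "sz (foldl (%acc y. y # acc) [] ys) \<le> sz (l x)"
   using sz_append[of ys zs] sz_pos[of zs] sz[of ys] by (simp add: foldl_conv_fold rev_conv_fold)
 qed (intro FP_Cons FP_fst FP_snd FP_id FP_size l)+
 then show ?thesis by (simp add: foldl_conv_fold rev_conv_fold)
qed

lemma FP_append: "FP l ==> FP m ==> FP (%x. l x @ m x)"
proof -
 assume l: "FP l" and m: "FP m"
 have eq: "foldl (%acc y. y # acc) ms ys = rev ys @ ms" for ys ms :: "'b list"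
  by (induction ys arbitrary: ms) auto
 have "FP (%x. foldl (%acc y. y # acc) (m x) (rev (l x)))"
 proof (rule FP_foldl[OF FP_rev[OF l] m, where B = "%x. sz (l x) + sz (m x)"])
  fix x ys zs assume "rev (l x) = ys @ zs"
  then have "l x = rev zs @ rev ys" by (metis rev_append rev_rev_ident)
  then show "sz (foldl (%acc y. y # acc) (m x) ys) \<le> sz (l x) + sz (m x)"
   using sz_append[of "rev zs" "rev ys"] sz_pos[of "rev zs"] sz_append[of "rev ys" "m x"] by (simp add: eq)
 qed (intro FP_Cons FP_fst FP_snd FP_id FP_size l m pbound_add)+
 then show ?thesis by (simp add: eq)
qed

lemma FP_map:
 assumes "FP (%p. h (fst p) (snd p))" "FP l"
 shows "FP (%x. map (h x) (l x))"
proof -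
 obtain k where k: "\<And>x y. sz (h x y) \<le> (sz x + sz y + 3) ^ k" using FP_size2[OF assms(1)] by blast
 have eq: "foldl (%acc y. h x y # acc) ms ys = rev (map (h x) ys) @ ms" for x ys ms
  by (induction ys arbitrary: ms) auto
 let ?b = "%x. (sz x + sz (l x) + 3) ^ k"
 have "FP (%x. foldl (%acc y. h x y # acc) [] (l x))"
 proof (rule FP_foldl[OF assms(2) FP_const, where B = "%x. sz (l x) * (?b x + 1) + 1"])
  fix x ys zs assume l: "l x = ys @ zs"
  have "sz z \<le> ?b x" if z: "z \<in> set (rev (map (h x) ys))" for z
  proof -
   obtain y where y: "y \<in> set ys" "z = h x y" using z by auto
   then have "sz y \<le> sz (l x)" by (intro sz_mem) (simp add: l)
   then have "(sz x + sz y + 3) ^ k \<le> ?b x" by (intro power_mono) auto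
   with k[of x y] y(2) show ?thesis by (metis order.trans)
  qed
  then have "sz (rev (map (h x) ys)) \<le> length (rev (map (h x) ys)) * (?b x + 1) + 1" by (rule sz_list_le)
  also have "\<dots> \<le> sz (l x) * (?b x + 1) + 1"
   using length_le_sz[of "l x"] by (intro add_le_mono1 mult_le_mono1) (simp add: l)
  finally show "sz (foldl (%acc y. h x y # acc) [] ys) \<le> sz (l x) * (?b x + 1) + 1" by (simp add: eq)
 next
  show "FP (%p. h (fst p) (snd (snd p)) # fst (snd p))"
   by (intro FP_Cons FP_comp2[OF assms(1)] FP_fst FP_snd FP_id)
  show "pbound (%x. sz (l x) * (?b x + 1) + 1)" by (intro pbound_intros FP_size assms)
 qed
 then have "FP (%x. rev (foldl (%acc y. h x y # acc) [] (l x)))" by (rule FP_rev)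
 then show ?thesis by (simp add: eq)
qed

lemma FP_concat:
 assumes "FP l" shows "FP (%x. concat (l x))"
proof -
 have eq: "foldl (@) ms ys = ms @ concat ys" for ms :: "'b list" and ys
  by (induction ys arbitrary: ms) auto
 have sz: "sz (concat ys) \<le> sz ys" for ys :: "'b list list"
 proof (induction ys)
  case (Cons y ys) then show ?case using sz_append[of y "concat ys"] by simp
 qed simp
 have "FP (%x. foldl (%acc y. acc @ y) [] (l x))"
 proof (rule FP_foldl[OF assms FP_const, where B = "%x. sz (l x)"])
  fix x ys zs assume l: "l x = ys @ zs"
  show "sz (foldl (@) [] ys) \<le> sz (l x)"
   using sz[of ys] sz_append[of ys zs] sz_pos[of zs] by (simp add: eq l)
 qed (intro FP_append FP_fst FP_snd FP_id FP_size assms)+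
 then show ?thesis by (simp add: eq)
qed

lemma FP_filter:
 assumes "FP (%p. P (fst p) (snd p))" "FP l"
 shows "FP (%x. filter (P x) (l x))"
proof -
 have "FP (%x. concat (map (%y. if P x y then [y] else []) (l x)))"
  by (intro FP_concat FP_map FP_if FP_Cons FP_fst FP_snd FP_id FP_const assms)
 moreover have "concat (map (%y. if Q y then [y] else []) ys) = filter Q ys" for Q and ys :: "'b list"
  by (induction ys) auto
 ultimately show ?thesis by simp
qed

lemma FP_null: "FP l ==> FP (%x. l x = [])"
proof -
 assume "FP l"
 then have "FP (%x. case l x of [] => True | y # ys => False)" by (intro FP_case_list FP_const)
 moreover have "(%x. case l x of [] => True | y # ys => False) = (%x. l x = [])"
  by (auto simp: fun_eq_iff split: list.split)
 ultimately show ?thesis by simp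
qed

lemma FP_Bex:
 assumes "FP (%p. P (fst p) (snd p))" "FP l"
 shows "FP (%x. \<exists>y\<in>set (l x). P x y)"
 using FP_not[OF FP_null[OF FP_filter[OF assms]]] by (simp add: filter_empty_conv)

lemma FP_Ball:
 assumes "FP (%p. P (fst p) (snd p))" "FP l"
 shows "FP (%x. \<forall>y\<in>set (l x). P x y)"
 using FP_not[OF FP_Bex[OF FP_not[OF assms(1)] assms(2)]] by simp

lemma FP_length: "FP l ==> FP (%x. length (l x))"
proof -
 assume "FP l"
 then have "FP (%x. map (%_. ()) (l x))" by (intro FP_map FP_const)
 moreover have "ec (map (%_. ()) ys) = ec (length ys)" for ys :: "'b list"
  by (induction ys) (auto simp: ec_unit_def)
 ultimately show ?thesis by (auto elim: FP_coerce)
qed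

lemma ec_replicate: "ec (replicate n ()) = ec n"
 by (induction n) (auto simp: ec_unit_def)

lemma FP_unary: "FP f ==> FP (%x. replicate (f x) ())"
 by (erule FP_coerce) (simp add: ec_replicate)

lemma FP_add: "FP f ==> FP g ==> FP (%x. f x + g x :: nat)"
 using FP_length[OF FP_append[OF FP_unary FP_unary], of f g] by simp

lemma FP_Suc: "FP f ==> FP (%x. Suc (f x))"
 using FP_add[OF FP_const[of 1], of f] by simp

lemma FP_mult: "FP f ==> FP g ==> FP (%x. f x * g x :: nat)"
proof -
 assume fg: "FP f" "FP g"
 have "FP (%x. length (concat (map (%_. replicate (g x) ()) (replicate (f x) ()))))"
  by (intro FP_length FP_concat FP_map FP_unary FP_comp[OF fg(2)] fg FP_fst FP_id)
 moreover have "length (concat (map (%_. replicate n ()) (replicate m ()))) = m * n" for m n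
  by (induction m) auto
 ultimately show ?thesis by simp
qed

lemma FP_upt: "FP f ==> FP (%x. [0..<f x])"
proof -
 assume f: "FP f"
 have eq: "foldl (%acc _. acc @ [length acc]) [] ys = [0..<length ys]" for ys :: "unit list"
  by (induction ys rule: rev_induct) auto
 have "FP (%x. foldl (%acc (_::unit). acc @ [length acc]) [] (replicate (f x) ()))"
 proof (rule FP_foldl[OF FP_unary[OF f] FP_const, where B = "%x. sz (f x) * (2 * sz (f x) + 2) + 1"])
  fix x ys zs assume "replicate (f x) () = ys @ zs"
  then have n: "length ys \<le> f x" by (metis length_append length_replicate le_add1)
  have "sz [0..<length ys] \<le> length [0..<length ys] * (2 * sz (f x) + 1 + 1) + 1"
   by (rule sz_list_le) (use n in \<open>auto simp: sz_nat\<close>)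
  also have "\<dots> \<le> sz (f x) * (2 * sz (f x) + 1 + 1) + 1"
   by (intro add_le_mono1 mult_le_mono1) (use n in \<open>auto simp: sz_nat\<close>)
  finally show "sz (foldl (%acc _. acc @ [length acc]) [] ys) \<le> sz (f x) * (2 * sz (f x) + 2) + 1"
   by (simp add: eq)
 next
  show "FP (%p. fst (snd p) @ [length (fst (snd p))])"
   by (intro FP_append FP_Cons FP_length FP_const FP_fst FP_snd FP_id)
  show "pbound (%x. sz (f x) * (2 * sz (f x) + 2) + 1)" by (intro pbound_intros FP_size f)
 qed
 then show ?thesis by (simp add: eq)
qed

lemma FP_product: "FP l ==> FP m ==> FP (%x. List.product (l x) (m x))"
proof -
 assume l: "FP l" and m: "FP m"
 show ?thesis unfolding product_concat_map
  by (intro FP_concat FP_map FP_pair FP_comp[OF m] l FP_fst FP_snd FP_id)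
qed

text \<open>The list of the bits on the \<^const>\<open>IO\<close> stack, bottom first, is pushed as a value.\<close>

definition input_com :: com where
 "input_com = Push MN False ;; drain IO (Push MN False ;; Push MN True)
   (Push MN False ;; Push MN False ;; Push MN True ;; Push MN True)"

lemma runs_input:
 assumes "12 * length w + 9 \<le> T"
 shows "runs input_com ((main r)(IO := rev w)) T (main (bits (ec w) @ r))"
proof -
 let ?g = "%x S. S(MN := (if x then [True, True, False, False] else [True, False]) @ S MN)"
 have g: "fold ?g (rev w) S = S(MN := butlast (bits (ec w)) @ S MN)" for S :: stacks
 proof (induction w arbitrary: S)
  case (Cons b w)
  have "bits (ec w) \<noteq> []" using bits_pos[of "ec w"] by auto
  then show ?case using Cons by (cases b) (auto simp: ec_bool_def butlast_append)
 qed simp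
 have b: "butlast (bits (ec w)) @ [False] = bits (ec w)"
 proof (induction w)
  case (Cons b w)
  have "bits (ec w) \<noteq> []" using bits_pos[of "ec w"] by auto
  then show ?case using Cons by (auto simp: butlast_append)
 qed simp
 have 1: "runs (Push MN False) ((main r)(IO := rev w)) 1 ((main (False # r))(IO := rev w))"
  by (rule runs_Push) (auto simp: main_def)
 have 2: "runs (drain IO (Push MN False ;; Push MN True)
   (Push MN False ;; Push MN False ;; Push MN True ;; Push MN True))
  ((main (False # r))(IO := rev w)) (12 * length w + 7) (main (bits (ec w) @ r))"
 proof (rule runs_drain[where k = 7 and g = ?g])
  fix x and S :: stacks
  show "runs (if x then Push MN False ;; Push MN False ;; Push MN True ;; Push MN True
    else Push MN False ;; Push MN True) S 7 (?g x S)"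
  proof (cases x)
   case True
   have "runs (Push MN False ;; Push MN False ;; Push MN True ;; Push MN True) S 7 (?g True S)"
    by (rule runs_Seq[OF runs_Push[OF refl order.refl] runs_Seq[OF runs_Push[OF refl order.refl]
      runs_Seq[OF runs_Push[OF refl order.refl] runs_Push[OF _ order.refl] order.refl] order.refl]]) auto
   then show ?thesis using True by simp
  next
   case False
   have "runs (Push MN False ;; Push MN True) S 7 (?g False S)"
    by (rule runs_Seq[OF runs_Push[OF refl order.refl] runs_Push[OF _ order.refl]]) auto
   then show ?thesis using False by simp
  qed
 next
  have "bits (ec w) @ r = butlast (bits (ec w)) @ False # r" using b by (metis append.assoc append_Cons append_Nil)
  then show "main (bits (ec w) @ r) = fold ?g (((main (False # r))(IO := rev w)) IO) ((main (False # r))(IO := rev w, IO := []))"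
   by (auto simp: g main_def)
 qed (auto simp: main_def)
 show ?thesis unfolding input_com_def
  by (rule runs_Seq[OF 1 2]) (use assms in simp)
qed

text \<open>The code is moved to the input stack and read back as if it were an input word, which
  makes its bits available as data.\<close>

lemma FP_bits:
 fixes f :: "'a::enc => 'b::enc"
 assumes "FP f" shows "FP (%x. bits (ec (f x)))"
proof -
 have "computes (mv [IO] ;; input_com) (%d :: 'b. bits (ec d)) (%d. 50 * sz d)"
  unfolding computes_def
 proof (intro allI)
  fix d :: 'b and r
  have 1: "runs (mv [IO]) (main (bits (ec d) @ r)) (20 * sz d + 3) ((main r)(IO := rev (bits (ec d))))"
   by (rule runs_mv) (auto simp: main_def sz_def)
  have 2: "runs input_com ((main r)(IO := rev (bits (ec d)))) (12 * sz d + 9) (main (bits (ec (bits (ec d))) @ r))"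
   by (rule runs_input) (simp add: sz_def)
  show "runs (mv [IO] ;; input_com) (main (bits (ec d) @ r)) (50 * sz d) (main (bits (ec (bits (ec d))) @ r))"
   by (rule runs_Seq[OF 1 2]) (use sz_pos[of d] in linarith)
 qed
 moreover have "pbound (%d :: 'b. 50 * sz d)" by (intro pbound_intros)
 ultimately have "FP (%d :: 'b. bits (ec d))" unfolding FP_def by blast
 then show ?thesis using assms by (rule FP_comp)
qed

text \<open>Codes are compared bit by bit, which decides equality because both \<open>ec\<close> and
  \<open>bits\<close> are injective. The fold runs along the first code and consumes the
  second.\<close>

lemma FP_eq:
 assumes "FP f" "FP g" shows "FP (%x. f x = g x)"
proof -
 let ?h = "%(acc :: bool list \<times> bool) y. case fst acc of [] => ([], False)
  | z # zs => (zs, snd acc \<and> (if y then z else \<not> z))"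
 have eq: "foldl ?h (v, b) u = (drop (length u) v, b \<and> length u \<le> length v \<and> u = take (length u) v)" for u v b
  by (induction u arbitrary: v b) (auto split: list.split)
 have "FP (%x. foldl ?h (bits (ec (g x)), True) (bits (ec (f x))))"
 proof (rule FP_foldl[where B = "%x. sz (bits (ec (g x))) + 4"])
  fix x and ys zs :: "bool list"
  have "sz (drop (length ys) (bits (ec (g x)))) \<le> sz (bits (ec (g x)))"
   using sz_append[of "take (length ys) (bits (ec (g x)))" "drop (length ys) (bits (ec (g x)))"]
    sz_pos[of "take (length ys) (bits (ec (g x)))"] by simp
  then show "sz (foldl ?h (bits (ec (g x)), True) ys) \<le> sz (bits (ec (g x))) + 4"
   unfolding eq sz_simps(1) by (intro order.trans[OF add_mono[OF add_mono[OF order.refl] sz_bool]]) auto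
 next
  show "FP (%p. case fst (fst (snd p)) of [] => ([], False)
   | z # zs => (zs, snd (fst (snd p)) \<and> (if snd (snd p) then z else \<not> z)))"
   by (intro FP_case_list FP_pair FP_conj FP_if FP_not FP_const FP_fst FP_snd FP_id)
  show "pbound (%x. sz (bits (ec (g x))) + 4)" by (intro pbound_intros FP_size FP_bits assms)
 qed (intro FP_bits FP_pair FP_const assms)+
 then have "FP (%x. snd (foldl ?h (bits (ec (g x)), True) (bits (ec (f x))))
   \<and> fst (foldl ?h (bits (ec (g x)), True) (bits (ec (f x)))) = [])"
  by (intro FP_conj FP_snd FP_fst FP_null)
 moreover have "(snd (foldl ?h (bits (ec (g x)), True) (bits (ec (f x))))
   \<and> fst (foldl ?h (bits (ec (g x)), True) (bits (ec (f x)))) = []) \<longleftrightarrow> f x = g x" for x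
 proof -
  have 1: "(True \<and> length u \<le> length v \<and> u = take (length u) v) \<and> drop (length u) v = [] \<longleftrightarrow> u = v"
   for u v :: "bool list"
   by (metis append_Nil2 append_take_drop_id order.refl take_all drop_all)
  have "bits (ec (f x)) = bits (ec (g x)) \<longleftrightarrow> f x = g x" by (auto dest: bits_inj ec_inj)
  then show ?thesis unfolding eq fst_conv snd_conv 1 .
 qed
 ultimately show ?thesis by simp
qed

lemma FP_mem: "FP f ==> FP l ==> FP (%x. f x \<in> set (l x))"
proof -
 assume f: "FP f" and l: "FP l"
 have "FP (%x. \<exists>y\<in>set (l x). f x = y)"
  by (intro FP_Bex FP_eq FP_comp[OF f] l FP_fst FP_snd FP_id)
 then show ?thesis by simp
qed

lemma FP_less: "FP f ==> FP g ==> FP (%x. f x < (g x :: nat))"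
 using FP_mem[OF _ FP_upt, of f g] by simp

lemma FP_odd: "FP f ==> FP (%x. odd (f x :: nat))"
proof -
 assume f: "FP f"
 have eq: "foldl (%b _. \<not> b) False ys = odd (length ys)" for ys :: "unit list"
  by (induction ys rule: rev_induct) auto
 have "FP (%x. foldl (%b (_::unit). \<not> b) False (replicate (f x) ()))"
  by (rule FP_foldl[where B = "%x. 3"]) (intro FP_unary FP_const f FP_not FP_fst FP_snd FP_id pbound_intros sz_bool)+
 then show ?thesis by (simp add: eq)
qed

lemma FP_div2: "FP f ==> FP (%x. f x div 2 :: nat)"
proof -
 assume f: "FP f"
 have "FP (%x. length (filter odd [0..<f x]))"
  by (intro FP_length FP_filter FP_odd FP_upt f FP_snd FP_id)
 moreover have "length (filter odd [0..<n]) = n div 2" for n :: nat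
  by (induction n) auto
 ultimately show ?thesis by simp
qed

lemma FP_pred: "FP f ==> FP (%x. f x - 1 :: nat)"
proof -
 assume f: "FP f"
 have "FP (%x. length (case replicate (f x) () of [] => [] | y # ys => ys))"
  by (intro FP_length FP_case_list FP_unary f FP_const FP_snd FP_id)
 moreover have "length (case replicate n () of [] => [] | y # ys => ys) = n - 1" for n
  by (cases n) auto
 ultimately show ?thesis by simp
qed

lemmas FP_intros = FP_const FP_id FP_fst FP_snd FP_pair FP_Cons FP_if FP_not FP_conj FP_disj FP_imp
 FP_case_list FP_map FP_concat FP_filter FP_append FP_rev FP_Bex FP_Ball FP_length FP_add FP_Suc FP_mult
 FP_upt FP_product FP_eq FP_mem FP_less FP_odd FP_div2 FP_pred FP_unary

section \<open>Relation symbols and formulas as data\<close>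

instantiation rsym :: enc
begin
primrec ec_rsym :: "rsym => dat" where
 "ec_rsym (Base i n) = Cn (ec (0::nat)) (ec (i, n))"
| "ec_rsym (Dist u) = Cn (ec (1::nat)) (ec u)"
instance
proof
 show "ec R = ec R' ==> R = R'" for R R' :: rsym
  by (cases R; cases R') (auto dest: ec_inj)
qed
end

instantiation fm :: enc
begin
primrec ec_fm :: "fm => dat" where
 "ec_fm (Atom R xs) = Cn (ec (0::nat)) (ec (R, xs))"
| "ec_fm (Eq x y) = Cn (ec (1::nat)) (ec (x, y))"
| "ec_fm (And a b) = Cn (ec (2::nat)) (Cn (ec_fm a) (ec_fm b))"
| "ec_fm (Or a b) = Cn (ec (3::nat)) (Cn (ec_fm a) (ec_fm b))"
| "ec_fm (Exists x a) = Cn (ec (4::nat)) (Cn (ec x) (ec_fm a))"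
| "ec_fm (Neg a) = Cn (ec (5::nat)) (ec_fm a)"
instance
proof
 show "ec \<phi> = ec \<psi> ==> \<phi> = \<psi>" for \<phi> \<psi> :: fm
 proof (induction \<phi> arbitrary: \<psi>)
  case (Atom R xs) then show ?case by (cases \<psi>) (auto simp: eval_nat_numeral dest: ec_inj)
 next
  case (Eq x y) then show ?case by (cases \<psi>) (auto simp: eval_nat_numeral dest: ec_inj)
 next
  case (And a b) then show ?case by (cases \<psi>) (auto simp: eval_nat_numeral dest: ec_inj)
 next
  case (Or a b) then show ?case by (cases \<psi>) (auto simp: eval_nat_numeral dest: ec_inj)
 next
  case (Exists x a) then show ?case by (cases \<psi>) (auto simp: eval_nat_numeral dest: ec_inj)
 next
  case (Neg a) then show ?case by (cases \<psi>) (auto simp: eval_nat_numeral dest: ec_inj)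
 qed
qed
end

lemma FP_Base: "FP f ==> FP g ==> FP (%x. Base (f x) (g x))"
 by (rule FP_coerce[OF FP_pair[OF FP_const[of "0::nat"] FP_pair]]) (simp_all add: ec_prod_def)

lemma FP_Dist: "FP f ==> FP (%x. Dist (f x))"
 by (rule FP_coerce[OF FP_pair[OF FP_const[of "1::nat"]]]) (simp_all add: ec_prod_def)

lemma FP_Atom: "FP f ==> FP g ==> FP (%x. Atom (f x) (g x))"
 by (rule FP_coerce[OF FP_pair[OF FP_const[of "0::nat"] FP_pair]]) (simp_all add: ec_prod_def)

lemma FP_Eq: "FP f ==> FP g ==> FP (%x. Eq (f x) (g x))"
 by (rule FP_coerce[OF FP_pair[OF FP_const[of "1::nat"] FP_pair]]) (simp_all add: ec_prod_def)

lemma FP_And: "FP f ==> FP g ==> FP (%x. And (f x) (g x))"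
 by (rule FP_coerce[OF FP_pair[OF FP_const[of "2::nat"] FP_pair]]) (simp_all add: ec_prod_def)

lemma FP_Or: "FP f ==> FP g ==> FP (%x. Or (f x) (g x))"
 by (rule FP_coerce[OF FP_pair[OF FP_const[of "3::nat"] FP_pair]]) (simp_all add: ec_prod_def)

lemma FP_Exists: "FP f ==> FP g ==> FP (%x. Exists (f x) (g x))"
 by (rule FP_coerce[OF FP_pair[OF FP_const[of "4::nat"] FP_pair]]) (simp_all add: ec_prod_def)

lemma FP_Neg: "FP f ==> FP (%x. Neg (f x))"
 by (rule FP_coerce[OF FP_pair[OF FP_const[of "5::nat"]]]) (simp_all add: ec_prod_def)

lemmas FP_fm_intros = FP_Base FP_Dist FP_Atom FP_Eq FP_And FP_Or FP_Exists FP_Neg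

lemma FP_case_rsym:
 fixes f :: "'a::enc => rsym" and h1 :: "'a => nat => nat => 'c::enc"
 assumes f: "FP f" and "FP (%p. h1 (fst p) (fst (snd p)) (snd (snd p)))" "FP (%p. h2 (fst p) (snd p))"
 shows "FP (%x. case f x of Base i n => h1 x i n | Dist u => h2 x u)"
proof -
 obtain c1 k1 where 1: "\<forall>y r n. sz y \<le> n --> runs c1 (main (bits (ec y) @ r)) ((n + 2) ^ k1)
   (main (bits (ec (h1 (fst y) (fst (snd y)) (snd (snd y)))) @ r))"
  by (rule FP_bounded_program[OF assms(2)])
 obtain c2 k2 where 2: "\<forall>y r n. sz y \<le> n --> runs c2 (main (bits (ec y) @ r)) ((n + 2) ^ k2)
   (main (bits (ec (h2 (fst y) (snd y))) @ r))"
  by (rule FP_bounded_program[OF assms(3)])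
 let ?n = "%x. sz x + sz (f x) + 1"
 show ?thesis
 proof (rule FP_branch[OF f, where cs = "[c1, c2]" and U = "%x. (?n x + 2) ^ k1 + (?n x + 2) ^ k2"])
  show "pbound (%x. (?n x + 2) ^ k1 + (?n x + 2) ^ k2)" by (intro pbound_intros FP_size f)
  fix x
  show "\<exists>i p. i < length [c1, c2] \<and> ec (f x) = Cn (ec i) p \<and>
   (\<forall>r. runs ([c1, c2] ! i) (main (bits (Cn (ec x) p) @ r)) ((?n x + 2) ^ k1 + (?n x + 2) ^ k2)
    (main (bits (ec (case f x of Base i n => h1 x i n | Dist u => h2 x u)) @ r)))"
  proof (cases "f x")
   case (Base i n)
   have "sz (x, (i, n)) \<le> ?n x" by (simp add: Base sz_def ec_prod_def)
   then have "runs c1 (main (bits (Cn (ec x) (ec (i, n))) @ r)) ((?n x + 2) ^ k1) (main (bits (ec (h1 x i n)) @ r))" for r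
    using 1[rule_format, of "(x, (i, n))" "?n x" r] by (simp only: ec_pair fst_conv snd_conv)
   then have "runs c1 (main (bits (Cn (ec x) (ec (i, n))) @ r)) ((?n x + 2) ^ k1 + (?n x + 2) ^ k2) (main (bits (ec (h1 x i n)) @ r))" for r
    by (rule runs_mono) linarith
   then show ?thesis by (intro exI[of _ 0] exI[of _ "ec (i, n)"]) (simp add: Base)
  next
   case (Dist u)
   have "sz (x, u) \<le> ?n x" by (simp add: Dist sz_def ec_prod_def)
   then have "runs c2 (main (bits (Cn (ec x) (ec u)) @ r)) ((?n x + 2) ^ k2) (main (bits (ec (h2 x u)) @ r))" for r
    using 2[rule_format, of "(x, u)" "?n x" r] by (simp only: ec_pair fst_conv snd_conv)
   then have "runs c2 (main (bits (Cn (ec x) (ec u)) @ r)) ((?n x + 2) ^ k1 + (?n x + 2) ^ k2) (main (bits (ec (h2 x u)) @ r))" for r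
    by (rule runs_mono) linarith
   then show ?thesis by (intro exI[of _ 1] exI[of _ "ec u"]) (simp add: Dist)
  qed
 qed
qed

lemma FP_case_fm:
 fixes f :: "'a::enc => fm" and h1 :: "'a => rsym => nat list => 'c::enc"
 assumes f: "FP f" and "FP (%p. h1 (fst p) (fst (snd p)) (snd (snd p)))"
  "FP (%p. h2 (fst p) (fst (snd p)) (snd (snd p)))" "FP (%p. h3 (fst p) (fst (snd p)) (snd (snd p)))"
  "FP (%p. h4 (fst p) (fst (snd p)) (snd (snd p)))" "FP (%p. h5 (fst p) (fst (snd p)) (snd (snd p)))"
  "FP (%p. h6 (fst p) (snd p))"
 shows "FP (%x. case f x of Atom R xs => h1 x R xs | Eq y z => h2 x y z | And a b => h3 x a b
  | Or a b => h4 x a b | Exists y a => h5 x y a | Neg a => h6 x a)"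
proof -
 let ?s = "%c k h. \<forall>y r n. sz y \<le> n --> runs c (main (bits (ec y) @ r)) ((n + 2) ^ k)
   (main (bits (ec (h (fst y) (fst (snd y)) (snd (snd y)) :: 'c)) @ r))"
 obtain c1 k1 where 1: "?s c1 k1 h1" by (rule FP_bounded_program[OF assms(2)])
 obtain c2 k2 where 2: "?s c2 k2 h2" by (rule FP_bounded_program[OF assms(3)])
 obtain c3 k3 where 3: "?s c3 k3 h3" by (rule FP_bounded_program[OF assms(4)])
 obtain c4 k4 where 4: "?s c4 k4 h4" by (rule FP_bounded_program[OF assms(5)])
 obtain c5 k5 where 5: "?s c5 k5 h5" by (rule FP_bounded_program[OF assms(6)])
 obtain c6 k6 where 6: "\<forall>y r n. sz y \<le> n --> runs c6 (main (bits (ec y) @ r)) ((n + 2) ^ k6)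
   (main (bits (ec (h6 (fst y) (snd y))) @ r))"
  by (rule FP_bounded_program[OF assms(7)])
 let ?n = "%x. sz x + sz (f x) + 1"
 let ?U = "%x. (?n x + 2) ^ k1 + (?n x + 2) ^ k2 + (?n x + 2) ^ k3 + (?n x + 2) ^ k4 + (?n x + 2) ^ k5 + (?n x + 2) ^ k6"
 let ?cs = "[c1, c2, c3, c4, c5, c6]"
 show ?thesis
 proof (rule FP_branch[OF f, where cs = ?cs and U = ?U])
  show "pbound ?U" by (intro pbound_intros FP_size f)
  fix x
  show "\<exists>i p. i < length ?cs \<and> ec (f x) = Cn (ec i) p \<and>
   (\<forall>r. runs (?cs ! i) (main (bits (Cn (ec x) p) @ r)) (?U x)
    (main (bits (ec (case f x of Atom R xs => h1 x R xs | Eq y z => h2 x y z | And a b => h3 x a b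
  | Or a b => h4 x a b | Exists y a => h5 x y a | Neg a => h6 x a)) @ r)))"
  proof (cases "f x")
   case (Atom R xs)
   have "sz (x, (R, xs)) \<le> ?n x" by (simp add: Atom sz_def ec_prod_def)
   then have "runs c1 (main (bits (Cn (ec x) (ec (R, xs))) @ r)) ((?n x + 2) ^ k1) (main (bits (ec (h1 x R xs)) @ r))" for r
    using 1[rule_format, of "(x, (R, xs))" "?n x" r] by (simp only: ec_pair fst_conv snd_conv)
   then have "runs c1 (main (bits (Cn (ec x) (ec (R, xs))) @ r)) (?U x) (main (bits (ec (h1 x R xs)) @ r))" for r
    by (rule runs_mono) linarith
   then show ?thesis by (intro exI[of _ 0] exI[of _ "ec (R, xs)"]) (simp add: Atom)
  next
   case (Eq y z)
   have "sz (x, (y, z)) \<le> ?n x" by (simp add: Eq sz_def ec_prod_def)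
   then have "runs c2 (main (bits (Cn (ec x) (ec (y, z))) @ r)) ((?n x + 2) ^ k2) (main (bits (ec (h2 x y z)) @ r))" for r
    using 2[rule_format, of "(x, (y, z))" "?n x" r] by (simp only: ec_pair fst_conv snd_conv)
   then have "runs c2 (main (bits (Cn (ec x) (ec (y, z))) @ r)) (?U x) (main (bits (ec (h2 x y z)) @ r))" for r
    by (rule runs_mono) linarith
   then show ?thesis by (intro exI[of _ 1] exI[of _ "ec (y, z)"]) (simp add: Eq)
  next
   case (And a b)
   have "sz (x, (a, b)) \<le> ?n x" by (simp add: And sz_def ec_prod_def)
   then have "runs c3 (main (bits (Cn (ec x) (ec (a, b))) @ r)) ((?n x + 2) ^ k3) (main (bits (ec (h3 x a b)) @ r))" for r
    using 3[rule_format, of "(x, (a, b))" "?n x" r] by (simp only: ec_pair fst_conv snd_conv)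
   then have "runs c3 (main (bits (Cn (ec x) (ec (a, b))) @ r)) (?U x) (main (bits (ec (h3 x a b)) @ r))" for r
    by (rule runs_mono) linarith
   then show ?thesis by (intro exI[of _ 2] exI[of _ "ec (a, b)"]) (simp add: And ec_pair)
  next
   case (Or a b)
   have "sz (x, (a, b)) \<le> ?n x" by (simp add: Or sz_def ec_prod_def)
   then have "runs c4 (main (bits (Cn (ec x) (ec (a, b))) @ r)) ((?n x + 2) ^ k4) (main (bits (ec (h4 x a b)) @ r))" for r
    using 4[rule_format, of "(x, (a, b))" "?n x" r] by (simp only: ec_pair fst_conv snd_conv)
   then have "runs c4 (main (bits (Cn (ec x) (ec (a, b))) @ r)) (?U x) (main (bits (ec (h4 x a b)) @ r))" for r
    by (rule runs_mono) linarith
   then show ?thesis by (intro exI[of _ 3] exI[of _ "ec (a, b)"]) (simp add: Or ec_pair)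
  next
   case (Exists y a)
   have "sz (x, (y, a)) \<le> ?n x" by (simp add: Exists sz_def ec_prod_def)
   then have "runs c5 (main (bits (Cn (ec x) (ec (y, a))) @ r)) ((?n x + 2) ^ k5) (main (bits (ec (h5 x y a)) @ r))" for r
    using 5[rule_format, of "(x, (y, a))" "?n x" r] by (simp only: ec_pair fst_conv snd_conv)
   then have "runs c5 (main (bits (Cn (ec x) (ec (y, a))) @ r)) (?U x) (main (bits (ec (h5 x y a)) @ r))" for r
    by (rule runs_mono) linarith
   then show ?thesis by (intro exI[of _ 4] exI[of _ "ec (y, a)"]) (simp add: Exists ec_pair)
  next
   case (Neg a)
   have "sz (x, a) \<le> ?n x" by (simp add: Neg sz_def ec_prod_def)
   then have "runs c6 (main (bits (Cn (ec x) (ec a)) @ r)) ((?n x + 2) ^ k6) (main (bits (ec (h6 x a)) @ r))" for r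
    using 6[rule_format, of "(x, a)" "?n x" r] by (simp only: ec_pair fst_conv snd_conv)
   then have "runs c6 (main (bits (Cn (ec x) (ec a)) @ r)) (?U x) (main (bits (ec (h6 x a)) @ r))" for r
    by (rule runs_mono) linarith
   then show ?thesis by (intro exI[of _ 5] exI[of _ "ec a"]) (simp add: Neg)
  qed
 qed
qed

section \<open>Finite covers of labelled graphs\<close>

definition tog :: "'e => 'e set => 'e set" where
 "tog e x = (if e \<in> x then x - {e} else insert e x)"

lemma mem_tog [simp]: "f \<in> tog e x \<longleftrightarrow> (f = e) \<noteq> (f \<in> x)"
 by (auto simp: tog_def)

lemma odd_card_tog:
 assumes "finite x"
 shows "odd (card (tog e x \<inter> D)) \<longleftrightarrow> odd (card (x \<inter> D)) \<noteq> (e \<in> D)"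
proof (cases "e \<in> D")
 case False
 then have "tog e x \<inter> D = x \<inter> D" by auto
 then show ?thesis using False by simp
next
 case True
 show ?thesis
 proof (cases "e \<in> x")
  case ex: True
  have "tog e x \<inter> D = x \<inter> D - {e}" using ex by auto
  moreover have "0 < card (x \<inter> D)" using ex True assms by (auto simp: card_gt_0_iff)
  ultimately show ?thesis using ex True by (simp add: card_Diff_singleton)
 next
  case ex: False
  have "tog e x \<inter> D = insert e (x \<inter> D)" using ex True by auto
  then show ?thesis using ex True assms by simp
 qed
qed

text \<open>
 A graph whose edge \<open>e\<close> may be traversed under the label \<open>k\<close> from \<open>src e\<close> to \<open>dst e\<close> if \<open>fw e k\<close>,
 and backwards if \<open>bw e k\<close>. A point of the cover is a vertex with a set of edges, and traversing
 \<open>e\<close> toggles \<open>e\<close> in the set. The potential shows that an edge traversable under \<open>k\<close> in one direction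
 only occurs at most once on a path labelled \<open>k\<close>.
\<close>

locale cover =
 fixes E :: "'e set" and src dst :: "'e => 'v" and fw bw :: "'e => 'k => bool" and pot :: "'k => 'v => int"
 assumes fw_pot: "e \<in> E ==> fw e k ==> pot k (dst e) \<le> pot k (src e)"
  and bw_pot: "e \<in> E ==> bw e k ==> pot k (src e) \<le> pot k (dst e)"
  and fw_strict: "e \<in> E ==> fw e k ==> \<not> bw e k ==> pot k (dst e) < pot k (src e)"
  and bw_strict: "e \<in> E ==> bw e k ==> \<not> fw e k ==> pot k (src e) < pot k (dst e)"
begin

definition arc :: "'k set => 'e => 'v => 'v => bool" where
 "arc Ks e v v' \<longleftrightarrow> (v = src e \<and> v' = dst e \<and> (\<forall>k\<in>Ks. fw e k)) \<or> (v = dst e \<and> v' = src e \<and> (\<forall>k\<in>Ks. bw e k))"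

definition hop :: "'k => (('v \<times> 'e set) \<times> ('v \<times> 'e set)) set" where
 "hop k = {((v, x), (v', x')). \<exists>e\<in>E. x' = tog e x \<and> arc {k} e v v'}"

lemma hop_pot: "((v, x), (v', x')) \<in> hop k ==> pot k v' \<le> pot k v"
 unfolding hop_def arc_def using fw_pot bw_pot by auto

lemma hops_pot: "((v, x), (v', x')) \<in> (hop k)\<^sup>* ==> pot k v' \<le> pot k v"
proof (induction "(v', x')" arbitrary: v' x' rule: rtrancl_induct)
 case (step b)
 then show ?case using hop_pot by (cases b) fastforce
qed simp

text \<open>An edge whose membership differs at the two ends was toggled an odd number of times,
  hence traversed at least once.\<close>

lemma hops_use:
 assumes "((v, x), (v', x')) \<in> (hop k)\<^sup>*" "(e \<in> x) \<noteq> (e \<in> x')"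
 shows "\<exists>u u' y y'. ((v, x), (u, y)) \<in> (hop k)\<^sup>* \<and> arc {k} e u u' \<and> e \<in> E \<and> ((u', y'), (v', x')) \<in> (hop k)\<^sup>*"
 using assms
proof (induction "(v', x')" arbitrary: v' x' rule: rtrancl_induct)
 case base then show ?case by simp
next
 case (step b)
 obtain u y where b: "b = (u, y)" by (cases b)
 obtain f where f: "f \<in> E" "x' = tog f y" "arc {k} f u v'" using step.hyps(2) unfolding b hop_def by auto
 show ?case
 proof (cases "f = e")
  case True
  then show ?thesis using step.hyps(1) f b by (intro exI[of _ u] exI[of _ v'] exI[of _ y] exI[of _ x']) simp
 next
  case False
  then have "(e \<in> x) \<noteq> (e \<in> y)" using step.prems f(2) by simp
  then obtain u1 u1' y1 y1' where "((v, x), (u1, y1)) \<in> (hop k)\<^sup>*" "arc {k} e u1 u1'" "e \<in> E"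
   "((u1', y1'), (u, y)) \<in> (hop k)\<^sup>*"
   using step.hyps(3)[OF b] by blast
  moreover have "((u1', y1'), (v', x')) \<in> (hop k)\<^sup>*"
   using calculation(4) step.hyps(2) unfolding b by (rule rtrancl_into_rtrancl)
  ultimately show ?thesis by blast
 qed
qed

text \<open>One of the two edges is used after the other. As potentials never increase on the way,
  the start of the later one is not above the end of the earlier one.\<close>

lemma hops_use_two:
 assumes "((v, x), (v', x')) \<in> (hop k)\<^sup>*" "(e \<in> x) \<noteq> (e \<in> x')" "(f \<in> x) \<noteq> (f \<in> x')" "e \<noteq> f"
 shows "\<exists>u u' w w'. arc {k} e u u' \<and> arc {k} f w w' \<and> (pot k w \<le> pot k u' \<or> pot k u \<le> pot k w')"
 using assms(1-3)
proof (induction "(v', x')" arbitrary: v' x' rule: rtrancl_induct)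
 case base then show ?case by simp
next
 case (step b)
 obtain u y where b: "b = (u, y)" by (cases b)
 obtain g where g: "g \<in> E" "x' = tog g y" "arc {k} g u v'" using step.hyps(2) unfolding b hop_def by auto
 consider "g = e" | "g = f" | "g \<noteq> e" "g \<noteq> f" by blast
 then show ?case
 proof cases
  case 1
  then have "(f \<in> x) \<noteq> (f \<in> y)" using step.prems g(2) assms(4) by simp
  from hops_use[OF step.hyps(1)[unfolded b] this] obtain w w' z' where
   "arc {k} f w w'" "((w', z'), (u, y)) \<in> (hop k)\<^sup>*" by blast
  then show ?thesis using g(3) 1 hops_pot by blast
 next
  case 2
  then have "(e \<in> x) \<noteq> (e \<in> y)" using step.prems g(2) assms(4) by simp
  from hops_use[OF step.hyps(1)[unfolded b] this] obtain w w' z' where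
   "arc {k} e w w'" "((w', z'), (u, y)) \<in> (hop k)\<^sup>*" by blast
  then show ?thesis using g(3) 2 hops_pot by blast
 next
  case 3
  then show ?thesis using step.prems g(2) step.hyps(3)[OF b] by simp
 qed
qed

text \<open>A step that changes sides toggles exactly one edge of the cut D and any other step none,
  so the parity of the toggled cut edges tells whether the ends lie on different sides.\<close>

lemma hops_parity:
 assumes "((v, x), (v', x')) \<in> (hop k)\<^sup>*" "finite x"
  and D: "D = {e \<in> E. (src e \<in> C) \<noteq> (dst e \<in> C)}"
 shows "finite x' \<and> ((v \<in> C) \<noteq> (v' \<in> C) \<longleftrightarrow> odd (card (x \<inter> D)) \<noteq> odd (card (x' \<inter> D)))"
 using assms(1)
proof (induction "(v', x')" arbitrary: v' x' rule: rtrancl_induct)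
 case base then show ?case using assms(2) by simp
next
 case (step b)
 obtain u y where b: "b = (u, y)" by (cases b)
 obtain g where g: "g \<in> E" "x' = tog g y" "arc {k} g u v'" using step.hyps(2) unfolding b hop_def by auto
 have y: "finite y" "((v \<in> C) \<noteq> (u \<in> C)) = (odd (card (x \<inter> D)) \<noteq> odd (card (y \<inter> D)))"
  using step.hyps(3)[OF b] by auto
 have "(u \<in> C) \<noteq> (v' \<in> C) \<longleftrightarrow> g \<in> D" using g(1,3) unfolding D arc_def by auto
 moreover have "odd (card (x' \<inter> D)) \<longleftrightarrow> odd (card (y \<inter> D)) \<noteq> (g \<in> D)"
  unfolding g(2) by (rule odd_card_tog[OF y(1)])
 moreover have "finite x'" unfolding g(2) tog_def using y(1) by simp
 ultimately show ?case using y(2) by blast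
qed

text \<open>
 Cut argument: the set \<open>C\<close> of vertices reachable by a path that works for all labels at once is left
 by some edge \<open>e\<close> that is toggled between the two points, hence used on the path of every label.
\<close>

lemma common_path:
 assumes Ks: "Ks \<noteq> {}" and hops: "\<And>k. k \<in> Ks ==> ((v, x), (v', x')) \<in> (hop k)\<^sup>*" and "finite x"
 shows "(v, v') \<in> {(u, u'). \<exists>e\<in>E. arc Ks e u u'}\<^sup>*"
proof -
 define R where "R = {(u, u'). \<exists>e\<in>E. (e \<in> x) \<noteq> (e \<in> x') \<and> arc Ks e u u'}"
 define C where "C = {u. (v, u) \<in> R\<^sup>*}"
 have "v' \<in> C"
 proof (rule ccontr)
  assume v': "v' \<notin> C"
  define D where "D = {e \<in> E. (src e \<in> C) \<noteq> (dst e \<in> C)}"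
  obtain k0 where "k0 \<in> Ks" using Ks by blast
  have "v \<in> C" by (simp add: C_def)
  then have "x \<inter> D \<noteq> x' \<inter> D"
   using hops_parity[OF hops[OF \<open>k0 \<in> Ks\<close>] \<open>finite x\<close> D_def] v' by metis
  then obtain e where e: "e \<in> E" "(src e \<in> C) \<noteq> (dst e \<in> C)" "(e \<in> x) \<noteq> (e \<in> x')"
   unfolding D_def by blast
  obtain i j where ij: "i \<in> C" "j \<notin> C" "(i = src e \<and> j = dst e) \<or> (i = dst e \<and> j = src e)"
   using e(2) by blast
  have "\<not> arc Ks e i j"
  proof
   assume "arc Ks e i j"
   then have "(i, j) \<in> R" using e unfolding R_def by blast
   with ij(1,2) show False unfolding C_def by (auto intro: rtrancl_into_rtrancl)
  qed
  moreover have sd: "src e \<noteq> dst e" using e(2) by auto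
  \<comment> \<open>A label k for which e cannot be traversed out of C. The path of k still uses e,
    hence from j to i, and the edge being one-way for k, the potential drops strictly there.\<close>
  ultimately obtain k where k: "k \<in> Ks" "\<not> arc {k} e i j" unfolding arc_def using ij(3) by auto
  have hk: "((v, x), (v', x')) \<in> (hop k)\<^sup>*" by (rule hops[OF k(1)])
  have e_dir: "u = j \<and> u' = i" if "arc {k} e u u'" for u u'
   using that k(2) ij unfolding arc_def by auto
  obtain p p' y y' where use: "((v, x), (p, y)) \<in> (hop k)\<^sup>*" "arc {k} e p p'" "((p', y'), (v', x')) \<in> (hop k)\<^sup>*"
   using hops_use[OF hk e(3)] by blast
  have "p = j" "p' = i" using e_dir[OF use(2)] by auto
  have ji: "pot k i < pot k j"
   using use(2) k(2) ij(3) fw_strict[OF e(1), of k] bw_strict[OF e(1), of k] e(2)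
   unfolding \<open>p = j\<close> \<open>p' = i\<close> arc_def by auto
  have vj: "pot k j \<le> pot k v" using hops_pot[OF use(1)] \<open>p = j\<close> by simp
  \<comment> \<open>A step of R falling below the potential of j would be one-way for k and, being
    toggled, would also occur on the path of k, as e does. Whichever of the two comes first there,
    the potential would have to rise in between.\<close>
  have cross: "pot k j \<le> pot k w" if "(v, w) \<in> R\<^sup>*" for w
   using that
  proof (induction rule: rtrancl_induct)
   case base show ?case by (rule vj)
  next
   case (step a b)
   obtain f where f: "f \<in> E" "(f \<in> x) \<noteq> (f \<in> x')" "arc Ks f a b" using step.hyps(2) unfolding R_def by blast
   have fk: "arc {k} f a b" using f(3) k(1) unfolding arc_def by auto
   show ?case
   proof (rule ccontr)
    assume nb: "\<not> pot k j \<le> pot k b"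
    have fdir: "w = a \<and> w' = b" if "arc {k} f w w'" for w w'
     using that fk nb step.IH fw_pot[OF f(1), of k] bw_pot[OF f(1), of k] unfolding arc_def by auto
    show False
    proof (cases "f = e")
     case True
     then have "a = j" using e_dir fk by blast
     moreover have "a \<in> C" using step.hyps(1) by (simp add: C_def)
     ultimately show False using ij(2) by simp
    next
     case False
     obtain u u' w w' where "arc {k} e u u'" "arc {k} f w w'" "pot k w \<le> pot k u' \<or> pot k u \<le> pot k w'"
      using hops_use_two[OF hk e(3) f(2)] False by blast
     then have "pot k a \<le> pot k i \<or> pot k j \<le> pot k b" using e_dir fdir by blast
     then show False using nb step.IH ji by linarith
    qed
   qed
  qed
  have "(v, i) \<in> R\<^sup>*" using ij(1) by (simp add: C_def)
  from cross[OF this] ji show False by simp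
 qed
 then have "(v, v') \<in> R\<^sup>*" by (simp add: C_def)
 moreover have "R \<subseteq> {(u, u'). \<exists>e\<in>E. arc Ks e u u'}" unfolding R_def by blast
 ultimately show ?thesis by (meson rtrancl_mono subsetD)
qed

text \<open>A one-way first step would lower the potential for good, so the way back forces an edge
  that is two-way for k.\<close>

lemma hops_return:
 assumes "((v, x), (v', x')) \<in> hop k" "((v', x'), (v, y)) \<in> (hop k)\<^sup>*"
 shows "\<exists>e\<in>E. arc {k} e v v' \<and> arc {k} e v' v"
proof -
 obtain e where e: "e \<in> E" "arc {k} e v v'" using assms(1) unfolding hop_def by auto
 have "\<not> pot k v' < pot k v" using hops_pot[OF assms(2)] by simp
 then have "arc {k} e v' v"
  using e fw_strict[OF e(1), of k] bw_strict[OF e(1), of k] unfolding arc_def by auto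
 with e show ?thesis by blast
qed

text \<open>The edge e itself lies on the path. If it could be used only in the opposite direction,
  the potential would be strictly larger at v' than at v, whereas the path shows that it is
  not.\<close>

lemma hops_single:
 assumes "((v, x), (v', tog e x)) \<in> (hop k)\<^sup>*" "(v = src e \<and> v' = dst e) \<or> (v = dst e \<and> v' = src e)" "src e \<noteq> dst e"
 shows "arc {k} e v v'"
proof -
 obtain u u' y y' where use: "((v, x), (u, y)) \<in> (hop k)\<^sup>*" "arc {k} e u u'" "e \<in> E"
  "((u', y'), (v', tog e x)) \<in> (hop k)\<^sup>*"
  using hops_use[OF assms(1), of e] by auto
 have "pot k v' \<le> pot k v" by (rule hops_pot[OF assms(1)])
 then show ?thesis
  using use(2) assms(2,3) fw_strict[OF use(3), of k] bw_strict[OF use(3), of k] unfolding arc_def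
  by (cases "fw e k"; cases "bw e k") auto
qed

end

section \<open>Bounding ranks\<close>

fun lexle :: "nat list => nat list => bool" where
 "lexle (x # xs) (y # ys) \<longleftrightarrow> x < y \<or> (x = y \<and> lexle xs ys)"
| "lexle _ _ \<longleftrightarrow> True"

lemma lexle_trans: "length xs = length ys ==> length ys = length zs ==> lexle xs ys ==> lexle ys zs ==> lexle xs zs"
proof (induction xs arbitrary: ys zs)
 case (Cons x xs)
 obtain y ys' z zs' where "ys = y # ys'" "zs = z # zs'"
  using Cons.prems by (metis length_Suc_conv list.size(4) Suc_eq_plus1)
 with Cons.prems Cons.IH[of ys' zs'] show ?case by auto
qed simp

lemma lexle_total: "lexle xs ys \<or> lexle ys xs"
 by (induction xs ys rule: lexle.induct) auto

lemma lexle_append: "length xs = length ys ==> lexle (xs @ us) (ys @ vs) ==> lexle xs ys"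
 by (induction xs ys rule: list_induct2) auto

lemma lexle_pointwise: "(\<And>k. k \<in> set ks ==> f k \<le> g k) ==> lexle (map f ks) (map g ks)"
 by (induction ks) (auto simp: le_less)

lemma lexle_strict:
 "(\<And>k. k \<in> set ks ==> f k \<le> g k) ==> lexle (map g ks) (map f ks) ==> k \<in> set ks ==> f k = g k"
 by (induction ks) fastforce+

lemma lexle_least:
 assumes "finite A" "A \<noteq> {}" "\<And>a. a \<in> A ==> length (f a) = n"
 shows "\<exists>a\<in>A. \<forall>b\<in>A. lexle (f a) (f b)"
 using assms
proof (induction rule: finite_ne_induct)
 case (singleton a)
 have "lexle (f a) (f a)" using lexle_total by blast
 then show ?case by simp
next
 case (insert a A)
 then obtain b where b: "b \<in> A" "\<forall>c\<in>A. lexle (f b) (f c)" by auto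
 show ?case
 proof (cases "lexle (f a) (f b)")
  case True
  have "lexle (f a) (f a)" using lexle_total by blast
  moreover have "lexle (f a) (f c)" if "c \<in> A" for c
   by (rule lexle_trans[OF _ _ True]) (use b that insert.prems in auto)
  ultimately show ?thesis by blast
 next
  case False
  then have "lexle (f b) (f a)" using lexle_total by blast
  then show ?thesis using b by auto
 qed
qed

definition bef :: "'k list => 'k => 'k => bool" where
 "bef t z y \<longleftrightarrow> (\<exists>us vs. t = us @ vs \<and> z \<in> set us \<and> y \<in> set vs)"

lemma bef_split:
 assumes "distinct t" "\<And>z y. z \<in> Z ==> y \<in> set t ==> y \<notin> Z ==> z \<in> set t ==> bef t z y"
 shows "t = filter (%k. k \<in> Z) t @ filter (%k. k \<notin> Z) t"
 using assms
proof (induction t)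
 case (Cons x t)
 have sub: "bef t z y" if "z \<in> Z" "y \<in> set t" "y \<notin> Z" "z \<in> set t" for z y
 proof -
  have "bef (x # t) z y" using Cons.prems(2)[of z y] that by simp
  then obtain us vs where uv: "x # t = us @ vs" "z \<in> set us" "y \<in> set vs"
   unfolding bef_def by blast
  have "z \<noteq> x" using Cons.prems(1) that(4) by auto
  with uv show ?thesis unfolding bef_def by (cases us) auto
 qed
 show ?case
 proof (cases "x \<in> Z")
  case True
  then show ?thesis using Cons.IH sub Cons.prems(1) by simp
 next
  case False
  have "z \<notin> Z" if "z \<in> set t" for z
  proof
   assume "z \<in> Z"
   then have "bef (x # t) z x" using Cons.prems(2)[of z x] that False by simp
   then obtain us vs where uv: "x # t = us @ vs" "z \<in> set us" "x \<in> set vs"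
    unfolding bef_def by blast
   then show False using Cons.prems(1) by (cases us) auto
  qed
  then have "filter (%k. k \<in> Z) t = []" "filter (%k. k \<notin> Z) t = t" by (auto simp: filter_empty_conv filter_id_conv)
  then show ?thesis using False by simp
 qed
qed simp

definition renew :: "'k set => 'k list => 'k list" where
 "renew L t = filter (%k. k \<in> L) t @ filter (%k. k \<notin> L) t"

lemma bef_renew:
 assumes "z \<in> set t" "y \<in> set t" "z \<in> L" "y \<notin> L \<or> bef t z y"
 shows "bef (renew L t) z y"
proof (cases "y \<in> L")
 case False
 then show ?thesis unfolding bef_def renew_def
  using assms by (intro exI[of _ "filter (%k. k \<in> L) t"] exI[of _ "filter (%k. k \<notin> L) t"]) auto
next
 case True
 then obtain us vs where uv: "t = us @ vs" "z \<in> set us" "y \<in> set vs" using assms(4) unfolding bef_def by blast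
 then show ?thesis unfolding bef_def renew_def using assms(3) True
  by (intro exI[of _ "filter (%k. k \<in> L) us"] exI[of _ "filter (%k. k \<in> L) vs @ filter (%k. k \<notin> L) t"]) auto
qed

lemma perm_renew: "distinct t ==> distinct (renew L t)" "set (renew L t) = set t" "length (renew L t) = length t"
proof -
 show "length (renew L t) = length t" unfolding renew_def by (induction t) auto
qed (auto simp: renew_def)

inductive walk :: "('s \<times> 'l \<times> 's) set => 's => 'l list => 's => bool" for T where
 walk_Nil: "walk T s [] s"
| walk_snoc: "walk T s Ls u ==> (u, L, u') \<in> T ==> walk T s (Ls @ [L]) u'"

lemma walk_rtrancl:
 "(s, u) \<in> {(s, u). \<exists>L. (s, L, u) \<in> T \<and> k \<in> L}\<^sup>* ==> \<exists>Ls. walk T s Ls u \<and> (\<forall>L\<in>set Ls. k \<in> L)"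
proof (induction rule: rtrancl_induct)
 case base show ?case using walk_Nil by fastforce
next
 case (step u u')
 then obtain Ls L where "walk T s Ls u" "\<forall>L\<in>set Ls. k \<in> L" "(u, L, u') \<in> T" "k \<in> L" by blast
 then show ?case by (intro exI[of _ "Ls @ [L]"]) (auto intro: walk_snoc)
qed

text \<open>
 Positions of a play are reduced to profiles together with a latest appearance record \<open>t\<close>, a list of the
 keys in which those missing from the last edge label are moved to the end. A profile with record
 \<open>t\<close> is represented by a position whose ranks, read in the order \<open>t\<close>, are lexicographically least.
 On a cycle the keys present in all labels form a common prefix of the records, on
 which the ranks cannot increase; so no rank of such a key decreases along the cycle.
\<close>

lemma record_ranks:
 fixes A :: "'a set" and pr :: "'a => 'p" and rk :: "'a => 'k => nat" and flip :: "'k => 'k"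
 assumes "finite A" "distinct ks"
  and W: "\<And>a i. a \<in> A ==> req (pr a) i ==> \<exists>a'\<in>A. \<exists>L. ok (pr a) i L (pr a')
   \<and> (\<forall>k\<in>set ks. k \<in> L --> rk a' k \<le> rk a k \<and> (flip k \<notin> L --> rk a' k < rk a k))"
 obtains S :: "('p \<times> 'k list) set" and \<rho> :: "'p \<times> 'k list => 'k => nat" where
  "S = pr ` A \<times> {t. distinct t \<and> set t = set ks}"
  "\<forall>s\<in>S. \<forall>k. \<rho> s k \<le> card (pr ` A) * length ks ^ length ks"
  "\<forall>p t i. (p, t) \<in> S --> req p i --> (\<exists>p' t' L. (p', t') \<in> S \<and> ok p i L p'
   \<and> (\<forall>k\<in>set ks. k \<in> L --> \<rho> (p', t') k \<le> \<rho> (p, t) k \<and> (flip k \<notin> L --> \<rho> (p', t') k < \<rho> (p, t) k)))"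
proof -
 define S where "S = pr ` A \<times> {t. distinct t \<and> set t = set ks}"
 have perms: "{t. distinct t \<and> set t = set ks} \<subseteq> {t. set t \<subseteq> set ks \<and> length t = length ks}"
  using assms(2) by (auto simp: distinct_card[symmetric])
 have fin_S: "finite S" unfolding S_def
  by (intro finite_cartesian_product finite_imageI assms(1) finite_subset[OF perms] finite_lists_length_eq) simp
 have card_S: "card S \<le> card (pr ` A) * length ks ^ length ks"
  unfolding S_def card_cartesian_product using card_mono[OF finite_lists_length_eq perms]
  by (simp add: card_lists_length_eq distinct_card[OF assms(2)])
 define best where "best s a \<longleftrightarrow> a \<in> A \<and> pr a = fst s \<and>
  (\<forall>b\<in>A. pr b = fst s --> lexle (map (rk a) (snd s)) (map (rk b) (snd s)))" for s a
 have ex_best: "\<exists>a. best s a" if "s \<in> S" for s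
 proof -
  have "\<exists>a\<in>{a \<in> A. pr a = fst s}. \<forall>b\<in>{a \<in> A. pr a = fst s}. lexle (map (rk a) (snd s)) (map (rk b) (snd s))"
   by (rule lexle_least[of _ _ "length (snd s)"]) (use that assms(1) in \<open>auto simp: S_def\<close>)
  then show ?thesis unfolding best_def by blast
 qed
 define rep where "rep s = (SOME a. best s a)" for s
 have rep: "best s (rep s)" if "s \<in> S" for s unfolding rep_def using ex_best[OF that] by (rule someI_ex)
 define good where "good s i a L \<longleftrightarrow> a \<in> A \<and> ok (fst s) i L (pr a) \<and>
  (\<forall>k\<in>set ks. k \<in> L --> rk a k \<le> rk (rep s) k \<and> (flip k \<notin> L --> rk a k < rk (rep s) k))" for s i a L
 have ex_good: "\<exists>a L. good s i a L" if "s \<in> S" "req (fst s) i" for s i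
  using W[of "rep s" i] rep[OF that(1)] that(2) unfolding best_def good_def by metis
 define T where "T = {(s, L, s'). s \<in> S \<and> (\<exists>i a. req (fst s) i \<and> good s i a L \<and> s' = (pr a, renew L (snd s)))}"
 have T_S: "s' \<in> S" if "(s, L, s') \<in> T" for s L s'
  using that unfolding T_def S_def good_def by (auto simp: perm_renew)
 have T_S0: "s \<in> S" if "(s, L, s') \<in> T" for s L s'
  using that unfolding T_def by simp
 have S_perm: "distinct (snd s) \<and> set (snd s) = set ks" if "s \<in> S" for s
  using that by (cases s) (simp add: S_def)
 \<comment> \<open>A key that some label misses falls behind every key that no label misses, and it
   stays behind.\<close>
 have acq: "s \<in> S ==> z \<in> set ks ==> y \<in> set ks ==> \<forall>L\<in>set Ls. z \<in> L ==> (\<exists>L\<in>set Ls. y \<notin> L) \<or> bef (snd s) z y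
   ==> bef (snd u) z y" if "walk T s Ls u" for s Ls u z y
  using that
 proof (induction rule: walk.induct)
  case (walk_Nil s) then show ?case by simp
 next
  case (walk_snoc s Ls u L u')
  have u: "u \<in> S" "u' \<in> S" by (rule T_S0[OF walk_snoc.hyps(2)], rule T_S[OF walk_snoc.hyps(2)])
  have "snd u' = renew L (snd u)" using walk_snoc.hyps(2) unfolding T_def by auto
  moreover have "bef (renew L (snd u)) z y"
  proof (rule bef_renew)
   show "y \<notin> L \<or> bef (snd u) z y"
   proof (cases "y \<in> L")
    case True
    have "bef (snd u) z y" by (rule walk_snoc.IH) (use walk_snoc.prems True in simp_all)
    then show ?thesis ..
   qed simp
  qed (use walk_snoc.prems S_perm[OF u(1)] in simp_all)
  ultimately show ?case using u by simp
 qed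
 \<comment> \<open>While the keys of a prefix lie in all labels, it remains a prefix of the record.
   Each new representative is lexicographically least for a record beginning with it, so the ranks
   on the prefix cannot go up in this order.\<close>
 have chain: "s \<in> S ==> snd s = zs @ r0 ==> \<forall>L\<in>set Ls. set zs \<subseteq> L ==>
   (\<exists>r. snd u = zs @ r) \<and> lexle (map (rk (rep u)) zs) (map (rk (rep s)) zs)" if "walk T s Ls u" for s Ls u zs r0
  using that
 proof (induction rule: walk.induct)
  case (walk_Nil s)
  have "lexle (map (rk (rep s)) zs) (map (rk (rep s)) zs)" using lexle_total by blast
  with walk_Nil show ?case by blast
 next
  case (walk_snoc s Ls u L u')
  have "(\<exists>r. snd u = zs @ r) \<and> lexle (map (rk (rep u)) zs) (map (rk (rep s)) zs)"
   by (rule walk_snoc.IH) (use walk_snoc.prems in simp_all)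
  then obtain r where r: "snd u = zs @ r" and le: "lexle (map (rk (rep u)) zs) (map (rk (rep s)) zs)" by blast
  have u: "u \<in> S" "u' \<in> S" by (rule T_S0[OF walk_snoc.hyps(2)], rule T_S[OF walk_snoc.hyps(2)])
  obtain i a where a: "good u i a L" "u' = (pr a, renew L (snd u))" using walk_snoc.hyps(2) unfolding T_def by auto
  have zL: "set zs \<subseteq> L" using walk_snoc.prems by simp
  have "filter (%k. k \<in> L) zs = zs" using zL by (auto simp: filter_id_conv)
  then have u': "snd u' = zs @ (filter (%k. k \<in> L) r @ filter (%k. k \<notin> L) (snd u))"
   unfolding a(2) renew_def r by simp
  have "lexle (map (rk (rep u')) (snd u')) (map (rk a) (snd u'))"
   using rep[OF u(2)] a unfolding best_def good_def by simp
  then have 1: "lexle (map (rk (rep u')) zs) (map (rk a) zs)"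
   unfolding u' map_append by (rule lexle_append[rotated]) simp
  have "rk a k \<le> rk (rep u) k" if "k \<in> set zs" for k
   using a(1) zL that S_perm[OF u(1)] r unfolding good_def by auto
  then have 2: "lexle (map (rk a) zs) (map (rk (rep u)) zs)" by (rule lexle_pointwise)
  have "lexle (map (rk (rep u')) zs) (map (rk (rep s)) zs)"
   by (rule lexle_trans[OF _ _ 1 lexle_trans[OF _ _ 2 le]]) simp_all
  with u' show ?case by blast
 qed
 define Ek where "Ek k = {(s, u). \<exists>L. (s, L, u) \<in> T \<and> k \<in> L}" for k
 have no_cycle: False if T: "(s, L, s') \<in> T" "k \<in> set ks" "k \<in> L" "flip k \<notin> L" and cyc: "(s', s) \<in> (Ek k)\<^sup>*" for s L s' k
 proof -
  obtain Ls where Ls: "walk T s' Ls s" "\<forall>L\<in>set Ls. k \<in> L"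
   using walk_rtrancl[of s' s T k] cyc unfolding Ek_def by blast
  have s: "s \<in> S" "s' \<in> S" by (rule T_S0[OF T(1)], rule T_S[OF T(1)])
  obtain i a where a: "good s i a L" "s' = (pr a, renew L (snd s))" using T(1) unfolding T_def by auto
  \<comment> \<open>The keys present on the whole cycle, among them k. By \<open>acq\<close> all
    other keys lie behind them in the record of s, so Z fills a prefix.\<close>
  define Z where "Z = {z \<in> set ks. z \<in> L \<and> (\<forall>L\<in>set Ls. z \<in> L)}"
  have "bef (snd s) z y" if "z \<in> Z" "y \<in> set (snd s)" "y \<notin> Z" "z \<in> set (snd s)" for z y
  proof -
   have "(\<exists>L\<in>set Ls. y \<notin> L) \<or> bef (snd s') z y"
   proof (cases "y \<in> L")
    case True then show ?thesis using that S_perm[OF s(1)] by (auto simp: Z_def)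
   next
    case False
    then have "bef (snd s') z y" unfolding a(2) snd_conv using that by (intro bef_renew) (auto simp: Z_def)
    then show ?thesis ..
   qed
   then show ?thesis using acq[OF Ls(1) s(2), of z y] that S_perm[OF s(1)] by (auto simp: Z_def)
  qed
  then have split: "snd s = filter (%k. k \<in> Z) (snd s) @ filter (%k. k \<notin> Z) (snd s)"
   using S_perm[OF s(1)] by (intro bef_split) auto
  define zs where "zs = filter (%k. k \<in> Z) (snd s)"
  have zs: "set zs = Z" using S_perm[OF s(1)] by (auto simp: zs_def Z_def)
  have w1: "walk T s [L] s'" using walk_snoc[OF walk_Nil T(1)] by simp
  have c1: "(\<exists>r. snd s' = zs @ r) \<and> lexle (map (rk (rep s')) zs) (map (rk (rep s)) zs)"
   by (rule chain[OF w1 s(1) split[folded zs_def]]) (auto simp: zs Z_def)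
  then obtain r1 where r1: "snd s' = zs @ r1" by blast
  have c2: "lexle (map (rk (rep s)) zs) (map (rk (rep s')) zs)"
   using chain[OF Ls(1) s(2) r1] by (auto simp: zs Z_def)
  have "lexle (map (rk (rep s')) (snd s')) (map (rk a) (snd s'))"
   using rep[OF s(2)] a unfolding best_def good_def by simp
  then have c3: "lexle (map (rk (rep s')) zs) (map (rk a) zs)"
   unfolding r1 map_append by (rule lexle_append[rotated]) simp
  \<comment> \<open>The cycle leads from a back to the representative of s without a lexicographic
    increase, although a is pointwise below it. All ranks on the prefix therefore agree, against the
    strict drop of k.\<close>
  have "lexle (map (rk (rep s)) zs) (map (rk a) zs)" by (rule lexle_trans[OF _ _ c2 c3]) simp_all
  moreover have "rk a k \<le> rk (rep s) k" if "k \<in> set zs" for k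
   using a(1) that unfolding zs good_def Z_def by auto
  moreover have "k \<in> set zs" using T(2,3) Ls(2) by (simp add: zs Z_def)
  ultimately have "rk a k = rk (rep s) k" using lexle_strict by metis
  with a(1) T(2-4) show False unfolding good_def by auto
 qed
 \<comment> \<open>The compressed rank counts the states reachable by steps whose labels contain k,
   so it is bounded by the number of states. A one-way step has no way back, hence loses its
   starting state from the count.\<close>
 define \<rho> where "\<rho> s k = card {u. (s, u) \<in> (Ek k)\<^sup>*}" for s k
 have reach_S: "{u. (s, u) \<in> (Ek k)\<^sup>*} \<subseteq> S" if "s \<in> S" for s k
 proof
  fix u assume "u \<in> {u. (s, u) \<in> (Ek k)\<^sup>*}"
  then have "(s, u) \<in> (Ek k)\<^sup>*" by simp
  then show "u \<in> S" by (induction rule: rtrancl_induct) (use that T_S in \<open>auto simp: Ek_def\<close>)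
 qed
 show ?thesis
 proof (rule that[OF S_def, of \<rho>]; intro ballI allI impI)
  show "\<rho> s k \<le> card (pr ` A) * length ks ^ length ks" if "s \<in> S" for s k
   unfolding \<rho>_def using card_mono[OF fin_S reach_S[OF that]] card_S le_trans by blast
  fix p t i assume pt: "(p, t) \<in> S" "req p i"
  obtain a L where a: "good (p, t) i a L" using ex_good[OF pt(1), of i] pt(2) by auto
  let ?s = "(p, t)" and ?s' = "(pr a, renew L t)"
  have T: "(?s, L, ?s') \<in> T" using a pt unfolding T_def by auto
  have "\<rho> ?s' k \<le> \<rho> ?s k \<and> (flip k \<notin> L --> \<rho> ?s' k < \<rho> ?s k)" if k: "k \<in> set ks" "k \<in> L" for k
  proof -
   have step: "(?s, ?s') \<in> Ek k" using T k unfolding Ek_def by blast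
   have sub: "{u. (?s', u) \<in> (Ek k)\<^sup>*} \<subseteq> {u. (?s, u) \<in> (Ek k)\<^sup>*}"
    using step by (auto intro: converse_rtrancl_into_rtrancl)
   have fin: "finite {u. (?s, u) \<in> (Ek k)\<^sup>*}" by (rule finite_subset[OF reach_S[OF pt(1)] fin_S])
   have "?s \<notin> {u. (?s', u) \<in> (Ek k)\<^sup>*}" if "flip k \<notin> L" using no_cycle[OF T k that] by blast
   then have "{u. (?s', u) \<in> (Ek k)\<^sup>*} \<subset> {u. (?s, u) \<in> (Ek k)\<^sup>*}" if "flip k \<notin> L" using sub that by blast
   then show ?thesis unfolding \<rho>_def using card_mono[OF fin sub] psubset_card_mono[OF fin] by blast
  qed
  moreover have "ok p i L (pr a)" using a unfolding good_def by simp
  ultimately show "\<exists>p' t' L. (p', t') \<in> S \<and> ok p i L p'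
   \<and> (\<forall>k\<in>set ks. k \<in> L --> \<rho> (p', t') k \<le> \<rho> (p, t) k \<and> (flip k \<notin> L --> \<rho> (p', t') k < \<rho> (p, t) k))"
   using T_S[OF T] by blast
 qed
qed

text \<open>
 A single potential per relation: after a strict step downwards it is set to the
 remaining rank, after a strict step upwards to the remaining distance from the maximum.
\<close>

lemma bounded_potentials:
 fixes A :: "'a set" and pr :: "'a => 'p" and rk :: "'a => 'r \<times> bool => nat"
 assumes "finite A" "distinct ks" and flip: "\<And>R d. (R, d) \<in> set ks ==> (R, \<not> d) \<in> set ks"
  and W: "\<And>a i. a \<in> A ==> req (pr a) i ==> \<exists>a'\<in>A. \<exists>L. ok (pr a) i L (pr a')
   \<and> (\<forall>R d. (R, d) \<in> set ks --> (R, d) \<in> L -->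
      rk a' (R, d) \<le> rk a (R, d) \<and> ((R, \<not> d) \<notin> L --> rk a' (R, d) < rk a (R, d)))"
  and M: "2 * (card (pr ` A) * length ks ^ length ks) \<le> M"
 obtains Y :: "('p \<times> ('r => nat)) set" where
  "\<forall>a\<in>A. \<exists>r. (pr a, r) \<in> Y" "\<forall>p r. (p, r) \<in> Y --> p \<in> pr ` A \<and> (\<forall>R. r R \<le> M)"
  "\<forall>p r i. (p, r) \<in> Y --> req p i --> (\<exists>p' r' L. (p', r') \<in> Y \<and> ok p i L p' \<and>
   (\<forall>R d. (R, d) \<in> set ks --> (R, d) \<in> L -->
    (if (R, \<not> d) \<in> L then r' R = r R else if d then r' R < r R else r R < r' R)))"
proof -
 let ?fl = "%k :: 'r \<times> bool. (fst k, \<not> snd k)"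
 have W': "\<exists>a'\<in>A. \<exists>L. ok (pr a) i L (pr a')
   \<and> (\<forall>k\<in>set ks. k \<in> L --> rk a' k \<le> rk a k \<and> (?fl k \<notin> L --> rk a' k < rk a k))"
  if a: "a \<in> A" "req (pr a) i" for a i
 proof -
  obtain a' L where "a' \<in> A" "ok (pr a) i L (pr a')" "\<forall>R d. (R, d) \<in> set ks --> (R, d) \<in> L -->
      rk a' (R, d) \<le> rk a (R, d) \<and> ((R, \<not> d) \<notin> L --> rk a' (R, d) < rk a (R, d))"
   using W[OF a] by blast
  then show ?thesis by (intro bexI[of _ a'] exI[of _ L]) auto
 qed
 define N where "N = card (pr ` A) * length ks ^ length ks"
 obtain S \<rho> where S: "S = pr ` A \<times> {t. distinct t \<and> set t = set ks}"
  and bnd: "\<forall>s\<in>S. \<forall>k. \<rho> s k \<le> N"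
  and nxt: "\<forall>p t i. (p, t) \<in> S --> req p i --> (\<exists>p' t' L. (p', t') \<in> S \<and> ok p i L p'
   \<and> (\<forall>k\<in>set ks. k \<in> L --> \<rho> (p', t') k \<le> \<rho> (p, t) k \<and> (?fl k \<notin> L --> \<rho> (p', t') k < \<rho> (p, t) k)))"
  unfolding N_def
  by (rule record_ranks[where req = req and ok = ok and pr = pr and rk = rk and flip = ?fl and A = A and ks = ks,
     OF assms(1,2) W'])
 \<comment> \<open>Invariant: the potential leaves room for the remaining rank below it and for the
   rank of the inverse key between it and M. Since M is at least twice the bound of the ranks, both
   demands can always be met.\<close>
 define ok_r where "ok_r s r \<longleftrightarrow> (\<forall>R. r R \<le> M \<and> ((R, True) \<in> set ks --> \<rho> s (R, True) \<le> r R \<and> r R + \<rho> s (R, False) \<le> M))"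
  for s and r :: "'r => nat"
 define Y where "Y = {(p, r). \<exists>t. (p, t) \<in> S \<and> ok_r (p, t) r}"
 have NM: "2 * N \<le> M" using M by (simp add: N_def)
 show ?thesis
 proof (rule that[of Y]; intro ballI allI impI)
  fix a assume "a \<in> A"
  then have s: "(pr a, ks) \<in> S" using assms(2) by (simp add: S)
  have "ok_r (pr a, ks) (%_. N)"
   unfolding ok_r_def using bnd s NM by (fastforce intro: order.trans[of _ "N + N"])
  then show "\<exists>r. (pr a, r) \<in> Y" using s unfolding Y_def by blast
 next
  fix p r assume "(p, r) \<in> Y"
  then show "p \<in> pr ` A \<and> (\<forall>R. r R \<le> M)" unfolding Y_def ok_r_def S by auto
 next
  fix p r i assume pr: "(p, r) \<in> Y" "req p i"
  then obtain t where t: "(p, t) \<in> S" "ok_r (p, t) r" unfolding Y_def by blast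
  obtain p' t' L where n: "(p', t') \<in> S" "ok p i L p'" and
   rho: "\<forall>k\<in>set ks. k \<in> L --> \<rho> (p', t') k \<le> \<rho> (p, t) k \<and> (?fl k \<notin> L --> \<rho> (p', t') k < \<rho> (p, t) k)"
   using nxt[rule_format, OF t(1) pr(2)] by (elim exE conjE)
  \<comment> \<open>With both directions in the label the old value has to be kept, and the
    invariant survives because neither rank increases. With neither direction, any value within the
    invariant would do.\<close>
  define r' where "r' R = (if (R, True) \<notin> set ks then r R
   else if (R, True) \<in> L \<and> (R, False) \<in> L then r R
   else if (R, False) \<in> L then M - \<rho> (p', t') (R, False) else \<rho> (p', t') (R, True))" for R
  have b: "\<rho> (p', t') k \<le> N" for k using bnd n(1) by blast
  have key: "r' R \<le> M \<and> ((R, True) \<in> set ks --> \<rho> (p', t') (R, True) \<le> r' R \<and> r' R + \<rho> (p', t') (R, False) \<le> M \<and>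
   (\<forall>d. (R, d) \<in> L --> (if (R, \<not> d) \<in> L then r' R = r R else if d then r' R < r R else r R < r' R)))" for R
  proof (cases "(R, True) \<in> set ks")
   case False then show ?thesis using t(2) by (auto simp: r'_def ok_r_def)
  next
   case True
   then have F: "(R, False) \<in> set ks" using flip[OF True] by simp
   have o: "r R \<le> M" "\<rho> (p, t) (R, True) \<le> r R" "r R + \<rho> (p, t) (R, False) \<le> M"
    using t(2) True unfolding ok_r_def by auto
   have bb: "\<rho> (p', t') (R, True) + \<rho> (p', t') (R, False) \<le> M" "\<rho> (p', t') (R, False) \<le> M"
    using b[of "(R, True)"] b[of "(R, False)"] NM by auto
   show ?thesis
   proof (cases "(R, True) \<in> L"; cases "(R, False) \<in> L")
    assume "(R, True) \<in> L" "(R, False) \<in> L"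
    then show ?thesis using o bspec[OF rho True] bspec[OF rho F] by (fastforce simp: r'_def)
   next
    assume *: "(R, True) \<in> L" "(R, False) \<notin> L"
    have "(if (R, \<not> d) \<in> L then r' R = r R else if d then r' R < r R else r R < r' R)" if "(R, d) \<in> L" for d
     using that * o bspec[OF rho True] by (cases d) (auto simp: r'_def True)
    moreover have "r' R \<le> M" "\<rho> (p', t') (R, True) \<le> r' R" "r' R + \<rho> (p', t') (R, False) \<le> M"
     using * bb by (auto simp: r'_def True)
    ultimately show ?thesis by blast
   next
    assume *: "(R, True) \<notin> L" "(R, False) \<in> L"
    have "(if (R, \<not> d) \<in> L then r' R = r R else if d then r' R < r R else r R < r' R)" if "(R, d) \<in> L" for d
     using that * o bspec[OF rho F] bb by (cases d) (auto simp: r'_def True)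
    moreover have "r' R \<le> M" "\<rho> (p', t') (R, True) \<le> r' R" "r' R + \<rho> (p', t') (R, False) \<le> M"
     using * bb by (auto simp: r'_def True)
    ultimately show ?thesis by blast
   next
    assume *: "(R, True) \<notin> L" "(R, False) \<notin> L"
    have "(R, d) \<notin> L" for d using * by (cases d) auto
    moreover have "r' R \<le> M" "\<rho> (p', t') (R, True) \<le> r' R" "r' R + \<rho> (p', t') (R, False) \<le> M"
     using * bb by (auto simp: r'_def True)
    ultimately show ?thesis by blast
   qed
  qed
  have "ok_r (p', t') r'" unfolding ok_r_def using key by blast
  then have "(p', r') \<in> Y" using n(1) unfolding Y_def by blast
  moreover have "\<forall>R d. (R, d) \<in> set ks --> (R, d) \<in> L -->
    (if (R, \<not> d) \<in> L then r' R = r R else if d then r' R < r R else r R < r' R)"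
  proof (intro allI impI)
   fix R d assume "(R, d) \<in> set ks" "(R, d) \<in> L"
   moreover from this have "(R, True) \<in> set ks" using flip[of R d] by (cases d) auto
   ultimately show "if (R, \<not> d) \<in> L then r' R = r R else if d then r' R < r R else r R < r' R"
    using key[of R] by blast
  qed
  ultimately show "\<exists>p' r' L. (p', r') \<in> Y \<and> ok p i L p' \<and>
   (\<forall>R d. (R, d) \<in> set ks --> (R, d) \<in> L -->
    (if (R, \<not> d) \<in> L then r' R = r R else if d then r' R < r R else r R < r' R))"
   using n(2) by blast
 qed
qed

section \<open>Certificates for finite satisfiability\<close>

text \<open>
 A key \<open>(R, d)\<close> stands for \<open>R(x, y)\<close> if \<open>d\<close> and for \<open>R(y, x)\<close> otherwise; the
 symbols with even index are eliminated in favour of their inverses.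
\<close>

type_synonym key = "rsym \<times> bool"

fun nrm :: "rsym => rsym" where
 "nrm (Dist u) = Dist (if odd u then u else u - 1)"
| "nrm (Base i n) = Base i n"

fun key_of :: "rsym => bool => key" where
 "key_of (Dist u) d = (if odd u then (Dist u, d) else (Dist (u - 1), \<not> d))"
| "key_of (Base i n) d = (Base i n, d)"

definition flip :: "key => key" where "flip k = (fst k, \<not> snd k)"

fun is_dist :: "rsym => bool" where
 "is_dist (Dist u) = True"
| "is_dist (Base i n) = False"

lemma flip_flip [simp]: "flip (flip k) = k" by (simp add: flip_def)
lemma fst_flip [simp]: "fst (flip k) = fst k" by (simp add: flip_def)
lemma snd_flip [simp]: "snd (flip k) = (\<not> snd k)" by (simp add: flip_def)
lemma fst_key_of [simp]: "fst (key_of R d) = nrm R" by (cases R) auto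
lemma key_of_flip: "key_of R (\<not> d) = flip (key_of R d)" by (cases R) (auto simp: flip_def)
lemma is_dist_nrm [simp]: "is_dist (nrm R) = is_dist R" by (cases R) auto
lemma arity_nrm [simp]: "arity (nrm R) = arity R" by (cases R) auto

fun subf :: "fm => fm list" where
 "subf (And a b) = And a b # subf a @ subf b"
| "subf (Or a b) = Or a b # subf a @ subf b"
| "subf (Exists x a) = Exists x a # subf a"
| "subf (Neg a) = Neg a # subf a"
| "subf \<phi> = [\<phi>]"

lemma subf_self: "\<phi> \<in> set (subf \<phi>)"
 by (cases \<phi>) auto

lemma subf_trans: "\<psi> \<in> set (subf \<phi>) ==> \<chi> \<in> set (subf \<psi>) ==> \<chi> \<in> set (subf \<phi>)"
 by (induction \<phi>) auto

lemma subf_sub: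
 "And a b \<in> set (subf \<phi>) ==> a \<in> set (subf \<phi>) \<and> b \<in> set (subf \<phi>)"
 "Or a b \<in> set (subf \<phi>) ==> a \<in> set (subf \<phi>) \<and> b \<in> set (subf \<phi>)"
 "Exists x a \<in> set (subf \<phi>) ==> a \<in> set (subf \<phi>)"
 "Neg a \<in> set (subf \<phi>) ==> a \<in> set (subf \<phi>)"
 using subf_self[of a] subf_self[of b] subf_trans[of _ \<phi>] by (metis Un_iff list.set_intros(2) set_append subf.simps)+

definition rsyms :: "fm => rsym list" where
 "rsyms \<phi> = concat (map (%\<psi>. case \<psi> of Atom R xs => [nrm R] | Eq x y => [] | And a b => []
   | Or a b => [] | Exists x a => [] | Neg a => []) (subf \<phi>))"

lemma rsyms_Atom: "Atom R xs \<in> set (subf \<phi>) ==> nrm R \<in> set (rsyms \<phi>)"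
 unfolding rsyms_def by force

lemma syms_subf: "R \<in> syms \<phi> \<longleftrightarrow> (\<exists>xs. Atom R xs \<in> set (subf \<phi>))"
 by (induction \<phi>) auto

lemma rsyms_syms: "R \<in> set (rsyms \<phi>) \<longleftrightarrow> (\<exists>R'\<in>syms \<phi>. R = nrm R')"
proof
 assume "R \<in> set (rsyms \<phi>)"
 then obtain R' xs where "Atom R' xs \<in> set (subf \<phi>)" "R = nrm R'"
  by (auto simp: rsyms_def split: fm.splits)
 then show "\<exists>R'\<in>syms \<phi>. R = nrm R'" using syms_subf by blast
qed (use rsyms_Atom syms_subf in blast)

definition both_keys :: "rsym list => key list" where
 "both_keys Rs = concat (map (%R. [(R, True), (R, False)]) Rs)"

lemma set_both_keys [simp]: "k \<in> set (both_keys Rs) \<longleftrightarrow> fst k \<in> set Rs"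
 by (cases k) (auto simp: both_keys_def)

definition drs :: "fm => rsym list" where
 "drs \<phi> = filter is_dist (rsyms \<phi>)"

definition all_keys :: "fm => key list" where
 "all_keys \<phi> = both_keys (filter (%R. arity R = 2) (rsyms \<phi>))"

definition dkeys :: "fm => key list" where
 "dkeys \<phi> = both_keys (drs \<phi>)"

text \<open>
 A type \<open>(lp, fs)\<close> of an element \<open>a\<close>: the symbols true of the tuple \<open>(a, ..., a)\<close> and the
 subformulas true when all variables denote \<open>a\<close>.
\<close>

type_synonym tp = "rsym list \<times> fm list"

text \<open>The truth value of a formula at two distinct elements of types \<open>\<alpha>\<close> and \<open>\<beta>\<close> related by the keys \<open>P\<close>.\<close>

definition unary :: "tp => tp => fm => bool => bool" where
 "unary \<alpha> \<beta> \<psi> b = (if 1 \<notin> fv \<psi> then \<psi> \<in> set (snd \<alpha>) else if 0 \<notin> fv \<psi> then \<psi> \<in> set (snd \<beta>) else b)"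

text \<open>The default \<open>False\<close> concerns formulas with both variables free: an equation
  fails at distinct elements, and in a two-variable sentence with unary negation neither a negation
  nor a quantified formula has two free variables.\<close>

fun ev :: "tp => (key => bool) => tp => fm => bool" where
 "ev \<alpha> P \<beta> (Atom R xs) = unary \<alpha> \<beta> (Atom R xs) (P (key_of R (xs = [0, 1])))"
| "ev \<alpha> P \<beta> (And a b) = unary \<alpha> \<beta> (And a b) (ev \<alpha> P \<beta> a \<and> ev \<alpha> P \<beta> b)"
| "ev \<alpha> P \<beta> (Or a b) = unary \<alpha> \<beta> (Or a b) (ev \<alpha> P \<beta> a \<or> ev \<alpha> P \<beta> b)"
| "ev \<alpha> P \<beta> \<psi> = unary \<alpha> \<beta> \<psi> False"

text \<open>The element of type \<open>\<alpha>\<close> is named by the variable that is not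
  quantified; quantifying variable 0 therefore swaps the two elements and flips the keys.\<close>

definition evx :: "nat => tp => (key => bool) => tp => fm => bool" where
 "evx x \<alpha> P \<beta> \<psi> = (if x = 1 then ev \<alpha> P \<beta> \<psi> else ev \<beta> (%k. P (flip k)) \<alpha> \<psi>)"

text \<open>Negations and quantified subformulas are read off a type, so keys occur only below
  conjunction and disjunction.\<close>

lemma ev_mono: "ev \<alpha> P \<beta> \<psi> ==> (\<And>k. P k ==> Q k) ==> ev \<alpha> Q \<beta> \<psi>"
 by (induction \<psi>) (auto simp: unary_def split: if_splits)

lemma evx_mono: "evx x \<alpha> P \<beta> \<psi> ==> (\<And>k. P k ==> Q k) ==> evx x \<alpha> Q \<beta> \<psi>"
 using ev_mono[of \<alpha> P \<beta> \<psi> Q] ev_mono[of \<beta> "%k. P (flip k)" \<alpha> \<psi> "%k. Q (flip k)"]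
 unfolding evx_def by (cases "x = 1") simp_all

definition okT :: "fm => tp => bool" where
 "okT \<phi> \<tau> \<longleftrightarrow> (\<forall>\<psi>\<in>set (subf \<phi>). case \<psi> of
    Atom R xs => \<psi> \<in> set (snd \<tau>) \<longleftrightarrow> nrm R \<in> set (fst \<tau>)
   | Eq x y => \<psi> \<in> set (snd \<tau>)
   | And a b => \<psi> \<in> set (snd \<tau>) \<longleftrightarrow> a \<in> set (snd \<tau>) \<and> b \<in> set (snd \<tau>)
   | Or a b => \<psi> \<in> set (snd \<tau>) \<longleftrightarrow> a \<in> set (snd \<tau>) \<or> b \<in> set (snd \<tau>)
   | Exists x a => a \<in> set (snd \<tau>) --> \<psi> \<in> set (snd \<tau>)
   | Neg a => \<psi> \<in> set (snd \<tau>) \<longleftrightarrow> a \<notin> set (snd \<tau>))"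

text \<open>The false existential formulas are the universal requirements of an element. The
  condition is antitone in P, so it may be checked for an upper bound of the actual
  relations.\<close>

definition no_viol :: "fm => tp => (key => bool) => tp => bool" where
 "no_viol \<phi> \<alpha> P \<beta> \<longleftrightarrow> (\<forall>\<psi>\<in>set (subf \<phi>). case \<psi> of
    Atom R xs => True | Eq x y => True | And a b => True | Or a b => True
   | Exists x a => \<psi> \<notin> set (snd \<alpha>) --> \<not> evx x \<alpha> P \<beta> a
   | Neg a => True)"

text \<open>
 A profile consists of a type and a list \<open>D\<close> of pairs \<open>(U, \<beta>)\<close>, which must cover all
 elements: one of type \<open>\<beta>\<close> related to the present one by distinguished keys that lie in \<open>U\<close>.
\<close>

type_synonym prof = "tp \<times> (key list \<times> tp) list"

definition covers :: "(key list \<times> tp) list => (key => bool) => key list => tp => bool" where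
 "covers D P ks \<beta> \<longleftrightarrow> (\<exists>q\<in>set D. snd q = \<beta> \<and> (\<forall>k\<in>set ks. P k --> k \<in> set (fst q)))"

text \<open>The last conjunct serves distinct points of the model over the same vertex: the
  distinguished keys between them are loops of its type.\<close>

definition okP :: "fm => prof => bool" where
 "okP \<phi> p \<longleftrightarrow> okT \<phi> (fst p) \<and>
   (\<forall>q\<in>set (snd p). no_viol \<phi> (fst p) (%k. k \<in> set (fst q)) (snd q) \<and>
    (\<forall>R\<in>set (rsyms \<phi>). arity R = 0 --> (R \<in> set (fst (fst p)) \<longleftrightarrow> R \<in> set (fst (snd q))))) \<and>
   covers (snd p) (%k. fst k \<in> set (fst (fst p))) (dkeys \<phi>) (fst p)"

text \<open>Coverings are transported along the edge in both directions: what is related by U to one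
  end is, by transitivity, related to the other end by the keys common to U and the label. The last
  conjunct makes two-way distinguished keys loops at both ends, as transitivity demands.\<close>

definition edge :: "fm => prof => key list => prof => bool" where
 "edge \<phi> p L p' \<longleftrightarrow>
   no_viol \<phi> (fst p) (%k. k \<in> set L) (fst p') \<and> no_viol \<phi> (fst p') (%k. flip k \<in> set L) (fst p) \<and>
   covers (snd p) (%k. k \<in> set L) (dkeys \<phi>) (fst p') \<and>
   covers (snd p') (%k. flip k \<in> set L) (dkeys \<phi>) (fst p) \<and>
   (\<forall>q\<in>set (snd p'). covers (snd p) (%k. k \<in> set L) (fst q) (snd q)) \<and>
   (\<forall>q\<in>set (snd p). covers (snd p') (%k. flip k \<in> set L) (fst q) (snd q)) \<and>
   (\<forall>k\<in>set (dkeys \<phi>). k \<in> set L --> flip k \<in> set L -->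
    fst k \<in> set (fst (fst p)) \<and> fst k \<in> set (fst (fst p')))"

text \<open>A potential gives every distinguished relation a number with \<open>l\<close> bits, as the set of its nonzero bits.\<close>

type_synonym potential = "(rsym \<times> nat) list"

definition plt :: "nat => rsym => potential => potential => bool" where
 "plt l R r r' \<longleftrightarrow> (\<exists>j\<in>set [0..<l]. (R, j) \<in> set r' \<and> (R, j) \<notin> set r \<and>
   (\<forall>i\<in>set [0..<l]. j < i --> ((R, i) \<in> set r) = ((R, i) \<in> set r')))"

definition peq :: "nat => rsym => potential => potential => bool" where
 "peq l R r r' \<longleftrightarrow> (\<forall>i\<in>set [0..<l]. ((R, i) \<in> set r) = ((R, i) \<in> set r'))"

primrec bval :: "(nat => bool) => nat => nat" where
 "bval f 0 = 0"
| "bval f (Suc l) = bval f l + (if f l then 2 ^ l else 0)"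

lemma bval_less: "bval f l < 2 ^ l"
 by (induction l) auto

lemma bval_cong: "(\<And>i. i < l ==> f i = g i) ==> bval f l = bval g l"
 by (induction l) auto

lemma bval_bit: "bval (bit n) l = take_bit l n"
 by (induction l) (auto simp: take_bit_Suc_from_most)

lemma bval_lt_iff: "(\<exists>j<l. g j \<and> \<not> f j \<and> (\<forall>i<l. j < i --> f i = g i)) \<longleftrightarrow> bval f l < bval g l"
proof (induction l)
 case (Suc l)
 have *: "(\<exists>j<Suc l. g j \<and> \<not> f j \<and> (\<forall>i<Suc l. j < i --> f i = g i)) \<longleftrightarrow>
  (g l \<and> \<not> f l) \<or> (f l = g l \<and> (\<exists>j<l. g j \<and> \<not> f j \<and> (\<forall>i<l. j < i --> f i = g i)))"
  by (auto simp: less_Suc_eq)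
 show ?case unfolding * Suc.IH using bval_less[of f l] bval_less[of g l] by (cases "f l"; cases "g l") simp_all
qed simp

lemma bval_eq_iff: "(\<forall>i<l. f i = g i) \<longleftrightarrow> bval f l = bval g l"
proof
 assume eq: "bval f l = bval g l"
 show "\<forall>i<l. f i = g i"
 proof (rule ccontr)
  assume "\<not> (\<forall>i<l. f i = g i)"
  then have ex: "\<exists>i<l. f i \<noteq> g i" by blast
  define j where "j = (GREATEST i. i < l \<and> f i \<noteq> g i)"
  have j: "j < l \<and> f j \<noteq> g j" unfolding j_def by (rule GreatestI_ex_nat[where b = l]) (use ex in auto)
  have "f i = g i" if "i < l" "j < i" for i
   using Greatest_le_nat[of "%i. i < l \<and> f i \<noteq> g i" i l] that unfolding j_def by fastforce
  then have "bval f l < bval g l \<or> bval g l < bval f l"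
   using j bval_lt_iff[of l g f] bval_lt_iff[of l f g] by blast
  with eq show False by simp
 qed
qed (rule bval_cong, simp)

abbreviation pval :: "nat => rsym => potential => nat" where
 "pval l R r \<equiv> bval (%i. (R, i) \<in> set r) l"

lemma plt_iff: "plt l R r r' \<longleftrightarrow> pval l R r < pval l R r'"
 unfolding plt_def bval_lt_iff[symmetric] by auto

lemma peq_iff: "peq l R r r' \<longleftrightarrow> pval l R r = pval l R r'"
 unfolding peq_def bval_eq_iff[symmetric] by auto

type_synonym cand = "prof \<times> potential"

definition pot_ok :: "fm => nat => potential => key list => potential => bool" where
 "pot_ok \<phi> l r L r' \<longleftrightarrow> (\<forall>k\<in>set (dkeys \<phi>). k \<in> set L -->
   (if flip k \<in> set L then peq l (fst k) r r' else if snd k then plt l (fst k) r' r else plt l (fst k) r r'))"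

definition wit :: "fm => nat => key list list => cand list => cand => bool" where
 "wit \<phi> l Ls X c \<longleftrightarrow> (\<forall>\<psi>\<in>set (subf \<phi>). case \<psi> of
    Atom R xs => True | Eq x y => True | And a b => True | Or a b => True
   | Exists x a => \<psi> \<in> set (snd (fst (fst c))) --> a \<in> set (snd (fst (fst c))) \<or>
     (\<exists>L\<in>set Ls. \<exists>c'\<in>set X. evx x (fst (fst c)) (%k. k \<in> set L) (fst (fst c')) a \<and>
      edge \<phi> (fst c) L (fst c') \<and> pot_ok \<phi> l (snd c) L (snd c'))
   | Neg a => True)"

lemma no_violD: "no_viol \<phi> \<alpha> P \<beta> ==> Exists x a \<in> set (subf \<phi>) ==> Exists x a \<notin> set (snd \<alpha>) ==> \<not> evx x \<alpha> P \<beta> a"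
 unfolding no_viol_def by fastforce

lemma witD: "wit \<phi> l Ls X c ==> Exists x a \<in> set (subf \<phi>) ==> Exists x a \<in> set (snd (fst (fst c))) ==>
  a \<in> set (snd (fst (fst c))) \<or> (\<exists>L\<in>set Ls. \<exists>c'\<in>set X. evx x (fst (fst c)) (%k. k \<in> set L) (fst (fst c')) a \<and>
      edge \<phi> (fst c) L (fst c') \<and> pot_ok \<phi> l (snd c) L (snd c'))"
 unfolding wit_def by fastforce

section \<open>Free variables, subformulas and isomorphic copies\<close>

lemma sat_cong: "(\<And>x. x \<in> fv \<phi> ==> v x = w x) ==> sat A v \<phi> = sat A w \<phi>"
proof (induction \<phi> arbitrary: v w)
 case (Atom R xs)
 then have "map v xs = map w xs" by auto
 then show ?case by (simp only: sat.simps)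
next
 case (And a b)
 have "sat A v a = sat A w a" by (rule And.IH(1)) (use And.prems in auto)
 moreover have "sat A v b = sat A w b" by (rule And.IH(2)) (use And.prems in auto)
 ultimately show ?case by simp
next
 case (Or a b)
 have "sat A v a = sat A w a" by (rule Or.IH(1)) (use Or.prems in auto)
 moreover have "sat A v b = sat A w b" by (rule Or.IH(2)) (use Or.prems in auto)
 ultimately show ?case by simp
next
 case (Exists x a)
 have "sat A (v(x := c)) a = sat A (w(x := c)) a" for c
  by (rule Exists.IH) (use Exists.prems in auto)
 then show ?case by simp
next
 case (Neg a)
 have "sat A v a = sat A w a" by (rule Neg.IH) (use Neg.prems in auto)
 then show ?case by simp
qed auto

lemma fv_vars: "fv \<phi> \<subseteq> vars \<phi>"
 by (induction \<phi>) auto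

lemma vars_subf: "\<psi> \<in> set (subf \<phi>) ==> vars \<psi> \<subseteq> vars \<phi>"
 by (induction \<phi>) auto

lemma unfo_subf: "unfo \<phi> ==> \<psi> \<in> set (subf \<phi>) ==> unfo \<psi>"
proof (induction \<phi>)
 case (Neg \<phi>)
 then show ?case by (cases "\<psi> = Neg \<phi>") simp_all
qed auto

definition image_struct :: "('a => 'b) => 'a struct => 'b struct" where
 "image_struct h A = \<lparr>universe = h ` universe A, interp = (%R. map h ` interp A R)\<rparr>"

lemma sat_image:
 assumes "inj_on h (universe A)" "is_struct A" "range v \<subseteq> universe A"
 shows "sat (image_struct h A) (h \<circ> v) \<phi> = sat A v \<phi>"
 using assms(3)
proof (induction \<phi> arbitrary: v)
 case (Atom R xs)
 have "map v xs \<in> interp A R" if "map (h \<circ> v) xs = map h as" "as \<in> interp A R" for as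
 proof -
  have "set as \<subseteq> universe A" using assms(2) that(2) unfolding is_struct_def by blast
  moreover have "set (map v xs) \<subseteq> universe A" using Atom by auto
  ultimately have "inj_on h (set (map v xs) \<union> set as)" by (intro inj_on_subset[OF assms(1)]) auto
  moreover have "map h (map v xs) = map h as" using that(1) by simp
  ultimately have "map v xs = as" by (simp only: inj_on_map_eq_map)
  then show ?thesis using that(2) by simp
 qed
 then have "map (h \<circ> v) xs \<in> map h ` interp A R \<longleftrightarrow> map v xs \<in> interp A R"
  by (metis imageE image_eqI map_map)
 then show ?case by (simp add: image_struct_def comp_def)
next
 case (Eq x y)
 then show ?case using inj_onD[OF assms(1), of "v x" "v y"] by auto
next
 case (Exists x \<phi>)
 have eq: "sat (image_struct h A) ((h \<circ> v)(x := h a)) \<phi> = sat A (v(x := a)) \<phi>" if "a \<in> universe A" for a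
 proof -
  have "(h \<circ> v)(x := h a) = h \<circ> (v(x := a))" by auto
  moreover have "range (v(x := a)) \<subseteq> universe A" using Exists.prems that by auto
  ultimately show ?thesis using Exists.IH[of "v(x := a)"] by (simp only: comp_def)
 qed
 have "universe (image_struct h A) = h ` universe A" by (simp add: image_struct_def)
 then show ?case unfolding sat.simps by (simp only: bex_simps(7)) (intro bex_cong refl eq)
next
 case (And a b) then show ?case using And.IH(1)[of v] And.IH(2)[of v] by simp
next
 case (Or a b) then show ?case using Or.IH(1)[of v] Or.IH(2)[of v] by simp
next
 case (Neg a) then show ?case using Neg.IH[of v] by simp
qed

text \<open>Finite satisfiability is defined through structures on natural numbers, while the
  constructed models live on other types; an injection of the finite universe transports
  them.\<close>

lemma finitely_satisfiableI:
 fixes A :: "'a struct"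
 assumes "admissible k A" "finite (universe A)" "models A \<phi>"
 shows "finitely_satisfiable k \<phi>"
proof -
 obtain h :: "'a => nat" where h: "inj_on h (universe A)" using finite_imp_inj_to_nat_seg[OF assms(2)] by blast
 let ?B = "image_struct h A"
 have A: "is_struct A" using assms(1) by (simp add: admissible_def)
 have rel: "dist_rel ?B u = (%(a, b). (h a, h b)) ` dist_rel A u" for u
 proof -
  have "[x, y] \<in> map h ` interp A (Dist u) \<longleftrightarrow> (\<exists>a b. x = h a \<and> y = h b \<and> [a, b] \<in> interp A (Dist u))" for x y
   by (auto simp: image_iff Cons_eq_map_conv)
  then show ?thesis unfolding dist_rel_def image_struct_def by (auto simp: image_def)
 qed
 have dist_U: "(a, b) \<in> dist_rel A u ==> a \<in> universe A \<and> b \<in> universe A" for a b u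
  using A unfolding is_struct_def dist_rel_def by fastforce
 have "is_struct ?B" using A unfolding is_struct_def image_struct_def by fastforce
 moreover have "trans (dist_rel ?B u)" if "u \<in> {1..2 * k}" for u
 proof -
  have "trans (dist_rel A u)" using assms(1) that unfolding admissible_def by blast
  show ?thesis
  proof (rule transI)
   fix x y z assume "(x, y) \<in> dist_rel ?B u" "(y, z) \<in> dist_rel ?B u"
   then obtain a b b' c where abc: "(a, b) \<in> dist_rel A u" "(b', c) \<in> dist_rel A u"
    "x = h a" "y = h b" "y = h b'" "z = h c" unfolding rel by auto
   then have "b = b'" using inj_onD[OF h] dist_U by metis
   with abc \<open>trans (dist_rel A u)\<close> have "(a, c) \<in> dist_rel A u" by (meson transD)
   then show "(x, z) \<in> dist_rel ?B u" unfolding rel abc(3,6) by force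
  qed
 qed
 moreover have "dist_rel ?B (2 * u) = (dist_rel ?B (2 * u - 1))\<inverse>" if "u \<in> {1..k}" for u
 proof -
  have "dist_rel A (2 * u) = (dist_rel A (2 * u - 1))\<inverse>" using assms(1) that unfolding admissible_def by blast
  then show ?thesis unfolding rel by force
 qed
 ultimately have "admissible k ?B" unfolding admissible_def by blast
 moreover have "finite (universe ?B)" using assms(2) by (simp add: image_struct_def)
 moreover have "models ?B \<phi>" unfolding models_def
 proof (intro allI impI)
  fix v :: "nat => nat" assume v: "range v \<subseteq> universe ?B"
  define w where "w x = inv_into (universe A) h (v x)" for x
  have "v x \<in> h ` universe A" for x using v by (auto simp: image_struct_def)
  then have w: "w x \<in> universe A" "h (w x) = v x" for x
   unfolding w_def by (auto intro: inv_into_into f_inv_into_f)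
  have "sat ?B (h \<circ> w) \<phi> = sat A w \<phi>" by (rule sat_image[OF h A]) (use w in auto)
  moreover have "h \<circ> w = v" using w by auto
  moreover have "sat A w \<phi>" using assms(3) w unfolding models_def by auto
  ultimately show "sat ?B v \<phi>" by simp
 qed
 ultimately show ?thesis unfolding finitely_satisfiable_def by blast
qed

declare split_paired_All [simp del] split_paired_Ex [simp del]

lemma tog_neq: "tog e x \<noteq> x"
 using mem_tog[of e e x] by blast

section \<open>From a certificate to a finite model\<close>

type_synonym vert = "cand \<times> bool"
type_synonym edg = "vert \<times> key list \<times> vert"

locale certificate =
 fixes \<phi> :: fm and l :: nat and Ls :: "key list list" and X :: "cand list" and c0 :: cand
 assumes unfo: "unfo \<phi>" and vars: "vars \<phi> \<subseteq> {0, 1}" and arity: "\<And>R. R \<in> syms \<phi> ==> arity R \<le> 2"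
  and okX: "\<And>c. c \<in> set X ==> okP \<phi> (fst c)" and witX: "\<And>c. c \<in> set X ==> wit \<phi> l Ls X c"
  and c0: "c0 \<in> set X" and Ls: "\<And>L. L \<in> set Ls ==> set L \<subseteq> set (all_keys \<phi>)"
begin

text \<open>The Boolean component makes the graph free of loops.\<close>

definition edges :: "edg set" where
 "edges = {((c, f), L, (c', \<not> f)) | c f L c'. c \<in> set X \<and> c' \<in> set X \<and> L \<in> set Ls \<and>
   edge \<phi> (fst c) L (fst c') \<and> pot_ok \<phi> l (snd c) L (snd c')}"

definition esrc :: "edg => vert" where "esrc e = fst e"
definition edst :: "edg => vert" where "edst e = snd (snd e)"
definition elab :: "edg => key list" where "elab e = fst (snd e)"

definition dfw :: "edg => key => bool" where "dfw e k \<longleftrightarrow> fst k \<in> set (drs \<phi>) \<and> k \<in> set (elab e)"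
definition dbw :: "edg => key => bool" where "dbw e k \<longleftrightarrow> fst k \<in> set (drs \<phi>) \<and> flip k \<in> set (elab e)"

text \<open>One number per relation serves both directions: the inverse key takes it with the
  opposite sign, so that a two-way edge has to keep it constant.\<close>

definition vpot :: "key => vert => int" where
 "vpot k v = (if snd k then int (pval l (fst k) (snd (fst v))) else - int (pval l (fst k) (snd (fst v))))"

abbreviation vp :: "vert => prof" where "vp v \<equiv> fst (fst v)"
abbreviation vt :: "vert => tp" where "vt v \<equiv> fst (fst (fst v))"

lemma finite_edges: "finite edges"
proof (rule finite_subset)
 show "edges \<subseteq> (set X \<times> UNIV) \<times> set Ls \<times> (set X \<times> UNIV)" unfolding edges_def by auto
 show "finite ((set X \<times> (UNIV :: bool set)) \<times> set Ls \<times> (set X \<times> (UNIV :: bool set)))" by simp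
qed

lemma edgesI: "c \<in> set X ==> c' \<in> set X ==> L \<in> set Ls ==> edge \<phi> (fst c) L (fst c') ==>
  pot_ok \<phi> l (snd c) L (snd c') ==> ((c, f), L, (c', \<not> f)) \<in> edges"
 unfolding edges_def by blast

lemma edgesD:
 assumes "e \<in> edges"
 shows "fst (esrc e) \<in> set X" "fst (edst e) \<in> set X" "esrc e \<noteq> edst e"
  "edge \<phi> (vp (esrc e)) (elab e) (vp (edst e))" "pot_ok \<phi> l (snd (fst (esrc e))) (elab e) (snd (fst (edst e)))"
 using assms unfolding edges_def esrc_def edst_def elab_def by auto

lemma pot_okD:
 "pot_ok \<phi> l r L r' ==> fst k \<in> set (drs \<phi>) ==> k \<in> set L ==>
  (if flip k \<in> set L then pval l (fst k) r = pval l (fst k) r'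
   else if snd k then pval l (fst k) r' < pval l (fst k) r else pval l (fst k) r < pval l (fst k) r')"
 unfolding pot_ok_def dkeys_def plt_iff peq_iff by simp

sublocale cover edges esrc edst dfw dbw vpot
proof
 fix e k assume e: "e \<in> edges"
 note po = edgesD(5)[OF e]
 show "vpot k (edst e) \<le> vpot k (esrc e)" if "dfw e k"
  using pot_okD[OF po, of k] that by (auto simp: dfw_def vpot_def split: if_splits)
 show "vpot k (esrc e) \<le> vpot k (edst e)" if "dbw e k"
  using pot_okD[OF po, of "flip k"] that by (auto simp: dbw_def vpot_def split: if_splits)
 show "vpot k (edst e) < vpot k (esrc e)" if "dfw e k" "\<not> dbw e k"
  using pot_okD[OF po, of k] that by (auto simp: dfw_def dbw_def vpot_def split: if_splits)
 show "vpot k (esrc e) < vpot k (edst e)" if "dbw e k" "\<not> dfw e k"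
  using pot_okD[OF po, of "flip k"] that by (auto simp: dfw_def dbw_def vpot_def split: if_splits)
qed

lemma arc_flip: "arc {k} e v v' \<longleftrightarrow> arc {flip k} e v' v"
 unfolding arc_def dfw_def dbw_def by auto

lemma hop_flip: "(b, b') \<in> hop k \<longleftrightarrow> (b', b) \<in> hop (flip k)"
proof -
 have t: "x' = tog e x \<longleftrightarrow> x = tog e x'" for x x' and e :: edg by (auto simp: set_eq_iff)
 show ?thesis unfolding hop_def using arc_flip[of k] t by (auto split: prod.splits)
qed

lemma hops_flip: "(b, b') \<in> (hop k)\<^sup>+ \<longleftrightarrow> (b', b) \<in> (hop (flip k))\<^sup>+"
proof -
 have "hop (flip k) = (hop k)\<inverse>"
 proof (rule set_eqI)
  fix p show "p \<in> hop (flip k) \<longleftrightarrow> p \<in> (hop k)\<inverse>"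
   using hop_flip[of "snd p" "fst p" k] by (cases p) simp
 qed
 then show ?thesis by (simp add: trancl_converse)
qed

text \<open>The graph is restricted to the component of \<open>c0\<close>. Inside it even points
  without a common key are joined by a path, so that coverings reach every pair and nullary symbols
  agree.\<close>

definition verts :: "vert set" where
 "verts = {v. ((c0, False), v) \<in> {(u, u'). \<exists>e\<in>edges. arc {} e u u'}\<^sup>*}"

lemma verts_X: "v \<in> verts ==> fst v \<in> set X"
proof -
 assume "v \<in> verts"
 then have "((c0, False), v) \<in> {(u, u'). \<exists>e\<in>edges. arc {} e u u'}\<^sup>*" by (simp add: verts_def)
 then show ?thesis by (induction rule: rtrancl_induct) (use c0 edgesD in \<open>auto simp: arc_def\<close>)
qed

lemma verts_arc: "v \<in> verts ==> e \<in> edges ==> arc Ks e v v' ==> v' \<in> verts"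
proof -
 assume "v \<in> verts" "e \<in> edges" "arc Ks e v v'"
 then have "(v, v') \<in> {(u, u'). \<exists>e\<in>edges. arc {} e u u'}" unfolding arc_def by auto
 then show ?thesis using \<open>v \<in> verts\<close> unfolding verts_def by (auto intro: rtrancl_into_rtrancl)
qed

lemma verts_c0: "(c0, False) \<in> verts" by (simp add: verts_def)

lemma finite_verts: "finite verts"
proof (rule finite_subset)
 show "verts \<subseteq> set X \<times> UNIV" using verts_X by auto
qed simp

text \<open>Transport of a covering along one edge keeps the keys that the edge admits in this
  direction, and all of \<open>Ks\<close> are such.\<close>

lemma covers_step:
 assumes "e \<in> edges" "arc Ks e u u'" "covers (snd (vp u')) (%k. k \<in> Ks) (dkeys \<phi>) \<beta>" "Ks \<subseteq> set (dkeys \<phi>)"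
 shows "covers (snd (vp u)) (%k. k \<in> Ks) (dkeys \<phi>) \<beta>"
proof -
 note ed = edgesD(4)[OF assms(1), unfolded edge_def]
 obtain q where q: "q \<in> set (snd (vp u'))" "snd q = \<beta>" "\<forall>k\<in>set (dkeys \<phi>). k \<in> Ks --> k \<in> set (fst q)"
  using assms(3) unfolding covers_def by blast
 from assms(2) show ?thesis unfolding arc_def
 proof (elim disjE conjE)
  assume u: "u = esrc e" "u' = edst e" and fw: "\<forall>k\<in>Ks. dfw e k"
  have "covers (snd (vp u)) (%k. k \<in> set (elab e)) (fst q) (snd q)" using ed q(1) unfolding u by blast
  then show ?thesis using q fw assms(4) unfolding covers_def dfw_def by blast
 next
  assume u: "u = edst e" "u' = esrc e" and bw: "\<forall>k\<in>Ks. dbw e k"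
  have "covers (snd (vp u)) (%k. flip k \<in> set (elab e)) (fst q) (snd q)" using ed q(1) unfolding u by blast
  then show ?thesis using q bw assms(4) unfolding covers_def dbw_def by blast
 qed
qed

lemma covers_mono: "covers D P ks \<beta> ==> (\<And>k. k \<in> set ks ==> Q k ==> P k) ==> covers D Q ks \<beta>"
 unfolding covers_def by blast

lemma covers_arc:
 assumes "e \<in> edges" "arc Ks e u u'" "Ks \<subseteq> set (dkeys \<phi>)"
 shows "covers (snd (vp u)) (%k. k \<in> Ks) (dkeys \<phi>) (vt u')"
proof -
 note ed = edgesD(4)[OF assms(1), unfolded edge_def]
 from assms(2) show ?thesis unfolding arc_def
 proof (elim disjE conjE)
  assume u: "u = esrc e" "u' = edst e" and fw: "\<forall>k\<in>Ks. dfw e k"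
  have "covers (snd (vp u)) (%k. k \<in> set (elab e)) (dkeys \<phi>) (vt u')" using ed unfolding u by (elim conjE)
  then show ?thesis by (rule covers_mono) (use fw in \<open>simp add: dfw_def\<close>)
 next
  assume u: "u = edst e" "u' = esrc e" and bw: "\<forall>k\<in>Ks. dbw e k"
  have "covers (snd (vp u)) (%k. flip k \<in> set (elab e)) (dkeys \<phi>) (vt u')" using ed unfolding u by (elim conjE)
  then show ?thesis by (rule covers_mono) (use bw in \<open>simp add: dbw_def\<close>)
 qed
qed

lemma covers_path:
 assumes "(u, u') \<in> {(u, u'). \<exists>e\<in>edges. arc Ks e u u'}\<^sup>+" "Ks \<subseteq> set (dkeys \<phi>)"
 shows "covers (snd (vp u)) (%k. k \<in> Ks) (dkeys \<phi>) (vt u')"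
 using assms(1)
proof (induction rule: converse_trancl_induct)
 case (base y) then show ?case using covers_arc assms(2) by blast
next
 case (step y z) then show ?case using covers_step assms(2) by blast
qed

definition points :: "(vert \<times> edg set) set" where "points = verts \<times> Pow edges"

lemma finite_points: "finite points"
 unfolding points_def using finite_verts finite_edges by simp

lemma points_fin: "b \<in> points ==> finite (snd b)"
 unfolding points_def mem_Times_iff using finite_edges by (auto intro: finite_subset)

lemma points_tog: "(v, x) \<in> points ==> e \<in> edges ==> arc Ks e v v' ==> (v', tog e x) \<in> points"
 unfolding points_def using verts_arc[of v e Ks v'] by (auto simp: tog_def)

lemma points_vt: "b \<in> points ==> fst (fst b) \<in> set X"
 unfolding points_def using verts_X by auto

definition link :: "key => (vert \<times> edg set) => (vert \<times> edg set) => bool" where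
 "link k b b' \<longleftrightarrow> (\<exists>e\<in>edges. snd b' = tog e (snd b) \<and>
   ((fst b = esrc e \<and> fst b' = edst e \<and> k \<in> set (elab e)) \<or> (fst b = edst e \<and> fst b' = esrc e \<and> flip k \<in> set (elab e))))"

text \<open>Between distinct points, base relations hold along single edges only, whereas
  distinguished ones are transitive closures of hops; transitivity and compatibility with inverses
  are then built in.\<close>

definition brel :: "key => (vert \<times> edg set) => (vert \<times> edg set) => bool" where
 "brel k b b' \<longleftrightarrow> (b = b' \<and> fst k \<in> set (fst (vt (fst b)))) \<or>
   (if is_dist (fst k) then (b, b') \<in> (hop k)\<^sup>+ else link k b b')"

lemma brel_flip: "brel k b b' \<longleftrightarrow> brel (flip k) b' b"
proof -
 have t: "x' = tog e x \<longleftrightarrow> x = tog e x'" for x x' and e :: edg by (auto simp: set_eq_iff)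
 have "link k b b' \<longleftrightarrow> link (flip k) b' b" unfolding link_def using t by auto
 then show ?thesis unfolding brel_def using hops_flip[of b b' k] by auto
qed

lemma hop_drs: "(b, b') \<in> hop k ==> fst k \<in> set (drs \<phi>)"
 unfolding hop_def arc_def dfw_def dbw_def by auto

lemma hops_drs: "(b, b') \<in> (hop k)\<^sup>+ ==> fst k \<in> set (drs \<phi>)"
 by (induction rule: trancl_induct) (auto dest: hop_drs)

text \<open>A return to the vertex forces the first step to be two-way (\<open>hops_return\<close>),
  and two-way keys are loops by the last condition of \<open>edge\<close>.\<close>

lemma hops_loop:
 assumes "((v, x), (v, y)) \<in> (hop k)\<^sup>+"
 shows "fst k \<in> set (fst (vt v))"
proof -
 obtain v' x' where h: "((v, x), (v', x')) \<in> hop k" "((v', x'), (v, y)) \<in> (hop k)\<^sup>*"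
  using assms by (metis converse_tranclE prod.collapse rtrancl.rtrancl_refl trancl_into_rtrancl)
 obtain e where e: "e \<in> edges" "arc {k} e v v'" "arc {k} e v' v" using hops_return[OF h] by blast
 note ed = edgesD(4)[OF e(1), unfolded edge_def]
 have "k \<in> set (elab e)" "flip k \<in> set (elab e)" "fst k \<in> set (drs \<phi>)" "v = esrc e \<or> v = edst e"
  using e(2,3) edgesD(3)[OF e(1)] unfolding arc_def dfw_def dbw_def by auto
 then show ?thesis using ed unfolding dkeys_def by auto
qed

lemma brel_same: "brel k b b \<longleftrightarrow> fst k \<in> set (fst (vt (fst b)))"
proof -
 have "\<not> link k b b" unfolding link_def using tog_neq by metis
 moreover have "(b, b) \<in> (hop k)\<^sup>+ ==> fst k \<in> set (fst (vt (fst b)))"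
  using hops_loop[of "fst b" "snd b" "snd b" k] by simp
 ultimately show ?thesis unfolding brel_def by auto
qed

lemma okX_point: "b \<in> points ==> okP \<phi> (vp (fst b))"
 using okX points_vt by blast

text \<open>Points that differ by one edge between their vertices are related only by keys of that
  edge (\<open>hops_single\<close>), which was checked for violations. Between other distinct points
  only distinguished relations hold; over different vertices these have a common path, along which a
  covering entry is transported.\<close>

lemma brel_no_viol:
 assumes b: "b \<in> points" "b' \<in> points" "b \<noteq> b'"
 shows "\<exists>P. (\<forall>k. brel k b b' --> P k) \<and> no_viol \<phi> (vt (fst b)) P (vt (fst b'))"
proof (cases "\<exists>e\<in>edges. snd b' = tog e (snd b) \<and> ((fst b = esrc e \<and> fst b' = edst e) \<or> (fst b = edst e \<and> fst b' = esrc e))")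
 case True
 then obtain e where e: "e \<in> edges" "snd b' = tog e (snd b)"
  "(fst b = esrc e \<and> fst b' = edst e) \<or> (fst b = edst e \<and> fst b' = esrc e)" by blast
 note ed = edgesD(4)[OF e(1), unfolded edge_def]
 have uniq: "e' = e" if "snd b' = tog e' (snd b)" for e'
 proof -
  have "e' \<in> tog e (snd b) \<longleftrightarrow> e' \<in> tog e' (snd b)" using that e(2) by simp
  then show ?thesis by auto
 qed
 define P where "P k \<longleftrightarrow> (if fst b = esrc e then k \<in> set (elab e) else flip k \<in> set (elab e))" for k
 have "P k" if "brel k b b'" for k
 proof (cases "is_dist (fst k)")
  case True
  then have "(b, b') \<in> (hop k)\<^sup>+" using that b(3) unfolding brel_def by auto
  then have "((fst b, snd b), (fst b', tog e (snd b))) \<in> (hop k)\<^sup>*" using e(2) by (metis prod.collapse trancl_into_rtrancl)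
  then have "arc {k} e (fst b) (fst b')" by (rule hops_single[OF _ e(3) edgesD(3)[OF e(1)]])
  then show ?thesis using edgesD(3)[OF e(1)] unfolding P_def arc_def dfw_def dbw_def by auto
 next
  case False
  then have "link k b b'" using that b(3) unfolding brel_def by auto
  then show ?thesis using uniq edgesD(3)[OF e(1)] unfolding link_def P_def by auto
 qed
 moreover have "no_viol \<phi> (vt (fst b)) P (vt (fst b'))"
  using e(3) ed edgesD(3)[OF e(1)] unfolding P_def by (cases "fst b = esrc e") auto
 ultimately show ?thesis by blast
next
 case False
 define Ks where "Ks = {k. brel k b b'}"
 have hops: "(b, b') \<in> (hop k)\<^sup>+" if "k \<in> Ks" for k
  using that False b(3) unfolding Ks_def brel_def link_def by (auto split: if_splits)
 have Ksub: "Ks \<subseteq> set (dkeys \<phi>)"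
  using hops hops_drs unfolding dkeys_def by (meson set_both_keys subsetI)
 have "covers (snd (vp (fst b))) (%k. k \<in> Ks) (dkeys \<phi>) (vt (fst b'))"
 proof (cases "fst b = fst b'")
  case True
  have "fst k \<in> set (fst (vt (fst b)))" if "k \<in> Ks" for k
   using hops[OF that] hops_loop[of "fst b" "snd b" "snd b'"] True by (metis prod.collapse)
  moreover have "covers (snd (vp (fst b))) (%k. fst k \<in> set (fst (vt (fst b)))) (dkeys \<phi>) (vt (fst b))"
   using okX_point[OF b(1)] unfolding okP_def by blast
  ultimately show ?thesis unfolding covers_def True by blast
 next
  case neq: False
  have "(fst b, fst b') \<in> {(u, u'). \<exists>e\<in>edges. arc Ks e u u'}\<^sup>*"
  proof (cases "Ks = {}")
   case True
   \<comment> \<open>Without a common key the cut argument does not apply; the pair is then joined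
     through \<open>c0\<close>, as \<open>arc {}\<close> may be traversed both ways.\<close>
   have "sym {(u, u'). \<exists>e\<in>edges. arc {} e u u'}" unfolding arc_def by (auto intro!: symI)
   moreover have "((c0, False), fst b) \<in> {(u, u'). \<exists>e\<in>edges. arc {} e u u'}\<^sup>*"
    "((c0, False), fst b') \<in> {(u, u'). \<exists>e\<in>edges. arc {} e u u'}\<^sup>*"
    using b unfolding points_def verts_def by auto
   ultimately show ?thesis unfolding True by (meson rtrancl_trans sym_rtrancl symD)
  next
   case nonempty: False
   show ?thesis
   proof (rule common_path[OF nonempty])
    show "((fst b, snd b), (fst b', snd b')) \<in> (hop k)\<^sup>*" if "k \<in> Ks" for k
     using hops[OF that] by (simp add: trancl_into_rtrancl)
   qed (rule points_fin[OF b(1)])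
  qed
  then have "(fst b, fst b') \<in> {(u, u'). \<exists>e\<in>edges. arc Ks e u u'}\<^sup>+"
   using rtranclD[of "fst b" "fst b'"] neq by blast
  then show ?thesis by (rule covers_path[OF _ Ksub])
 qed
 then obtain q where q: "q \<in> set (snd (vp (fst b)))" "snd q = vt (fst b')" "\<forall>k\<in>set (dkeys \<phi>). k \<in> Ks --> k \<in> set (fst q)"
  unfolding covers_def by blast
 have "no_viol \<phi> (vt (fst b)) (%k. k \<in> set (fst q)) (vt (fst b'))"
  using okX_point[OF b(1)] q(1) unfolding okP_def q(2)[symmetric] by blast
 moreover have "\<forall>k. brel k b b' --> k \<in> set (fst q)" using q(3) Ksub unfolding Ks_def by blast
 ultimately show ?thesis by (intro exI[of _ "%k. k \<in> set (fst q)"] conjI)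
qed

lemma nullary_agree:
 assumes "b \<in> points" "R \<in> set (rsyms \<phi>)" "arity R = 0"
 shows "R \<in> set (fst (vt (fst b))) \<longleftrightarrow> R \<in> set (fst (vt (c0, False)))"
proof (cases "fst b = (c0, False)")
 case False
 have *: "((c0, False), fst b) \<in> {(u, u'). \<exists>e\<in>edges. arc {} e u u'}\<^sup>*"
  using assms(1) unfolding points_def verts_def by auto
 have "((c0, False), fst b) \<in> {(u, u'). \<exists>e\<in>edges. arc {} e u u'}\<^sup>+"
  using rtranclD[OF *] False by (elim disjE conjE) simp_all
 then have "covers (snd (vp (c0, False))) (%k. k \<in> {}) (dkeys \<phi>) (vt (fst b))" by (rule covers_path) simp
 then obtain q where "q \<in> set (snd (fst c0))" "snd q = vt (fst b)" unfolding covers_def by auto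
 then show ?thesis using okX[OF c0] assms(2,3) unfolding okP_def by fastforce
qed simp

definition model :: "(vert \<times> edg set) struct" where
 "model = \<lparr>universe = points, interp = (%R. {as. length as = arity R \<and> set as \<subseteq> points \<and>
   (case as of [] => R \<in> set (fst (fst (fst c0))) | [b] => R \<in> set (fst (vt (fst b)))
   | b # b' # _ => brel (key_of R True) b b')})\<rparr>"

lemma okT_point: "b \<in> points ==> okT \<phi> (vt (fst b))"
 using okX_point unfolding okP_def by blast

text \<open>A witness is the point reached by traversing the edge that \<open>wit\<close> supplies.
  It has at least the keys of the label, and further ones do no harm by \<open>evx_mono\<close>. The
  converse rests on \<open>brel_no_viol\<close>.\<close>

lemma exists_iff:
 assumes b: "b \<in> points" and ex: "Exists x a \<in> set (subf \<phi>)"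
 shows "Exists x a \<in> set (snd (vt (fst b))) \<longleftrightarrow> a \<in> set (snd (vt (fst b))) \<or>
  (\<exists>c\<in>points. c \<noteq> b \<and> evx x (vt (fst b)) (%k. brel k b c) (vt (fst c)) a)"
proof
 assume "Exists x a \<in> set (snd (vt (fst b)))"
 from witD[OF witX[OF points_vt[OF b]] ex this]
 show "a \<in> set (snd (vt (fst b))) \<or> (\<exists>c\<in>points. c \<noteq> b \<and> evx x (vt (fst b)) (%k. brel k b c) (vt (fst c)) a)"
 proof
  assume "\<exists>L\<in>set Ls. \<exists>c'\<in>set X. evx x (vt (fst b)) (%k. k \<in> set L) (fst (fst c')) a \<and>
   edge \<phi> (fst (fst (fst b))) L (fst c') \<and> pot_ok \<phi> l (snd (fst (fst b))) L (snd c')"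
  then obtain L c' where L: "L \<in> set Ls" "c' \<in> set X" "evx x (vt (fst b)) (%k. k \<in> set L) (fst (fst c')) a"
   "edge \<phi> (fst (fst (fst b))) L (fst c')" "pot_ok \<phi> l (snd (fst (fst b))) L (snd c')" by blast
  define e where "e = (fst b, L, (c', \<not> snd (fst b)))"
  have e: "e \<in> edges" "esrc e = fst b" "edst e = (c', \<not> snd (fst b))" "elab e = L"
   using edgesI[OF points_vt[OF b] L(2,1,4,5), of "snd (fst b)"]
   unfolding e_def esrc_def edst_def elab_def by simp_all
  define c where "c = (edst e, tog e (snd b))"
  have "c \<in> points" unfolding c_def
   by (rule points_tog[of "fst b" _ _ "{}"]) (use b e in \<open>auto simp: arc_def\<close>)
  moreover have "c \<noteq> b" unfolding c_def using tog_neq by (metis snd_conv)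
  moreover have "brel k b c" if "k \<in> set L" for k
  proof (cases "is_dist (fst k)")
   case False
   have "link k b c" unfolding link_def c_def using e that by auto
   then show ?thesis using False unfolding brel_def by simp
  next
   case True
   then have "fst k \<in> set (drs \<phi>)" using Ls[OF L(1)] that by (auto simp: all_keys_def drs_def)
   then have "((fst b, snd b), (edst e, tog e (snd b))) \<in> hop k"
    unfolding hop_def arc_def dfw_def using e that by auto
   then have "(b, c) \<in> (hop k)\<^sup>+" unfolding c_def by (cases b) auto
   then show ?thesis using True unfolding brel_def by simp
  qed
  then have "evx x (vt (fst b)) (%k. brel k b c) (fst (fst c')) a" by (rule evx_mono[OF L(3)])
  then have "evx x (vt (fst b)) (%k. brel k b c) (vt (fst c)) a" unfolding c_def e by simp
  ultimately show ?thesis by blast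
 qed simp
next
 assume "a \<in> set (snd (vt (fst b))) \<or> (\<exists>c\<in>points. c \<noteq> b \<and> evx x (vt (fst b)) (%k. brel k b c) (vt (fst c)) a)"
 then show "Exists x a \<in> set (snd (vt (fst b)))"
 proof
  assume "a \<in> set (snd (vt (fst b)))"
  then show ?thesis using okT_point[OF b] ex unfolding okT_def by fastforce
 next
  assume "\<exists>c\<in>points. c \<noteq> b \<and> evx x (vt (fst b)) (%k. brel k b c) (vt (fst c)) a"
  then obtain c where c: "c \<in> points" "c \<noteq> b" "evx x (vt (fst b)) (%k. brel k b c) (vt (fst c)) a" by blast
  obtain P where P: "\<forall>k. brel k b c --> P k" "no_viol \<phi> (vt (fst b)) P (vt (fst c))"
   using brel_no_viol[OF b c(1)] c(2) by blast
  have "evx x (vt (fst b)) P (vt (fst c)) a" by (rule evx_mono[OF c(3)]) (use P in blast)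
  then show ?thesis using no_violD[OF P(2) ex] by blast
 qed
qed

lemma nrm_Base: "arity R \<noteq> 2 ==> nrm R = R"
 by (cases R) auto

lemma interp_model:
 "[] \<in> interp model R \<longleftrightarrow> arity R = 0 \<and> R \<in> set (fst (vt (c0, False)))"
 "b \<in> points ==> [b] \<in> interp model R \<longleftrightarrow> arity R = 1 \<and> R \<in> set (fst (vt (fst b)))"
 "b \<in> points ==> b' \<in> points ==> [b, b'] \<in> interp model R \<longleftrightarrow> arity R = 2 \<and> brel (key_of R True) b b'"
 by (auto simp: model_def)

lemma sat_model_atom:
 assumes at: "Atom R xs \<in> set (subf \<phi>)" and b: "b \<in> points" "b' \<in> points"
 shows "map (%x. if x = 0 then b else b') xs \<in> interp model R \<longleftrightarrow>
  (if b = b' then Atom R xs \<in> set (snd (vt (fst b))) else ev (vt (fst b)) (%k. brel k b b') (vt (fst b')) (Atom R xs))"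
proof -
 have len: "length xs = arity R" using unfo_subf[OF unfo at] by simp
 have ar: "arity R \<le> 2" using arity syms_subf at by blast
 have xs: "set xs \<subseteq> {0, 1}" using vars_subf[OF at] vars by auto
 have okb: "Atom R xs \<in> set (snd (vt (fst c))) \<longleftrightarrow> nrm R \<in> set (fst (vt (fst c)))" if "c \<in> points" for c
  using okT_point[OF that] at unfolding okT_def by fastforce
 consider "xs = []" | x where "xs = [x]" "x = 0 \<or> x = 1" | x where "xs = [x, x]" "x = 0 \<or> x = 1" | "xs = [0, 1]" | "xs = [1, 0]"
 proof -
  have "length xs = 0 \<or> length xs = 1 \<or> length xs = 2" using len ar by auto
  then show ?thesis
   by (elim disjE) (use xs that in \<open>auto simp: length_Suc_conv numeral_2_eq_2\<close>)
 qed
 then show ?thesis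
 proof cases
  case 1
  have "nrm R = R" using nrm_Base len 1 by simp
  then show ?thesis using nullary_agree[OF b(1), of R] rsyms_Atom[OF at] okb[OF b(1)] len 1
   by (auto simp: interp_model unary_def)
 next
  case (2 x)
  have "nrm R = R" using nrm_Base len 2 by simp
  then show ?thesis using okb[OF b(1)] okb[OF b(2)] len 2 b by (auto simp: interp_model unary_def)
 next
  case (3 x)
  then show ?thesis using okb[OF b(1)] okb[OF b(2)] len b by (auto simp: interp_model unary_def brel_same)
 next
  case 4
  then show ?thesis using okb[OF b(1)] len b by (auto simp: interp_model unary_def brel_same)
 next
  case 5
  have "brel (key_of R True) b' b \<longleftrightarrow> brel (key_of R False) b b'"
   using brel_flip[of "key_of R True" b' b] key_of_flip[of R True] by simp
  then show ?thesis using okb[OF b(1)] len b 5 by (auto simp: interp_model unary_def brel_same)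
 qed
qed

definition agrees :: "(nat => vert \<times> edg set) => fm => bool" where
 "agrees v \<psi> \<longleftrightarrow> (sat model v \<psi> \<longleftrightarrow>
  (if v 0 = v 1 then \<psi> \<in> set (snd (vt (fst (v 0))))
   else ev (vt (fst (v 0))) (%k. brel k (v 0) (v 1)) (vt (fst (v 1))) \<psi>))"

lemma ev_unary: "1 \<notin> fv c ==> ev \<alpha> P \<beta> c = (c \<in> set (snd \<alpha>))"
 "1 \<in> fv c ==> 0 \<notin> fv c ==> ev \<alpha> P \<beta> c = (c \<in> set (snd \<beta>))"
 by (cases c; simp add: unary_def)+

text \<open>A formula with at most one free variable keeps its value when the other variable is
  moved to the same point, where the type decides. Only formulas with both variables free at
  distinct points remain.\<close>

lemma agreesI:
 assumes v: "v 0 \<in> points" "v 1 \<in> points"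
  and diag: "\<And>w. w 0 \<in> points ==> w 0 = w 1 ==> sat model w \<psi> \<longleftrightarrow> \<psi> \<in> set (snd (vt (fst (w 0))))"
  and off: "v 0 \<noteq> v 1 ==> 0 \<in> fv \<psi> ==> 1 \<in> fv \<psi> ==> agrees v \<psi>"
 shows "agrees v \<psi>"
proof (cases "v 0 = v 1")
 case True then show ?thesis using diag[of v] v unfolding agrees_def by simp
next
 case neq: False
 consider "1 \<notin> fv \<psi>" | "1 \<in> fv \<psi>" "0 \<notin> fv \<psi>" | "0 \<in> fv \<psi>" "1 \<in> fv \<psi>" by blast
 then show ?thesis
 proof cases
  case 1
  have "sat model v \<psi> = sat model (v(1 := v 0)) \<psi>" by (rule sat_cong) (use 1 in auto)
  then show ?thesis using diag[of "v(1 := v 0)"] v neq unfolding agrees_def ev_unary(1)[OF 1] by simp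
 next
  case 2
  have "sat model v \<psi> = sat model (v(0 := v 1)) \<psi>" by (rule sat_cong) (use 2 in auto)
  then show ?thesis using diag[of "v(0 := v 1)"] v neq unfolding agrees_def ev_unary(2)[OF 2] by simp
 next
  case 3 then show ?thesis using off neq by blast
 qed
qed

lemma sat_model: "\<psi> \<in> set (subf \<phi>) ==> v 0 \<in> points ==> v 1 \<in> points ==> agrees v \<psi>"
proof (induction \<psi> arbitrary: v)
 case (Atom R xs)
 have xs: "set xs \<subseteq> {0, 1}" using vars_subf[OF Atom(1)] vars by auto
 then have "map v xs = map (%x. if x = 0 then v 0 else v 1) xs" by auto
 then show ?case using sat_model_atom[OF Atom] unfolding agrees_def by (simp only: sat.simps)
next
 case (Eq x y)
 have xy: "x \<in> {0, 1}" "y \<in> {0, 1}" using vars_subf[OF Eq(1)] vars by auto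
 have okb: "Eq x y \<in> set (snd (vt (fst c)))" if "c \<in> points" for c
  using okT_point[OF that] Eq(1) unfolding okT_def by fastforce
 show ?case
 proof (rule agreesI[OF Eq(2,3)])
  show "sat model w (Eq x y) \<longleftrightarrow> Eq x y \<in> set (snd (vt (fst (w 0))))" if "w 0 \<in> points" "w 0 = w 1" for w
   using okb[OF that(1)] xy that(2) by auto
  show "agrees v (Eq x y)" if "v 0 \<noteq> v 1" "0 \<in> fv (Eq x y)" "1 \<in> fv (Eq x y)"
   using that unfolding agrees_def by (auto simp: unary_def)
 qed
next
 case (And a b)
 note ab = subf_sub(1)[OF And.prems(1)]
 have ok: "And a b \<in> set (snd (vt (fst c))) \<longleftrightarrow> a \<in> set (snd (vt (fst c))) \<and> b \<in> set (snd (vt (fst c)))"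
  if "c \<in> points" for c
  using okT_point[OF that] And.prems(1) unfolding okT_def by fastforce
 have IH: "agrees w a" "agrees w b" if "w 0 \<in> points" "w 1 \<in> points" for w
  using And.IH ab that by blast+
 show ?case
 proof (rule agreesI[OF And.prems(2,3)])
  show "sat model w (And a b) \<longleftrightarrow> And a b \<in> set (snd (vt (fst (w 0))))" if "w 0 \<in> points" "w 0 = w 1" for w
   using ok[OF that(1)] IH[of w] that unfolding agrees_def by simp
  show "agrees v (And a b)" if "v 0 \<noteq> v 1" "0 \<in> fv (And a b)" "1 \<in> fv (And a b)"
   using that IH[of v] And.prems unfolding agrees_def by (simp add: unary_def)
 qed
next
 case (Or a b)
 note ab = subf_sub(2)[OF Or.prems(1)]
 have ok: "Or a b \<in> set (snd (vt (fst c))) \<longleftrightarrow> a \<in> set (snd (vt (fst c))) \<or> b \<in> set (snd (vt (fst c)))"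
  if "c \<in> points" for c
  using okT_point[OF that] Or.prems(1) unfolding okT_def by fastforce
 have IH: "agrees w a" "agrees w b" if "w 0 \<in> points" "w 1 \<in> points" for w
  using Or.IH ab that by blast+
 show ?case
 proof (rule agreesI[OF Or.prems(2,3)])
  show "sat model w (Or a b) \<longleftrightarrow> Or a b \<in> set (snd (vt (fst (w 0))))" if "w 0 \<in> points" "w 0 = w 1" for w
   using ok[OF that(1)] IH[of w] that unfolding agrees_def by simp
  show "agrees v (Or a b)" if "v 0 \<noteq> v 1" "0 \<in> fv (Or a b)" "1 \<in> fv (Or a b)"
   using that IH[of v] Or.prems unfolding agrees_def by (simp add: unary_def)
 qed
next
 case (Neg a)
 have ok: "Neg a \<in> set (snd (vt (fst c))) \<longleftrightarrow> a \<notin> set (snd (vt (fst c)))" if "c \<in> points" for c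
  using okT_point[OF that] Neg.prems(1) unfolding okT_def by fastforce
 have IH: "agrees w a" if "w 0 \<in> points" "w 1 \<in> points" for w
  using Neg.IH subf_sub(4)[OF Neg.prems(1)] that by blast
 have "\<exists>x. fv a \<subseteq> {x}" using unfo_subf[OF unfo Neg.prems(1)] by simp
 then have nb: "\<not> (0 \<in> fv a \<and> 1 \<in> fv a)" by auto
 show ?case
 proof (rule agreesI[OF Neg.prems(2,3)])
  show "sat model w (Neg a) \<longleftrightarrow> Neg a \<in> set (snd (vt (fst (w 0))))" if "w 0 \<in> points" "w 0 = w 1" for w
   using ok[OF that(1)] IH[of w] that unfolding agrees_def by simp
 qed (use nb in simp)
next
 case (Exists x a)
 have x: "x = 0 \<or> x = 1" using vars_subf[OF Exists.prems(1)] vars by auto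
 have IH: "agrees w a" if "w 0 \<in> points" "w 1 \<in> points" for w
  using Exists.IH subf_sub(3)[OF Exists.prems(1)] that by blast
 show ?case
 proof (rule agreesI[OF Exists.prems(2,3)])
  fix w :: "nat => vert \<times> edg set" assume w: "w 0 \<in> points" "w 0 = w 1"
  have "sat model (w(x := c)) a \<longleftrightarrow> (if c = w 0 then a \<in> set (snd (vt (fst (w 0))))
    else evx x (vt (fst (w 0))) (%k. brel k (w 0) c) (vt (fst c)) a)" if c: "c \<in> points" for c
  proof (cases "x = 1")
   case True
   then show ?thesis using IH[of "w(x := c)"] w c unfolding agrees_def evx_def by auto
  next
   case False
   then have "x = 0" using x by simp
   then show ?thesis using IH[of "w(x := c)"] w c brel_flip[of _ c "w 0"] unfolding agrees_def evx_def by auto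
  qed
  moreover have "universe model = points" by (simp add: model_def)
  ultimately show "sat model w (Exists x a) \<longleftrightarrow> Exists x a \<in> set (snd (vt (fst (w 0))))"
   unfolding exists_iff[OF w(1) Exists.prems(1)] sat.simps using w(1) by metis
 qed (use x in auto)
qed

lemma trans_brel: "trans {(b, b'). b \<in> points \<and> b' \<in> points \<and> brel k b b'}" if "is_dist (fst k)"
proof (rule transI, clarsimp simp only: mem_Collect_eq case_prod_conv)
 fix b b' b'' assume "brel k b b'" "brel k b' b''"
 then show "brel k b b''" using that unfolding brel_def by (auto dest: trancl_trans)
qed

theorem certificate_sound:
 assumes "fv \<phi> = {}" "\<phi> \<in> set (snd (fst (fst c0)))"
 shows "finitely_satisfiable k \<phi>"
proof (rule finitely_satisfiableI)
 have uni: "universe model = points" by (simp add: model_def)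
 have p0: "((c0, False), {}) \<in> points" using verts_c0 by (simp add: points_def)
 have rel: "dist_rel model u = {(b, b'). b \<in> points \<and> b' \<in> points \<and> brel (key_of (Dist u) True) b b'}" for u
  unfolding dist_rel_def by (auto simp: model_def)
 have "is_struct model" unfolding is_struct_def using p0 by (auto simp: model_def)
 moreover have "trans (dist_rel model u)" for u unfolding rel by (rule trans_brel) simp
 moreover have "dist_rel model (2 * u) = (dist_rel model (2 * u - 1))\<inverse>" if "u \<in> {1..k}" for u
 proof -
  have "odd (2 * u - 1)" using that by auto
  then have "key_of (Dist (2 * u - 1)) True = flip (key_of (Dist (2 * u)) True)" by (simp add: flip_def)
  then show ?thesis unfolding rel using brel_flip by auto
 qed
 ultimately show "admissible k model" unfolding admissible_def by blast
 show "finite (universe model)" unfolding uni by (rule finite_points)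
 show "models model \<phi>" unfolding models_def
 proof (intro allI impI)
  fix v :: "nat => vert \<times> edg set"
  have "sat model v \<phi> = sat model (%_. ((c0, False), {})) \<phi>" by (rule sat_cong) (use assms in simp)
  moreover have "agrees (%_. ((c0, False), {})) \<phi>" by (rule sat_model[OF subf_self]) (use p0 in auto)
  ultimately show "sat model v \<phi>" using assms(2) unfolding agrees_def by simp
 qed
qed

end

section \<open>From a finite model to a certificate\<close>

definition types :: "fm => tp list" where
 "types \<phi> = List.product (subseqs (rsyms \<phi>)) (subseqs (subf \<phi>))"

definition covs :: "fm => (key list \<times> tp) list list" where
 "covs \<phi> = subseqs (List.product (subseqs (dkeys \<phi>)) (types \<phi>))"

definition pots :: "fm => nat => potential list" where
 "pots \<phi> l = subseqs (List.product (drs \<phi>) [0..<l])"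

definition cands :: "fm => nat => cand list" where
 "cands \<phi> l = List.product (List.product (types \<phi>) (covs \<phi>)) (pots \<phi> l)"

lemma filter_in_subseqs: "filter P xs \<in> set (subseqs xs)"
 by (induction xs) (auto simp: Let_def)

lemma subseqs_subset: "ys \<in> set (subseqs xs) ==> set ys \<subseteq> set xs"
 using subseqs_powset[of xs] by (metis PowD image_eqI image_set)

context
 fixes \<phi> :: fm and k :: nat and A :: "nat struct"
 assumes sent: "unfo2_S_sentence k \<phi>" and adm: "admissible k A" and fin: "finite (universe A)" and mod: "models A \<phi>"
begin

lemma unfo': "unfo \<phi>" and vars': "vars \<phi> \<subseteq> {0, 1}"
 and sig': "Dist u \<in> syms \<phi> ==> u \<in> {1..2 * k}" and sentence': "fv \<phi> = {}"
 using sent unfolding unfo2_S_sentence_def two_variable_def over_signature_def by auto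

definition hk :: "key => nat => nat => bool" where
 "hk q a b = (if snd q then [a, b] \<in> interp A (fst q) else [b, a] \<in> interp A (fst q))"

definition tau :: "nat => tp" where
 "tau a = (filter (%R. replicate (arity R) a \<in> interp A R) (rsyms \<phi>), filter (%\<psi>. sat A (%_. a) \<psi>) (subf \<phi>))"

text \<open>Taken as large as the model permits, so that each covering condition reduces to
  exhibiting an element.\<close>

definition cov :: "nat => (key list \<times> tp) list" where
 "cov a = filter (%q. \<exists>b\<in>universe A. tau b = snd q \<and> (\<forall>r\<in>set (fst q). hk r a b))
   (List.product (subseqs (dkeys \<phi>)) (types \<phi>))"

definition lab :: "nat => nat => key list" where
 "lab a b = filter (%q. hk q a b) (all_keys \<phi>)"

lemma hk_flip: "hk (flip q) a b = hk q b a"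
 by (simp add: hk_def)

lemma dist_odd: "Dist u \<in> set (drs \<phi>) ==> odd u \<and> u \<in> {1..2 * k}"
proof -
 assume "Dist u \<in> set (drs \<phi>)"
 then obtain R where "R \<in> syms \<phi>" "Dist u = nrm R" by (auto simp: drs_def rsyms_syms)
 then obtain w where w: "Dist w \<in> syms \<phi>" "u = (if odd w then w else w - 1)" by (cases R) auto
 from sig'[OF w(1)] w(2) show ?thesis by (auto split: if_splits)
qed

lemma hk_trans: "fst q \<in> set (drs \<phi>) ==> hk q a b ==> hk q b c ==> hk q a c"
proof -
 assume q: "fst q \<in> set (drs \<phi>)" and h: "hk q a b" "hk q b c"
 have "is_dist (fst q)" using q by (simp add: drs_def)
 then obtain u where u: "fst q = Dist u" by (cases "fst q") auto
 then have "trans (dist_rel A u)" using dist_odd[of u] q adm unfolding admissible_def by auto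
 then show ?thesis using h u unfolding hk_def dist_rel_def trans_def by (auto split: if_splits)
qed

lemma hk_key_of: "R \<in> syms \<phi> ==> arity R = 2 ==> hk (key_of R True) a b \<longleftrightarrow> [a, b] \<in> interp A R"
proof (cases R)
 case (Dist u)
 assume "R \<in> syms \<phi>"
 then have u: "u \<in> {1..2 * k}" using sig' Dist by blast
 show ?thesis
 proof (cases "odd u")
  case False
  then obtain w where w: "u = 2 * w" by blast
  then have "dist_rel A (2 * w) = (dist_rel A (2 * w - 1))\<inverse>" using u adm unfolding admissible_def by auto
  then show ?thesis using Dist w False unfolding hk_def dist_rel_def by (auto simp: set_eq_iff)
 qed (simp add: Dist hk_def)
qed (simp add: hk_def)

lemma nrm_loop: "R \<in> syms \<phi> ==> replicate (arity R) a \<in> interp A (nrm R) \<longleftrightarrow> replicate (arity R) a \<in> interp A R"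
proof (cases "arity R = 2")
 case True
 assume "R \<in> syms \<phi>"
 have "hk (key_of R True) a a \<longleftrightarrow> [a, a] \<in> interp A (nrm R)" by (simp add: hk_def)
 then show ?thesis using hk_key_of[OF \<open>R \<in> syms \<phi>\<close> True, of a a] True by (simp add: numeral_2_eq_2)
next
 case False then show ?thesis by (cases R) auto
qed

lemma mem_lp: "R \<in> set (fst (tau a)) \<longleftrightarrow> R \<in> set (rsyms \<phi>) \<and> replicate (arity R) a \<in> interp A R"
 by (auto simp: tau_def)

lemma mem_fs: "\<psi> \<in> set (snd (tau a)) \<longleftrightarrow> \<psi> \<in> set (subf \<phi>) \<and> sat A (%_. a) \<psi>"
 by (auto simp: tau_def)

lemma hk_loop: "fst q \<in> set (drs \<phi>) ==> hk q a a \<longleftrightarrow> fst q \<in> set (fst (tau a))"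
 unfolding mem_lp hk_def drs_def by (cases "fst q") (auto simp: numeral_2_eq_2)

definition two :: "nat => nat => nat => nat" where
 "two a b x = (if x = 0 then a else b)"

lemma sat_unary:
 assumes "\<psi> \<in> set (subf \<phi>)"
 shows "1 \<notin> fv \<psi> ==> sat A (two a b) \<psi> \<longleftrightarrow> \<psi> \<in> set (snd (tau a))"
  and "0 \<notin> fv \<psi> ==> sat A (two a b) \<psi> \<longleftrightarrow> \<psi> \<in> set (snd (tau b))"
proof -
 have fv: "fv \<psi> \<subseteq> {0, 1}" using fv_vars vars_subf[OF assms] vars' by blast
 show "sat A (two a b) \<psi> \<longleftrightarrow> \<psi> \<in> set (snd (tau a))" if "1 \<notin> fv \<psi>"
 proof -
  have "sat A (two a b) \<psi> = sat A (%_. a) \<psi>" by (rule sat_cong) (use that fv in \<open>auto simp: two_def\<close>)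
  then show ?thesis using assms by (simp add: mem_fs)
 qed
 show "sat A (two a b) \<psi> \<longleftrightarrow> \<psi> \<in> set (snd (tau b))" if "0 \<notin> fv \<psi>"
 proof -
  have "sat A (two a b) \<psi> = sat A (%_. b) \<psi>" by (rule sat_cong) (use that fv in \<open>auto simp: two_def\<close>)
  then show ?thesis using assms by (simp add: mem_fs)
 qed
qed

lemma unary_sat:
 assumes "\<psi> \<in> set (subf \<phi>)" "unary (tau a) (tau b) \<psi> False"
 shows "sat A (two a b) \<psi>"
 using assms sat_unary[OF assms(1), of a b] unfolding unary_def by (metis (full_types))

lemma atom_both:
 assumes "Atom R xs \<in> set (subf \<phi>)" "0 \<in> set xs" "1 \<in> set xs"
 shows "(map (two a b) xs \<in> interp A R \<longleftrightarrow> hk (key_of R (xs = [0, 1])) a b) \<and> arity R = 2 \<and> R \<in> syms \<phi>"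
proof -
 have R: "R \<in> syms \<phi>" using assms(1) syms_subf by blast
 have "length xs = arity R" "arity R \<le> 2"
  using unfo_subf[OF unfo' assms(1)] sent R unfolding unfo2_S_sentence_def two_variable_def by auto
 moreover have "set xs \<subseteq> {0, 1}" using vars_subf[OF assms(1)] vars' by auto
 moreover have "2 \<le> length xs"
 proof -
  have "card {0::nat, 1} \<le> card (set xs)" using assms by (intro card_mono) auto
  then show ?thesis using card_length[of xs] by simp
 qed
 ultimately have ar: "arity R = 2" "length xs = 2" "set xs \<subseteq> {0, 1}" by auto
 then have "xs = [0, 1] \<or> xs = [1, 0]" using assms by (auto simp: length_Suc_conv numeral_2_eq_2)
 then show ?thesis using hk_key_of[OF R ar(1)] key_of_flip[of R True] hk_flip[of "key_of R True"] ar R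
  by (auto simp: two_def)
qed

lemma key_in: "R \<in> syms \<phi> ==> arity R = 2 ==> key_of R d \<in> set (all_keys \<phi>)"
 by (auto simp: all_keys_def rsyms_syms)

lemma ev_sound:
 assumes P: "\<And>q. q \<in> set (all_keys \<phi>) ==> P q ==> hk q a b"
 shows "\<psi> \<in> set (subf \<phi>) ==> ev (tau a) P (tau b) \<psi> ==> sat A (two a b) \<psi>"
proof (induction \<psi>)
 case (Atom R xs)
 show ?case
 proof (cases "0 \<in> set xs \<and> 1 \<in> set xs")
  case True
  then show ?thesis using Atom atom_both[OF Atom(1), of a b] P key_in by (auto simp: unary_def)
 next
  case False
  then show ?thesis using Atom sat_unary[OF Atom(1), of a b] by (auto simp: unary_def split: if_splits)
 qed
next
 case (And c d)
 show ?case
 proof (cases "0 \<in> fv (And c d) \<and> 1 \<in> fv (And c d)")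
  case True
  then have "ev (tau a) P (tau b) c \<and> ev (tau a) P (tau b) d" using And.prems(2) by (auto simp: unary_def)
  then show ?thesis using And.IH subf_sub(1)[OF And.prems(1)] by simp
 next
  case False
  then show ?thesis using And.prems sat_unary[OF And.prems(1), of a b] by (auto simp: unary_def split: if_splits)
 qed
next
 case (Or c d)
 show ?case
 proof (cases "0 \<in> fv (Or c d) \<and> 1 \<in> fv (Or c d)")
  case True
  then have "ev (tau a) P (tau b) c \<or> ev (tau a) P (tau b) d" using Or.prems(2) by (auto simp: unary_def)
  then show ?thesis using Or.IH subf_sub(2)[OF Or.prems(1)] by auto
 next
  case False
  then show ?thesis using Or.prems sat_unary[OF Or.prems(1), of a b] by (auto simp: unary_def split: if_splits)
 qed
next
 case (Eq x y) then show ?case using unary_sat by (simp only: ev.simps)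
next
 case (Exists x c) then show ?case using unary_sat by (simp only: ev.simps)
next
 case (Neg c) then show ?case using unary_sat by (simp only: ev.simps)
qed

lemma ev_complete:
 assumes "a \<noteq> b"
 shows "\<psi> \<in> set (subf \<phi>) ==> sat A (two a b) \<psi> ==> ev (tau a) (%q. q \<in> set (lab a b)) (tau b) \<psi>"
proof (induction \<psi>)
 case (Atom R xs)
 then show ?case using sat_unary[OF Atom(1), of a b] atom_both[OF Atom(1), of a b] key_in
  by (auto simp: unary_def lab_def)
next
 case (Eq x y)
 have "vars (Eq x y) \<subseteq> {0, 1}" using vars_subf[OF Eq(1)] vars' by blast
 then show ?case using Eq sat_unary[OF Eq(1), of a b] assms by (auto simp: unary_def two_def)
next
 case (And c d)
 then show ?case using sat_unary[OF And.prems(1), of a b] subf_sub(1)[OF And.prems(1)] by (auto simp: unary_def)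
next
 case (Or c d)
 then show ?case using sat_unary[OF Or.prems(1), of a b] subf_sub(2)[OF Or.prems(1)] by (auto simp: unary_def)
next
 case (Exists x c)
 have "vars (Exists x c) \<subseteq> {0, 1}" using vars_subf[OF Exists.prems(1)] vars' by blast
 then have "\<not> (0 \<in> fv (Exists x c) \<and> 1 \<in> fv (Exists x c))" by auto
 then show ?case using Exists.prems sat_unary[OF Exists.prems(1), of a b] by (auto simp: unary_def)
next
 case (Neg c)
 have "\<exists>x. fv c \<subseteq> {x}" using unfo_subf[OF unfo' Neg.prems(1)] by simp
 then have "\<not> (0 \<in> fv (Neg c) \<and> 1 \<in> fv (Neg c))" by auto
 then show ?case using Neg.prems sat_unary[OF Neg.prems(1), of a b] by (auto simp: unary_def)
qed

lemma sat_exists: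
 assumes "Exists x c \<in> set (subf \<phi>)" "a \<in> universe A"
 shows "sat A (%_. a) (Exists x c) \<longleftrightarrow> (\<exists>b\<in>universe A. sat A (if x = 1 then two a b else two b a) c)"
proof -
 have x: "x = 0 \<or> x = 1" "vars c \<subseteq> {0, 1}" using vars_subf[OF assms(1)] vars' by auto
 have "sat A ((%_. a)(x := b)) c = sat A (if x = 1 then two a b else two b a) c" for b
  by (rule sat_cong) (use x fv_vars[of c] in \<open>auto simp: two_def\<close>)
 then show ?thesis by simp
qed

lemma evx_sound:
 assumes "\<And>q. q \<in> set (all_keys \<phi>) ==> P q ==> hk q a b" "c \<in> set (subf \<phi>)" "evx x (tau a) P (tau b) c"
 shows "sat A (if x = 1 then two a b else two b a) c"
proof (cases "x = 1")
 case True then show ?thesis using ev_sound[OF assms(1,2)] assms(3) by (simp add: evx_def)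
next
 case False
 have "hk q b a" if "q \<in> set (all_keys \<phi>)" "P (flip q)" for q
  using assms(1)[of "flip q"] that hk_flip[of "flip q" b a] by (simp add: all_keys_def)
 from ev_sound[of "%q. P (flip q)" b a, OF this assms(2)] False assms(3) show ?thesis by (simp add: evx_def)
qed

lemma evx_complete:
 assumes "a \<noteq> b" "c \<in> set (subf \<phi>)" "sat A (if x = 1 then two a b else two b a) c"
 shows "evx x (tau a) (%q. q \<in> set (lab a b)) (tau b) c"
proof (cases "x = 1")
 case True then show ?thesis using ev_complete[OF assms(1,2)] assms(3) by (simp add: evx_def)
next
 case False
 then have "ev (tau b) (%q. q \<in> set (lab b a)) (tau a) c" using ev_complete[OF assms(1)[symmetric] assms(2)] assms(3) by simp
 then have "ev (tau b) (%q. flip q \<in> set (lab a b)) (tau a) c"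
  by (rule ev_mono) (auto simp: lab_def hk_flip all_keys_def)
 then show ?thesis using False by (simp add: evx_def)
qed

lemma no_viol_hk:
 assumes "a \<in> universe A" "b \<in> universe A" "\<And>q. q \<in> set (all_keys \<phi>) ==> P q ==> hk q a b"
 shows "no_viol \<phi> (tau a) P (tau b)"
proof -
 have "\<not> evx x (tau a) P (tau b) c" if "Exists x c \<in> set (subf \<phi>)" "Exists x c \<notin> set (snd (tau a))" for x c
  using evx_sound[OF assms(3) subf_sub(3)[OF that(1)]] sat_exists[OF that(1) assms(1)] assms(2) that
  unfolding mem_fs by blast
 then show ?thesis unfolding no_viol_def by (auto split: fm.split)
qed

lemma tau_types: "tau a \<in> set (types \<phi>)"
 by (auto simp: tau_def types_def filter_in_subseqs)

lemma covers_cov: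
 assumes "b \<in> universe A" "set ks \<subseteq> set (dkeys \<phi>)" "\<And>q. q \<in> set ks ==> P q ==> hk q a b"
 shows "covers (cov a) P ks (tau b)"
proof -
 define U where "U = filter (%q. hk q a b) (dkeys \<phi>)"
 have "(U, tau b) \<in> set (cov a)"
  unfolding cov_def U_def using assms(1) tau_types filter_in_subseqs by auto
 moreover have "\<forall>q\<in>set ks. P q --> q \<in> set U" using assms(2,3) unfolding U_def by auto
 ultimately show ?thesis unfolding covers_def by (intro bexI[of _ "(U, tau b)"]) auto
qed

lemma covD:
 assumes "q \<in> set (cov a)"
 obtains b where "b \<in> universe A" "snd q = tau b" "set (fst q) \<subseteq> set (dkeys \<phi>)" "\<forall>r\<in>set (fst q). hk r a b"
proof -
 have q: "q \<in> set (List.product (subseqs (dkeys \<phi>)) (types \<phi>))"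
  "\<exists>b\<in>universe A. tau b = snd q \<and> (\<forall>r\<in>set (fst q). hk r a b)"
  using assms unfolding cov_def by simp_all
 have "fst q \<in> set (subseqs (dkeys \<phi>))" using q(1) unfolding set_product by (simp add: mem_Times_iff)
 then show ?thesis using subseqs_subset q(2) that by metis
qed

lemma dkeys_all: "r \<in> set (dkeys \<phi>) ==> r \<in> set (all_keys \<phi>)"
proof -
 have "is_dist R ==> arity R = 2" for R by (cases R) auto
 then show "r \<in> set (dkeys \<phi>) ==> r \<in> set (all_keys \<phi>)" by (auto simp: dkeys_def all_keys_def drs_def)
qed

lemma okP_model: "a \<in> universe A ==> okP \<phi> (tau a, cov a)"
proof -
 assume a: "a \<in> universe A"
 have "okT \<phi> (tau a)" unfolding okT_def
 proof
  fix \<psi> assume \<psi>: "\<psi> \<in> set (subf \<phi>)"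
  show "case \<psi> of Atom R xs => \<psi> \<in> set (snd (tau a)) \<longleftrightarrow> nrm R \<in> set (fst (tau a))
   | Eq x y => \<psi> \<in> set (snd (tau a))
   | And c b => \<psi> \<in> set (snd (tau a)) \<longleftrightarrow> c \<in> set (snd (tau a)) \<and> b \<in> set (snd (tau a))
   | Or c b => \<psi> \<in> set (snd (tau a)) \<longleftrightarrow> c \<in> set (snd (tau a)) \<or> b \<in> set (snd (tau a))
   | Exists x c => c \<in> set (snd (tau a)) --> \<psi> \<in> set (snd (tau a))
   | Neg c => \<psi> \<in> set (snd (tau a)) \<longleftrightarrow> c \<notin> set (snd (tau a))"
  proof (cases \<psi>)
   case (Atom R xs)
   have "R \<in> syms \<phi>" using \<psi> syms_subf unfolding Atom by blast
   moreover have "map (%_. a) xs = replicate (arity R) a"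
    using unfo_subf[OF unfo' \<psi>] Atom by (simp add: map_replicate_const)
   ultimately show ?thesis using \<psi> nrm_loop[of R a] rsyms_Atom[of R xs] unfolding Atom by (simp add: mem_fs mem_lp)
  next
   case (Exists x c)
   have "(%_. a)(x := a) = (%_. a)" by auto
   then show ?thesis using \<psi> a unfolding Exists by (auto simp: mem_fs intro!: bexI[of _ a])
  next
   case (Eq x y) then show ?thesis using \<psi> by (simp add: mem_fs)
  next
   case (And c b) then show ?thesis using \<psi> subf_sub(1)[of c b \<phi>] by (simp add: mem_fs)
  next
   case (Or c b) then show ?thesis using \<psi> subf_sub(2)[of c b \<phi>] by (simp add: mem_fs)
  next
   case (Neg c) then show ?thesis using \<psi> subf_sub(4)[of c \<phi>] by (simp add: mem_fs)
  qed
 qed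
 moreover have "no_viol \<phi> (tau a) (%r. r \<in> set (fst q)) (snd q) \<and>
  (\<forall>R\<in>set (rsyms \<phi>). arity R = 0 --> (R \<in> set (fst (tau a)) \<longleftrightarrow> R \<in> set (fst (snd q))))" if q: "q \<in> set (cov a)" for q
 proof -
  obtain b where b: "b \<in> universe A" "snd q = tau b" "set (fst q) \<subseteq> set (dkeys \<phi>)" "\<forall>r\<in>set (fst q). hk r a b"
   by (rule covD[OF q])
  have "no_viol \<phi> (tau a) (%r. r \<in> set (fst q)) (tau b)" by (rule no_viol_hk[OF a b(1)]) (use b(4) in blast)
  then show ?thesis unfolding b(2) by (simp add: mem_lp)
 qed
 moreover have "covers (cov a) (%r. fst r \<in> set (fst (tau a))) (dkeys \<phi>) (tau a)"
  by (rule covers_cov[OF a]) (auto simp: hk_loop dkeys_def)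
 ultimately show ?thesis unfolding okP_def by auto
qed

lemma edge_model:
 assumes a: "a \<in> universe A" and b: "b \<in> universe A"
 shows "edge \<phi> (tau a, cov a) (lab a b) (tau b, cov b)"
 unfolding edge_def fst_conv snd_conv
proof (intro conjI ballI impI)
 have lab: "q \<in> set (lab a b) ==> hk q a b" for q by (simp add: lab_def)
 have lab': "flip q \<in> set (lab a b) ==> hk q b a" for q by (simp add: lab_def hk_flip)
 show "no_viol \<phi> (tau a) (%q. q \<in> set (lab a b)) (tau b)" by (rule no_viol_hk[OF a b lab])
 show "no_viol \<phi> (tau b) (%q. flip q \<in> set (lab a b)) (tau a)" by (rule no_viol_hk[OF b a lab'])
 show "covers (cov a) (%q. q \<in> set (lab a b)) (dkeys \<phi>) (tau b)" by (rule covers_cov[OF b order.refl lab])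
 show "covers (cov b) (%q. flip q \<in> set (lab a b)) (dkeys \<phi>) (tau a)" by (rule covers_cov[OF a order.refl lab'])
 show "covers (cov a) (%r. r \<in> set (lab a b)) (fst q) (snd q)" if q: "q \<in> set (cov b)" for q
 proof -
  obtain c where c: "c \<in> universe A" "snd q = tau c" "set (fst q) \<subseteq> set (dkeys \<phi>)" "\<forall>r\<in>set (fst q). hk r b c"
   by (rule covD[OF q])
  show ?thesis unfolding c(2)
  proof (rule covers_cov[OF c(1) c(3)])
   fix r assume r: "r \<in> set (fst q)" "r \<in> set (lab a b)"
   have "fst r \<in> set (drs \<phi>)" using c(3) r(1) unfolding dkeys_def by (meson set_both_keys subsetD)
   then show "hk r a c" using hk_trans lab[OF r(2)] c(4) r(1) by blast
  qed
 qed
 show "covers (cov b) (%r. flip r \<in> set (lab a b)) (fst q) (snd q)" if q: "q \<in> set (cov a)" for q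
 proof -
  obtain c where c: "c \<in> universe A" "snd q = tau c" "set (fst q) \<subseteq> set (dkeys \<phi>)" "\<forall>r\<in>set (fst q). hk r a c"
   by (rule covD[OF q])
  show ?thesis unfolding c(2)
  proof (rule covers_cov[OF c(1) c(3)])
   fix r assume r: "r \<in> set (fst q)" "flip r \<in> set (lab a b)"
   have "fst r \<in> set (drs \<phi>)" using c(3) r(1) unfolding dkeys_def by (meson set_both_keys subsetD)
   then show "hk r b c" using hk_trans lab'[OF r(2)] c(4) r(1) by blast
  qed
 qed
 fix q assume q: "q \<in> set (dkeys \<phi>)" "q \<in> set (lab a b)" "flip q \<in> set (lab a b)"
 have "hk q a b" "hk q b a" "fst q \<in> set (drs \<phi>)" using lab[OF q(2)] lab'[OF q(3)] q(1) by (auto simp: dkeys_def)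
 then have "hk q a a" "hk q b b" using hk_trans by blast+
 then show "fst q \<in> set (fst (tau a))" "fst q \<in> set (fst (tau b))"
  using hk_loop \<open>fst q \<in> set (drs \<phi>)\<close> by blast+
qed

text \<open>The element itself is counted together with those that it reaches. If the step to b
  cannot be reversed, a is missing from the count at b, so the decrease is strict even when a has no
  loop.\<close>

lemma rank_model:
 assumes "q \<in> set (dkeys \<phi>)" "a \<in> universe A" "b \<in> universe A" "hk q a b"
 defines "rk \<equiv> %a. card (insert a {c \<in> universe A. hk q a c})"
 shows "rk b \<le> rk a \<and> (\<not> hk (flip q) a b --> rk b < rk a)"
proof -
 have q: "fst q \<in> set (drs \<phi>)" using assms(1) by (simp add: dkeys_def)
 have sub: "insert b {c \<in> universe A. hk q b c} \<subseteq> insert a {c \<in> universe A. hk q a c}"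
  using assms(3,4) hk_trans[OF q] by auto
 have f: "finite (insert a {c \<in> universe A. hk q a c})" using fin by simp
 have "insert b {c \<in> universe A. hk q b c} \<subset> insert a {c \<in> universe A. hk q a c}" if "\<not> hk (flip q) a b"
 proof -
  have "a \<notin> insert b {c \<in> universe A. hk q b c}" using that assms(4) hk_flip[of q a b] by auto
  then show ?thesis using sub by blast
 qed
 then show ?thesis unfolding rk_def using card_mono[OF f sub] psubset_card_mono[OF f] by blast
qed

text \<open>Ranks taken from the model are compressed by \<open>bounded_potentials\<close> and
  written with l bits. The hypothesis says that l bits suffice: types times coverings bounds the
  profiles, and the power bounds the records.\<close>

theorem certificate_complete:
 assumes l: "2 * (length (types \<phi>) * length (covs \<phi>) * length (dkeys \<phi>) ^ length (dkeys \<phi>)) < 2 ^ l"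
 shows "\<exists>X. set X \<subseteq> set (cands \<phi> l) \<and>
  (\<forall>c\<in>set X. okP \<phi> (fst c) \<and> wit \<phi> l (subseqs (all_keys \<phi>)) X c) \<and> (\<exists>c\<in>set X. \<phi> \<in> set (snd (fst (fst c))))"
proof -
 define pr where "pr a = (tau a, cov a)" for a
 define ks where "ks = remdups (dkeys \<phi>)"
 define req where "req p i \<longleftrightarrow> (case i of (x, c) => Exists x c \<in> set (subf \<phi>) \<and> Exists x c \<in> set (snd (fst p)) \<and> c \<notin> set (snd (fst p)))"
  for p :: prof and i :: "nat \<times> fm"
 define ok where "ok p i L p' \<longleftrightarrow> (case i of (x, c) => \<exists>L'\<in>set (subseqs (all_keys \<phi>)). set L' = L \<and>
   evx x (fst p) (%q. q \<in> set L') (fst p') c \<and> edge \<phi> p L' p')" for p i L and p' :: prof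
 define rk where "rk a q = card (insert a {c \<in> universe A. hk q a c})" for a q
 define M where "M = (2::nat) ^ l - 1"
 have prA: "pr ` universe A \<subseteq> set (List.product (types \<phi>) (covs \<phi>))"
  unfolding pr_def covs_def cov_def using tau_types filter_in_subseqs by auto
 have cardP: "card (pr ` universe A) \<le> length (types \<phi>) * length (covs \<phi>)"
  using card_mono[OF _ prA] card_length[of "List.product (types \<phi>) (covs \<phi>)"] by (simp add: length_product)
 have "length ks ^ length ks \<le> length (dkeys \<phi>) ^ length (dkeys \<phi>)"
 proof -
  have le: "length ks \<le> length (dkeys \<phi>)" by (simp add: ks_def length_remdups_leq)
  show ?thesis
  proof (cases "dkeys \<phi> = []")
   case False
   have "length ks ^ length ks \<le> length (dkeys \<phi>) ^ length ks" by (rule power_mono[OF le]) simp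
   also have "\<dots> \<le> length (dkeys \<phi>) ^ length (dkeys \<phi>)" by (rule power_increasing[OF le]) (use False in \<open>simp add: Suc_le_eq\<close>)
   finally show ?thesis .
  qed (simp add: ks_def)
 qed
 then have "card (pr ` universe A) * length ks ^ length ks
   \<le> length (types \<phi>) * length (covs \<phi>) * length (dkeys \<phi>) ^ length (dkeys \<phi>)"
  by (rule mult_le_mono[OF cardP])
 then have bound: "2 * (card (pr ` universe A) * length ks ^ length ks) \<le> M"
  using l unfolding M_def by linarith
 have flp: "(R, \<not> d) \<in> set ks" if "(R, d) \<in> set ks" for R d using that by (simp add: ks_def dkeys_def)
 have W: "\<exists>a'\<in>universe A. \<exists>L. ok (pr a) i L (pr a')
   \<and> (\<forall>R d. (R, d) \<in> set ks --> (R, d) \<in> L -->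
      rk a' (R, d) \<le> rk a (R, d) \<and> ((R, \<not> d) \<notin> L --> rk a' (R, d) < rk a (R, d)))"
  if a: "a \<in> universe A" "req (pr a) i" for a i
 proof -
  obtain x c where i: "i = (x, c)" by (cases i)
  have ex: "Exists x c \<in> set (subf \<phi>)" "Exists x c \<in> set (snd (tau a))" "c \<notin> set (snd (tau a))"
   using a(2) unfolding req_def i pr_def by simp_all
  have exs: "sat A (%_. a) (Exists x c)" using ex(2) mem_fs by blast
  note cs = subf_sub(3)[OF ex(1)]
  obtain b where b: "b \<in> universe A" "sat A (if x = 1 then two a b else two b a) c" using sat_exists[OF ex(1) a(1)] exs by blast
  have "a \<noteq> b"
  proof
   assume "a = b"
   have "sat A (if x = 1 then two a b else two b a) c = sat A (%_. a) c"
    by (rule sat_cong) (use \<open>a = b\<close> in \<open>auto simp: two_def\<close>)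
   then show False using b(2) ex(3) cs unfolding mem_fs by blast
  qed
  have "ok (pr a) i (set (lab a b)) (pr b)"
   unfolding ok_def i pr_def using evx_complete[OF \<open>a \<noteq> b\<close> cs b(2)] edge_model[OF a(1) b(1)]
   by (auto intro!: bexI[of _ "lab a b"] simp: lab_def filter_in_subseqs)
  moreover have "rk b (R, d) \<le> rk a (R, d) \<and> ((R, \<not> d) \<notin> set (lab a b) --> rk b (R, d) < rk a (R, d))"
   if "(R, d) \<in> set ks" "(R, d) \<in> set (lab a b)" for R d
  proof -
   have q: "(R, d) \<in> set (dkeys \<phi>)" "(R, \<not> d) \<in> set (all_keys \<phi>)"
    using that(1) dkeys_all[of "(R, \<not> d)"] by (auto simp: ks_def dkeys_def)
   have "hk (R, d) a b" using that(2) by (simp add: lab_def)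
   from rank_model[OF q(1) a(1) b(1) this] q(2) show ?thesis unfolding rk_def by (auto simp: lab_def flip_def)
  qed
  ultimately show ?thesis using b(1) by blast
 qed
 have dist: "distinct ks" by (simp add: ks_def)
 obtain Y where Y: "\<forall>a\<in>universe A. \<exists>r. (pr a, r) \<in> Y"
  "\<forall>p r. (p, r) \<in> Y --> p \<in> pr ` universe A \<and> (\<forall>R. r R \<le> M)"
  "\<forall>p r i. (p, r) \<in> Y --> req p i --> (\<exists>p' r' L. (p', r') \<in> Y \<and> ok p i L p' \<and>
   (\<forall>R d. (R, d) \<in> set ks --> (R, d) \<in> L -->
    (if (R, \<not> d) \<in> L then r' R = r R else if d then r' R < r R else r R < r' R)))"
  by (rule bounded_potentials[where A = "universe A" and pr = pr and ks = ks and rk = rk and req = req and ok = ok and M = M,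
     OF fin dist flp W bound])
 define rb where "rb r = filter (%(R, j). bit (r R) j) (List.product (drs \<phi>) [0..<l])" for r :: "rsym => nat"
 have pval: "pval l R (rb r) = r R" if "R \<in> set (drs \<phi>)" "\<forall>R. r R \<le> M" for R r
 proof -
  have "pval l R (rb r) = bval (bit (r R)) l" by (rule bval_cong) (use that in \<open>auto simp: rb_def\<close>)
  moreover have "r R < 2 ^ l" using that(2) unfolding M_def by (metis Suc_pred' less_Suc_eq_le zero_less_numeral zero_less_power)
  ultimately show ?thesis by (simp add: bval_bit take_bit_nat_eq_self)
 qed
 define Z where "Z = (%(p, r). (p, rb r)) ` Y"
 have "Z \<subseteq> set (cands \<phi> l)"
  using Y(2) prA filter_in_subseqs unfolding Z_def cands_def pots_def rb_def by (auto simp: subset_iff; fastforce)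
 then obtain X where X: "set X = Z" by (meson finite_list finite_set finite_subset)
 have "okP \<phi> (fst c) \<and> wit \<phi> l (subseqs (all_keys \<phi>)) X c" if c: "c \<in> Z" for c
 proof -
  obtain p r where pr: "(p, r) \<in> Y" "c = (p, rb r)" using c unfolding Z_def by auto
  obtain a where a: "a \<in> universe A" "p = pr a" using Y(2) pr(1) by blast
  have rM: "\<forall>R. r R \<le> M" using Y(2) pr(1) by blast
  have "okP \<phi> p" using okP_model[OF a(1)] a(2) by (simp add: pr_def)
  moreover have "c' \<in> set (snd (fst p)) \<or> (\<exists>L\<in>set (subseqs (all_keys \<phi>)). \<exists>d\<in>set X.
    evx x (fst p) (%q. q \<in> set L) (fst (fst d)) c' \<and> edge \<phi> p L (fst d) \<and> pot_ok \<phi> l (rb r) L (snd d))"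
   if ex: "Exists x c' \<in> set (subf \<phi>)" "Exists x c' \<in> set (snd (fst p))" for x c'
  proof (cases "c' \<in> set (snd (fst p))")
   case False
   then have "req p (x, c')" using ex by (simp add: req_def)
   then obtain p' r' L where n: "(p', r') \<in> Y" "ok p (x, c') L p'"
    "\<forall>R d. (R, d) \<in> set ks --> (R, d) \<in> L -->
     (if (R, \<not> d) \<in> L then r' R = r R else if d then r' R < r R else r R < r' R)"
    using Y(3) pr(1) by blast
   obtain L' where L': "L' \<in> set (subseqs (all_keys \<phi>))" "set L' = L"
    "evx x (fst p) (%q. q \<in> set L') (fst p') c'" "edge \<phi> p L' p'" using n(2) unfolding ok_def by auto
   have rM': "\<forall>R. r' R \<le> M" using Y(2) n(1) by blast
   have "pot_ok \<phi> l (rb r) L' (rb r')" unfolding pot_ok_def plt_iff peq_iff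
   proof (intro ballI impI)
    fix q assume q: "q \<in> set (dkeys \<phi>)" "q \<in> set L'"
    have "fst q \<in> set (drs \<phi>)" using q(1) by (simp add: dkeys_def)
    then show "if flip q \<in> set L' then pval l (fst q) (rb r) = pval l (fst q) (rb r')
     else if snd q then pval l (fst q) (rb r') < pval l (fst q) (rb r) else pval l (fst q) (rb r) < pval l (fst q) (rb r')"
     using n(3)[rule_format, of "fst q" "snd q"] q L'(2) pval[OF _ rM, of "fst q"] pval[OF _ rM', of "fst q"]
     by (simp add: ks_def flip_def split: if_splits)
   qed
   moreover have "(p', rb r') \<in> set X" using n(1) unfolding X Z_def by force
   ultimately show ?thesis using L' by (metis fst_conv snd_conv)
  qed simp
  ultimately show ?thesis unfolding pr(2) wit_def by (auto split: fm.split)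
 qed
 moreover have "\<exists>c\<in>Z. \<phi> \<in> set (snd (fst (fst c)))"
 proof -
  obtain a where a: "a \<in> universe A" using adm unfolding admissible_def is_struct_def by blast
  obtain r where r: "(pr a, r) \<in> Y" using Y(1) a by blast
  have "sat A (%_. a) \<phi>" using mod a unfolding models_def by auto
  then have "\<phi> \<in> set (snd (fst (pr a)))" by (simp add: pr_def mem_fs subf_self)
  with r show ?thesis unfolding Z_def by force
 qed
 ultimately show ?thesis using \<open>Z \<subseteq> _\<close> X by blast
qed

end

section \<open>Polynomial-time functions on formulas\<close>

fun kids :: "fm => fm list" where
 "kids (And a b) = [a, b]"
| "kids (Or a b) = [a, b]"
| "kids (Exists x a) = [a]"
| "kids (Neg a) = [a]"
| "kids \<phi> = []"

lemma FP_kids: "FP f ==> FP (%x. kids (f x))"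
proof -
 have "FP (%\<psi>. case \<psi> of Atom R xs => [] | Eq y z => [] | And a b => [a, b] | Or a b => [a, b]
   | Exists y a => [a] | Neg a => [a])"
  by (intro FP_case_fm FP_id FP_const FP_Cons FP_fst FP_snd)
 moreover have "(%\<psi>. case \<psi> of Atom R xs => [] | Eq y z => [] | And a b => [a, b] | Or a b => [a, b]
   | Exists y a => [a] | Neg a => [a]) = kids"
  by (rule ext) (simp split: fm.split)
 ultimately have "FP kids" by simp
 then show "FP f ==> FP (%x. kids (f x))" by (rule FP_comp)
qed

lemma subf_kids: "subf \<phi> = \<phi> # concat (map subf (kids \<phi>))"
 by (cases \<phi>) auto

lemma sz_kids: "sz (kids \<phi>) \<le> sz \<phi>"
 by (cases \<phi>) (auto simp: sz_def ec_prod_def eval_nat_numeral)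

lemma sz_subf_mem: "\<psi> \<in> set (subf \<phi>) ==> sz \<psi> \<le> sz \<phi>"
 by (induction \<phi>) (auto simp: sz_def ec_prod_def)

lemma length_subf: "length (subf \<phi>) \<le> sz \<phi>"
 by (induction \<phi>) (auto simp: sz_def ec_prod_def)

text \<open>Preorder traversal with an explicit worklist, as recursion is available only in the form
  of iteration. The fold runs over the bits of the code, of which there are at least as many as
  subformulas.\<close>

definition visit :: "fm list \<times> fm list => bool => fm list \<times> fm list" where
 "visit s _ = (case fst s of [] => s | \<psi> # ws => (kids \<psi> @ ws, \<psi> # snd s))"

lemma visit_simps: "visit ([], out) u = ([], out)" "visit (\<psi> # ws, out) u = (kids \<psi> @ ws, \<psi> # out)"
 by (simp_all add: visit_def)

lemma visit_all: "length (concat (map subf ws)) \<le> length us ==>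
  foldl visit (ws, out) us = ([], rev (concat (map subf ws)) @ out)"
proof (induction us arbitrary: ws out)
 case Nil
 have "ws = []" using Nil subf_kids by (cases ws) auto
 then show ?case by simp
next
 case (Cons u us)
 show ?case
 proof (cases ws)
  case Nil
  then show ?thesis using Cons.IH[of "[]" out] by (simp add: visit_simps)
 next
  case (Cons \<psi> ws')
  have "foldl visit (kids \<psi> @ ws', \<psi> # out) us = ([], rev (concat (map subf (kids \<psi> @ ws'))) @ \<psi> # out)"
   by (rule Cons.IH) (use Cons.prems in \<open>simp add: Cons subf_kids[of \<psi>]\<close>)
  then show ?thesis by (simp add: Cons visit_simps subf_kids[of \<psi>])
 qed
qed

lemma FP_subf: "FP f ==> FP (%x. subf (f x))"
proof -
 have inv: "sz (fst (foldl visit ([\<phi>], []) us)) \<le> sz [\<phi>] \<and> length (snd (foldl visit ([\<phi>], []) us)) \<le> length us \<and>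
   (\<forall>\<psi> \<in> set (fst (foldl visit ([\<phi>], []) us)) \<union> set (snd (foldl visit ([\<phi>], []) us)). sz \<psi> \<le> sz \<phi>)" for \<phi> us
 proof (induction us rule: rev_induct)
  case (snoc u us)
  obtain ws out where s: "foldl visit ([\<phi>], []) us = (ws, out)" by (cases "foldl visit ([\<phi>], []) us")
  show ?case
  proof (cases ws)
   case Nil then show ?thesis using snoc s by (auto simp: visit_simps)
  next
   case (Cons \<psi> ws')
   have "sz (kids \<psi> @ ws') \<le> sz (\<psi> # ws')" using sz_append[of "kids \<psi>" ws'] sz_kids[of \<psi>] by simp
   moreover have "sz \<chi> \<le> sz \<phi>" if "\<chi> \<in> set (kids \<psi>)" for \<chi>
    using sz_mem[OF that] sz_kids[of \<psi>] snoc s Cons by auto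
   ultimately show ?thesis using snoc s Cons by (auto simp: visit_simps)
  qed
 qed simp
 have "FP (%\<phi>. foldl visit ([\<phi>], []) (bits (ec \<phi>)))"
 proof (rule FP_foldl[where B = "%\<phi>. (sz \<phi> + 2) + (sz \<phi> * (sz \<phi> + 1) + 1) + 1" and h = "%\<phi>. visit"])
  show "FP (%\<phi>. bits (ec \<phi>))" by (intro FP_bits FP_id)
  show "FP (%\<phi>. ([\<phi>], []))" by (intro FP_pair FP_Cons FP_const FP_id)
  show "FP (%p. visit (fst (snd p)) (snd (snd p)))" unfolding visit_def
   by (intro FP_case_list FP_pair FP_append FP_kids FP_Cons FP_fst FP_snd FP_id)
  show "pbound (%\<phi> :: fm. (sz \<phi> + 2) + (sz \<phi> * (sz \<phi> + 1) + 1) + 1)" by (intro pbound_intros)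
  fix \<phi> :: fm and ys zs assume ys: "bits (ec \<phi>) = ys @ zs"
  let ?s = "foldl visit ([\<phi>], []) ys"
  have "length ys \<le> sz \<phi>" by (simp add: sz_def ys)
  have "sz (snd ?s) \<le> length (snd ?s) * (sz \<phi> + 1) + 1" by (rule sz_list_le) (use inv in blast)
  also have "\<dots> \<le> sz \<phi> * (sz \<phi> + 1) + 1"
   using inv[of \<phi> ys] \<open>length ys \<le> sz \<phi>\<close> by (intro add_le_mono1 mult_le_mono1) linarith
  finally have "sz (snd ?s) \<le> sz \<phi> * (sz \<phi> + 1) + 1" .
  moreover have "sz (fst ?s) \<le> sz \<phi> + 2" using inv[of \<phi> ys] by simp
  moreover have "sz ?s = 1 + sz (fst ?s) + sz (snd ?s)" by (metis prod.collapse sz_simps(1))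
  ultimately show "sz ?s \<le> (sz \<phi> + 2) + (sz \<phi> * (sz \<phi> + 1) + 1) + 1" by linarith
 qed
 then have "FP (%\<phi>. rev (snd (foldl visit ([\<phi>], []) (bits (ec \<phi>)))))" by (intro FP_rev FP_snd)
 moreover have "rev (snd (foldl visit ([\<phi>], []) (bits (ec \<phi>)))) = subf \<phi>" for \<phi>
  using visit_all[of "[\<phi>]" "bits (ec \<phi>)" "[]"] length_subf[of \<phi>] by (simp add: sz_def)
 ultimately have "FP subf" by simp
 then show "FP f ==> FP (%x. subf (f x))" by (rule FP_comp)
qed

definition look :: "'r => (fm \<times> 'r) list => fm => 'r" where
 "look d t \<psi> = (case filter (%p. fst p = \<psi>) t of [] => d | p # ps => snd p)"

text \<open>Recursion over formulas, by filling a table from the subformulas upwards.\<close>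

lemma FP_fm_rec:
 fixes F :: "'x::enc => fm => 'r::enc" and G :: "'x => fm => 'r list => 'r"
 assumes G: "FP (%p. G (fst p) (fst (snd p)) (snd (snd p)))" and F: "\<And>x \<psi>. F x \<psi> = G x \<psi> (map (F x) (kids \<psi>))"
  and B: "pbound B" "\<And>x \<phi> \<psi>. \<psi> \<in> set (subf \<phi>) ==> sz (F x \<psi>) \<le> B (x, \<phi>)"
 shows "FP (%p. F (fst p) (snd p))"
proof -
 fix d :: 'r
 let ?st = "%x t \<psi>. (\<psi>, G x \<psi> (map (look d t) (kids \<psi>))) # t"
 define valid where "valid x t \<longleftrightarrow> (\<forall>p\<in>set t. snd p = F x (fst p))" for x t
 have look: "look d t \<psi> = F x \<psi>" if "valid x t" "\<psi> \<in> fst ` set t" for x t \<psi>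
 proof -
  have "filter (%p. fst p = \<psi>) t \<noteq> []" using that(2) by (auto simp: filter_empty_conv)
  then obtain p ps where p: "filter (%p. fst p = \<psi>) t = p # ps" by (cases "filter (%p. fst p = \<psi>) t") auto
  have "p \<in> set t \<and> fst p = \<psi>" using p by (metis (mono_tags, lifting) list.set_intros(1) mem_Collect_eq set_filter)
  then show ?thesis using that(1) p unfolding valid_def look_def by auto
 qed
 have step: "valid x (?st x t \<psi>)" if "valid x t" "set (kids \<psi>) \<subseteq> fst ` set t" for x t \<psi>
 proof -
  have "map (look d t) (kids \<psi>) = map (F x) (kids \<psi>)"
   by (rule map_cong[OF refl]) (use look[OF that(1)] that(2) in blast)
  then have "G x \<psi> (map (look d t) (kids \<psi>)) = F x \<psi>" using F[of x \<psi>] by metis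
  then show ?thesis using that(1) unfolding valid_def by simp
 qed
 \<comment> \<open>In the reversed preorder every formula comes after its subformulas, so their
   values are already in the table when they are looked up.\<close>
 have main: "valid x t ==> valid x (foldl (?st x) t (rev (subf \<phi>))) \<and> \<phi> \<in> fst ` set (foldl (?st x) t (rev (subf \<phi>)))
   \<and> set t \<subseteq> set (foldl (?st x) t (rev (subf \<phi>)))" for x t \<phi>
 proof (induction \<phi> arbitrary: t)
  case (And a b)
  let ?t1 = "foldl (?st x) t (rev (subf b))"
  let ?t2 = "foldl (?st x) ?t1 (rev (subf a))"
  have 1: "valid x ?t1" "b \<in> fst ` set ?t1" "set t \<subseteq> set ?t1" using And.IH(2)[OF And.prems] by auto
  have 2: "valid x ?t2" "a \<in> fst ` set ?t2" "set ?t1 \<subseteq> set ?t2" using And.IH(1)[OF 1(1)] by auto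
  have "valid x (?st x ?t2 (And a b))" by (rule step[OF 2(1)]) (use 1 2 in auto)
  then show ?case using 1 2 by auto
 next
  case (Or a b)
  let ?t1 = "foldl (?st x) t (rev (subf b))"
  let ?t2 = "foldl (?st x) ?t1 (rev (subf a))"
  have 1: "valid x ?t1" "b \<in> fst ` set ?t1" "set t \<subseteq> set ?t1" using Or.IH(2)[OF Or.prems] by auto
  have 2: "valid x ?t2" "a \<in> fst ` set ?t2" "set ?t1 \<subseteq> set ?t2" using Or.IH(1)[OF 1(1)] by auto
  have "valid x (?st x ?t2 (Or a b))" by (rule step[OF 2(1)]) (use 1 2 in auto)
  then show ?case using 1 2 by auto
 next
  case (Exists y a)
  let ?t1 = "foldl (?st x) t (rev (subf a))"
  have 1: "valid x ?t1" "a \<in> fst ` set ?t1" "set t \<subseteq> set ?t1" using Exists.IH[OF Exists.prems] by auto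
  have "valid x (?st x ?t1 (Exists y a))" by (rule step[OF 1(1)]) (use 1 in auto)
  then show ?case using 1 by auto
 next
  case (Neg a)
  let ?t1 = "foldl (?st x) t (rev (subf a))"
  have 1: "valid x ?t1" "a \<in> fst ` set ?t1" "set t \<subseteq> set ?t1" using Neg.IH[OF Neg.prems] by auto
  have "valid x (?st x ?t1 (Neg a))" by (rule step[OF 1(1)]) (use 1 in auto)
  then show ?case using 1 by auto
 next
  case (Atom R xs) then show ?case using step[of x t "Atom R xs"] by auto
 next
  case (Eq y z) then show ?case using step[of x t "Eq y z"] by auto
 qed
 \<comment> \<open>\<open>FP_foldl\<close> asks for a size bound at every intermediate table. Tables
   only grow, so each of them inherits validity from the final one.\<close>
 have ok_prefix: "valid x (foldl (?st x) [] ys) \<and> fst ` set (foldl (?st x) [] ys) \<subseteq> set (subf \<phi>)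
   \<and> length (foldl (?st x) [] ys) = length ys" if "rev (subf \<phi>) = ys @ zs" for x \<phi> ys zs
 proof -
  have len: "length (foldl (?st x) t ys) = length t + length ys" for t ys by (induction ys arbitrary: t) auto
  have dom: "fst ` set (foldl (?st x) t ys) = fst ` set t \<union> set ys" for t ys by (induction ys arbitrary: t) auto
  have val: "valid x (foldl (?st x) t (ys @ zs)) ==> valid x (foldl (?st x) t ys)" for t
  proof -
   have "set (foldl (?st x) t ys) \<subseteq> set (foldl (?st x) (foldl (?st x) t ys) zs)"
   proof -
    have "set t \<subseteq> set (foldl (?st x) t zs)" for t
    proof (induction zs arbitrary: t)
     case (Cons z zs)
     have "set t \<subseteq> set (?st x t z)" by auto
     then show ?case using Cons[of "?st x t z"] unfolding foldl_Cons by (rule order.trans)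
    qed simp
    then show ?thesis .
   qed
   then show "valid x (foldl (?st x) t (ys @ zs)) ==> valid x (foldl (?st x) t ys)" unfolding valid_def by auto
  qed
  have "set ys \<subseteq> set (subf \<phi>)" using that by (metis Un_iff set_append set_rev subsetI)
  moreover have "valid x (foldl (?st x) [] (ys @ zs))" using main[of x "[]" \<phi>] unfolding that[symmetric] valid_def by simp
  ultimately show ?thesis using val[of "[]"] len[of "[]"] dom[of "[]" ys] by auto
 qed
 have lk: "FP (%q. look d (fst q) (snd q))" unfolding look_def
  by (intro FP_case_list FP_filter FP_eq FP_const FP_fst FP_snd FP_id)
 have "FP (%p. foldl (?st (fst p)) [] (rev (subf (snd p))))"
 proof (rule FP_foldl[where B = "%p. sz (subf (snd p)) * ((sz (subf (snd p)) + B p + 1) + 1) + 1"])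
  show "FP (%p. rev (subf (snd p)))" by (intro FP_rev FP_subf FP_snd FP_id)
  show "FP (%p :: 'x \<times> fm. [] :: (fm \<times> 'r) list)" by (rule FP_const)
  show "FP (%p. ?st (fst (fst p)) (fst (snd p)) (snd (snd p)))"
   by (intro FP_Cons FP_pair FP_comp3[OF G] FP_map FP_comp2[OF lk] FP_kids FP_fst FP_snd FP_id)
  show "pbound (%p. sz (subf (snd p)) * ((sz (subf (snd p)) + B p + 1) + 1) + 1)"
   by (intro pbound_intros FP_size FP_subf FP_snd FP_id B)
  fix p :: "'x \<times> fm" and ys zs assume ys: "rev (subf (snd p)) = ys @ zs"
  let ?t = "foldl (?st (fst p)) [] ys"
  note o = ok_prefix[OF ys, of "fst p"]
  have "sz q \<le> sz (subf (snd p)) + B p + 1" if "q \<in> set ?t" for q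
  proof -
   have "fst q \<in> set (subf (snd p))" "snd q = F (fst p) (fst q)" using o that unfolding valid_def by auto
   then have "sz (fst q) \<le> sz (subf (snd p))" "sz (snd q) \<le> B p" using sz_mem B(2)[of "fst q" "snd p" "fst p"] by auto
   moreover have "sz q = 1 + sz (fst q) + sz (snd q)" by (metis prod.collapse sz_simps(1))
   ultimately show ?thesis by simp
  qed
  then have "sz ?t \<le> length ?t * ((sz (subf (snd p)) + B p + 1) + 1) + 1" by (rule sz_list_le)
  also have "\<dots> \<le> sz (subf (snd p)) * ((sz (subf (snd p)) + B p + 1) + 1) + 1"
  proof (intro add_le_mono1 mult_le_mono1)
   have "length ys \<le> length (subf (snd p))" using ys by (metis length_append length_rev le_add1)
   then show "length ?t \<le> sz (subf (snd p))" using o length_le_sz[of "subf (snd p)"] by simp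
  qed
  finally show "sz ?t \<le> sz (subf (snd p)) * ((sz (subf (snd p)) + B p + 1) + 1) + 1" .
 qed
 then have "FP (%p. look d (foldl (?st (fst p)) [] (rev (subf (snd p)))) (snd p))"
  by (rule FP_comp2[OF lk]) (intro FP_snd FP_id)
 moreover have "look d (foldl (?st (fst p)) [] (rev (subf (snd p)))) (snd p) = F (fst p) (snd p)" for p
  using main[of "fst p" "[]" "snd p"] look unfolding valid_def by simp
 ultimately show ?thesis by simp
qed

section \<open>Machines from polynomial-time functions\<close>

definition output_com :: com where
 "output_com = Whl MN (Case MN Skip (Push IO False) (drop_com ;; drop_com ;; Push IO True))"

lemma runs_output: "runs output_com ((main (bits (ec w)))(IO := u)) (70 * length w + 1) ((main [])(IO := rev w @ u))"
proof (induction w arbitrary: u)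
 case Nil
 show ?case unfolding output_com_def by (rule runs_WhlF) (auto simp: main_def)
next
 case (Cons b w)
 let ?body = "Case MN Skip (Push IO False) (drop_com ;; drop_com ;; Push IO True)"
 let ?S = "(main (bits (ec (b # w))))(IO := u)"
 let ?S1 = "(main (bits (ec w)))(IO := b # u)"
 have dr: "runs drop_com ((main (False # r))(IO := u)) 23 ((main r)(IO := u))" for r
  unfolding drop_com_def by (rule runs_mv[where d = Nl]) (auto simp: main_def)
 have MN: "?S MN = True # bits (ec b) @ bits (ec w)" by (simp add: main_def)
 have "runs ?body (?S(MN := bits (ec b) @ bits (ec w))) 60 ?S1"
 proof (cases b)
  case False
  show ?thesis
   by (rule runs_CaseF[where r = "bits (ec w)" and ?T1.0 = 1]; (rule runs_Push)?)
    (auto simp: False main_def ec_bool_def)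
 next
  case True
  have p: "runs (Push IO True) ((main (bits (ec w)))(IO := u)) 1 ?S1" by (rule runs_Push) (auto simp: main_def True)
  have "runs (drop_com ;; drop_com ;; Push IO True) ((main (False # False # bits (ec w)))(IO := u)) 49 ?S1"
   by (rule runs_Seq[OF dr runs_Seq[OF dr p order.refl]]) simp
  moreover have "?S(MN := bits (ec b) @ bits (ec w), MN := False # False # bits (ec w)) = (main (False # False # bits (ec w)))(IO := u)"
   by (auto simp: main_def)
  ultimately show ?thesis
   by (intro runs_CaseT[where r = "False # False # bits (ec w)"]) (auto simp: True main_def ec_bool_def)
 qed
 from runs_WhlT[OF MN this Cons.IH[of "b # u", unfolded output_com_def], of "70 * length (b # w) + 1"]
 show ?case unfolding output_com_def by (simp del: fun_upd_apply)
qed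

lemma sz_word: "sz (w :: bool list) \<le> 4 * length w + 1"
proof (induction w)
 case (Cons b w) then show ?case using sz_bool[of b] by simp
qed simp

lemma main_Nil: "(%_. [])(IO := w) = (main [])(IO := w)" "main r = (main r)(IO := [])"
 by (auto simp: main_def)

theorem FP_polytime_computable:
 assumes "FP f"
 shows "polytime_computable f"
proof -
 obtain c k where c: "\<forall>y r n. sz y \<le> n --> runs c (main (bits (ec y) @ r)) ((n + 2) ^ k) (main (bits (ec (f y)) @ r))"
  by (rule FP_bounded_program[OF assms])
 \<comment> \<open>The main summands pay for reading the input, running the program and writing the
   output; 4n+1 bounds the size of a word of n letters as a value.\<close>
 define T where "T n = 12 * n + 10 + (4 * n + 3) ^ k + (70 * (4 * n + 1 + (4 * n + 3) ^ k) + 1) + 2" for n :: nat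
 have "\<exists>t. exec (input_com ;; c ;; output_com) ((%_. [])(IO := rev w)) t ((%_. [])(IO := rev (f w))) \<and> t \<le> T (length w)" for w
 proof -
  have 1: "runs input_com ((%_. [])(IO := rev w)) (12 * length w + 9) (main (bits (ec w)))"
   using runs_input[of w "12 * length w + 9" "[]"] unfolding main_Nil(1) by simp
  have 2: "runs c (main (bits (ec w))) ((4 * length w + 3) ^ k) (main (bits (ec (f w))))"
   using c[rule_format, OF sz_word, of w "[]"] by (simp add: eval_nat_numeral)
  have "length (f w) \<le> sz (f w)" by (rule length_le_sz)
  also have "\<dots> \<le> 4 * length w + 1 + (4 * length w + 3) ^ k"
   using runs_height[OF 2, of MN] sz_word[of w] by (simp add: main_def sz_def)
  finally have 3: "runs output_com (main (bits (ec (f w)))) (70 * (4 * length w + 1 + (4 * length w + 3) ^ k) + 1)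
    ((%_. [])(IO := rev (f w)))"
   using runs_mono[OF runs_output[of "f w" "[]"], of "70 * (4 * length w + 1 + (4 * length w + 3) ^ k) + 1"]
   unfolding main_Nil(1) main_Nil(2)[symmetric] append_Nil2 by simp
  have "runs (input_com ;; c ;; output_com) ((%_. [])(IO := rev w)) (T (length w)) ((%_. [])(IO := rev (f w)))"
   by (rule runs_Seq[OF 1 runs_Seq[OF 2 3 order.refl]]) (simp add: T_def)
  then show ?thesis unfolding runs_def by blast
 qed
 from stack_computer[OF this] obtain M where M: "is_tm M" "computes_in_time M f (sim_time T)" by blast
 define q :: "nat poly" where "q = [:10, 12:] + [:3, 4:] ^ k + (70 * ([:1, 4:] + [:3, 4:] ^ k) + 1) + 2"
 have q: "poly q n = T n" for n unfolding q_def T_def by (simp add: algebra_simps)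
 have "poly ((q + 2) * (2 * ([:0, 1:] + q) + 4)) n = sim_time T n" for n
  unfolding sim_time_def by (simp add: q)
 then have "computes_in_time M f (poly ((q + 2) * (2 * ([:0, 1:] + q) + 4)))" using M(2) by presburger
 with M(1) show ?thesis unfolding polytime_computable_def by blast
qed

definition dbl :: "unit list \<times> 'a \<times> unit list => unit list \<times> 'a \<times> unit list" where
 "dbl s = (tl (fst s), fst (snd s), snd (snd s) @ snd (snd s))"

lemma dbl_iter: "(dbl ^^ i) (us, x, acc) = (drop i us, x, replicate (2 ^ i * length acc) ())"
proof (induction i)
 case 0
 have "acc = replicate (length acc) ()" by (induction acc) auto
 then show ?case by simp
next
 case (Suc i)
 have "(dbl ^^ Suc i) (us, x, acc) = dbl ((dbl ^^ i) (us, x, acc))" by simp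
 also have "\<dots> = (drop (Suc i) us, x, replicate (2 ^ Suc i * length acc) ())"
  unfolding Suc by (simp add: dbl_def drop_Suc tl_drop replicate_add[symmetric] algebra_simps)
 finally show ?case .
qed

lemma sz_units: "sz (us :: unit list) \<le> 2 * length us + 1" "length us \<le> sz us"
proof -
 show "sz us \<le> 2 * length us + 1" by (induction us) (auto simp: sz_def ec_unit_def)
qed (rule length_le_sz)

text \<open>The padding is made by repeated doubling. The time is polynomial in the padded pair
  rather than in the input, which suffices because the padding has to be written anyway.\<close>

lemma pad_computes:
 fixes cnt :: "'a::enc => unit list"
 assumes "FP cnt"
 shows "\<exists>c T. pbound T \<and> (\<forall>x r. runs c (main (bits (ec x) @ r)) (T (x, replicate (2 ^ length (cnt x)) ()))
  (main (bits (ec (x, replicate (2 ^ length (cnt x)) ())) @ r)))"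
proof -
 let ?s0 = "%x. (cnt x, x, [()])"
 let ?pad = "%x. replicate (2 ^ length (cnt x)) ()"
 define B where "B y = 2 * sz (cnt (fst y)) + 1 + sz (fst y) + 2 * sz (snd y) + 3" for y :: "'a \<times> unit list"
 have "FP (%s :: unit list \<times> 'a \<times> unit list. case fst s of [] => [] | y # ys => ys)"
  by (intro FP_intros)
 then have tl: "FP (%s :: unit list \<times> 'a \<times> unit list. tl (fst s))" unfolding tl_def[abs_def] by simp
 have f: "FP (dbl :: unit list \<times> 'a \<times> unit list => _)" unfolding dbl_def[abs_def]
  by (intro FP_pair tl FP_append FP_fst FP_snd FP_id)
 have iter: "(dbl ^^ i) (?s0 x) = (drop i (cnt x), x, replicate (2 ^ i) ())" for i x
  using dbl_iter[of i "cnt x" x "[()]"] by simp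
 have "\<exists>c T l k. pbound T \<and> computes c (%x. (dbl ^^ length (cnt x)) (?s0 x))
  (%x. T x + (length (cnt x) + 1) * (70 * B (x, ?pad x) + (B (x, ?pad x) + 2) ^ l + (B (x, ?pad x) + 2) ^ k + 70 + 2) + 3)"
 proof (rule while_computes[OF f, where P = "%s. fst s \<noteq> []"])
  show "FP (%s :: unit list \<times> 'a \<times> unit list. fst s \<noteq> [])" by (intro FP_not FP_null FP_fst FP_id)
  show "FP ?s0" by (intro FP_pair assms FP_id FP_const)
  show "\<And>x i. i < length (cnt x) ==> fst ((dbl ^^ i) (?s0 x)) \<noteq> []" unfolding iter by simp
  show "\<And>x. \<not> fst ((dbl ^^ length (cnt x)) (?s0 x)) \<noteq> []" unfolding iter by simp
  fix x i assume i: "i \<le> length (cnt x)"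
  have "(2::nat) ^ i \<le> 2 ^ length (cnt x)" using i by simp
  then have "sz (replicate (2 ^ i) ()) \<le> 2 * sz (?pad x) + 1"
   using sz_units(1)[of "replicate (2 ^ i) ()"] sz_units(2)[of "?pad x"] unfolding length_replicate by linarith
  moreover have "sz (drop i (cnt x)) \<le> 2 * sz (cnt x) + 1"
   using sz_units(1)[of "drop i (cnt x)"] sz_units(2)[of "cnt x"] by simp
  ultimately show "sz ((dbl ^^ i) (?s0 x)) \<le> B (x, ?pad x)" unfolding iter B_def by simp
 qed
 then obtain c T l k where c: "pbound T" "computes c (%x. ([] :: unit list, (x, ?pad x)))
  (%x. T x + (length (cnt x) + 1) * (70 * B (x, ?pad x) + (B (x, ?pad x) + 2) ^ l + (B (x, ?pad x) + 2) ^ k + 70 + 2) + 3)"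
  unfolding iter by auto
 define U where "U y = T (fst y) + (sz (cnt (fst y)) + 1) * (70 * B y + (B y + 2) ^ l + (B y + 2) ^ k + 70 + 2) + 3 + 80 * (sz y + 2) + 1"
  for y
 have "pbound B" unfolding B_def
  by (intro pbound_intros FP_size FP_fst FP_snd FP_id FP_comp[OF assms])
 then have "pbound U" unfolding U_def
  by (intro pbound_intros FP_size pbound_comp[OF c(1)] FP_fst FP_id FP_comp[OF assms])
 moreover have "runs (c ;; snd_com) (main (bits (ec x) @ r)) (U (x, ?pad x)) (main (bits (ec (x, ?pad x)) @ r))" for x r
 proof (rule runs_Seq)
  show "runs c (main (bits (ec x) @ r)) (T x + (length (cnt x) + 1) * (70 * B (x, ?pad x) + (B (x, ?pad x) + 2) ^ l + (B (x, ?pad x) + 2) ^ k + 70 + 2) + 3)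
    (main (bits (ec ([] :: unit list, (x, ?pad x))) @ r))" using c(2) unfolding computes_def by blast
  show "runs snd_com (main (bits (ec ([] :: unit list, (x, ?pad x))) @ r)) (80 * (sz (x, ?pad x) + 2)) (main (bits (ec (x, ?pad x)) @ r))"
   unfolding ec_prod_def sz_def fst_conv snd_conv by (rule runs_snd) simp
  have "(length (cnt x) + 1) * (70 * B (x, ?pad x) + (B (x, ?pad x) + 2) ^ l + (B (x, ?pad x) + 2) ^ k + 70 + 2)
    \<le> (sz (cnt x) + 1) * (70 * B (x, ?pad x) + (B (x, ?pad x) + 2) ^ l + (B (x, ?pad x) + 2) ^ k + 70 + 2)"
   by (intro mult_le_mono1 add_le_mono1 length_le_sz)
  then show "T x + (length (cnt x) + 1) * (70 * B (x, ?pad x) + (B (x, ?pad x) + 2) ^ l + (B (x, ?pad x) + 2) ^ k + 70 + 2) + 3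
    + 80 * (sz (x, ?pad x) + 2) + 1 \<le> U (x, ?pad x)" unfolding U_def fst_conv by linarith
 qed
 ultimately show ?thesis by blast
qed

text \<open>Polynomial time on an input padded to doubly exponential length is doubly exponential
  time. The first padding e supplies an exponential number in unary, for the bit length of
  potentials and the bound on symbol indices; the second, p, leaves room for the lists of
  candidates.\<close>

theorem TWO_EXPTIME_I:
 fixes P :: "(bool list \<times> unit list) \<times> unit list => bool"
 assumes "FP P" and a: "0 < a" "0 < b" and X: "\<And>w e p. length e = 2 ^ (a * length w + a) ==> length p = 2 ^ (length e ^ b) ==>
  w \<in> X \<longleftrightarrow> P ((w, e), p)"
 shows "X \<in> TWO_EXPTIME"
proof -
 define c1 where "c1 w = replicate (a * length w + a) ()" for w :: "bool list"
 define c2 where "c2 q = replicate (length (snd q) ^ b) ()" for q :: "bool list \<times> unit list"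
 have pw: "FP (%q :: bool list \<times> unit list. length (snd q) ^ b)" for b
  by (induction b) (simp_all, intro FP_const, intro FP_mult FP_length FP_snd FP_id)
 have c: "FP c1" "FP c2" unfolding c1_def[abs_def] c2_def[abs_def] by (intro FP_unary pw FP_intros)+
 obtain d1 T1 where d1: "pbound T1" "\<And>x r. runs d1 (main (bits (ec x) @ r)) (T1 (x, replicate (2 ^ length (c1 x)) ()))
  (main (bits (ec (x, replicate (2 ^ length (c1 x)) ())) @ r))" using pad_computes[OF c(1)] by blast
 obtain d2 T2 where d2: "pbound T2" "\<And>x r. runs d2 (main (bits (ec x) @ r)) (T2 (x, replicate (2 ^ length (c2 x)) ()))
  (main (bits (ec (x, replicate (2 ^ length (c2 x)) ())) @ r))" using pad_computes[OF c(2)] by blast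
 obtain d3 T3 where d3: "pbound T3" "computes d3 P T3" using assms(1) unfolding FP_def by blast
 let ?e = "%w. replicate (2 ^ length (c1 w)) ()"
 let ?Y = "%w. ((w, ?e w), replicate (2 ^ length (c2 (w, ?e w))) ())"
 define U where "U Y = 12 * sz (fst (fst Y)) + 9 + T1 (fst Y) + T2 Y + T3 Y + 70" for Y
 have "pbound U" unfolding U_def by (intro pbound_intros FP_size d2 d3 pbound_comp[OF d1(1)] FP_fst FP_id)
 then obtain k where k: "\<And>Y. U Y \<le> (sz Y + 2) ^ k" unfolding pbound_def by blast
 let ?fin = "Case MN Skip (Push IO False) (drop_com ;; drop_com ;; Push IO True)"
 let ?c = "input_com ;; d1 ;; d2 ;; d3 ;; ?fin"
 have run: "runs ?c ((%_. [])(IO := rev w)) (U (?Y w)) ((%_. [])(IO := [w \<in> X]))" for w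
 proof -
  have "12 * length w + 9 \<le> 12 * sz w + 9" using length_le_sz[of w] by simp
  from runs_input[OF this, of "[]"]
  have 1: "runs input_com ((%_. [])(IO := rev w)) (12 * sz w + 9) (main (bits (ec w)))"
   unfolding main_Nil(1) by simp
  have 2: "runs d1 (main (bits (ec w))) (T1 (fst (?Y w))) (main (bits (ec (w, ?e w))))"
   using d1(2)[of w "[]"] by simp
  have 3: "runs d2 (main (bits (ec (w, ?e w)))) (T2 (?Y w)) (main (bits (ec (?Y w))))"
   using d2(2)[of "(w, ?e w)" "[]"] by simp
  have XP: "w \<in> X \<longleftrightarrow> P (?Y w)" by (rule X) (simp_all add: c1_def c2_def)
  have 4: "runs d3 (main (bits (ec (?Y w)))) (T3 (?Y w)) (main (bits (ec (w \<in> X))))"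
   using d3(2)[unfolded computes_def, rule_format, of "?Y w" "[]"] unfolding XP by simp
  have 5: "runs ?fin (main (bits (ec (w \<in> X)))) 65 ((%_. [])(IO := [w \<in> X]))"
  proof (cases "w \<in> X")
   case False
   have "runs (Push IO False) (main []) 1 ((%_. [])(IO := [w \<in> X]))" by (rule runs_Push) (auto simp: main_def False)
   then have "runs ?fin (main [False]) 65 ((%_. [])(IO := [w \<in> X]))" by (rule runs_case_main(1)) simp
   then show ?thesis by (simp add: False ec_bool_def)
  next
   case True
   have dr: "runs drop_com (main (False # r)) 30 (main r)" for r using runs_drop[of Nl 30 r] by simp
   have "runs (Push IO True) (main []) 1 ((%_. [])(IO := [w \<in> X]))" by (rule runs_Push) (auto simp: main_def True)
   then have "runs (drop_com ;; drop_com ;; Push IO True) (main [False, False]) 63 ((%_. [])(IO := [w \<in> X]))"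
    by (rule runs_Seq[OF dr runs_Seq[OF dr _ order.refl]]) simp
   then have "runs ?fin (main [True, False, False]) 65 ((%_. [])(IO := [w \<in> X]))" by (rule runs_case_main(2)) simp
   then show ?thesis by (simp add: True ec_bool_def)
  qed
  show ?thesis
   by (rule runs_Seq[OF 1 runs_Seq[OF 2 runs_Seq[OF 3 runs_Seq[OF 4 5 order.refl] order.refl] order.refl]])
    (simp add: U_def)
 qed
 \<comment> \<open>The length of the second padding; all other sizes and times are bounded by powers
   of it.\<close>
 define L where "L n = (2::nat) ^ ((2 ^ (a * n + a)) ^ b)" for n
 have UL: "U (?Y w) \<le> L (length w) ^ (5 * k + 2)" for w
 proof -
  let ?n = "length w" let ?L = "L (length w)"
  have "?n \<le> a * ?n + a" using a by (cases a) auto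
  also have "\<dots> \<le> 2 ^ (a * ?n + a)" using less_exp less_imp_le_nat by blast
  finally have 1: "?n \<le> 2 ^ (a * ?n + a)" .
  have "(2 ^ (a * ?n + a)) ^ 1 \<le> ((2::nat) ^ (a * ?n + a)) ^ b" by (rule power_increasing) (use a in auto)
  moreover have "(2 ^ (a * ?n + a)) ^ b \<le> ?L" unfolding L_def using less_exp less_imp_le_nat by blast
  ultimately have 2: "2 ^ (a * ?n + a) \<le> ?L" by simp
  have "1 \<le> ((2::nat) ^ (a * ?n + a)) ^ b" by simp
  then have 3: "2 \<le> ?L" unfolding L_def using power_increasing[of 1 "(2 ^ (a * ?n + a)) ^ b" "2::nat"] by simp
  have "length (?e w) = 2 ^ (a * ?n + a)" "length (snd (?Y w)) = ?L" by (simp_all add: c1_def c2_def L_def)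
  then have "sz (?e w) \<le> 2 * ?L + 1" "sz (snd (?Y w)) \<le> 2 * ?L + 1" "sz w \<le> 4 * ?L + 1"
   using sz_units(1)[of "?e w"] sz_units(1)[of "snd (?Y w)"] sz_word[of w] 1 2 by linarith+
  then have "sz (?Y w) + 2 \<le> 16 * ?L" using 3 by simp
  also have "\<dots> \<le> ?L ^ 4 * ?L" using power_mono[OF 3, of 4] by (intro mult_le_mono1) simp
  also have "\<dots> = ?L ^ 5" by (simp add: eval_nat_numeral)
  finally have "U (?Y w) \<le> (?L ^ 5) ^ k" using k[of "?Y w"] power_mono[of "sz (?Y w) + 2" "?L ^ 5" k] by linarith
  also have "\<dots> \<le> ?L ^ (5 * k + 2)" unfolding power_mult[symmetric] using 3 by (intro power_increasing) auto
  finally show ?thesis .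
 qed
 define K where "K = 5 * k + 2"
 have ex: "\<exists>t S. exec ?c ((%_. [])(IO := rev w)) t S \<and> t \<le> L (length w) ^ K \<and> S IO = [w \<in> X]" for w
  using runs_mono[OF run UL, of w] unfolding runs_def K_def by (metis fun_upd_same)
 obtain M where M: "is_tm M" "decides_in_time M X (sim_time (%n. L n ^ K))"
  using stack_decider[of ?c "%n. L n ^ K" X] ex by blast
 \<comment> \<open>The product a b (n + 1) is the exponent in the power of 2 that \<open>L n\<close>
   has as exponent; the summand 2K+8 absorbs the power of \<open>L n\<close> that bounds the
   simulation.\<close>
 define p :: "nat poly" where "p = [:2 * K + 8 + a * b, a * b:]"
 have "sim_time (%n. L n ^ K) n \<le> 2 ^ 2 ^ poly p n" for n
 proof -
  let ?E = "((2::nat) ^ (a * n + a)) ^ b"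
  have E: "1 \<le> ?E" by simp
  have L: "2 \<le> L n" unfolding L_def using power_increasing[of 1 ?E "2::nat"] by simp
  have "n \<le> a * n + a" using a by (cases a) auto
  also have "\<dots> \<le> 2 ^ (a * n + a)" using less_exp less_imp_le_nat by blast
  also have "\<dots> \<le> ?E" using power_increasing[of 1 b "(2::nat) ^ (a * n + a)"] a by simp
  also have "\<dots> \<le> L n" unfolding L_def using less_exp less_imp_le_nat by blast
  also have "\<dots> \<le> L n ^ K" using power_increasing[of 1 K "L n"] L by (simp add: K_def)
  finally have n: "n \<le> L n ^ K" .
  have T: "1 \<le> L n ^ K" using L by simp
  have "sim_time (%n. L n ^ K) n \<le> (3 * L n ^ K) * (8 * L n ^ K)" unfolding sim_time_def
  proof (rule mult_le_mono)
   show "L n ^ K + 2 \<le> 3 * L n ^ K" using T by linarith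
   have "2 * (n + Z) + 4 \<le> 8 * Z" if "n \<le> Z" "1 \<le> Z" for Z :: nat using that by presburger
   then show "2 * (n + L n ^ K) + 4 \<le> 8 * L n ^ K" using n T by blast
  qed
  also have "\<dots> \<le> L n ^ 8 * (L n ^ K * L n ^ K)" using power_mono[OF L, of 8] by simp
  also have "\<dots> = L n ^ (2 * K + 8)" by (simp add: power_add power_mult power2_eq_square mult.commute)
  also have "\<dots> = 2 ^ (?E * (2 * K + 8))" unfolding L_def by (simp add: power_mult)
  also have "\<dots> \<le> 2 ^ (2 ^ poly p n)"
  proof (rule power_increasing)
   have "?E * (2 * K + 8) \<le> 2 ^ ((a * n + a) * b) * 2 ^ (2 * K + 8)"
    unfolding power_mult by (intro mult_le_mono order.refl) (use less_exp less_imp_le_nat in blast)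
   also have "\<dots> = 2 ^ poly p n" unfolding power_add[symmetric] p_def by (simp add: algebra_simps)
   finally show "?E * (2 * K + 8) \<le> 2 ^ poly p n" .
  qed simp
  finally show ?thesis .
 qed
 then have "decides_in_time M X (%n. 2 ^ 2 ^ poly p n)" using M(2) unfolding decides_in_time_def by (meson order.trans)
 then show ?thesis using M(1) unfolding TWO_EXPTIME_def by blast
qed

section \<open>The decision procedure runs in doubly exponential time\<close>

lemma FP_nrm: "FP f ==> FP (%x. nrm (f x))"
proof -
 have "FP (%R. case R of Base i n => Base i n | Dist u => Dist (if odd u then u else u - 1))"
  by (intro FP_case_rsym FP_intros FP_fm_intros)
 moreover have "(%R. case R of Base i n => Base i n | Dist u => Dist (if odd u then u else u - 1)) = nrm"
  by (rule ext) (simp split: rsym.split)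
 ultimately have "FP nrm" by simp
 then show "FP f ==> FP (%x. nrm (f x))" by (rule FP_comp)
qed

lemma FP_arity: "FP f ==> FP (%x. arity (f x))"
proof -
 have "FP (%R. case R of Base i n => n | Dist u => 2)" by (intro FP_case_rsym FP_intros)
 moreover have "(%R. case R of Base i n => n | Dist u => 2) = arity"
  by (rule ext) (simp split: rsym.split)
 ultimately have "FP arity" by simp
 then show "FP f ==> FP (%x. arity (f x))" by (rule FP_comp)
qed

lemma FP_is_dist: "FP f ==> FP (%x. is_dist (f x))"
proof -
 have "FP (%R. case R of Base i n => False | Dist u => True)" by (intro FP_case_rsym FP_intros)
 moreover have "(%R. case R of Base i n => False | Dist u => True) = is_dist"
  by (rule ext) (simp split: rsym.split)
 ultimately have "FP is_dist" by simp
 then show "FP f ==> FP (%x. is_dist (f x))" by (rule FP_comp)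
qed

lemma FP_flip: "FP f ==> FP (%x. flip (f x))"
 unfolding flip_def by (intro FP_intros)

lemma FP_key_of: "FP f ==> FP g ==> FP (%x. key_of (f x) (g x))"
proof -
 have "FP (%p. case fst p of Base i n => (Base i n, snd p)
   | Dist u => if odd u then (Dist u, snd p) else (Dist (u - 1), \<not> snd p))"
  by (intro FP_case_rsym FP_intros FP_fm_intros)
 moreover have "(%p. case fst p of Base i n => (Base i n, snd p)
   | Dist u => if odd u then (Dist u, snd p) else (Dist (u - 1), \<not> snd p)) = (%p. key_of (fst p) (snd p))"
  by (rule ext) (simp split: rsym.split)
 ultimately have "FP (%p. key_of (fst p) (snd p))" by simp
 then show "FP f ==> FP g ==> FP (%x. key_of (f x) (g x))" by (rule FP_comp2[where f = key_of])
qed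

lemma FP_rsyms: "FP f ==> FP (%x. rsyms (f x))"
 unfolding rsyms_def by (intro FP_concat FP_map FP_subf FP_case_fm FP_Cons FP_nrm FP_const FP_fst FP_snd FP_id)

lemma FP_both_keys: "FP f ==> FP (%x. both_keys (f x))"
 unfolding both_keys_def by (intro FP_intros)

lemma FP_drs: "FP f ==> FP (%x. drs (f x))"
 unfolding drs_def by (intro FP_intros FP_is_dist FP_rsyms)

lemma FP_all_keys: "FP f ==> FP (%x. all_keys (f x))"
 unfolding all_keys_def by (intro FP_intros FP_arity FP_rsyms FP_both_keys)

lemma FP_dkeys: "FP f ==> FP (%x. dkeys (f x))"
 unfolding dkeys_def by (intro FP_drs FP_both_keys)

lemma FP_fv: "FP f ==> FP g ==> FP (%x. f x \<in> fv (g x))"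
proof -
 let ?G = "%x \<psi> rs. case \<psi> of Atom R xs => x \<in> set xs | Eq y z => x = y \<or> x = z | And a b => \<exists>r\<in>set rs. r
   | Or a b => \<exists>r\<in>set rs. r | Exists y a => x \<noteq> y \<and> (\<exists>r\<in>set rs. r) | Neg a => \<exists>r\<in>set rs. r"
 have "FP (%p. fst p \<in> fv (snd p))"
 proof (rule FP_fm_rec[where F = "%x \<psi>. x \<in> fv \<psi>" and G = ?G and B = "%_. 3"])
  show "FP (%p. ?G (fst p) (fst (snd p)) (snd (snd p)))"
   by (intro FP_case_fm FP_mem FP_disj FP_conj FP_not FP_eq FP_Bex FP_fst FP_snd FP_id)
  show "(x \<in> fv \<psi>) = ?G x \<psi> (map (%\<psi>. x \<in> fv \<psi>) (kids \<psi>))" for x \<psi> by (cases \<psi>) auto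
 qed (auto intro: pbound_const sz_bool)
 then show "FP f ==> FP g ==> FP (%x. f x \<in> fv (g x))" by (rule FP_comp2[where f = "%x \<psi>. x \<in> fv \<psi>"])
qed

lemma FP_unary_val: "FP a ==> FP b ==> FP s ==> FP v ==> FP (%x. unary (a x) (b x) (s x) (v x))"
 unfolding unary_def by (intro FP_intros FP_fv)

lemma FP_ev: "FP a ==> FP U ==> FP b ==> FP s ==> FP (%x. ev (a x) (%k. k \<in> set (U x)) (b x) (s x))"
proof -
 let ?G = "%(t :: tp \<times> key list \<times> tp) \<psi> rs. unary (fst t) (snd (snd t)) \<psi> (case \<psi> of Atom R xs => key_of R (xs = [0, 1]) \<in> set (fst (snd t))
   | Eq y z => False | And a b => \<forall>r\<in>set rs. r | Or a b => \<exists>r\<in>set rs. r | Exists y a => False | Neg a => False)"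
 let ?F = "%(t :: tp \<times> key list \<times> tp) \<psi>. ev (fst t) (%k. k \<in> set (fst (snd t))) (snd (snd t)) \<psi>"
 have "FP (%p. ?F (fst p) (snd p))"
 proof (rule FP_fm_rec[where F = ?F and G = ?G and B = "%_. 3"])
  show "FP (%p. ?G (fst p) (fst (snd p)) (snd (snd p)))"
   by (intro FP_unary_val FP_case_fm FP_mem FP_key_of FP_eq FP_Bex FP_Ball FP_const FP_fst FP_snd FP_id)
  show "?F x \<psi> = ?G x \<psi> (map (?F x) (kids \<psi>))" for x \<psi> by (cases \<psi>) auto
 qed (auto intro: pbound_const sz_bool)
 then show "FP a ==> FP U ==> FP b ==> FP s ==> FP (%x. ev (a x) (%k. k \<in> set (U x)) (b x) (s x))"
  using FP_comp2[where f = ?F and a = "%x. (a x, U x, b x)" and b = s] by (simp add: FP_pair)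
qed

text \<open>Computable predicates receive a set of keys as a list, so flipping is moved from the
  tested key to the list.\<close>

lemma flip_mem: "flip k \<in> set L \<longleftrightarrow> k \<in> set (map flip L)"
 using flip_flip by (metis image_eqI image_iff list.set_map)

lemma FP_evx: "FP n ==> FP a ==> FP U ==> FP b ==> FP s ==>
  FP (%x. evx (n x) (a x) (%k. k \<in> set (U x)) (b x) (s x))"
 unfolding evx_def flip_mem by (intro FP_if FP_ev FP_eq FP_map FP_flip FP_const FP_snd FP_id)

lemma FP_okT: "FP (%t. okT (fst t) (snd t))"
 unfolding okT_def
 by (intro FP_Ball FP_case_fm FP_subf FP_eq FP_mem FP_nrm FP_conj FP_disj FP_imp FP_not FP_const FP_fst FP_snd FP_id)

lemma FP_no_viol: "FP f ==> FP a ==> FP U ==> FP b ==> FP (%x. no_viol (f x) (a x) (%k. k \<in> set (U x)) (b x))"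
proof -
 let ?f = "%\<phi> \<alpha> U \<beta>. no_viol \<phi> \<alpha> (%k. k \<in> set U) \<beta>"
 have "FP (%t. ?f (fst t) (fst (snd t)) (fst (snd (snd t))) (snd (snd (snd t))))"
  unfolding no_viol_def
  by (intro FP_Ball FP_case_fm FP_evx FP_subf FP_mem FP_imp FP_not FP_const FP_fst FP_snd FP_id)
 then show "FP f ==> FP a ==> FP U ==> FP b ==> FP (%x. no_viol (f x) (a x) (%k. k \<in> set (U x)) (b x))"
  by (rule FP_comp4[where f = ?f])
qed

lemma FP_covers: "FP D ==> FP U ==> FP ks ==> FP b ==> FP (%x. covers (D x) (%k. k \<in> set (U x)) (ks x) (b x))"
proof -
 let ?f = "%D U ks \<beta>. covers D (%k. k \<in> set U) ks \<beta>"
 have "FP (%t. ?f (fst t) (fst (snd t)) (fst (snd (snd t))) (snd (snd (snd t))))"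
  unfolding covers_def by (intro FP_Bex FP_Ball FP_conj FP_imp FP_eq FP_mem FP_fst FP_snd FP_id)
 then show "FP D ==> FP U ==> FP ks ==> FP b ==> FP (%x. covers (D x) (%k. k \<in> set (U x)) (ks x) (b x))"
  by (rule FP_comp4[where f = ?f])
qed

lemma FP_okP: "FP (%t. okP (fst t) (snd t))"
 unfolding okP_def set_both_keys[symmetric]
 by (intro FP_conj FP_Ball FP_comp2[where f = okT, OF FP_okT] FP_no_viol FP_covers FP_both_keys FP_rsyms FP_imp FP_eq
   FP_arity FP_mem FP_dkeys FP_const FP_fst FP_snd FP_id)

lemma FP_edge: "FP f ==> FP a ==> FP U ==> FP b ==> FP (%x. edge (f x) (a x) (U x) (b x))"
proof -
 have "FP (%t. edge (fst t) (fst (snd t)) (fst (snd (snd t))) (snd (snd (snd t))))"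
  unfolding edge_def flip_mem
  by (intro FP_conj FP_Ball FP_no_viol FP_covers FP_map FP_flip FP_imp FP_mem FP_dkeys FP_fst FP_snd FP_id)
 then show "FP f ==> FP a ==> FP U ==> FP b ==> FP (%x. edge (f x) (a x) (U x) (b x))"
  by (rule FP_comp4[where f = edge])
qed

lemma FP_plt: "FP l ==> FP R ==> FP r ==> FP s ==> FP (%x. plt (l x) (R x) (r x) (s x))"
proof -
 have "FP (%t. plt (fst t) (fst (snd t)) (fst (snd (snd t))) (snd (snd (snd t))))"
  unfolding plt_def by (intro FP_Bex FP_Ball FP_conj FP_imp FP_less FP_eq FP_mem FP_not FP_pair FP_upt FP_fst FP_snd FP_id)
 then show "FP l ==> FP R ==> FP r ==> FP s ==> FP (%x. plt (l x) (R x) (r x) (s x))"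
  by (rule FP_comp4[where f = plt])
qed

lemma FP_peq: "FP l ==> FP R ==> FP r ==> FP s ==> FP (%x. peq (l x) (R x) (r x) (s x))"
proof -
 have "FP (%t. peq (fst t) (fst (snd t)) (fst (snd (snd t))) (snd (snd (snd t))))"
  unfolding peq_def by (intro FP_Ball FP_eq FP_mem FP_pair FP_upt FP_fst FP_snd FP_id)
 then show "FP l ==> FP R ==> FP r ==> FP s ==> FP (%x. peq (l x) (R x) (r x) (s x))"
  by (rule FP_comp4[where f = peq])
qed

lemma FP_pot_ok: "FP f ==> FP l ==> FP r ==> FP U ==> FP s ==> FP (%x. pot_ok (f x) (l x) (r x) (U x) (s x))"
proof -
 let ?f = "%q l r U. pot_ok (fst q) l r U (snd q)"
 have "FP (%t. ?f (fst t) (fst (snd t)) (fst (snd (snd t))) (snd (snd (snd t))))"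
  unfolding pot_ok_def flip_mem
  by (intro FP_Ball FP_imp FP_mem FP_if FP_plt FP_peq FP_map FP_flip FP_dkeys FP_fst FP_snd FP_id)
 from FP_comp4[where f = ?f, OF this, where a = "%x. (f x, s x)"]
 show "FP f ==> FP l ==> FP r ==> FP U ==> FP s ==> FP (%x. pot_ok (f x) (l x) (r x) (U x) (s x))"
  by (simp add: FP_pair)
qed

lemma FP_wit: "FP f ==> FP l ==> FP Ls ==> FP X ==> FP c ==> FP (%x. wit (f x) (l x) (Ls x) (X x) (c x))"
proof -
 let ?f = "%q l Ls X. wit (fst q) l Ls X (snd q)"
 have "FP (%t. ?f (fst t) (fst (snd t)) (fst (snd (snd t))) (snd (snd (snd t))))"
  unfolding wit_def
  by (intro FP_Ball FP_Bex FP_case_fm FP_imp FP_disj FP_conj FP_mem FP_evx FP_edge FP_pot_ok FP_subf FP_const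
    FP_fst FP_snd FP_id)
 from FP_comp4[where f = ?f, OF this, where a = "%x. (f x, c x)"]
 show "FP f ==> FP l ==> FP Ls ==> FP X ==> FP c ==> FP (%x. wit (f x) (l x) (Ls x) (X x) (c x))"
  by (simp add: FP_pair)
qed

subsection \<open>Subsequences and elimination\<close>

definition ext_subs :: "unit list => 'a list list => 'a => 'a list list" where
 "ext_subs p acc x = (if length p < length (map (Cons x) acc @ acc) then [] else map (Cons x) acc @ acc)"

text \<open>The list of all subsequences, abandoned when it becomes longer than the padding \<open>p\<close>.\<close>

definition bsubs :: "unit list => 'a list => 'a list list" where
 "bsubs p xs = foldl (ext_subs p) [[]] (rev xs)"

lemma bsubs_Cons: "bsubs p (x # xs) = ext_subs p (bsubs p xs) x"
 by (simp add: bsubs_def)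

lemma bsubs_eq: "2 ^ length xs \<le> length p ==> bsubs p xs = subseqs xs"
proof (induction xs)
 case (Cons x xs)
 then have "bsubs p xs = subseqs xs" by simp
 then show ?case using Cons.prems by (simp add: bsubs_Cons ext_subs_def Let_def length_subseqs)
qed (simp add: bsubs_def)

lemma FP_bsubs: "FP p ==> FP l ==> FP (%x. bsubs (p x) (l x))" for l :: "'x::enc => 'a::enc list"
proof -
 have len: "length (bsubs p xs) \<le> length p + 1" for p and xs :: "'a list"
 proof (cases xs)
  case (Cons y ys) then show ?thesis by (simp add: bsubs_Cons ext_subs_def)
 qed (simp add: bsubs_def)
 have el: "y \<in> set (bsubs p xs) ==> sz y \<le> sz xs" for p y and xs :: "'a list"
 proof (induction xs arbitrary: y)
  case (Cons x xs)
  then consider "y \<in> set (bsubs p xs)" | z where "y = x # z" "z \<in> set (bsubs p xs)"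
   by (auto simp: bsubs_Cons ext_subs_def split: if_splits)
  then show ?case
  proof cases
   case 1 then show ?thesis using Cons.IH[of y] by simp
  next
   case 2 then show ?thesis using Cons.IH[of z] by simp
  qed
 qed (simp add: bsubs_def)
 have "FP (%q. foldl (ext_subs (fst q)) [[]] (rev (snd q :: 'a list)))"
 proof (rule FP_foldl[where B = "%q. (sz (fst q) + 1) * (sz (snd q) + 1) + 1"])
  show "FP (%q :: unit list \<times> 'a list. rev (snd q))" by (intro FP_intros)
  show "FP (%q :: unit list \<times> 'a list. [[]] :: 'a list list)" by (rule FP_const)
  show "FP (%p. ext_subs (fst (fst p)) (fst (snd p)) (snd (snd p)))"
   unfolding ext_subs_def by (intro FP_intros)
  show "pbound (%q :: unit list \<times> 'a list. (sz (fst q) + 1) * (sz (snd q) + 1) + 1)"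
   by (intro pbound_intros FP_size FP_fst FP_snd FP_id)
  fix q :: "unit list \<times> 'a list" and ys zs assume "rev (snd q) = ys @ zs"
  then have q: "snd q = rev zs @ rev ys" by (metis rev_append rev_rev_ident)
  have e: "foldl (ext_subs (fst q)) [[]] ys = bsubs (fst q) (rev ys)" by (simp add: bsubs_def)
  have "sz (bsubs (fst q) (rev ys)) \<le> length (bsubs (fst q) (rev ys)) * (sz (snd q) + 1) + 1"
  proof (rule sz_list_le)
   fix y assume "y \<in> set (bsubs (fst q) (rev ys))"
   from el[OF this] show "sz y \<le> sz (snd q)" unfolding q using sz_append[of "rev zs" "rev ys"] sz_append[of "[]" "rev zs"]
    length_le_sz[of "rev zs"] by (cases "rev zs") auto
  qed
  also have "\<dots> \<le> (sz (fst q) + 1) * (sz (snd q) + 1) + 1"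
   using len[of "fst q" "rev ys"] length_le_sz[of "fst q"] by (intro add_le_mono1 mult_le_mono1) linarith
  finally show "sz (foldl (ext_subs (fst q)) [[]] ys) \<le> (sz (fst q) + 1) * (sz (snd q) + 1) + 1" unfolding e .
 qed
 then show "FP p ==> FP l ==> FP (%x. bsubs (p x) (l x))"
  unfolding bsubs_def by (rule FP_comp2[where f = "%p l. foldl (ext_subs p) [[]] (rev l)"])
qed

lemma sz_filter: "sz (filter P xs) \<le> sz xs"
 by (induction xs) auto

definition elim_round :: "fm => nat => key list list => cand list => cand => cand list" where
 "elim_round \<phi> l Ls X _ = filter (wit \<phi> l Ls X) X"

definition elim :: "fm => nat => key list list => cand list => cand list" where
 "elim \<phi> l Ls X0 = foldl (elim_round \<phi> l Ls) X0 X0"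

lemma wit_mono: "wit \<phi> l Ls X c ==> set X \<subseteq> set Y ==> wit \<phi> l Ls Y c"
proof -
 assume w: "wit \<phi> l Ls X c" and XY: "set X \<subseteq> set Y"
 show "wit \<phi> l Ls Y c" unfolding wit_def
 proof
  fix \<psi> assume "\<psi> \<in> set (subf \<phi>)"
  from w[unfolded wit_def, rule_format, OF this]
  show "case \<psi> of Atom R xs => True | Eq x y => True | And a b => True | Or a b => True
   | Exists x a => \<psi> \<in> set (snd (fst (fst c))) --> a \<in> set (snd (fst (fst c))) \<or>
     (\<exists>L\<in>set Ls. \<exists>c'\<in>set Y. evx x (fst (fst c)) (%k. k \<in> set L) (fst (fst c')) a \<and>
      edge \<phi> (fst c) L (fst c') \<and> pot_ok \<phi> l (snd c) L (snd c')) | Neg a => True"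
   using XY by (cases \<psi>) (simp_all, blast)
 qed
qed

lemma elim_subset: "set (foldl (elim_round \<phi> l Ls) X us) \<subseteq> set X"
proof (induction us arbitrary: X)
 case (Cons u us)
 then have "set (foldl (elim_round \<phi> l Ls) X (u # us)) \<subseteq> set (elim_round \<phi> l Ls X u)" by simp
 then show ?case unfolding elim_round_def by auto
qed simp

text \<open>A round either shortens the list or leaves it unchanged for ever after, so as many
  rounds as candidates reach a stable set.\<close>

lemma elim_stable: "length X \<le> length us ==> c \<in> set (foldl (elim_round \<phi> l Ls) X us) ==>
  wit \<phi> l Ls (foldl (elim_round \<phi> l Ls) X us) c"
proof (induction us arbitrary: X)
 case (Cons u us)
 let ?Y = "filter (wit \<phi> l Ls X) X"
 show ?case
 proof (cases "length ?Y \<le> length us")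
  case True then show ?thesis using Cons by (simp add: elim_round_def)
 next
  case False
  then have "length ?Y = length X" using Cons.prems(1) length_filter_le[of "wit \<phi> l Ls X" X] unfolding list.size by linarith
  then have w: "\<forall>c\<in>set X. wit \<phi> l Ls X c" using length_filter_less[of _ X "wit \<phi> l Ls X"] by fastforce
  then have fx: "filter (wit \<phi> l Ls X) X = X" by simp
  have "foldl (elim_round \<phi> l Ls) X vs = X" for vs by (induction vs) (auto simp: elim_round_def fx)
  then show ?thesis using Cons.prems(2) w by metis
 qed
qed simp

text \<open>By monotonicity of \<open>wit\<close>, a set that witnesses all its demands never loses
  a member; the result of the elimination is thus the largest such set.\<close>

lemma elim_keeps:
 assumes "set Y \<subseteq> set X" "\<forall>c\<in>set Y. wit \<phi> l Ls Y c"
 shows "set Y \<subseteq> set (foldl (elim_round \<phi> l Ls) X us)"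
 using assms(1)
proof (induction us arbitrary: X)
 case (Cons u us)
 have "set Y \<subseteq> set (filter (wit \<phi> l Ls X) X)" using Cons.prems assms(2) wit_mono[OF _ Cons.prems] by auto
 from Cons.IH[OF this] show ?case by (simp add: elim_round_def)
qed simp

lemma FP_elim: "FP f ==> FP l ==> FP Ls ==> FP X ==> FP (%x. elim (f x) (l x) (Ls x) (X x))"
proof -
 have "FP (%t. foldl (elim_round (fst t) (fst (snd t)) (fst (snd (snd t)))) (snd (snd (snd t))) (snd (snd (snd t))))"
 proof (rule FP_foldl[where B = "%t. sz (snd (snd (snd t)))"])
  show "FP (%p. elim_round (fst (fst p)) (fst (snd (fst p))) (fst (snd (snd (fst p)))) (fst (snd p)) (snd (snd p)))"
   unfolding elim_round_def by (intro FP_filter FP_wit FP_fst FP_snd FP_id)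
  show "pbound (%t :: fm \<times> nat \<times> key list list \<times> cand list. sz (snd (snd (snd t))))" by (intro FP_size FP_snd FP_id)
  have "sz (foldl (elim_round \<phi> l Ls) X ys) \<le> sz X" for \<phi> l Ls X ys
  proof (induction ys arbitrary: X)
   case (Cons y ys)
   show ?case using Cons[of "elim_round \<phi> l Ls X y"] sz_filter[of "wit \<phi> l Ls X" X]
    unfolding foldl_Cons elim_round_def[of _ _ _ X] by linarith
  qed simp
  then show "sz (foldl (elim_round (fst t) (fst (snd t)) (fst (snd (snd t)))) (snd (snd (snd t))) ys) \<le> sz (snd (snd (snd t)))"
   for t :: "fm \<times> nat \<times> key list list \<times> cand list" and ys by blast
 qed (intro FP_intros)+
 then have "FP (%t. elim (fst t) (fst (snd t)) (fst (snd (snd t))) (snd (snd (snd t))))" unfolding elim_def .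
 then show "FP f ==> FP l ==> FP Ls ==> FP X ==> FP (%x. elim (f x) (l x) (Ls x) (X x))"
  by (rule FP_comp4[where f = elim])
qed

section \<open>The test for finite satisfiability and the sizes of its lists\<close>

definition btypes :: "unit list => fm => tp list" where
 "btypes p \<phi> = List.product (bsubs p (rsyms \<phi>)) (bsubs p (subf \<phi>))"

definition bcands :: "unit list => fm => nat => cand list" where
 "bcands p \<phi> l = List.product (List.product (btypes p \<phi>)
   (bsubs p (List.product (bsubs p (dkeys \<phi>)) (btypes p \<phi>)))) (bsubs p (List.product (drs \<phi>) [0..<l]))"

definition accepts :: "unit list => nat => fm => bool" where
 "accepts p l \<phi> \<longleftrightarrow> (\<exists>c\<in>set (elim \<phi> l (bsubs p (all_keys \<phi>)) (filter (%c. okP \<phi> (fst c)) (bcands p \<phi> l))).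
   \<phi> \<in> set (snd (fst (fst c))))"

lemma FP_accepts: "FP p ==> FP l ==> FP f ==> FP (%x. accepts (p x) (l x) (f x))"
proof -
 have "FP (%t. accepts (fst t) (fst (snd t)) (snd (snd t)))"
  unfolding accepts_def bcands_def btypes_def
  by (intro FP_Bex FP_elim FP_filter FP_comp2[where f = okP, OF FP_okP] FP_bsubs FP_product FP_all_keys FP_rsyms FP_subf
    FP_dkeys FP_drs FP_upt FP_mem FP_fst FP_snd FP_id)
 then show "FP p ==> FP l ==> FP f ==> FP (%x. accepts (p x) (l x) (f x))"
  by (rule FP_comp3[where f = accepts])
qed

lemma length_rsyms: "length (rsyms \<phi>) \<le> length (subf \<phi>)"
proof -
 have "length (concat (map f xs)) \<le> length xs" if "\<And>x. length (f x) \<le> 1" for f :: "fm => rsym list" and xs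
 proof (induction xs)
  case (Cons x xs) then show ?case using that[of x] by simp
 qed simp
 then show ?thesis unfolding rsyms_def by (simp split: fm.split)
qed

lemma length_both_keys: "length (both_keys Rs) = 2 * length Rs"
 unfolding both_keys_def by (induction Rs) auto

lemma accepts_iff:
 assumes \<phi>: "unfo2_S_sentence k \<phi>" and n: "length (subf \<phi>) \<le> n"
  and l: "l = 2 ^ (8 * n + 8)" and p: "length p = 2 ^ (l ^ 2)"
 shows "accepts p l \<phi> \<longleftrightarrow> finitely_satisfiable k \<phi>"
proof -
 \<comment> \<open>m bounds the pairs from which coverings are chosen: at most 2^(2n) lists of keys
   times 2^(2n) types. Hence there are at most 2^m coverings, and l equals 256 m^2.\<close>
 define m where "m = (2::nat) ^ (4 * n)"
 have "8 * n + 8 = 8 + 4 * n + 4 * n" by simp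
 then have l': "l = 256 * (m * m)" unfolding l m_def by (simp only: power_add) simp
 have m1: "1 \<le> m" unfolding m_def by simp
 have nm: "n \<le> m" unfolding m_def by (rule order.trans[OF less_imp_le_nat[OF less_exp]]) simp
 have mm: "m \<le> m * m" using m1 by simp
 have ml: "m \<le> l" using mm unfolding l' by linarith
 have ll: "l \<le> l ^ 2" unfolding power2_eq_square by simp
 have r: "length (rsyms \<phi>) \<le> n" using length_rsyms[of \<phi>] n by simp
 have d: "length (drs \<phi>) \<le> n" unfolding drs_def using r length_filter_le[of is_dist "rsyms \<phi>"] by linarith
 have dk: "length (dkeys \<phi>) \<le> 2 * n" unfolding dkeys_def length_both_keys using d by simp
 have ak: "length (all_keys \<phi>) \<le> 2 * n" unfolding all_keys_def length_both_keys
  using r length_filter_le[of "%R. arity R = 2" "rsyms \<phi>"] by linarith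
 have bs: "bsubs p xs = subseqs xs" if "length xs \<le> l ^ 2" for xs :: "'z list"
  by (rule bsubs_eq) (simp add: p that)
 have 2: "2 * n \<le> l ^ 2"
 proof -
  have "2 * n \<le> 2 * (m * m)" using nm mm by linarith
  then show ?thesis using ll unfolding l' by linarith
 qed
 have ty: "length (types \<phi>) \<le> 2 ^ (2 * n)"
 proof -
  have "length (types \<phi>) = 2 ^ (length (rsyms \<phi>) + length (subf \<phi>))"
   unfolding types_def by (simp add: length_subseqs power_add)
  also have "\<dots> \<le> 2 ^ (2 * n)" using r n by (intro power_increasing) auto
  finally show ?thesis .
 qed
 have pr: "length (List.product (subseqs (dkeys \<phi>)) (types \<phi>)) \<le> m"
 proof -
  have "length (subseqs (dkeys \<phi>)) \<le> 2 ^ (2 * n)" unfolding length_subseqs using dk by (intro power_increasing) auto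
  then have "length (subseqs (dkeys \<phi>)) * length (types \<phi>) \<le> 2 ^ (2 * n) * 2 ^ (2 * n)" using ty by (rule mult_le_mono)
  also have "\<dots> = m" unfolding m_def power_add[symmetric] by simp
  finally show ?thesis by simp
 qed
 have bt: "btypes p \<phi> = types \<phi>" unfolding btypes_def types_def using bs[of "rsyms \<phi>"] bs[of "subf \<phi>"] r n 2 by simp
 have bk: "bsubs p (dkeys \<phi>) = subseqs (dkeys \<phi>)" "bsubs p (all_keys \<phi>) = subseqs (all_keys \<phi>)"
  using bs[of "dkeys \<phi>"] bs[of "all_keys \<phi>"] dk ak 2 by simp_all
 have bc: "bsubs p (List.product (subseqs (dkeys \<phi>)) (types \<phi>)) = covs \<phi>" unfolding covs_def
  by (rule bs) (use pr ml ll in linarith)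
 have "length (List.product (drs \<phi>) [0..<l]) \<le> l ^ 2"
  unfolding power2_eq_square using d nm ml by (simp add: mult_le_mono)
 then have bp: "bsubs p (List.product (drs \<phi>) [0..<l]) = pots \<phi> l" unfolding pots_def by (rule bs)
 have cands: "bcands p \<phi> l = cands \<phi> l" unfolding bcands_def cands_def bt bk(1) bc bp ..
 define X0 where "X0 = filter (%c. okP \<phi> (fst c)) (cands \<phi> l)"
 define Ls where "Ls = subseqs (all_keys \<phi>)"
 have acc: "accepts p l \<phi> \<longleftrightarrow> (\<exists>c\<in>set (elim \<phi> l Ls X0). \<phi> \<in> set (snd (fst (fst c))))"
  unfolding accepts_def cands bk(2) X0_def Ls_def ..
 have f: "unfo \<phi>" "vars \<phi> \<subseteq> {0, 1}" "\<And>R. R \<in> syms \<phi> ==> arity R \<le> 2" "fv \<phi> = {}"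
  using \<phi> unfolding unfo2_S_sentence_def two_variable_def by auto
 show ?thesis
 proof
  assume "accepts p l \<phi>"
  then obtain c where c: "c \<in> set (elim \<phi> l Ls X0)" "\<phi> \<in> set (snd (fst (fst c)))" unfolding acc by blast
  have "certificate \<phi> l Ls (elim \<phi> l Ls X0) c"
  proof
   show "okP \<phi> (fst c)" if "c \<in> set (elim \<phi> l Ls X0)" for c
    using that elim_subset[of \<phi> l Ls X0 X0] unfolding elim_def X0_def by auto
   show "wit \<phi> l Ls (elim \<phi> l Ls X0) c" if "c \<in> set (elim \<phi> l Ls X0)" for c
    using that unfolding elim_def by (rule elim_stable[OF order.refl])
   show "set L \<subseteq> set (all_keys \<phi>)" if "L \<in> set Ls" for L using subseqs_subset that unfolding Ls_def by blast
  qed (use f c in auto)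
  from certificate.certificate_sound[OF this f(4) c(2)] show "finitely_satisfiable k \<phi>" .
 next
  assume "finitely_satisfiable k \<phi>"
  then obtain A :: "nat struct" where A: "admissible k A" "finite (universe A)" "models A \<phi>"
   unfolding finitely_satisfiable_def by blast
  have "length (dkeys \<phi>) ^ length (dkeys \<phi>) \<le> (2 ^ length (dkeys \<phi>)) ^ length (dkeys \<phi>)"
   by (rule power_mono) (use less_exp less_imp_le_nat in blast)+
  also have "\<dots> \<le> 2 ^ (4 * (m * m))"
  proof -
   have "length (dkeys \<phi>) * length (dkeys \<phi>) \<le> (2 * m) * (2 * m)" using dk nm by (intro mult_le_mono) linarith+
   then show ?thesis unfolding power_mult[symmetric] by (intro power_increasing) auto
  qed
  finally have dd: "length (dkeys \<phi>) ^ length (dkeys \<phi>) \<le> 2 ^ (4 * (m * m))" .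
  have "length (covs \<phi>) \<le> 2 ^ m" unfolding covs_def length_subseqs using pr by (intro power_increasing) auto
  \<comment> \<open>The exponents 2n, m and 4 m^2 stand for types, coverings and records; with 1 for
    the factor 2 their sum stays below l.\<close>
  then have "2 * (length (types \<phi>) * length (covs \<phi>) * length (dkeys \<phi>) ^ length (dkeys \<phi>))
    \<le> 2 * (2 ^ (2 * n) * 2 ^ m * 2 ^ (4 * (m * m)))"
   using ty dd by (intro mult_le_mono order.refl)
  also have "\<dots> = 2 ^ (1 + 2 * n + m + 4 * (m * m))" by (simp add: power_add)
  also have "\<dots> < 2 ^ l"
  proof (rule power_strict_increasing)
   show "1 + 2 * n + m + 4 * (m * m) < l" using nm mm m1 unfolding l' by linarith
  qed simp
  finally have bound: "2 * (length (types \<phi>) * length (covs \<phi>) * length (dkeys \<phi>) ^ length (dkeys \<phi>)) < 2 ^ l" .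
  from certificate_complete[OF \<phi> A bound] obtain X where X: "set X \<subseteq> set (cands \<phi> l)"
   "\<forall>c\<in>set X. okP \<phi> (fst c) \<and> wit \<phi> l Ls X c" "\<exists>c\<in>set X. \<phi> \<in> set (snd (fst (fst c)))"
   unfolding Ls_def by blast
  have "set X \<subseteq> set X0" using X unfolding X0_def by auto
  then have "set X \<subseteq> set (elim \<phi> l Ls X0)" unfolding elim_def by (rule elim_keeps) (use X in blast)
  then show "accepts p l \<phi>" unfolding acc using X(3) by blast
 qed
qed

subsection \<open>Parsing by enumeration\<close>

definition enc_bits :: "nat \<times> bool list => unit => nat \<times> bool list" where
 "enc_bits s _ = (if fst s = 0 then s else (fst s div 2, snd s @ [True, odd (fst s)]))"

lemma FP_enc_nat: "FP f ==> FP (%x. enc_nat (f x))"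
proof -
 have eq: "length us \<ge> m ==> snd (foldl enc_bits (m, acc) us) @ [False] = acc @ enc_nat m" for us m acc
 proof (induction us arbitrary: m acc)
  case (Cons u us)
  show ?case
  proof (cases "m = 0")
   case True
   then show ?thesis using Cons.IH[of 0 acc] by (simp add: enc_bits_def)
  next
   case False
   then have "m div 2 \<le> length us" using Cons.prems by simp
   from Cons.IH[OF this] show ?thesis using False by (simp add: enc_bits_def enc_nat_pos)
  qed
 qed (simp add: enc_nat_0)
 have inv: "fst (foldl enc_bits (m, []) us) \<le> m \<and> length (snd (foldl enc_bits (m, []) us)) \<le> 2 * length us" for m us
  by (induction us rule: rev_induct) (auto simp: enc_bits_def)
 have "FP (%n. foldl enc_bits (n, []) (replicate n ()))"
 proof (rule FP_foldl[where B = "%n. 2 * sz n + 1 + (8 * sz n + 1) + 1" and h = "%_. enc_bits"])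
  show "FP (%p. enc_bits (fst (snd p)) (snd (snd p)))" unfolding enc_bits_def by (intro FP_intros)
  show "pbound (%n::nat. 2 * sz n + 1 + (8 * sz n + 1) + 1)" by (intro pbound_intros)
  fix n and ys zs :: "unit list" assume "replicate n () = ys @ zs"
  then have "length ys \<le> n" by (metis length_append length_replicate le_add1)
  moreover obtain a b where ab: "foldl enc_bits (n, []) ys = (a, b)" by (cases "foldl enc_bits (n, []) ys")
  ultimately show "sz (foldl enc_bits (n, []) ys) \<le> 2 * sz n + 1 + (8 * sz n + 1) + 1"
   using inv[of n ys] sz_word[of b] unfolding ab by (simp add: sz_nat)
 qed (intro FP_intros)+
 then have "FP (%n. snd (foldl enc_bits (n, []) (replicate n ())) @ [False])" by (intro FP_intros)
 moreover have "snd (foldl enc_bits (n, []) (replicate n ())) @ [False] = enc_nat n" for n using eq[of n "replicate n ()" "[]"] by simp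
 ultimately have "FP enc_nat" by simp
 then show "FP f ==> FP (%x. enc_nat (f x))" by (rule FP_comp)
qed

lemma length_enc_nat: "length (enc_nat n) \<le> 2 * n + 1"
proof (induction n rule: less_induct)
 case (less n)
 show ?case
 proof (cases "n = 0")
  case False
  then have "n div 2 + 1 \<le> n" by simp
  then show ?thesis using False less[of "n div 2"] unfolding enc_nat_pos[OF False] list.size by linarith
 qed (simp add: enc_nat_0)
qed

text \<open>An index occurring in a code of n letters is below 2^n, so a first padding of at least
  that length provides all atoms.\<close>

lemma less_enc_nat: "n < 2 ^ length (enc_nat n)"
proof (induction n rule: less_induct)
 case (less n)
 show ?case
 proof (cases "n = 0")
  case False
  then have "n div 2 < 2 ^ length (enc_nat (n div 2))" using less[of "n div 2"] by simp
  then show ?thesis using False by (simp add: enc_nat_pos)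
 qed (simp add: enc_nat_0)
qed

lemma enc_nats_concat: "enc_nats xs = concat (map (%x. True # enc_nat x) xs) @ [False]"
 by (induction xs) auto

lemma enc_rsym_case: "enc_rsym R = (case R of Base i n => False # enc_nat i @ enc_nat n | Dist u => True # enc_nat u)"
 by (cases R) auto

lemma length_enc_nats: "length (enc_nats xs) \<le> 2 * sz xs"
proof (induction xs)
 case (Cons x xs) then show ?case using length_enc_nat[of x] by (simp add: sz_nat)
qed simp

lemma length_enc_rsym: "length (enc_rsym R) \<le> 2 * sz R"
proof (cases R)
 case (Base i n) then show ?thesis using length_enc_nat[of i] length_enc_nat[of n] by (simp add: sz_def ec_prod_def sz_nat[unfolded sz_def])
next
 case (Dist u) then show ?thesis using length_enc_nat[of u] by (simp add: sz_def ec_prod_def sz_nat[unfolded sz_def])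
qed

lemma sz_fm: "sz (Atom R xs) \<ge> 2 + sz R + sz xs" "sz (Eq x y) \<ge> 3 + sz x + sz y" "sz (And a b) \<ge> 3 + sz a + sz b"
 "sz (Or a b) \<ge> 3 + sz a + sz b" "sz (Exists x a) \<ge> 3 + sz x + sz a" "sz (Neg a) \<ge> 3 + sz a"
 by (simp_all add: sz_def ec_prod_def eval_nat_numeral)

lemma length_enc_fm: "length (enc_fm \<phi>) \<le> 2 * sz \<phi>"
proof (induction \<phi>)
 case (Atom R xs) then show ?case using length_enc_rsym[of R] length_enc_nats[of xs] sz_fm(1)[of R xs] by simp
next
 case (Eq x y) then show ?case using length_enc_nat[of x] length_enc_nat[of y] sz_fm(2)[of x y] by (simp add: sz_nat)
next
 case (And a b) then show ?case using sz_fm(3)[of a b] by simp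
next
 case (Or a b) then show ?case using sz_fm(4)[of a b] by simp
next
 case (Exists x a) then show ?case using length_enc_nat[of x] sz_fm(5)[of x a] by (simp add: sz_nat)
next
 case (Neg a) then show ?case using sz_fm(6)[of a] by simp
qed

lemma FP_enc_fm: "FP f ==> FP (%x. enc_fm (f x))"
proof -
 let ?G = "%(x::unit) \<psi> rs. case \<psi> of
    Atom R xs => [False, False, False] @ (case R of Base i n => False # enc_nat i @ enc_nat n | Dist u => True # enc_nat u)
     @ concat (map (%x. True # enc_nat x) xs) @ [False]
   | Eq y z => [False, False, True] @ enc_nat y @ enc_nat z | And a b => [False, True, False] @ concat rs
   | Or a b => [False, True, True] @ concat rs | Exists y a => [True, False, False] @ enc_nat y @ concat rs
   | Neg a => [True, False, True] @ concat rs"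
 have "FP (%p. (%(x::unit) \<psi>. enc_fm \<psi>) (fst p) (snd p))"
 proof (rule FP_fm_rec[where F = "%(x::unit) \<psi>. enc_fm \<psi>" and G = ?G and B = "%p. 8 * sz p + 1"])
  show "FP (%p. ?G (fst p) (fst (snd p)) (snd (snd p)))"
   by (intro FP_case_fm FP_case_rsym FP_enc_nat FP_append FP_concat FP_map FP_Cons FP_const FP_fst FP_snd FP_id)
  show "enc_fm \<psi> = ?G x \<psi> (map enc_fm (kids \<psi>))" for x \<psi>
   by (cases \<psi>) (auto simp: enc_nats_concat enc_rsym_case)
  show "pbound (%p :: unit \<times> fm. 8 * sz p + 1)" by (intro pbound_intros)
  fix x :: unit and \<phi> \<psi> assume "\<psi> \<in> set (subf \<phi>)"
  then show "sz (enc_fm \<psi>) \<le> 8 * sz (x, \<phi>) + 1"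
   using sz_word[of "enc_fm \<psi>"] length_enc_fm[of \<psi>] sz_subf_mem[of \<psi> \<phi>] by simp
 qed
 from FP_comp2[where f = "%(x::unit) \<psi>. enc_fm \<psi>", OF this FP_const]
 show "FP f ==> FP (%x. enc_fm (f x))" .
qed

definition dedup :: "'a list => 'a list" where
 "dedup xs = foldl (%acc x. if x \<in> set acc then acc else x # acc) [] xs"

lemma dedup: "set (dedup xs) = set xs" "distinct (dedup xs)"
proof -
 have "set (foldl (%acc x. if x \<in> set acc then acc else x # acc) acc xs) = set acc \<union> set xs \<and>
   (distinct acc --> distinct (foldl (%acc x. if x \<in> set acc then acc else x # acc) acc xs))" for acc
  by (induction xs arbitrary: acc) auto
 from this[of "[]"] show "set (dedup xs) = set xs" "distinct (dedup xs)" unfolding dedup_def by auto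
qed

lemma FP_dedup: "FP l ==> FP (%x. dedup (l x))" for l :: "'x::enc => 'a::enc list"
proof -
 have sz: "sz (foldl (%acc x. if x \<in> set acc then acc else x # acc) acc xs) \<le> sz acc + sz xs" for acc xs :: "'a list"
 proof (induction xs arbitrary: acc)
  case (Cons x xs)
  show ?case using Cons[of acc] Cons[of "x # acc"] by simp
 qed simp
 have "FP (%xs :: 'a list. foldl (%acc x. if x \<in> set acc then acc else x # acc) [] xs)"
 proof (rule FP_foldl[where B = "%xs. 1 + sz xs" and h = "%_ acc x. if x \<in> set acc then acc else x # acc"])
  show "FP (%p :: 'a list \<times> 'a list \<times> 'a. if snd (snd p) \<in> set (fst (snd p)) then fst (snd p) else snd (snd p) # fst (snd p))"
   by (intro FP_intros)
  show "pbound (%xs :: 'a list. 1 + sz xs)" by (intro pbound_intros)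
  fix x ys zs :: "'a list" assume x: "x = ys @ zs"
  show "sz (foldl (%acc x. if x \<in> set acc then acc else x # acc) [] ys) \<le> 1 + sz x"
   using sz[of "[]" ys] sz_append[of ys zs] length_le_sz[of zs] unfolding x by (cases zs) auto
 qed (intro FP_intros)+
 then show "FP l ==> FP (%x. dedup (l x))" unfolding dedup_def by (rule FP_comp)
qed

definition atoms :: "nat => fm list" where
 "atoms E = map (%q. Atom (Base (fst q) (length (snd q))) (snd q))
    (List.product [0..<E] [[], [0], [1], [0, 0], [0, 1], [1, 0], [1, 1]]) @
   map (%q. Atom (Dist (fst q)) (snd q)) (List.product [0..<E] [[0, 0], [0, 1], [1, 0], [1, 1]]) @
   map (%q. Eq (fst q) (snd q)) (List.product [0, 1] [0, 1])"

definition grow :: "nat => fm list => fm list" where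
 "grow E T = atoms E @ map (%q. And (fst q) (snd q)) (List.product T T) @ map (%q. Or (fst q) (snd q)) (List.product T T)
   @ map (%q. Exists (fst q) (snd q)) (List.product [0, 1] T) @ map Neg T"

text \<open>Formulas are enumerated instead of parsed: after as many rounds as the word has letters,
  all well-formed formulas with codes no longer than the word are present. The list is abandoned
  when it outgrows the padding, which keeps the function polynomial even for a padding that is too
  short.\<close>

definition enum_step :: "(bool list \<times> unit list) \<times> unit list => fm list => bool => fm list" where
 "enum_step x T _ = (let T' = dedup (filter (%\<phi>. length (enc_fm \<phi>) < Suc (length (fst (fst x)))) (grow (length (snd (fst x))) T))
   in if length (snd x) < length T' then [] else T')"

definition enum :: "(bool list \<times> unit list) \<times> unit list => fm list" where
 "enum x = foldl (enum_step x) [] (fst (fst x))"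

lemma enc_fm_pos: "1 \<le> length (enc_fm \<phi>)"
 by (cases \<phi>) auto

text \<open>Indices are unary and below E, so a leaf may have a size linear in E, whereas inner
  nodes cost only a constant. The length of the code, to which every node contributes, pays for
  both.\<close>

lemma sz_grow:
 assumes "\<And>\<phi>. \<phi> \<in> set T ==> sz \<phi> \<le> length (enc_fm \<phi>) * (100 * (E + 1))" "\<phi> \<in> set (grow E T)"
 shows "sz \<phi> \<le> length (enc_fm \<phi>) * (100 * (E + 1))"
proof -
 let ?K = "100 * (E + 1)"
 have K: "sz \<phi> \<le> ?K ==> sz \<phi> \<le> length (enc_fm \<phi>) * ?K" for \<phi>
  using enc_fm_pos[of \<phi>] mult_le_mono1[of 1 "length (enc_fm \<phi>)" ?K] by linarith
 from assms(2) consider "\<phi> \<in> set (atoms E)" | a b where "a \<in> set T" "b \<in> set T" "\<phi> = And a b \<or> \<phi> = Or a b"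
  | x a where "x \<le> 1" "a \<in> set T" "\<phi> = Exists x a" | a where "a \<in> set T" "\<phi> = Neg a"
  unfolding grow_def by fastforce
 then show ?thesis
 proof cases
  case 1
  have "sz \<phi> \<le> 100 * (E + 1)" using 1 unfolding atoms_def
   by (auto simp: sz_def ec_prod_def eval_nat_numeral sz_nat[unfolded sz_def])
  then show ?thesis by (rule K)
 next
  case 2
  have "sz \<phi> \<le> sz a + sz b + 20" using 2 by (auto simp: sz_def ec_prod_def eval_nat_numeral)
  also have "\<dots> \<le> (length (enc_fm a) + length (enc_fm b) + 3) * ?K"
   unfolding add_mult_distrib by (rule add_mono[OF add_mono[OF assms(1)[OF 2(1)] assms(1)[OF 2(2)]]]) simp
  also have "\<dots> = length (enc_fm \<phi>) * ?K" using 2(3) by auto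
  finally show ?thesis .
 next
  case 3
  have "sz \<phi> \<le> sz a + 50" using 3 by (auto simp: sz_def ec_prod_def eval_nat_numeral sz_nat[unfolded sz_def] le_Suc_eq)
  also have "\<dots> \<le> (length (enc_fm a) + 3) * ?K" unfolding add_mult_distrib by (rule add_mono[OF assms(1)[OF 3(2)]]) simp
  also have "\<dots> \<le> length (enc_fm \<phi>) * ?K" using 3(3) by (intro mult_le_mono1) simp
  finally show ?thesis .
 next
  case 4
  have "sz \<phi> \<le> sz a + 50" using 4 by (auto simp: sz_def ec_prod_def eval_nat_numeral)
  also have "\<dots> \<le> (length (enc_fm a) + 3) * ?K" unfolding add_mult_distrib by (rule add_mono[OF assms(1)[OF 4(1)]]) simp
  also have "\<dots> \<le> length (enc_fm \<phi>) * ?K" using 4(2) by (intro mult_le_mono1) simp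
  finally show ?thesis .
 qed
qed

lemma enum_inv:
 defines "T \<equiv> %x us. foldl (enum_step x) [] us"
 shows "length (T x us) \<le> length (snd x) \<and> (\<forall>\<phi>\<in>set (T x us). length (enc_fm \<phi>) \<le> length (fst (fst x)) \<and>
  sz \<phi> \<le> length (enc_fm \<phi>) * (100 * (length (snd (fst x)) + 1)))"
 unfolding T_def
proof (induction us rule: rev_induct)
 case (snoc u us)
 let ?T = "foldl (enum_step x) [] us"
 have "foldl (enum_step x) [] (us @ [u]) = enum_step x ?T u" by simp
 moreover have "\<phi> \<in> set (enum_step x ?T u) ==> \<phi> \<in> set (grow (length (snd (fst x))) ?T) \<and> length (enc_fm \<phi>) \<le> length (fst (fst x))" for \<phi>
  unfolding enum_step_def Let_def by (auto simp: dedup split: if_splits)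
 moreover have "length (enum_step x ?T u) \<le> length (snd x)" unfolding enum_step_def Let_def by simp
 ultimately show ?case using sz_grow[of ?T] snoc by (metis (no_types, lifting))
qed simp

lemma FP_enum: "FP enum"
proof -
 have "FP (%x. foldl (enum_step x) [] (fst (fst x)))"
 proof (rule FP_foldl[where B = "%x. sz (snd x) * (sz (fst (fst x)) * (100 * (sz (snd (fst x)) + 1)) + 1) + 1"])
  show "FP (%p. enum_step (fst p) (fst (snd p)) (snd (snd p)))"
   unfolding enum_step_def Let_def grow_def atoms_def
   by (intro FP_if FP_less FP_length FP_dedup FP_filter FP_Suc FP_enc_fm FP_append FP_map FP_product FP_fm_intros
     FP_upt FP_const FP_fst FP_snd FP_id)
  show "pbound (%x :: (bool list \<times> unit list) \<times> unit list.
    sz (snd x) * (sz (fst (fst x)) * (100 * (sz (snd (fst x)) + 1)) + 1) + 1)"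
   by (intro pbound_intros FP_size FP_fst FP_snd FP_id)
  fix x :: "(bool list \<times> unit list) \<times> unit list" and us vs
  let ?T = "foldl (enum_step x) [] us"
  have "sz ?T \<le> length ?T * (sz (fst (fst x)) * (100 * (sz (snd (fst x)) + 1)) + 1) + 1"
  proof (rule sz_list_le)
   fix \<phi> assume "\<phi> \<in> set ?T"
   then have "sz \<phi> \<le> length (enc_fm \<phi>) * (100 * (length (snd (fst x)) + 1))" "length (enc_fm \<phi>) \<le> length (fst (fst x))"
    using enum_inv[of x us] by auto
   moreover have "length (enc_fm \<phi>) * (100 * (length (snd (fst x)) + 1)) \<le> sz (fst (fst x)) * (100 * (sz (snd (fst x)) + 1))"
    using calculation(2) length_le_sz[of "fst (fst x)"] length_le_sz[of "snd (fst x)"] by (intro mult_le_mono) linarith+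
   ultimately show "sz \<phi> \<le> sz (fst (fst x)) * (100 * (sz (snd (fst x)) + 1))" by linarith
  qed
  also have "\<dots> \<le> sz (snd x) * (sz (fst (fst x)) * (100 * (sz (snd (fst x)) + 1)) + 1) + 1"
   using enum_inv[of x us] length_le_sz[of "snd x"] by (intro add_le_mono1 mult_le_mono1) linarith
  finally show "sz ?T \<le> sz (snd x) * (sz (fst (fst x)) * (100 * (sz (snd (fst x)) + 1)) + 1) + 1" .
 qed (intro FP_intros)+
 then show ?thesis unfolding enum_def[abs_def] .
qed

text \<open>A test of single subformulas, hence computable by a bounded quantifier. Over two
  variables, having at most one free variable means that not both are free; \<open>Dist 0\<close> is
  excluded because it belongs to no signature.\<close>

definition well_formed :: "fm => bool" where
 "well_formed \<phi> \<longleftrightarrow> (\<forall>\<psi>\<in>set (subf \<phi>). case \<psi> of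
    Atom R xs => length xs = arity R \<and> arity R < 3 \<and> R \<noteq> Dist 0 \<and> (\<forall>x\<in>set xs. x < 2)
   | Eq x y => x < 2 \<and> y < 2 | And a b => True | Or a b => True | Exists x a => x < 2
   | Neg a => \<not> (0 \<in> fv a \<and> 1 \<in> fv a))"

lemma well_formed_iff: "well_formed \<phi> \<longleftrightarrow> unfo \<phi> \<and> two_variable \<phi> \<and> Dist 0 \<notin> syms \<phi>"
proof -
 have sub: "(\<exists>x. S \<subseteq> {x}) \<longleftrightarrow> \<not> (0 \<in> S \<and> 1 \<in> S)" if "S \<subseteq> {0, 1::nat}" for S using that by auto
 have two: "x < 2 \<longleftrightarrow> x = 0 \<or> x = Suc 0" for x :: nat by auto
 show ?thesis
 proof (induction \<phi>)
  case (Neg a)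
  have "fv a \<subseteq> {0, 1}" if "two_variable a" using that fv_vars[of a] unfolding two_variable_def by blast
  then show ?case using Neg sub[of "fv a"] unfolding well_formed_def two_variable_def by auto
 next
  case (Atom R xs) then show ?case unfolding well_formed_def two_variable_def by (auto simp: two)
 qed (auto simp: well_formed_def two_variable_def two)
qed

lemma FP_well_formed: "FP f ==> FP (%x. well_formed (f x))"
proof -
 have "FP (%\<phi>. well_formed \<phi>)" unfolding well_formed_def
  by (intro FP_Ball FP_case_fm FP_subf FP_conj FP_not FP_eq FP_less FP_length FP_arity FP_fv FP_const FP_fst FP_snd FP_id)
 then show "FP f ==> FP (%x. well_formed (f x))" by (rule FP_comp)
qed

lemma enum_complete:
 fixes x :: "(bool list \<times> unit list) \<times> unit list"
 assumes e: "2 ^ length (fst (fst x)) \<le> length (snd (fst x))" and p: "2 ^ Suc (length (fst (fst x))) \<le> length (snd x)"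
 shows "well_formed \<phi> ==> length (enc_fm \<phi>) \<le> length us ==> length (enc_fm \<phi>) \<le> length (fst (fst x)) ==>
  \<phi> \<in> set (foldl (enum_step x) [] us)"
proof (induction us arbitrary: \<phi> rule: rev_induct)
 case Nil then show ?case using enc_fm_pos[of \<phi>] by simp
next
 case (snoc u us)
 let ?T = "foldl (enum_step x) [] us" let ?n = "length (fst (fst x))" let ?E = "length (snd (fst x))"
 let ?T' = "dedup (filter (%\<phi>. length (enc_fm \<phi>) < Suc ?n) (grow ?E ?T))"
 \<comment> \<open>Codes are injective and there are fewer than 2^(n+1) words of length at most n,
   so the list fits the padding and is not abandoned.\<close>
 have "card (enc_fm ` set ?T') \<le> card {w :: bool list. set w \<subseteq> UNIV \<and> length w \<le> ?n}"
  by (rule card_mono[OF finite_lists_length_le]) (auto simp: dedup)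
 also have "\<dots> = (\<Sum>i\<le>?n. 2 ^ i)" by (subst card_lists_length_le) (auto simp: card_UNIV_bool)
 also have "\<dots> \<le> 2 ^ Suc ?n" by (induction ("?n")) auto
 finally have "card (enc_fm ` set ?T') \<le> 2 ^ Suc ?n" .
 moreover have "card (enc_fm ` set ?T') = length ?T'"
  by (simp add: card_image[OF inj_on_subset[OF inj_enc_fm]] distinct_card dedup(2) del: dedup(1))
 ultimately have "\<not> length (snd x) < length ?T'" using p by linarith
 then have st: "set (enum_step x ?T u) = {\<psi> \<in> set (grow ?E ?T). length (enc_fm \<psi>) \<le> ?n}"
  unfolding enum_step_def Let_def by (auto simp: dedup)
 have sub: "\<psi> \<in> set ?T" if "length (enc_fm \<psi>) < length (enc_fm \<phi>)" "\<psi> \<in> set (subf \<phi>)" for \<psi>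
 proof (rule snoc.IH)
  show "well_formed \<psi>" using snoc.prems(1) subf_trans[OF that(2)] unfolding well_formed_def by blast
 qed (use that snoc.prems in auto)
 have idx: "i < ?E" if "length (enc_nat i) \<le> length (enc_fm \<phi>)" for i
 proof -
  have "(2::nat) ^ length (enc_nat i) \<le> 2 ^ ?n" using that snoc.prems(3) by (intro power_increasing) auto
  then show ?thesis using less_enc_nat[of i] e by linarith
 qed
 have lists: "xs = [] \<or> xs = [0] \<or> xs = [1] \<or> xs = [0, 0] \<or> xs = [0, 1] \<or> xs = [1, 0] \<or> xs = [1, 1]"
  if "length xs < 3" "\<forall>x\<in>set xs. x < 2" for xs :: "nat list"
 proof -
  have el: "x = 0 \<or> x = 1" if "x \<in> set xs" for x using that \<open>\<forall>x\<in>set xs. x < 2\<close> by fastforce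
  have "length xs = 0 \<or> length xs = 1 \<or> length xs = 2" using that(1) by linarith
  then consider "xs = []" | a where "xs = [a]" | a b where "xs = [a, b]"
   by (auto simp: length_Suc_conv numeral_2_eq_2)
  then show ?thesis
  proof cases
   case 2 then show ?thesis using el[of a] by simp
  next
   case 3 then show ?thesis using el[of a] el[of b] by auto
  qed simp
 qed
 have "\<phi> \<in> set (grow ?E ?T)"
 proof (cases \<phi>)
  case (Atom R xs)
  then have wf: "length xs = arity R" "length xs < 3" "\<forall>x\<in>set xs. x < 2" using snoc.prems(1) unfolding well_formed_def by auto
  show ?thesis
  proof (cases R)
   case (Base i a)
   have "i < ?E" by (rule idx) (simp add: Atom Base)
   then have "(i, xs) \<in> set (List.product [0..<?E] [[], [0], [1], [0, 0], [0, 1], [1, 0], [1, 1]])"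
    using lists[OF wf(2,3)] by auto
   then have "(%q. Atom (Base (fst q) (length (snd q))) (snd q)) (i, xs) \<in> set (atoms ?E)"
    unfolding atoms_def set_append set_map by blast
   then show ?thesis using wf unfolding Atom Base grow_def by simp
  next
   case (Dist u)
   have "u < ?E" by (rule idx) (simp add: Atom Dist)
   then have "(u, xs) \<in> set (List.product [0..<?E] [[0, 0], [0, 1], [1, 0], [1, 1]])"
    using lists[OF wf(2,3)] wf(1) Dist by auto
   then have "(%q. Atom (Dist (fst q)) (snd q)) (u, xs) \<in> set (atoms ?E)"
    unfolding atoms_def set_append set_map by blast
   then show ?thesis unfolding Atom Dist grow_def by simp
  qed
 next
  case (Eq y z)
  then have "y = 0 \<or> y = 1" "z = 0 \<or> z = 1" using snoc.prems(1) unfolding well_formed_def by auto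
  then show ?thesis unfolding Eq grow_def atoms_def by auto
 next
  case (And a b)
  then have "a \<in> set ?T" "b \<in> set ?T" using sub[of a] sub[of b] subf_self by auto
  then show ?thesis unfolding And grow_def by force
 next
  case (Or a b)
  then have "a \<in> set ?T" "b \<in> set ?T" using sub[of a] sub[of b] subf_self by auto
  then show ?thesis unfolding Or grow_def by force
 next
  case (Exists y a)
  then have "a \<in> set ?T" "y = 0 \<or> y = 1" using sub[of a] subf_self snoc.prems(1) unfolding well_formed_def by auto
  then show ?thesis unfolding Exists grow_def by force
 next
  case (Neg a)
  then have "a \<in> set ?T" using sub[of a] subf_self by auto
  then show ?thesis unfolding Neg grow_def by force
 qed
 then show ?case using st snoc.prems(3) by simp
qed

theorem finsat_in_TWO_EXPTIME: "UNFO2_S_FINSAT \<in> TWO_EXPTIME"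
\<comment> \<open>The constants reproduce the paddings of \<open>accepts_iff\<close>, with the
  length of the word as bound for the number of subformulas.\<close>
proof (rule TWO_EXPTIME_I[where a = 8 and b = 2])
 let ?P = "%x :: (bool list \<times> unit list) \<times> unit list. \<exists>\<phi>\<in>set (enum x). enc_fm \<phi> = fst (fst x) \<and> well_formed \<phi> \<and>
   0 \<notin> fv \<phi> \<and> 1 \<notin> fv \<phi> \<and> accepts (snd x) (length (snd (fst x))) \<phi>"
 show "FP ?P"
  by (intro FP_Bex FP_comp[OF FP_enum] FP_conj FP_not FP_eq FP_enc_fm FP_well_formed FP_fv FP_accepts FP_length
    FP_const FP_fst FP_snd FP_id)
 fix w :: "bool list" and e p :: "unit list"
 assume e: "length e = 2 ^ (8 * length w + 8)" and p: "length p = 2 ^ (length e ^ 2)"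
 have len: "length (subf \<phi>) \<le> length (enc_fm \<phi>)" for \<phi> by (induction \<phi>) auto
 have sent: "\<exists>k. unfo2_S_sentence k \<phi>" if "well_formed \<phi>" "0 \<notin> fv \<phi>" "1 \<notin> fv \<phi>" for \<phi>
 proof -
  have fin: "finite {u. Dist u \<in> syms \<phi>}"
  proof (rule finite_subset)
   have "finite (syms \<phi>)" by (induction \<phi>) auto
   then show "finite ((%R. case R of Base i n => 0 | Dist u => u) ` syms \<phi>)" by (rule finite_imageI)
   show "{u. Dist u \<in> syms \<phi>} \<subseteq> (%R. case R of Base i n => 0 | Dist u => u) ` syms \<phi>" by force
  qed
  \<comment> \<open>The largest distinguished index, as a value of k, makes the range 1, ..., 2k
    contain every index that occurs.\<close>
  have "over_signature (Max (insert 0 {u. Dist u \<in> syms \<phi>})) \<phi>" unfolding over_signature_def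
  proof (intro allI impI)
   fix u assume u: "Dist u \<in> syms \<phi>"
   then have "u \<le> Max (insert 0 {u. Dist u \<in> syms \<phi>})" using fin by (intro Max_ge) auto
   moreover have "u \<noteq> 0" using u that(1) unfolding well_formed_iff by metis
   ultimately show "u \<in> {1..2 * Max (insert 0 {u. Dist u \<in> syms \<phi>})}" by simp
  qed
  moreover have "fv \<phi> \<subseteq> {0, 1}" using that(1) fv_vars[of \<phi>] unfolding well_formed_iff two_variable_def by blast
  then have "fv \<phi> = {}" using that by blast
  ultimately show ?thesis using that(1) unfolding unfo2_S_sentence_def well_formed_iff by blast
 qed
 show "w \<in> UNFO2_S_FINSAT \<longleftrightarrow> ?P ((w, e), p)"
 proof
  assume "w \<in> UNFO2_S_FINSAT"
  then obtain \<phi> k where \<phi>: "w = enc_fm \<phi>" "unfo2_S_sentence k \<phi>" "finitely_satisfiable k \<phi>"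
   unfolding UNFO2_S_FINSAT_def by blast
  have wf: "well_formed \<phi>" using \<phi>(2) unfolding unfo2_S_sentence_def over_signature_def well_formed_iff by force
  have "(2::nat) ^ length w \<le> length e" unfolding e by (rule power_increasing) auto
  moreover have "2 ^ Suc (length w) \<le> length p"
  proof -
   have "Suc (length w) \<le> 8 * length w + 8" by simp
   also have "\<dots> \<le> length e" unfolding e using less_exp less_imp_le_nat by blast
   also have "\<dots> \<le> length e ^ 2" unfolding power2_eq_square by (rule le_square)
   finally show ?thesis unfolding p by (intro power_increasing) auto
  qed
  ultimately have "\<phi> \<in> set (enum ((w, e), p))" unfolding enum_def
   by (intro enum_complete wf) (simp_all add: \<phi>(1))
  moreover have "accepts p (length e) \<phi>"
   using accepts_iff[OF \<phi>(2) len[of \<phi>] _ p] e \<phi>(1,3) by simp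
  moreover have "fv \<phi> = {}" using \<phi>(2) unfolding unfo2_S_sentence_def by simp
  ultimately show "?P ((w, e), p)" using wf \<phi>(1) by auto
 next
  assume "?P ((w, e), p)"
  then obtain \<phi> where \<phi>: "enc_fm \<phi> = w" "well_formed \<phi>" "0 \<notin> fv \<phi>" "1 \<notin> fv \<phi>" "accepts p (length e) \<phi>" by auto
  obtain k where k: "unfo2_S_sentence k \<phi>" using sent \<phi> by blast
  have "finitely_satisfiable k \<phi>" using accepts_iff[OF k len[of \<phi>] _ p] e \<phi>(1,5) by simp
  then show "w \<in> UNFO2_S_FINSAT" unfolding UNFO2_S_FINSAT_def using k \<phi>(1) by blast
 qed
qed simp_all

section \<open>Turing machines as cellular automata\<close>

text \<open>The code is one more than the offset of the sender as seen from the receiving cell: a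
  head that moves right arrives from offset -1.\<close>

fun dcode :: "move => nat" where
 "dcode Right = 0" | "dcode Stay = 1" | "dcode Left = 2"

definition letter :: "bool list => nat => bool" where
 "letter w m = (case drop m w of [] => False | b # _ => b)"

lemma letter_nth: "m < length w ==> letter w m = w ! m"
 by (simp add: letter_def Cons_nth_drop_Suc[symmetric])

text \<open>
 The machine \<open>M\<close> with a prelude: in state \<open>num_states M + m\<close> the letter \<open>w ! m\<close> is written and
 the head moves left, so that \<open>M\<close> is started on \<open>w\<close> from the blank tape.  Halting states loop.
\<close>

definition xdelta :: "tm => bool list => nat => nat => nat \<times> nat \<times> nat" where
 "xdelta M w q a = (if q = accept_state M \<or> q = reject_state M then (q, a, 1)
   else if q < num_states M then
    (if a < num_symbols M then case trans_fun M q a of (q', b, d) => (q', b, dcode d) else (q, a, 1))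
   else (if q = num_states M then 0 else q - 1, if letter w (q - num_states M) then 2 else 1,
    if q = num_states M then 1 else 2))"

text \<open>
 A cell \<open>(a, s)\<close> contains the symbol \<open>a\<close> and, if \<open>s = Suc q\<close>, the head in state \<open>q\<close>.  The
 head is sent to a cell by its neighbour at offset \<open>d - 1\<close>.
\<close>

definition wr :: "tm => bool list => nat \<times> nat => nat" where
 "wr M w c = (if snd c = 0 then fst c else fst (snd (xdelta M w (snd c - 1) (fst c))))"

definition msg :: "tm => bool list => nat => nat \<times> nat => nat" where
 "msg M w d c = (if snd c = 0 then 0 else if snd (snd (xdelta M w (snd c - 1) (fst c))) = d
   then Suc (fst (xdelta M w (snd c - 1) (fst c))) else 0)"

definition rule :: "tm => bool list => nat \<times> nat => nat \<times> nat => nat \<times> nat => nat \<times> nat" where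
 "rule M w l c r = (wr M w c, if msg M w 0 l \<noteq> 0 then msg M w 0 l else if msg M w 1 c \<noteq> 0 then msg M w 1 c else msg M w 2 r)"

definition start_state :: "tm => bool list => nat" where
 "start_state M w = (if w = [] then 0 else num_states M + (length w - 1))"

definition dstep :: "tm => bool list => config => config" where
 "dstep M w c = (let r = xdelta M w (state c) (tape c (head c)) in
   \<lparr>state = fst r, head = head c + 1 - int (snd (snd r)), tape = (tape c)(head c := fst (snd r))\<rparr>)"

definition start_config :: "tm => bool list => config" where
 "start_config M w = \<lparr>state = start_state M w, head = int (length w - 1), tape = (%_. 0)\<rparr>"

definition view :: "config => int => nat \<times> nat" where
 "view c z = (tape c z, if head c = z then Suc (state c) else 0)"

lemma xdelta_dir: "snd (snd (xdelta M w q a)) \<le> 2"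
proof -
 have "dcode d \<le> 2" for d by (cases d) auto
 then show ?thesis unfolding xdelta_def by (auto split: prod.split)
qed

text \<open>Locality: a machine step changes a cell depending only on the cell itself and its two
  neighbours.\<close>

lemma view_dstep: "view (dstep M w c) z = rule M w (view c (z - 1)) (view c z) (view c (z + 1))"
proof -
 obtain q b d where r: "xdelta M w (state c) (tape c (head c)) = (q, b, d)" by (cases "xdelta M w (state c) (tape c (head c))")
 have d: "d = 0 \<or> d = 1 \<or> d = 2" using xdelta_dir[of M w "state c" "tape c (head c)"] unfolding r by auto
 have v: "view (dstep M w c) z = (if z = head c then b else tape c z, if head c + 1 - int d = z then Suc q else 0)"
  unfolding view_def dstep_def r by simp
 consider "head c = z - 1" | "head c = z" | "head c = z + 1" | "head c \<noteq> z - 1" "head c \<noteq> z" "head c \<noteq> z + 1" by blast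
 then show ?thesis
 proof cases
  case 1
  then have "tape c (z - 1) = tape c (head c)" by simp
  then show ?thesis unfolding v using 1 r d by (auto simp: rule_def view_def wr_def msg_def)
 next
  case 2
  then show ?thesis unfolding v using r d by (auto simp: rule_def view_def wr_def msg_def)
 next
  case 3
  then have "tape c (z + 1) = tape c (head c)" by simp
  then show ?thesis unfolding v using 3 r d by (auto simp: rule_def view_def wr_def msg_def)
 next
  case 4 then show ?thesis unfolding v using d by (auto simp: rule_def view_def wr_def msg_def)
 qed
qed

locale simulation =
 fixes M :: tm and w :: "bool list" and N :: nat
 assumes tm: "is_tm M" and N: "2 \<le> N"
begin

lemma states: "0 < num_states M" "3 \<le> num_symbols M" "accept_state M < num_states M" "reject_state M < num_states M"
 "accept_state M \<noteq> reject_state M"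
 "q < num_states M ==> a < num_symbols M ==> trans_fun M q a = (q', b, d) ==> q' < num_states M \<and> b < num_symbols M"
 using tm unfolding is_tm_def by fastforce+

text \<open>The word is written from its last letter to its first, so that the head finishes at
  position 0, where M expects it.\<close>

lemma prelude:
 assumes "m < length w"
 shows "(dstep M w ^^ m) (start_config M w) = \<lparr>state = num_states M + (length w - 1 - m), head = int (length w - 1 - m),
  tape = (%z. if int (length w - m) \<le> z then word_tape w z else 0)\<rparr>"
 using assms
proof (induction m)
 case 0
 then show ?case by (auto simp: start_config_def start_state_def word_tape_def fun_eq_iff)
next
 case (Suc m)
 define j where "j = length w - 1 - m"
 have j: "length w - m = Suc j" "j < length w" "0 < j" "length w - Suc m = j" "length w - 1 - Suc m = j - 1"
  using Suc.prems unfolding j_def by auto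
 have "m < length w" using Suc.prems by simp
 from Suc.IH[OF this] have IH: "(dstep M w ^^ m) (start_config M w) = \<lparr>state = num_states M + j, head = int j,
   tape = (%z. if int (Suc j) \<le> z then word_tape w z else 0)\<rparr>" unfolding j_def[symmetric] j(1) .
 have 1: "xdelta M w (num_states M + j) a = (num_states M + j - 1, if w ! j then 2 else 1, 2)" for a
  using states(1-5) j(3) letter_nth[OF j(2)] unfolding xdelta_def by auto
 have 2: "(%z. if int (Suc j) \<le> z then word_tape w z else 0)(int j := if w ! j then 2 else 1)
   = (%z. if int j \<le> z then word_tape w z else 0)" using j(2) by (auto simp: word_tape_def fun_eq_iff)
 have "dstep M w \<lparr>state = num_states M + j, head = int j, tape = (%z. if int (Suc j) \<le> z then word_tape w z else 0)\<rparr>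
   = \<lparr>state = num_states M + (j - 1), head = int (j - 1), tape = (%z. if int j \<le> z then word_tape w z else 0)\<rparr>"
  unfolding dstep_def config.simps 1 Let_def fst_conv snd_conv 2 using j(3) by (simp add: of_nat_diff)
 then show ?case unfolding funpow.simps comp_apply IH j(4,5) .
qed

lemma prelude_end: "(dstep M w ^^ length w) (start_config M w) = init_config w"
proof (cases "w = []")
 case True
 then show ?thesis by (auto simp: start_config_def start_state_def init_config_def word_tape_def fun_eq_iff)
next
 case False
 then obtain n where n: "length w = Suc n" by (cases w) auto
 have p: "(dstep M w ^^ n) (start_config M w) = \<lparr>state = num_states M, head = 0,
  tape = (%z. if 1 \<le> z then word_tape w z else 0)\<rparr>" using prelude[of n] n by simp
 have "xdelta M w (num_states M) a = (0, if w ! 0 then 2 else 1, 1)" for a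
  using states(1-5) letter_nth[of 0 w] n unfolding xdelta_def by auto
 moreover have "(%z. if 1 \<le> z then word_tape w z else 0)(0 := if w ! 0 then 2 else 1) = word_tape w"
  using n by (auto simp: word_tape_def fun_eq_iff)
 ultimately have "dstep M w ((dstep M w ^^ n) (start_config M w)) = init_config w"
  unfolding p by (simp add: dstep_def init_config_def)
 then show ?thesis unfolding n by simp
qed

lemma dstep_step:
 assumes "state c < num_states M" "\<And>z. tape c z < num_symbols M"
 shows "dstep M w c = step M c \<and> state (dstep M w c) < num_states M \<and> (\<forall>z. tape (dstep M w c) z < num_symbols M)"
proof (cases "halted M c")
 case True
 then show ?thesis using assms by (auto simp: dstep_def step_def xdelta_def halted_def)
next
 case False
 obtain q b d where r: "trans_fun M (state c) (tape c (head c)) = (q, b, d)" by (cases "trans_fun M (state c) (tape c (head c))")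
 have "shift d (head c) = head c + 1 - int (dcode d)" by (cases d) auto
 then show ?thesis using False r assms states(6)[OF assms r]
  by (auto simp: dstep_def step_def xdelta_def halted_def)
qed

lemma dstep_steps: "(dstep M w ^^ (length w + t)) (start_config M w) = (step M ^^ t) (init_config w)"
proof -
 have "(dstep M w ^^ t) (init_config w) = (step M ^^ t) (init_config w) \<and> state ((step M ^^ t) (init_config w)) < num_states M \<and>
   (\<forall>z. tape ((step M ^^ t) (init_config w)) z < num_symbols M)" for t
 proof (induction t)
  case 0 then show ?case using states(1-5) by (auto simp: init_config_def word_tape_def)
 next
  case (Suc t) then show ?case using dstep_step[of "(step M ^^ t) (init_config w)"] by auto
 qed
 then show ?thesis unfolding add.commute[of "length w"] funpow_add comp_apply prelude_end by blast
qed

text \<open>Halting configurations are fixed points, so the decision can be read off at one time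
  chosen in advance, common to accepting and rejecting runs.\<close>

lemma final_state:
 assumes "decides_in_time M X T" "length w + T (length w) \<le> \<tau>"
 shows "state ((dstep M w ^^ \<tau>) (start_config M w)) = accept_state M \<longleftrightarrow> w \<in> X"
proof -
 obtain t where t: "t \<le> T (length w)" "state ((step M ^^ t) (init_config w)) = (if w \<in> X then accept_state M else reject_state M)"
  using assms(1) unfolding decides_in_time_def by blast
 have "halted M ((step M ^^ t) (init_config w))" using t(2) unfolding halted_def by auto
 then have fx: "step M ((step M ^^ t) (init_config w)) = (step M ^^ t) (init_config w)" by (simp add: step_def)
 have "(step M ^^ (j + t)) (init_config w) = (step M ^^ t) (init_config w)" for j
  by (induction j) (simp_all add: fx)
 moreover have "\<tau> = length w + ((\<tau> - length w - t) + t)" using assms(2) t(1) by simp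
 ultimately have "(dstep M w ^^ \<tau>) (start_config M w) = (step M ^^ t) (init_config w)"
  using dstep_steps[of "(\<tau> - length w - t) + t"] by metis
 then show ?thesis using t(2) states(5) by simp
qed

text \<open>The initial row has a head at every multiple of 2^N, because a counter of N bits knows
  the place only modulo 2^N.\<close>

primrec cell :: "nat => int => nat \<times> nat" where
 "cell 0 z = (0, if 2 ^ N dvd z then Suc (start_state M w) else 0)"
| "cell (Suc t) z = rule M w (cell t (z - 1)) (cell t z) (cell t (z + 1))"

lemma cell_periodic: "2 ^ N dvd z - z' ==> cell t z = cell t z'"
proof (induction t arbitrary: z z')
 case 0
 then show ?case using dvd_add_right_iff[of "2 ^ N" "z - z'" z'] by simp
next
 case (Suc t)
 have "cell t (z + k) = cell t (z' + k)" for k using Suc by simp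
 from this[of "- 1"] this[of 0] this[of 1] show ?case by simp
qed

lemma cell_range: "fst (cell t z) < num_symbols M \<and> snd (cell t z) \<le> num_states M + length w"
proof (induction t arbitrary: z)
 case 0
 have "Suc (start_state M w) \<le> num_states M + length w" using states(1) by (cases w) (auto simp: start_state_def)
 then show ?case using states(2) by simp
next
 case (Suc t)
 have d: "fst (xdelta M w q a) < num_states M + length w \<and> fst (snd (xdelta M w q a)) < num_symbols M"
  if "q < num_states M + length w" "a < num_symbols M" for q a
 proof (cases "q < num_states M")
  case True
  obtain q' b d where r: "trans_fun M q a = (q', b, d)" by (cases "trans_fun M q a")
  show ?thesis using True that r states(6)[OF True that(2) r] by (auto simp: xdelta_def)
 next
  case False
  then show ?thesis using that states(1-5) by (auto simp: xdelta_def)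
 qed
 have c: "snd (cell t z) - 1 < num_states M + length w" if "snd (cell t z) \<noteq> 0" for z using that Suc[of z] by linarith
 have "wr M w (cell t z) < num_symbols M" using Suc[of z] d[OF c] by (simp add: wr_def)
 moreover have "msg M w k (cell t z) \<le> num_states M + length w" for k z
  using Suc[of z] d[OF c, of z "fst (cell t z)"] by (simp add: msg_def Suc_le_eq)
 ultimately show ?case by (simp add: rule_def)
qed

lemma one_head: "\<exists>h. \<forall>z. snd (cell t z) \<noteq> 0 --> 2 ^ N dvd z - h"
proof (induction t)
 case 0 show ?case by (rule exI[of _ 0]) simp
next
 case (Suc t)
 then obtain h where h: "\<And>z. snd (cell t z) \<noteq> 0 ==> 2 ^ N dvd z - h" by blast
 let ?d = "snd (snd (xdelta M w (snd (cell t h) - 1) (fst (cell t h))))"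
 have m: "2 ^ N dvd z - (h + 1 - int ?d)" if "msg M w d (cell t (z + int d - 1)) \<noteq> 0" for d z
 proof -
  have "2 ^ N dvd (z + int d - 1) - h" using that h unfolding msg_def by metis
  moreover from cell_periodic[OF this] have "?d = d" using that unfolding msg_def by (metis (full_types))
  ultimately show ?thesis by (simp add: algebra_simps)
 qed
 have "2 ^ N dvd z - (h + 1 - int ?d)" if "snd (cell (Suc t) z) \<noteq> 0" for z
 proof -
  have "msg M w 0 (cell t (z - 1)) \<noteq> 0 \<or> msg M w 1 (cell t z) \<noteq> 0 \<or> msg M w 2 (cell t (z + 1)) \<noteq> 0"
   using that by (auto simp: rule_def split: if_splits)
  then show ?thesis using m[of 0 z] m[of 1 z] m[of 2 z] by (auto simp: add.commute)
 qed
 then show ?case by blast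
qed

text \<open>All heads of a row are congruent modulo 2^N, which is at least 4; so at most one of the
  three predecessors of a cell sends a head.\<close>

lemma one_msg:
 assumes "msg M w d (cell t (z + int d - 1)) \<noteq> 0" "msg M w e (cell t (z + int e - 1)) \<noteq> 0" "d < 3" "e < 3"
 shows "d = e"
proof -
 obtain h where h: "\<And>z. snd (cell t z) \<noteq> 0 ==> 2 ^ N dvd z - h" using one_head by blast
 have "2 ^ N dvd (z + int d - 1) - h" "2 ^ N dvd (z + int e - 1) - h" using assms(1,2) h unfolding msg_def by metis+
 from dvd_diff[OF this] have dv: "2 ^ N dvd int d - int e" by simp
 have "(4::int) \<le> 2 ^ N" using power_increasing[OF N, of "2::int"] by simp
 then show ?thesis using dvd_imp_le_int[OF _ dv] assms(3,4) by fastforce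
qed

lemma next_state: "d < 3 ==> msg M w d (cell t (z + int d - 1)) \<noteq> 0 ==> snd (cell (Suc t) z) = msg M w d (cell t (z + int d - 1))"
proof -
 assume d: "d < 3" and m: "msg M w d (cell t (z + int d - 1)) \<noteq> 0"
 have "msg M w e (cell t (z + int e - 1)) = 0" if "e < 3" "e \<noteq> d" for e using one_msg[OF m _ d that(1)] that(2) by blast
 from this[of 0] this[of 1] this[of 2] show ?thesis using d m
  by (auto simp: rule_def less_Suc_eq numeral_3_eq_3 numeral_2_eq_2 add.commute)
qed

lemma next_state_0: "(\<And>d. d < 3 ==> msg M w d (cell t (z + int d - 1)) = 0) ==> snd (cell (Suc t) z) = 0"
proof -
 assume m: "\<And>d. d < 3 ==> msg M w d (cell t (z + int d - 1)) = 0"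
 from m[of 0] m[of 1] m[of 2] show ?thesis by (simp add: rule_def add.commute)
qed

text \<open>The copies of the computation start 2^N apart and influence travels one cell per step,
  so inside the cone only the copy around 0 is seen. The shift is the starting position of the head,
  at the last letter of the word.\<close>

lemma light_cone: "\<bar>z\<bar> + int t < 2 ^ N ==> cell t z = view ((dstep M w ^^ t) (start_config M w)) (z + int (length w - 1))"
proof (induction t arbitrary: z)
 case 0
 then have "2 ^ N dvd z \<longleftrightarrow> z = 0" using dvd_imp_le_int[of z "2 ^ N"] by (cases "z = 0") auto
 then show ?case by (auto simp: view_def start_config_def)
next
 case (Suc t)
 have "cell t (z + k) = view ((dstep M w ^^ t) (start_config M w)) (z + k + int (length w - 1))" if "\<bar>k\<bar> \<le> 1" for k
  using Suc.IH[of "z + k"] Suc.prems that by simp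
 from this[of "- 1"] this[of 0] this[of 1] show ?case by (simp add: view_dstep algebra_simps)
qed

text \<open>At time 2^(N-1) - 1 every residue class still has a representative inside the light
  cone, namely the one from -2^(N-1) to 2^(N-1) - 1. Acceptance anywhere in the periodic row is thus
  acceptance by the machine.\<close>

lemma accepting_cell:
 assumes "decides_in_time M X T" and \<tau>: "\<tau> = 2 ^ (N - 1) - 1" "length w + T (length w) \<le> \<tau>"
 shows "(\<exists>z. snd (cell \<tau> z) = Suc (accept_state M)) \<longleftrightarrow> w \<in> X"
proof -
 let ?c = "(dstep M w ^^ \<tau>) (start_config M w)" let ?o = "int (length w - 1)"
 have NN: "(2::int) ^ N = 2 * 2 ^ (N - 1)" using N power_Suc[of "2::int" "N - 1"] by simp
 have t: "int \<tau> = 2 ^ (N - 1) - 1" unfolding \<tau>(1) by (simp add: of_nat_diff)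
 note fs = final_state[OF assms(1) \<tau>(2)]
 show ?thesis
 proof
  assume "\<exists>z. snd (cell \<tau> z) = Suc (accept_state M)"
  then obtain z where z: "snd (cell \<tau> z) = Suc (accept_state M)" by blast
  define y where "y = (z + 2 ^ (N - 1)) mod 2 ^ N - 2 ^ (N - 1)"
  have "z - y = 2 ^ N * ((z + 2 ^ (N - 1)) div 2 ^ N)"
   unfolding y_def using minus_mod_eq_mult_div[of "z + 2 ^ (N - 1)" "2 ^ N"] by (simp add: algebra_simps)
  then have "cell \<tau> z = cell \<tau> y" by (intro cell_periodic) simp
  moreover have "0 \<le> (z + 2 ^ (N - 1)) mod 2 ^ N" "(z + 2 ^ (N - 1)) mod 2 ^ N < 2 ^ N" by simp_all
  then have "\<bar>y\<bar> + int \<tau> < 2 ^ N" unfolding y_def t NN by linarith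
  ultimately have "snd (view ?c (y + ?o)) = Suc (accept_state M)" using light_cone[of y \<tau>] z by simp
  then show "w \<in> X" using fs by (auto simp: view_def split: if_splits)
 next
  assume "w \<in> X"
  then have acc: "state ?c = accept_state M" using fs by simp
  have "\<bar>head ((dstep M w ^^ t) (start_config M w)) - ?o\<bar> \<le> int t" for t
  proof (induction t)
   case (Suc t)
   let ?c = "(dstep M w ^^ t) (start_config M w)"
   have "\<bar>head (dstep M w ?c) - head ?c\<bar> \<le> 1"
    using xdelta_dir[of M w "state ?c" "tape ?c (head ?c)"] by (simp add: dstep_def Let_def)
   then show ?case using Suc by simp
  qed (simp add: start_config_def)
  from this[of \<tau>] have "\<bar>head ?c - ?o\<bar> + int \<tau> < 2 ^ N" unfolding NN using t by linarith
  from light_cone[OF this] have "snd (cell \<tau> (head ?c - ?o)) = Suc (accept_state M)" using acc by (simp add: view_def)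
  then show "\<exists>z. snd (cell \<tau> z) = Suc (accept_state M)" by blast
 qed
qed

end

section \<open>Describing the computation by a sentence\<close>

definition conjs :: "fm list => fm" where "conjs xs = foldl (%acc x. And x acc) (Eq 0 0) (rev xs)"
definition disjs :: "fm list => fm" where "disjs xs = foldl (%acc x. Or x acc) (Neg (Eq 0 0)) (rev xs)"

text \<open>Boolean combinations are paired with their negations, since negation may only be applied to unary formulas.\<close>

type_synonym bexp = "fm \<times> fm"

definition lit :: "nat => nat => bexp" where "lit p v = (Atom (Base p 1) [v], Neg (Atom (Base p 1) [v]))"
definition conjb :: "bexp list => bexp" where "conjb xs = (conjs (map fst xs), disjs (map snd xs))"
definition notb :: "bexp => bexp" where "notb q = (snd q, fst q)"
definition disjb :: "bexp list => bexp" where "disjb xs = notb (conjb (map notb xs))"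
definition impb :: "bexp => bexp => bexp" where "impb a b = disjb [notb a, b]"
definition iffb :: "bexp => bexp => bexp" where "iffb a b = conjb [impb a b, impb b a]"
definition isb :: "nat => nat => bool => bexp" where "isb p v b = (if b then lit p v else notb (lit p v))"
definition same :: "nat => bexp" where "same p = iffb (lit p 0) (lit p 1)"

inductive bx :: "bexp => bool" where
 bx_lit: "v < 2 ==> bx (lit p v)"
| bx_conjb: "(\<And>q. q \<in> set xs ==> bx q) ==> bx (conjb xs)"
| bx_notb: "bx q ==> bx (notb q)"

lemma conjs_simps: "conjs [] = Eq 0 0" "conjs (x # xs) = And x (conjs xs)" "disjs [] = Neg (Eq 0 0)" "disjs (x # xs) = Or x (disjs xs)"
 by (simp_all add: conjs_def disjs_def)

lemma sat_conjs [simp]: "sat A v (conjs xs) \<longleftrightarrow> (\<forall>x\<in>set xs. sat A v x)" "sat A v (disjs xs) \<longleftrightarrow> (\<exists>x\<in>set xs. sat A v x)"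
 by (induction xs) (auto simp: conjs_simps)

lemma bx_sat: "bx q ==> sat A v (snd q) \<longleftrightarrow> \<not> sat A v (fst q)"
 by (induction rule: bx.induct) (auto simp: lit_def conjb_def notb_def)

definition okf :: "fm => bool" where
 "okf \<psi> \<longleftrightarrow> unfo \<psi> \<and> vars \<psi> \<subseteq> {0, 1} \<and> (\<forall>R\<in>syms \<psi>. arity R \<le> 2 \<and> (\<forall>u. R = Dist u --> 1 \<le> u \<and> u \<le> 12))"

lemma okf_simps: "okf (And a b) \<longleftrightarrow> okf a \<and> okf b" "okf (Or a b) \<longleftrightarrow> okf a \<and> okf b" "okf (Eq 0 0)" "okf (Neg (Eq 0 0))"
 unfolding okf_def by (simp_all add: ball_Un) blast+

lemma okf_conjs: "okf (conjs xs) \<longleftrightarrow> (\<forall>x\<in>set xs. okf x)" "okf (disjs xs) \<longleftrightarrow> (\<forall>x\<in>set xs. okf x)"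
 by (induction xs) (simp_all add: conjs_simps okf_simps)

lemma bx_okf: "bx q ==> okf (fst q) \<and> okf (snd q)"
proof (induction rule: bx.induct)
 case (bx_lit v p) then show ?case by (auto simp: lit_def okf_def)
next
 case (bx_conjb xs) then show ?case by (auto simp: conjb_def okf_conjs)
qed (auto simp: notb_def)

lemma bx_intros [simp]: "bx (lit p 0)" "bx (lit p 1)" "bx (lit p (Suc 0))" "(\<forall>q\<in>set xs. bx q) ==> bx (conjb xs)"
 "bx q ==> bx (notb q)" "(\<forall>q\<in>set xs. bx q) ==> bx (disjb xs)" "bx a ==> bx b ==> bx (impb a b)"
 "bx a ==> bx b ==> bx (iffb a b)" "bx (isb p 0 c)" "bx (isb p 1 c)" "bx (isb p (Suc 0) c)" "bx (same p)"
 unfolding same_def isb_def iffb_def impb_def disjb_def by (auto intro!: bx.intros)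

lemma sat_bexp [simp]:
 "sat A v (fst (lit p x)) \<longleftrightarrow> [v x] \<in> interp A (Base p 1)" "sat A v (fst (conjb xs)) \<longleftrightarrow> (\<forall>q\<in>set xs. sat A v (fst q))"
 "bx q ==> sat A v (fst (notb q)) \<longleftrightarrow> \<not> sat A v (fst q)"
 "\<forall>q\<in>set xs. bx q ==> sat A v (fst (disjb xs)) \<longleftrightarrow> (\<exists>q\<in>set xs. sat A v (fst q))"
 "bx a ==> sat A v (fst (impb a b)) \<longleftrightarrow> (sat A v (fst a) --> sat A v (fst b))"
 "bx a ==> bx b ==> sat A v (fst (iffb a b)) \<longleftrightarrow> (sat A v (fst a) \<longleftrightarrow> sat A v (fst b))"
 "x < 2 ==> sat A v (fst (isb p x c)) \<longleftrightarrow> ([v x] \<in> interp A (Base p 1)) = c"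
 "sat A v (fst (same p)) \<longleftrightarrow> ([v 0] \<in> interp A (Base p 1)) = ([v 1] \<in> interp A (Base p 1))"
proof -
 show 1: "sat A v (fst (lit p x)) \<longleftrightarrow> [v x] \<in> interp A (Base p 1)" for x p by (simp add: lit_def)
 show 2: "sat A v (fst (conjb xs)) \<longleftrightarrow> (\<forall>q\<in>set xs. sat A v (fst q))" for xs by (simp add: conjb_def)
 show 3: "bx q ==> sat A v (fst (notb q)) \<longleftrightarrow> \<not> sat A v (fst q)" for q by (simp add: notb_def bx_sat)
 show 4: "\<forall>q\<in>set xs. bx q ==> sat A v (fst (disjb xs)) \<longleftrightarrow> (\<exists>q\<in>set xs. sat A v (fst q))" for xs
  unfolding disjb_def by (subst 3) (auto simp: 2 3)
 have imp: "sat A v (fst (impb a b)) \<longleftrightarrow> (sat A v (fst a) --> sat A v (fst b))" if "bx a" for a b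
  using bx_sat[OF that] unfolding impb_def disjb_def notb_def conjb_def by (simp add: notb_def) blast
 then show "bx a ==> sat A v (fst (impb a b)) \<longleftrightarrow> (sat A v (fst a) --> sat A v (fst b))" .
 show 6: "bx a ==> bx b ==> sat A v (fst (iffb a b)) \<longleftrightarrow> (sat A v (fst a) \<longleftrightarrow> sat A v (fst b))" for a b
  unfolding iffb_def 2 by (auto simp: imp)
 show "x < 2 ==> sat A v (fst (isb p x c)) \<longleftrightarrow> ([v x] \<in> interp A (Base p 1)) = c"
  unfolding isb_def by (auto simp: 1 3 bx_lit)
 show "sat A v (fst (same p)) \<longleftrightarrow> ([v 0] \<in> interp A (Base p 1)) = ([v 1] \<in> interp A (Base p 1))"
  unfolding same_def by (simp add: 1 6)
qed

text \<open>The odd symbols 1, 3, ..., 11, one for each offset and parity. Their inverses are not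
  mentioned: \<open>eqf\<close> asks for a connection in both directions.\<close>

definition eu :: "nat => bool => nat" where "eu d b = 4 * d + (if b then 3 else 1)"
definition eqf :: "nat => fm" where "eqf u = And (Atom (Dist u) [0, 1]) (Atom (Dist u) [1, 0])"

text \<open>Universal statements are negations of closed existential formulas, the negated matrix
  being taken from the pair. In \<open>allex\<close> the inner negation has only variable 0 free, so
  negation remains unary.\<close>

definition all2 :: "nat => bexp => fm" where "all2 u q = Neg (Exists 0 (Exists 1 (And (eqf u) (snd q))))"
definition all1 :: "bexp => fm" where "all1 q = Neg (Exists 0 (Exists 1 (snd q)))"
definition allex :: "bexp => nat list => bexp => fm" where
 "allex a us q = Neg (Exists 1 (Exists 0 (And (fst a) (Neg (Exists 1 (And (conjs (map eqf us)) (fst q)))))))"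

abbreviation tru :: "'a struct => nat => 'a => bool" where "tru A p x \<equiv> [x] \<in> interp A (Base p 1)"
abbreviation eqv :: "'a struct => nat => 'a => 'a => bool" where
 "eqv A u x y \<equiv> [x, y] \<in> interp A (Dist u) \<and> [y, x] \<in> interp A (Dist u)"

lemma sat_all:
 "bx q ==> sat A v (all2 u q) \<longleftrightarrow> (\<forall>x\<in>universe A. \<forall>y\<in>universe A. eqv A u x y --> sat A (v(0 := x, 1 := y)) (fst q))"
 "bx q ==> sat A v (all1 q) \<longleftrightarrow> (\<forall>x\<in>universe A. \<forall>y\<in>universe A. sat A (v(0 := x, 1 := y)) (fst q))"
 "sat A v (allex a us q) \<longleftrightarrow> (\<forall>z\<in>universe A. \<forall>x\<in>universe A. sat A (v(1 := z, 0 := x)) (fst a) -->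
   (\<exists>y\<in>universe A. (\<forall>u\<in>set us. eqv A u x y) \<and> sat A (v(1 := z, 0 := x, 1 := y)) (fst q)))"
 by (auto simp: all2_def all1_def allex_def eqf_def bx_sat)

definition closedf :: "fm => bool" where "closedf \<psi> \<longleftrightarrow> okf \<psi> \<and> fv \<psi> = {}"

lemma closed_all:
 "bx q ==> 1 \<le> u ==> u \<le> 12 ==> closedf (all2 u q)" "bx q ==> closedf (all1 q)"
 "bx a ==> bx q ==> \<forall>u\<in>set us. 1 \<le> u \<and> u \<le> 12 ==> closedf (allex a us q)"
 "bx q ==> closedf (Exists 0 (Exists 1 (fst q)))"
proof -
 have fv: "fv \<psi> \<subseteq> {0, 1}" if "okf \<psi>" for \<psi> using that fv_vars[of \<psi>] unfolding okf_def by blast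
 have eqf: "okf (eqf u)" if "1 \<le> u" "u \<le> 12" for u using that by (simp add: eqf_def okf_def)
 have ex: "fv (Exists 0 (Exists 1 \<psi>)) = {}" "fv (Exists 1 (Exists 0 \<psi>)) = {}" "fv (Exists 1 \<psi>) \<subseteq> {0}" if "okf \<psi>" for \<psi>
  using fv[OF that] by auto
 have cl: "closedf (Neg (Exists 0 (Exists 1 \<psi>)))" "closedf (Neg (Exists 1 (Exists 0 \<psi>)))" "closedf (Exists 0 (Exists 1 \<psi>))" if "okf \<psi>" for \<psi>
  using ex[OF that] that unfolding closedf_def okf_def by auto
 have ng: "okf (Neg (Exists 1 \<psi>))" if "okf \<psi>" for \<psi> using ex(3)[OF that] that unfolding okf_def by auto
 have an: "okf \<psi> ==> okf \<chi> ==> okf (And \<psi> \<chi>)" for \<psi> \<chi> unfolding okf_def by auto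
 show "bx q ==> 1 \<le> u ==> u \<le> 12 ==> closedf (all2 u q)" unfolding all2_def by (intro cl an eqf) (auto dest: bx_okf)
 show "bx q ==> closedf (all1 q)" unfolding all1_def by (intro cl) (auto dest: bx_okf)
 show "bx q ==> closedf (Exists 0 (Exists 1 (fst q)))" by (intro cl) (auto dest: bx_okf)
 show "bx a ==> bx q ==> \<forall>u\<in>set us. 1 \<le> u \<and> u \<le> 12 ==> closedf (allex a us q)"
  unfolding allex_def by (intro cl an ng) (auto dest: bx_okf simp: okf_conjs eqf)
qed

text \<open>
 An element stands for a bit position, its address, of a cell of the tableau.  \<open>PBt\<close>, \<open>PBi\<close> are
 the bits of time and place at the address, \<open>PKt\<close>, \<open>PKi\<close> tell that all lower bits are set, and
 \<open>PPar\<close> is the parity of time.  \<open>PA k\<close> are the bits of the address, \<open>PS\<close> and \<open>PQ\<close> the contents of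
 the cell and \<open>PM d\<close> tells that the head arrives from the cell at offset \<open>d - 1\<close>.
\<close>

abbreviation (input) "PPar \<equiv> 0 :: nat"
abbreviation (input) "PBt \<equiv> 1 :: nat"
abbreviation (input) "PKt \<equiv> 2 :: nat"
abbreviation (input) "PBi \<equiv> 3 :: nat"
abbreviation (input) "PKi \<equiv> 4 :: nat"
abbreviation (input) "PZt \<equiv> 5 :: nat"
abbreviation (input) "PZi \<equiv> 6 :: nat"
abbreviation (input) "PRoot \<equiv> 7 :: nat"
text \<open>Residues modulo 4 keep the four infinite families apart, and all of them start above the
  fixed predicates 0 to 7.\<close>

definition PM :: "nat => nat" where "PM d = 4 * d + 8"
definition PA :: "nat => nat" where "PA k = 4 * k + 9"
definition PS :: "nat => nat" where "PS a = 4 * a + 10"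
definition PQ :: "nat => nat" where "PQ s = 4 * s + 11"

definition sameaddr :: "nat => bexp" where "sameaddr P = conjb (map (%k. same (PA k)) [0..<P])"
text \<open>One position of an increment: the bit at x is the bit at y changed by the carry at
  y.\<close>

definition incb :: "nat => nat => nat => nat => bexp" where
 "incb B K x y = iffb (lit B x) (notb (iffb (lit B y) (lit K y)))"
definition succb :: "nat => bexp" where
 "succb P = conjb (map (%k. iffb (lit (PA k) 1) (notb (iffb (lit (PA k) 0) (conjb (map (%j. lit (PA j) 0) [0..<k]))))) [0..<P])"
definition carryb :: "nat => nat => nat => bexp" where
 "carryb P K B = iffb (lit K 1) (disjb [conjb (map (%k. notb (lit (PA k) 1)) [0..<P]), conjb [lit K 0, lit B 0]])"
definition parent :: "bool => bexp list" where "parent b = [isb PPar 0 b, isb PPar 1 (\<not> b)]"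

definition off_axioms :: "nat => fm list" where
 "off_axioms P =
  map (%q. all2 (eu (fst q) (snd q)) (impb (conjb (parent (snd q) @ [sameaddr P])) (conjb [incb PBt PKt 0 1,
    if fst q = 0 then incb PBi PKi 0 1 else if fst q = 1 then same PBi else incb PBi PKi 1 0])))
   (List.product [0, 1, 2] [False, True])"

text \<open>The groups concern, in this order: bit positions of a cell; counters of a cell and its
  predecessors; tests for time 0 and place 0; existence of predecessors; the first row, and absence
  of a head where none arrives; uniqueness of the head entry; transition; acceptance.\<close>

definition axioms :: "tm => bool list => nat => fm list list" where
 "axioms M w P = [
  [allex (conjb []) (map (%q. eu (fst q) (snd q)) (List.product [0, 1, 2] [False, True]))
    (conjb [same PPar, succb P, carryb P PKt PBt, carryb P PKi PBi]),
   all2 (eu 1 False) (impb (conjb [same PPar, sameaddr P]) (conjb [same PBt, same PBi]))],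
  off_axioms P,
  [all2 (eu 1 False) (impb (conjb [lit PZt 0, same PPar]) (notb (lit PBt 1))),
   allex (notb (lit PZt 0)) [eu 1 False] (conjb [same PPar, lit PBt 1]),
   all2 (eu 1 False) (impb (conjb [lit PZi 0, same PPar]) (notb (lit PBi 1))),
   allex (notb (lit PZi 0)) [eu 1 False] (conjb [same PPar, lit PBi 1])],
  map (%q. allex (conjb [notb (lit PZt 0), isb PPar 0 (snd q)]) [eu (fst q) (snd q)] (isb PPar 1 (\<not> snd q)))
   (List.product [0, 1, 2] [False, True]),
  [all1 (impb (lit PZt 0) (lit (PS 0) 0)),
   all1 (impb (conjb [lit PZt 0, lit PZi 0]) (lit (PQ (Suc (start_state M w))) 0)),
   all1 (impb (conjb [lit PZt 0, notb (lit PZi 0)]) (lit (PQ 0) 0)),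
   all1 (disjb [lit PZt 0, lit (PM 0) 0, lit (PM 1) 0, lit (PM 2) 0, lit (PQ 0) 0])],
  map (%q. all1 (notb (conjb [lit (PQ (fst q)) 0, lit (PQ (snd q)) 0])))
   (filter (%q. fst q \<noteq> snd q) (List.product [0..<Suc (num_states M + length w)] [0..<Suc (num_states M + length w)])),
  map (%q. all2 (eu (fst (fst q)) (snd (fst q))) (impb
    (conjb (parent (snd (fst q)) @ [lit (PS (fst (snd q))) 1, lit (PQ (snd (snd q))) 1]))
    (conjb [if fst (fst q) = 1 then lit (PS (wr M w (snd q))) 0 else conjb [],
     if msg M w (fst (fst q)) (snd q) = 0 then notb (lit (PM (fst (fst q))) 0) else lit (PQ (msg M w (fst (fst q)) (snd q))) 0])))
   (List.product (List.product [0, 1, 2] [False, True]) (List.product [0..<num_symbols M] [0..<Suc (num_states M + length w)])),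
  [Exists 0 (Exists 1 (fst (conjb [lit PRoot 0, lit (PQ (Suc (accept_state M))) 0]))),
   all2 (eu 1 False) (impb (conjb [lit PRoot 0, same PPar]) (iffb (lit PBt 1) (notb (conjb (map (%k. lit (PA k) 1) [0..<P])))))]]"

text \<open>The empty conjunction is the equation of variable 0 with itself, so the outer quantifier
  closes the formula.\<close>

definition sentence :: "tm => bool list => nat => fm" where
 "sentence M w P = Exists 0 (conjs (concat (axioms M w P)))"

text \<open>The meaning of the sentence for arbitrary predicates and relations, so that soundness
  and completeness deal with a set and not with formulas.\<close>

definition tableau :: "tm => bool list => nat => 'a set => (nat => 'a => bool) => (nat => bool => 'a => 'a => bool) => bool" where
 "tableau M w P U tr eq \<longleftrightarrow>
  ((\<forall>x\<in>U. \<exists>y\<in>U. (\<forall>d<3. \<forall>b. eq d b x y) \<and> tr PPar x = tr PPar y \<and>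
    (\<forall>k<P. tr (PA k) y = (tr (PA k) x \<noteq> (\<forall>j<k. tr (PA j) x))) \<and>
    tr PKt y = ((\<forall>k<P. \<not> tr (PA k) y) \<or> tr PKt x \<and> tr PBt x) \<and>
    tr PKi y = ((\<forall>k<P. \<not> tr (PA k) y) \<or> tr PKi x \<and> tr PBi x)) \<and>
   (\<forall>x\<in>U. \<forall>y\<in>U. eq 1 False x y --> tr PPar x = tr PPar y --> (\<forall>k<P. tr (PA k) x = tr (PA k) y) -->
    tr PBt x = tr PBt y \<and> tr PBi x = tr PBi y)) \<and>
  (\<forall>d<3. \<forall>b. \<forall>x\<in>U. \<forall>y\<in>U. eq d b x y --> tr PPar x = b --> tr PPar y = (\<not> b) -->
    (\<forall>k<P. tr (PA k) x = tr (PA k) y) --> tr PBt x = (tr PBt y \<noteq> tr PKt y) \<and>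
    (if d = 0 then tr PBi x = (tr PBi y \<noteq> tr PKi y) else if d = 1 then tr PBi x = tr PBi y
    else tr PBi y = (tr PBi x \<noteq> tr PKi x))) \<and>
  ((\<forall>x\<in>U. \<forall>y\<in>U. eq 1 False x y --> tr PZt x --> tr PPar x = tr PPar y --> \<not> tr PBt y) \<and>
   (\<forall>x\<in>U. \<not> tr PZt x --> (\<exists>y\<in>U. eq 1 False x y \<and> tr PPar x = tr PPar y \<and> tr PBt y)) \<and>
   (\<forall>x\<in>U. \<forall>y\<in>U. eq 1 False x y --> tr PZi x --> tr PPar x = tr PPar y --> \<not> tr PBi y) \<and>
   (\<forall>x\<in>U. \<not> tr PZi x --> (\<exists>y\<in>U. eq 1 False x y \<and> tr PPar x = tr PPar y \<and> tr PBi y))) \<and>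
  (\<forall>d<3. \<forall>b. \<forall>x\<in>U. \<not> tr PZt x --> tr PPar x = b --> (\<exists>y\<in>U. eq d b x y \<and> tr PPar y = (\<not> b))) \<and>
  (\<forall>x\<in>U. (tr PZt x --> tr (PS 0) x) \<and> (tr PZt x --> tr PZi x --> tr (PQ (Suc (start_state M w))) x) \<and>
    (tr PZt x --> \<not> tr PZi x --> tr (PQ 0) x) \<and>
    (tr PZt x \<or> tr (PM 0) x \<or> tr (PM 1) x \<or> tr (PM 2) x \<or> tr (PQ 0) x)) \<and>
  (\<forall>s\<le>num_states M + length w. \<forall>s'\<le>num_states M + length w. s \<noteq> s' --> (\<forall>x\<in>U. \<not> (tr (PQ s) x \<and> tr (PQ s') x))) \<and>
  (\<forall>d<3. \<forall>b. \<forall>a<num_symbols M. \<forall>s\<le>num_states M + length w. \<forall>x\<in>U. \<forall>y\<in>U. eq d b x y --> tr PPar x = b -->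
    tr PPar y = (\<not> b) --> tr (PS a) y --> tr (PQ s) y --> (d = 1 --> tr (PS (wr M w (a, s))) x) \<and>
    (if msg M w d (a, s) = 0 then \<not> tr (PM d) x else tr (PQ (msg M w d (a, s))) x)) \<and>
  ((\<exists>x\<in>U. tr PRoot x \<and> tr (PQ (Suc (accept_state M))) x) \<and>
   (\<forall>x\<in>U. \<forall>y\<in>U. eq 1 False x y --> tr PRoot x --> tr PPar x = tr PPar y --> tr PBt y = (\<not> (\<forall>k<P. tr (PA k) y))))"

lemma bx_parts [simp]: "bx (sameaddr P)" "bx (succb P)" "bx (carryb P K B)" "bx (incb B K 0 1)" "bx (incb B K 1 0)"
 "bx (incb B K 0 (Suc 0))" "bx (incb B K (Suc 0) 0)"
 "q \<in> set (parent b) ==> bx q"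
 unfolding sameaddr_def succb_def carryb_def incb_def parent_def by auto

lemma sat_parts [simp]:
 "sat A v (fst (sameaddr P)) \<longleftrightarrow> (\<forall>k<P. tru A (PA k) (v 0) = tru A (PA k) (v 1))"
 "sat A v (fst (succb P)) \<longleftrightarrow> (\<forall>k<P. tru A (PA k) (v 1) = (tru A (PA k) (v 0) \<noteq> (\<forall>j<k. tru A (PA j) (v 0))))"
 "sat A v (fst (carryb P K B)) \<longleftrightarrow> tru A K (v 1) = ((\<forall>k<P. \<not> tru A (PA k) (v 1)) \<or> tru A K (v 0) \<and> tru A B (v 0))"
 "x < 2 ==> y < 2 ==> sat A v (fst (incb B K x y)) \<longleftrightarrow> tru A B (v x) = (tru A B (v y) \<noteq> tru A K (v y))"
proof -
 have bl: "(\<forall>x\<in>{0..<n}. Q x) \<longleftrightarrow> (\<forall>x<n. Q x)" for n :: nat and Q by auto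
 show "sat A v (fst (sameaddr P)) \<longleftrightarrow> (\<forall>k<P. tru A (PA k) (v 0) = tru A (PA k) (v 1))"
  "sat A v (fst (succb P)) \<longleftrightarrow> (\<forall>k<P. tru A (PA k) (v 1) = (tru A (PA k) (v 0) \<noteq> (\<forall>j<k. tru A (PA j) (v 0))))"
  "sat A v (fst (carryb P K B)) \<longleftrightarrow> tru A K (v 1) = ((\<forall>k<P. \<not> tru A (PA k) (v 1)) \<or> tru A K (v 0) \<and> tru A B (v 0))"
  "x < 2 ==> y < 2 ==> sat A v (fst (incb B K x y)) \<longleftrightarrow> tru A B (v x) = (tru A B (v y) \<noteq> tru A K (v y))"
  unfolding sameaddr_def succb_def carryb_def incb_def by (simp_all add: bx_lit bl)
qed

lemma eu_bounds [simp]: "1 \<le> eu d b" "Suc 0 \<le> eu d b" "d < 3 ==> eu d b \<le> 12"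
 unfolding eu_def by auto

lemma all_less_3: "(\<forall>d<3. Q d) \<longleftrightarrow> Q 0 \<and> Q 1 \<and> Q (2::nat)"
 by (auto simp: less_Suc_eq numeral_3_eq_3 numeral_2_eq_2)

lemma ball_8: "(\<forall>x\<in>set [a, b, c, d, e, f, g, h]. Q x) \<longleftrightarrow> Q a \<and> Q b \<and> Q c \<and> Q d \<and> Q e \<and> Q f \<and> Q g \<and> Q h"
 by simp

lemma sat_sentence:
 assumes "universe A \<noteq> {}"
 shows "sat A v (sentence M w P) \<longleftrightarrow> tableau M w P (universe A) (tru A) (%d b. eqv A (eu d b))"
proof -
 have ball: "(\<forall>y\<in>universe A. Q) \<longleftrightarrow> Q" for Q using assms by auto
 have bex: "(\<exists>y\<in>universe A. Q) \<longleftrightarrow> Q" for Q using assms by auto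
 have six: "(\<forall>q\<in>set (List.product [0, 1, 2] [False, True]). Q q) \<longleftrightarrow> (\<forall>d<3. \<forall>b. Q (d, b))" for Q :: "nat \<times> bool => bool"
  unfolding all_less_3 by (auto simp: all_bool_eq)
 have ball_map: "(\<forall>x\<in>set (map f xs). Q x) \<longleftrightarrow> (\<forall>x\<in>set xs. Q (f x))" for f :: "'b => fm" and xs Q by simp
 have prod: "(\<forall>q\<in>set (List.product xs ys). Q q) \<longleftrightarrow> (\<forall>x\<in>set xs. \<forall>y\<in>set ys. Q (x, y))" for xs :: "'b list" and ys :: "'c list" and Q
  by auto
 have filt: "(\<forall>q\<in>set (filter R xs). Q q) \<longleftrightarrow> (\<forall>x\<in>set xs. R x --> Q x)" for xs :: "'b list" and R Q by auto
 have upt: "(\<forall>x\<in>set [0..<n]. Q x) \<longleftrightarrow> (\<forall>x<n. Q x)" for n Q by auto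
 have two: "(\<forall>x\<in>set [a, b]. Q x) \<longleftrightarrow> Q a \<and> Q b" for a b :: fm and Q by simp
 have main: "(\<forall>xs\<in>set (axioms M w P). \<forall>x\<in>set xs. sat A v x) \<longleftrightarrow> tableau M w P (universe A) (tru A) (%d b. eqv A (eu d b))" for v
  unfolding axioms_def off_axioms_def ball_8 tableau_def ball_map
 proof (intro arg_cong2[where f = "(\<and>)"], goal_cases)
  case 1
  have six': "(\<forall>u\<in>set (map f (List.product [0, 1, 2] [False, True])). Q u) \<longleftrightarrow> (\<forall>d<3. \<forall>b. Q (f (d, b)))"
   for f :: "nat \<times> bool => nat" and Q by (simp only: set_map ball_simps six)
  show ?case unfolding two sat_all(3) six' fst_conv snd_conv
  proof (intro arg_cong2[where f = "(\<and>)"], goal_cases)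
   case 1
   have "\<exists>z. z \<in> universe A" using assms by blast
   then show ?case by (simp add: ball)
  next
   case 2 show ?case by (simp add: sat_all imp_conjL)
  qed
 next
  case 2 show ?case unfolding six all_less_3 by (simp add: sat_all parent_def imp_conjL)
 next
  case 3 show ?case by (simp add: sat_all ball) blast
 next
  case 4 show ?case unfolding six by (simp add: sat_all ball) blast
 next
  case 5 show ?case by (simp add: sat_all ball) blast
 next
  case 6
  have p6: "sat A v (all1 (notb (conjb [lit p 0, lit q 0]))) \<longleftrightarrow> (\<forall>x\<in>universe A. \<not> (tru A p x \<and> tru A q x))" for p q
   using assms by (simp add: sat_all) blast
  show ?case unfolding filt prod upt p6 less_Suc_eq_le fst_conv snd_conv by (rule refl)
 next
  case 7
  have p7: "sat A v (all2 (eu d b) (impb (conjb (parent b @ [lit (PS a) 1, lit (PQ s) 1]))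
    (conjb [if d = 1 then lit (PS (wr M w (a, s))) 0 else conjb [],
     if msg M w d (a, s) = 0 then notb (lit (PM d) 0) else lit (PQ (msg M w d (a, s))) 0]))) \<longleftrightarrow>
   (\<forall>x\<in>universe A. \<forall>y\<in>universe A. eqv A (eu d b) x y --> tru A PPar x = b --> tru A PPar y = (\<not> b) -->
    tru A (PS a) y --> tru A (PQ s) y --> (d = 1 --> tru A (PS (wr M w (a, s))) x) \<and>
    (if msg M w d (a, s) = 0 then \<not> tru A (PM d) x else tru A (PQ (msg M w d (a, s))) x))" for d b a s
   by (cases "d = 1"; cases "msg M w d (a, s) = 0") (simp_all add: sat_all parent_def imp_conjL)
  have d3: "(\<forall>x\<in>set [0, 1, 2]. Q x) \<longleftrightarrow> (\<forall>d<3. Q d)" for Q :: "nat => bool" unfolding all_less_3 by simp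
  have bb: "(\<forall>x\<in>set [False, True]. Q x) \<longleftrightarrow> (\<forall>b. Q b)" for Q :: "bool => bool" by (simp add: all_bool_eq conj_commute)
  show ?case unfolding prod d3 bb upt less_Suc_eq_le fst_conv snd_conv p7 by (rule refl)
 next
  case 8
  have bl: "(\<forall>x\<in>{0..<n}. Q x) \<longleftrightarrow> (\<forall>x<n. Q x)" for n :: nat and Q by auto
  show ?case unfolding two
  proof (intro arg_cong2[where f = "(\<and>)"], goal_cases)
   case 1 show ?case using assms by auto
  next
   case 2 show ?case by (simp add: sat_all imp_conjL bl)
  qed
 qed
 have cc: "(\<forall>x\<in>set (concat xss). Q x) \<longleftrightarrow> (\<forall>xs\<in>set xss. \<forall>x\<in>set xs. Q x)" for xss :: "fm list list" and Q by auto
 have se: "sat A v (sentence M w P) \<longleftrightarrow> (\<exists>a\<in>universe A. \<forall>xs\<in>set (axioms M w P). \<forall>x\<in>set xs. sat A (v(0 := a)) x)"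
  unfolding sentence_def sat.simps sat_conjs cc ..
 show ?thesis unfolding se main bex by (rule refl)
qed

lemma sentence_ok: "unfo2_S_sentence 6 (sentence M w P)"
proof -
 have "\<forall>xs\<in>set (axioms M w P). \<forall>x\<in>set xs. closedf x" unfolding axioms_def off_axioms_def ball_8
 proof (intro conjI, goal_cases)
  case 7 show ?case unfolding parent_def by (auto intro!: closed_all)
 qed (simp_all add: closed_all closed_all(4)[unfolded One_nat_def] parent_def)
 then have "\<forall>x\<in>set (concat (axioms M w P)). closedf x" by auto
 then have c: "okf (conjs (concat (axioms M w P)))" by (simp add: okf_conjs closedf_def)
 have "\<forall>x\<in>set xs. closedf x ==> fv (conjs xs) = {0}" for xs by (induction xs) (auto simp: conjs_simps closedf_def)
 then have "fv (conjs (concat (axioms M w P))) = {0}" using \<open>\<forall>x\<in>set (concat (axioms M w P)). closedf x\<close> by blast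
 then have "fv (sentence M w P) = {}" unfolding sentence_def by simp
 moreover have "okf (sentence M w P)" using c unfolding okf_def sentence_def by simp
 ultimately show ?thesis unfolding okf_def unfo2_S_sentence_def two_variable_def over_signature_def by auto
qed

section \<open>Binary counters\<close>

lemma bval_inc_aux: "(\<And>j. j < l ==> g j = (f j \<noteq> (\<forall>i<j. f i))) ==>
  bval g l + (if \<forall>i<l. f i then 2 ^ l else 0) = bval f l + 1"
proof (induction l)
 case (Suc l)
 have "bval g l + (if \<forall>i<l. f i then 2 ^ l else 0) = bval f l + 1" using Suc by simp
 moreover have "(\<forall>i<Suc l. f i) \<longleftrightarrow> (\<forall>i<l. f i) \<and> f l" by (auto simp: less_Suc_eq)
 moreover have "g l = (f l \<noteq> (\<forall>i<l. f i))" using Suc.prems by blast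
 ultimately show ?case by (cases "\<forall>i<l. f i"; cases "f l") simp_all
qed simp

lemma bval_inc: "(\<And>j. j < l ==> g j = (f j \<noteq> (\<forall>i<j. f i))) ==> bval g l = (bval f l + 1) mod 2 ^ l"
proof -
 assume "\<And>j. j < l ==> g j = (f j \<noteq> (\<forall>i<j. f i))"
 then have e: "bval g l + (if \<forall>i<l. f i then 2 ^ l else 0) = bval f l + 1" by (rule bval_inc_aux)
 show ?thesis
 proof (cases "\<forall>i<l. f i")
  case True
  then have "bval f l + 1 = 2 ^ l" "bval g l = 0" using e bval_less[of f l] by auto
  then show ?thesis by simp
 next
  case False
  then have "bval g l = bval f l + 1" using e unfolding if_not_P[OF False] by simp
  then show ?thesis using bval_less[of g l] by (metis mod_less)
 qed
qed

lemma bval_0: "bval f l = 0 \<longleftrightarrow> (\<forall>i<l. \<not> f i)"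
 by (induction l) (auto simp: less_Suc_eq)

lemma bval_ones: "bval f l = 2 ^ l - 1 \<longleftrightarrow> (\<forall>i<l. f i)"
proof -
 have "bval (%_. True) l = 2 ^ l - 1" by (induction l) auto
 then show ?thesis using bval_eq_iff[of l f "%_. True"] by auto
qed

lemma bval_bt: "x < 2 ^ l ==> bval (bit x) l = x"
 by (simp add: bval_bit take_bit_nat_eq_self)

lemma bt_Suc: "(x::nat) < 2 ^ l ==> j < l ==> bit ((x + 1) mod 2 ^ l) j = (bit x j \<noteq> (\<forall>i<j. bit x i))"
proof -
 assume x: "x < 2 ^ l" and j: "j < l"
 let ?g = "%j. bit x j \<noteq> (\<forall>i<j. bit x i)"
 have "bval ?g l = bval (bit ((x + 1) mod 2 ^ l)) l" using bval_inc[of l ?g "bit x"] bval_bt[OF x] by (simp add: bval_bt)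
 then show ?thesis using bval_eq_iff[of l "bit ((x + 1) mod 2 ^ l)" ?g] j by metis
qed

lemma bt_0: "(x::nat) < 2 ^ l ==> (\<forall>k<l. \<not> bit x k) \<longleftrightarrow> x = 0"
 using bval_0[of "bit x" l] bval_bt[of x l] by metis

lemma bt_ones: "(x::nat) < 2 ^ l ==> (\<forall>k<l. bit x k) \<longleftrightarrow> x = 2 ^ l - 1"
 using bval_ones[of "bit x" l] bval_bt[of x l] by metis

lemma bt_inj: "(x::nat) < 2 ^ l ==> y < 2 ^ l ==> (\<forall>k<l. bit x k = bit y k) \<longleftrightarrow> x = y"
 using bval_eq_iff[of l "bit x" "bit y"] bval_bt[of x l] bval_bt[of y l] by metis

text \<open>The time of the accepting row is chosen to have all bits set but the highest, which the
  sentence can express through addresses alone.\<close>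

lemma bval_but_last: "0 < l ==> bval (%j. j \<noteq> l - 1) l = 2 ^ (l - 1) - 1"
proof -
 assume "0 < l"
 then obtain n where l: "l = Suc n" by (cases l) auto
 have "bval (%j. j \<noteq> n) n = 2 ^ n - 1" unfolding bval_ones by auto
 then show ?thesis unfolding l by simp
qed

section \<open>From a tableau to an accepting cell\<close>

context simulation
begin

theorem tableau_sound:
 assumes NP: "N = 2 ^ P" and tab: "tableau M w P U tr eq"
  and sym: "\<And>d b x y. d < 3 ==> eq d b x y ==> eq d b y x"
  and trans: "\<And>d b x y z. d < 3 ==> eq d b x y ==> eq d b y z ==> eq d b x z"
 shows "\<exists>z. snd (cell (2 ^ (N - 1) - 1) z) = Suc (accept_state M)"
proof -
 note t = tab[unfolded tableau_def]
 note t1 = t[THEN conjunct1, THEN conjunct1] and t2 = t[THEN conjunct1, THEN conjunct2]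
  and t3 = t[THEN conjunct2, THEN conjunct1] and t4 = t[THEN conjunct2, THEN conjunct2, THEN conjunct1]
  and t5 = t[THEN conjunct2, THEN conjunct2, THEN conjunct2, THEN conjunct1]
  and t6 = t[THEN conjunct2, THEN conjunct2, THEN conjunct2, THEN conjunct2, THEN conjunct1]
  and t7 = t[THEN conjunct2, THEN conjunct2, THEN conjunct2, THEN conjunct2, THEN conjunct2, THEN conjunct1]
  and t8 = t[THEN conjunct2, THEN conjunct2, THEN conjunct2, THEN conjunct2, THEN conjunct2, THEN conjunct2, THEN conjunct1]
  and t9 = t[THEN conjunct2, THEN conjunct2, THEN conjunct2, THEN conjunct2, THEN conjunct2, THEN conjunct2, THEN conjunct2]
 note t4a = t4[THEN conjunct1, rule_format] and t4b = t4[THEN conjunct2, THEN conjunct1, rule_format]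
  and t4c = t4[THEN conjunct2, THEN conjunct2, THEN conjunct1, rule_format]
  and t4d = t4[THEN conjunct2, THEN conjunct2, THEN conjunct2, rule_format]
 define adr where "adr x = bval (%k. tr (PA k) x) P" for x
 have adr_less: "adr x < N" for x unfolding adr_def NP by (rule bval_less)
 have adr_eq: "adr x = adr y \<longleftrightarrow> (\<forall>k<P. tr (PA k) x = tr (PA k) y)" for x y unfolding adr_def by (rule bval_eq_iff[symmetric])
 obtain nx where nx: "\<And>x. x \<in> U ==> nx x \<in> U" "\<And>x d b. x \<in> U ==> d < 3 ==> eq d b x (nx x)"
  "\<And>x. x \<in> U ==> tr PPar (nx x) = tr PPar x" "\<And>x. x \<in> U ==> adr (nx x) = (adr x + 1) mod N"
  "\<And>x. x \<in> U ==> tr PKt (nx x) = (adr (nx x) = 0 \<or> tr PKt x \<and> tr PBt x)"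
  "\<And>x. x \<in> U ==> tr PKi (nx x) = (adr (nx x) = 0 \<or> tr PKi x \<and> tr PBi x)"
 proof -
  obtain nx where nx: "\<forall>x\<in>U. nx x \<in> U \<and> (\<forall>d<3. \<forall>b. eq d b x (nx x)) \<and> tr PPar x = tr PPar (nx x) \<and>
    (\<forall>k<P. tr (PA k) (nx x) = (tr (PA k) x \<noteq> (\<forall>j<k. tr (PA j) x))) \<and>
    tr PKt (nx x) = ((\<forall>k<P. \<not> tr (PA k) (nx x)) \<or> tr PKt x \<and> tr PBt x) \<and>
    tr PKi (nx x) = ((\<forall>k<P. \<not> tr (PA k) (nx x)) \<or> tr PKi x \<and> tr PBi x)"
   using bchoice[OF t1[unfolded Bex_def]] by blast
  have a: "adr (nx x) = (adr x + 1) mod N" if "x \<in> U" for x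
   unfolding adr_def NP by (rule bval_inc) (use bspec[OF nx that] in simp)
  have z: "(\<forall>k<P. \<not> tr (PA k) y) \<longleftrightarrow> adr y = 0" for y unfolding adr_def bval_0 ..
  have n: "nx x \<in> U" "d < 3 ==> eq d b x (nx x)" "tr PPar (nx x) = tr PPar x"
   "tr PKt (nx x) = (adr (nx x) = 0 \<or> tr PKt x \<and> tr PBt x)" "tr PKi (nx x) = (adr (nx x) = 0 \<or> tr PKi x \<and> tr PBi x)"
   if "x \<in> U" for x d b using bspec[OF nx that] unfolding z by simp_all
  show thesis by (rule that[of nx]) (fact n a)+
 qed
 have chain: "\<exists>u. \<forall>j<N. u j \<in> U \<and> (\<forall>d<3. \<forall>b. eq d b x (u j)) \<and> tr PPar (u j) = tr PPar x \<and> adr (u j) = j \<and>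
   tr PKt (u j) = (\<forall>i<j. tr PBt (u i)) \<and> tr PKi (u j) = (\<forall>i<j. tr PBi (u i))" if x: "x \<in> U" for x
 proof -
  define v where "v m = (nx ^^ m) x" for m
  have v: "v m \<in> U \<and> tr PPar (v m) = tr PPar x \<and> adr (v m) = (adr x + m) mod N" for m
  proof (induction m)
   case 0 then show ?case using x adr_less[of x] by (simp add: v_def)
  next
   case (Suc m)
   have "v (Suc m) = nx (v m)" by (simp add: v_def)
   then show ?case using Suc nx(1,3,4)[of "v m"] by (simp add: mod_Suc_eq)
  qed
  have vS: "v (Suc m) = nx (v m)" for m by (simp add: v_def)
  have e: "eq d b x (v (Suc m))" if "d < 3" for d b m
  proof (induction m)
   case 0 then show ?case using nx(2)[OF x that] by (simp add: v_def)
  next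
   case (Suc m)
   then show ?case using trans[OF that Suc] nx(2)[of "v (Suc m)" d b] v[of "Suc m"] that vS[of "Suc m"] by metis
  qed
  \<comment> \<open>At least one step is made even if x has address 0: carries are prescribed only
    at successors, so those at x itself are not reliable.\<close>
  obtain m where m: "N = adr x + Suc m" using adr_less[of x] less_iff_Suc_add by auto
  define u where "u j = v (Suc (m + j))" for j
  have a: "adr (u j) = j" if "j < N" for j
  proof -
   have "adr x + Suc (m + j) = N + j" using m by simp
   then have "adr (u j) = (N + j) mod N" using v[of "Suc (m + j)"] unfolding u_def by metis
   then show ?thesis using that by simp
  qed
  have uS: "u 0 = nx (v m)" "u (Suc j) = nx (u j)" for j by (simp_all add: u_def v_def)
  have uU: "u j \<in> U" for j using v[of "Suc (m + j)"] unfolding u_def by blast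
  have k: "tr PKt (u j) = (\<forall>i<j. tr PBt (u i)) \<and> tr PKi (u j) = (\<forall>i<j. tr PBi (u i))" if "j < N" for j
   using that
  proof (induction j)
   case 0
   then have "adr (nx (v m)) = 0" using a[of 0] unfolding uS(1) by simp
   then show ?case using nx(5,6)[of "v m"] v[of m] unfolding uS(1) by simp
  next
   case (Suc j)
   have "adr (nx (u j)) \<noteq> 0" using a[OF Suc.prems] unfolding uS(2) by simp
   then show ?case using Suc nx(5,6)[OF uU[of j]] unfolding uS(2) by (auto simp: less_Suc_eq)
  qed
  show ?thesis by (rule exI[of _ u]) (use a k e v in \<open>auto simp: u_def\<close>)
 qed
 obtain ch where ch: "\<And>x j. x \<in> U ==> j < N ==> ch x j \<in> U" "\<And>x j d b. x \<in> U ==> j < N ==> d < 3 ==> eq d b x (ch x j)"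
  "\<And>x j. x \<in> U ==> j < N ==> tr PPar (ch x j) = tr PPar x" "\<And>x j. x \<in> U ==> j < N ==> adr (ch x j) = j"
  "\<And>x j. x \<in> U ==> j < N ==> tr PKt (ch x j) = (\<forall>i<j. tr PBt (ch x i))"
  "\<And>x j. x \<in> U ==> j < N ==> tr PKi (ch x j) = (\<forall>i<j. tr PBi (ch x i))"
 proof -
  have "\<forall>x\<in>U. \<exists>u. \<forall>j<N. u j \<in> U \<and> (\<forall>d<3. \<forall>b. eq d b x (u j)) \<and> tr PPar (u j) = tr PPar x \<and> adr (u j) = j \<and>
   tr PKt (u j) = (\<forall>i<j. tr PBt (u i)) \<and> tr PKi (u j) = (\<forall>i<j. tr PBi (u i))" using chain by blast
  from bchoice[OF this] obtain ch where c: "\<forall>x\<in>U. \<forall>j<N. ch x j \<in> U \<and> (\<forall>d<3. \<forall>b. eq d b x (ch x j)) \<and>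
   tr PPar (ch x j) = tr PPar x \<and> adr (ch x j) = j \<and>
   tr PKt (ch x j) = (\<forall>i<j. tr PBt (ch x i)) \<and> tr PKi (ch x j) = (\<forall>i<j. tr PBi (ch x i))" by blast
  show thesis by (rule that[of ch]) (use c in blast)+
 qed
 define T where "T x = bval (%j. tr PBt (ch x j)) N" for x
 define I where "I x = bval (%j. tr PBi (ch x j)) N" for x
 have less: "T x < 2 ^ N" "I x < 2 ^ N" for x unfolding T_def I_def by (rule bval_less)+
 \<comment> \<open>An element of the same class and parity as x agrees with the chain of x at its
   own address, so the counters do not depend on the chosen elements.\<close>
 have bits: "tr PBt y = tr PBt (ch x (adr y)) \<and> tr PBi y = tr PBi (ch x (adr y))"
  if "x \<in> U" "y \<in> U" "eq 1 False x y" "tr PPar x = tr PPar y" for x y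
 proof -
  note j = adr_less[of y]
  have "eq 1 False (ch x (adr y)) y" using trans[OF _ sym[OF _ ch(2)[OF that(1) j]] that(3)] by simp
  moreover have "tr PPar (ch x (adr y)) = tr PPar y" using ch(3)[OF that(1) j] that(4) by simp
  moreover have "\<forall>k<P. tr (PA k) (ch x (adr y)) = tr (PA k) y" using ch(4)[OF that(1) j] adr_eq by blast
  ultimately show ?thesis using t2 ch(1)[OF that(1) j] that(2) by blast
 qed
 have zt: "tr PZt x \<longleftrightarrow> T x = 0" and zi: "tr PZi x \<longleftrightarrow> I x = 0" if x: "x \<in> U" for x
 proof -
  have c: "ch x j \<in> U" "eq 1 False x (ch x j)" "tr PPar x = tr PPar (ch x j)" if "j < N" for j
   using ch(1,3)[OF x that] ch(2)[OF x that, of 1 False] by auto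
  show "tr PZt x \<longleftrightarrow> T x = 0"
  proof
   assume "tr PZt x"
   then show "T x = 0" unfolding T_def bval_0 using t4a[OF x c(1) c(2) _ c(3)] by blast
  next
   assume T: "T x = 0"
   show "tr PZt x"
   proof (rule ccontr)
    assume "\<not> tr PZt x"
    then obtain y where y: "y \<in> U" "eq 1 False x y" "tr PPar x = tr PPar y" "tr PBt y" using t4b[OF x] by blast
    then show False using T bits[OF x y(1-3)] adr_less[of y] unfolding T_def bval_0 by blast
   qed
  qed
  show "tr PZi x \<longleftrightarrow> I x = 0"
  proof
   assume "tr PZi x"
   then show "I x = 0" unfolding I_def bval_0 using t4c[OF x c(1) c(2) _ c(3)] by blast
  next
   assume I: "I x = 0"
   show "tr PZi x"
   proof (rule ccontr)
    assume "\<not> tr PZi x"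
    then obtain y where y: "y \<in> U" "eq 1 False x y" "tr PPar x = tr PPar y" "tr PBi y" using t4d[OF x] by blast
    then show False using I bits[OF x y(1-3)] adr_less[of y] unfolding I_def bval_0 by blast
   qed
  qed
 qed
 \<comment> \<open>The axioms compare the two chains address by address, and together these
   comparisons form an increment. For offset 2 it is the place of y that is the incremented one, so
   there the carries at x matter.\<close>
 have par: "T x = (T y + 1) mod 2 ^ N \<and> 2 ^ N dvd int (I y) - (int (I x) + int d - 1)"
  if d: "d < 3" and xy: "x \<in> U" "y \<in> U" "eq d b x y" "tr PPar x = b" "tr PPar y = (\<not> b)" for d b x y
 proof -
  have j: "tr PBt (ch x j) = (tr PBt (ch y j) \<noteq> tr PKt (ch y j)) \<and>
    (if d = 0 then tr PBi (ch x j) = (tr PBi (ch y j) \<noteq> tr PKi (ch y j)) else if d = 1 then tr PBi (ch x j) = tr PBi (ch y j)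
    else tr PBi (ch y j) = (tr PBi (ch x j) \<noteq> tr PKi (ch x j)))" if j: "j < N" for j
  proof -
   have "eq d b (ch x j) (ch y j)"
    using trans[OF d trans[OF d sym[OF d ch(2)[OF xy(1) j d]] xy(3)] ch(2)[OF xy(2) j d]] .
   moreover have "\<forall>k<P. tr (PA k) (ch x j) = tr (PA k) (ch y j)" using ch(4)[OF xy(1) j] ch(4)[OF xy(2) j] adr_eq by metis
   moreover have "tr PPar (ch x j) = b" "tr PPar (ch y j) = (\<not> b)" using ch(3)[OF xy(1) j] ch(3)[OF xy(2) j] xy by simp_all
   ultimately show ?thesis using t3[rule_format, OF d ch(1)[OF xy(1) j] ch(1)[OF xy(2) j]] by blast
  qed
  have "T x = (T y + 1) mod 2 ^ N" unfolding T_def by (rule bval_inc) (use j ch(5)[OF xy(2)] in blast)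
  moreover have md: "2 ^ N dvd int i' - (int i + 1)" if "i' = (i + 1) mod 2 ^ N" for i i'
   unfolding that by (simp add: zmod_int mod_eq_dvd_iff[symmetric] add.commute)
  have "2 ^ N dvd int (I y) - (int (I x) + int d - 1)"
  proof -
   consider "d = 0" | "d = 1" | "d = 2" using d by linarith
   then show ?thesis
   proof cases
    case 1
    have "I x = (I y + 1) mod 2 ^ N" unfolding I_def by (rule bval_inc) (use j 1 ch(6)[OF xy(2)] in auto)
    from md[OF this] have "2 ^ N dvd - (int (I x) - (int (I y) + 1))" by (simp only: dvd_minus_iff)
    then show ?thesis using 1 by (simp add: algebra_simps)
   next
    case 2
    have "I x = I y" unfolding I_def by (rule bval_cong) (use j 2 in auto)
    then show ?thesis using 2 by simp
   next
    case 3
    have "I y = (I x + 1) mod 2 ^ N" unfolding I_def by (rule bval_inc) (use j 3 ch(6)[OF xy(1)] in auto)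
    from md[OF this] show ?thesis using 3 by (simp add: algebra_simps)
   qed
  qed
  ultimately show ?thesis by blast
 qed
 \<comment> \<open>Induction on time: a cell with nonzero time has predecessors at all three
   offsets, their contents are known, and the transition axioms force its own.\<close>
 have main: "tr (PS (fst (cell (T x) (int (I x))))) x \<and> tr (PQ (snd (cell (T x) (int (I x))))) x" if "x \<in> U" for x
 proof -
  have "T x = t ==> x \<in> U ==> tr (PS (fst (cell t (int (I x))))) x \<and> tr (PQ (snd (cell t (int (I x))))) x" for t
  proof (induction t arbitrary: x)
   case 0
   have "2 ^ N dvd int (I x) \<longleftrightarrow> I x = 0" using less(2)[of x] dvd_imp_le_int[of "int (I x)" "2 ^ N"]
    by (cases "I x = 0") (auto simp flip: of_nat_power)
   then show ?case using bspec[OF t6 0(2)] zt[OF 0(2)] zi[OF 0(2)] 0(1) by auto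
  next
   case (Suc t)
   let ?c = "%d. cell t (int (I x) + int d - 1)"
   have nz: "\<not> tr PZt x" using zt Suc.prems by simp
   have st: "(d = 1 --> tr (PS (wr M w (?c d))) x) \<and>
    (if msg M w d (?c d) = 0 then \<not> tr (PM d) x else tr (PQ (msg M w d (?c d))) x)" if d: "d < 3" for d
   proof -
    obtain y where y: "y \<in> U" "eq d (tr PPar x) x y" "tr PPar y = (\<not> tr PPar x)" using t5[rule_format, OF d Suc.prems(2) nz refl] by blast
    note p = par[OF d Suc.prems(2) y(1,2) refl y(3)]
    have "T y = t" using p Suc.prems(1) less(1)[of y] by (cases "T y + 1 = 2 ^ N") auto
    have "cell t (int (I y)) = ?c d" by (rule cell_periodic) (use p in blast)
    with Suc.IH[OF \<open>T y = t\<close> y(1)] have "tr (PS (fst (?c d))) y" "tr (PQ (snd (?c d))) y" by simp_all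
    then show ?thesis using t8[rule_format, OF d _ _ Suc.prems(2) y(1,2) refl y(3), of "fst (?c d)" "snd (?c d)"]
     cell_range[of t "int (I x) + int d - 1"] unfolding prod.collapse by blast
   qed
   have 1: "fst (cell (Suc t) (int (I x))) = wr M w (?c 1)" by (simp add: rule_def)
   have "tr (PQ (snd (cell (Suc t) (int (I x))))) x"
   proof (cases "\<exists>d<3. msg M w d (?c d) \<noteq> 0")
    case True
    then obtain d where "d < 3" "msg M w d (?c d) \<noteq> 0" by blast
    then show ?thesis using st[OF \<open>d < 3\<close>, unfolded if_not_P[OF \<open>msg M w d (?c d) \<noteq> 0\<close>]] next_state[of d t "int (I x)"] by metis
   next
    case False
    have "\<not> tr (PM d) x" if "d < 3" for d
    proof -
     have "msg M w d (?c d) = 0" using False that by blast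
     from st[OF that, unfolded if_P[OF this]] show ?thesis by blast
    qed
    then have "\<not> tr (PM 0) x" "\<not> tr (PM 1) x" "\<not> tr (PM 2) x" by simp_all
    then have "tr (PQ 0) x" using bspec[OF t6 Suc.prems(2)] nz by blast
    then show ?thesis using next_state_0[of t "int (I x)"] False by metis
   qed
   then show ?case using st[of 1] 1 by simp
  qed
  then show ?thesis using that by blast
 qed
 obtain x where x: "x \<in> U" "tr PRoot x" "tr (PQ (Suc (accept_state M))) x" using t9[THEN conjunct1] by blast
 have "0 < N" using N by simp
 have "tr PBt (ch x j) = (j \<noteq> N - 1)" if j: "j < N" for j
 proof -
  have "tr PBt (ch x j) = (\<not> (\<forall>k<P. tr (PA k) (ch x j)))"
   using t9[THEN conjunct2, rule_format, OF x(1) ch(1)[OF x(1) j] ch(2)[OF x(1) j] x(2) ch(3)[OF x(1) j, symmetric]] by simp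
  also have "\<dots> = (adr (ch x j) \<noteq> 2 ^ P - 1)" unfolding adr_def bval_ones ..
  finally show ?thesis using ch(4)[OF x(1) j] NP by simp
 qed
 then have "T x = bval (%j. j \<noteq> N - 1) N" unfolding T_def by (rule bval_cong)
 then have "T x = 2 ^ (N - 1) - 1" using bval_but_last[OF \<open>0 < N\<close>] by simp
 then have q: "tr (PQ (snd (cell (2 ^ (N - 1) - 1) (int (I x))))) x" using main[OF x(1)] by simp
 have "Suc (accept_state M) \<le> num_states M + length w" using states(3) by simp
 then have "snd (cell (2 ^ (N - 1) - 1) (int (I x))) = Suc (accept_state M)"
  using t7[rule_format, OF _ _ _ x(1)] q x(3) cell_range[of "2 ^ (N - 1) - 1" "int (I x)"] by blast
 then show ?thesis by blast
qed

end

section \<open>From an accepting cell to a finite model\<close>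

type_synonym elt = "nat \<times> nat \<times> nat"

context simulation
begin

definition elts :: "elt set" where "elts = {..<2 ^ N} \<times> {..<2 ^ N} \<times> {..<N}"

text \<open>Predicate numbers are decoded by their residues modulo 4; r is the place of the
  accepting cell, so that \<open>PRoot\<close> marks it at all addresses.\<close>

definition hold :: "nat => nat => elt => bool" where
 "hold r p x = (case x of (t, i, j) =>
   if p = PPar then odd t else if p = PBt then bit t j else if p = PKt then \<forall>k<j. bit t k
   else if p = PBi then bit i j else if p = PKi then \<forall>k<j. bit i k else if p = PZt then t = 0 else if p = PZi then i = 0
   else if p = PRoot then t = 2 ^ (N - 1) - 1 \<and> i = r
   else if p mod 4 = 0 then t \<noteq> 0 \<and> msg M w ((p - 8) div 4) (cell (t - 1) (int i + int ((p - 8) div 4) - 1)) \<noteq> 0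
   else if p mod 4 = 1 then bit j ((p - 9) div 4) else if p mod 4 = 2 then fst (cell t (int i)) = (p - 10) div 4
   else snd (cell t (int i)) = (p - 11) div 4)"

text \<open>The classes: a cell whose time has parity \<open>b\<close> together with its predecessor at offset \<open>d - 1\<close>.\<close>

definition key :: "nat => bool => elt => nat \<times> int" where
 "key d b x = (case x of (t, i, j) => if odd t = b then (t, int i) else (t + 1, (int i - int d + 1) mod 2 ^ N))"

lemma hold_simps:
 "hold r PPar (t, i, j) = odd t" "hold r PBt (t, i, j) = bit t j" "hold r PKt (t, i, j) = (\<forall>k<j. bit t k)"
 "hold r PBi (t, i, j) = bit i j" "hold r PKi (t, i, j) = (\<forall>k<j. bit i k)" "hold r PZt (t, i, j) = (t = 0)"
 "hold r PZi (t, i, j) = (i = 0)" "hold r PRoot (t, i, j) = (t = 2 ^ (N - 1) - 1 \<and> i = r)"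
 "hold r (PM d) (t, i, j) = (t \<noteq> 0 \<and> msg M w d (cell (t - 1) (int i + int d - 1)) \<noteq> 0)"
 "hold r (PA k) (t, i, j) = bit j k" "hold r (PS a) (t, i, j) = (fst (cell t (int i)) = a)"
 "hold r (PQ s) (t, i, j) = (snd (cell t (int i)) = s)"
proof -
 have 0: "(4 * k + 8) mod 4 = 0" "(4 * k + 9) mod 4 = 1" "(4 * k + 10) mod 4 = 2" "(4 * k + 11) mod 4 = 3" for k :: nat
  by presburger+
 show "hold r (PM d) (t, i, j) = (t \<noteq> 0 \<and> msg M w d (cell (t - 1) (int i + int d - 1)) \<noteq> 0)"
  "hold r (PA k) (t, i, j) = bit j k" "hold r (PS a) (t, i, j) = (fst (cell t (int i)) = a)"
  "hold r (PQ s) (t, i, j) = (snd (cell t (int i)) = s)"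
  unfolding hold_def PM_def PA_def PS_def PQ_def prod.case 0 by simp_all
qed (simp_all add: hold_def)

lemma in_elts: "(t, i, j) \<in> elts \<longleftrightarrow> t < 2 ^ N \<and> i < 2 ^ N \<and> j < N"
 by (simp add: elts_def)

text \<open>For offset 1 a class joins a cell with the one just before it in time, which has the
  other parity; class and parity together determine the cell.\<close>

lemma key_same:
 assumes "(t, i, j) \<in> elts" "(t', i', j') \<in> elts" "key 1 b (t, i, j) = key 1 b (t', i', j')" "odd t = odd t'"
 shows "t = t' \<and> i = i'"
proof -
 have "int i mod 2 ^ N = int i" "int i' mod 2 ^ N = int i'" using assms(1,2) unfolding in_elts by simp_all
 then show ?thesis using assms(3,4) unfolding key_def by (auto split: if_splits)
qed

lemma key_parent:
 assumes "(t, i, j) \<in> elts" "(t', i', j') \<in> elts" "key d b (t, i, j) = key d b (t', i', j')" "odd t = b" "odd t' = (\<not> b)"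
 shows "t = t' + 1 \<and> int i = (int i' - int d + 1) mod 2 ^ N"
 using assms(3-5) unfolding key_def by (auto split: if_splits)

theorem tableau_complete:
 assumes NP: "N = 2 ^ P" and z: "snd (cell (2 ^ (N - 1) - 1) z) = Suc (accept_state M)"
 shows "tableau M w P elts (hold (nat (z mod 2 ^ N))) (%d b x y. key d b x = key d b y)"
proof -
 let ?tr = "hold (nat (z mod 2 ^ N))" let ?eq = "%d b x y. key d b x = key d b y"
 have NN: "0 < N" using N by simp
 have zr: "0 \<le> z mod 2 ^ N" "z mod 2 ^ N < 2 ^ N" by simp_all
 have adr: "(\<forall>k<P. bit j k = bit j' k) \<longleftrightarrow> j = j'" if "j < N" "j' < N" for j j' using that bt_inj[of j P j'] unfolding NP by blast
 have key_refl: "key d b (t, i, j) = key d b (t, i, j')" for d b t i j j' by (simp add: key_def)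
 have ex_bit: "\<exists>j<N. bit x j" if "x < 2 ^ N" "x \<noteq> 0" for x :: nat using bt_0[OF that(1)] that(2) by blast
 have 1: "\<exists>y\<in>elts. (\<forall>d<3. \<forall>b. ?eq d b x y) \<and> ?tr PPar x = ?tr PPar y \<and>
    (\<forall>k<P. ?tr (PA k) y = (?tr (PA k) x \<noteq> (\<forall>j<k. ?tr (PA j) x))) \<and>
    ?tr PKt y = ((\<forall>k<P. \<not> ?tr (PA k) y) \<or> ?tr PKt x \<and> ?tr PBt x) \<and>
    ?tr PKi y = ((\<forall>k<P. \<not> ?tr (PA k) y) \<or> ?tr PKi x \<and> ?tr PBi x)" if x: "x \<in> elts" for x
 proof -
  obtain t i j where tij: "x = (t, i, j)" by (cases x)
  note e = x[unfolded tij in_elts]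
  let ?j = "(j + 1) mod N"
  have j': "?j < N" using NN by simp
  have c: "(\<forall>k<?j. bit s k) = ((\<forall>k<P. \<not> bit ?j k) \<or> (\<forall>k<j. bit s k) \<and> bit s j)" for s :: nat
  proof (cases "j + 1 = N")
   case False
   then have "?j = Suc j" using e by simp
   then show ?thesis using bt_0[of ?j P] j' unfolding NP[symmetric] by (auto simp: less_Suc_eq)
  qed simp
  show ?thesis
  proof (rule bexI[of _ "(t, i, ?j)"])
   show "(t, i, ?j) \<in> elts" using e j' unfolding in_elts by simp
   show "(\<forall>d<3. \<forall>b. ?eq d b x (t, i, ?j)) \<and> ?tr PPar x = ?tr PPar (t, i, ?j) \<and>
     (\<forall>k<P. ?tr (PA k) (t, i, ?j) = (?tr (PA k) x \<noteq> (\<forall>j<k. ?tr (PA j) x))) \<and>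
     ?tr PKt (t, i, ?j) = ((\<forall>k<P. \<not> ?tr (PA k) (t, i, ?j)) \<or> ?tr PKt x \<and> ?tr PBt x) \<and>
     ?tr PKi (t, i, ?j) = ((\<forall>k<P. \<not> ?tr (PA k) (t, i, ?j)) \<or> ?tr PKi x \<and> ?tr PBi x)"
    unfolding tij hold_simps using c key_refl bt_Suc[of j P] e unfolding NP[symmetric] by blast
  qed
 qed
 have 2: "?tr PBt x = ?tr PBt y \<and> ?tr PBi x = ?tr PBi y" if "x \<in> elts" "y \<in> elts" "?eq 1 False x y" "?tr PPar x = ?tr PPar y"
  "\<forall>k<P. ?tr (PA k) x = ?tr (PA k) y" for x y
 proof -
  obtain t i j t' i' j' where xy: "x = (t, i, j)" "y = (t', i', j')" by (cases x, cases y)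
  show ?thesis using key_same[OF that(1-3)[unfolded xy]] adr[of j j'] that unfolding xy hold_simps in_elts by simp
 qed
 have 3: "?tr PBt x = (?tr PBt y \<noteq> ?tr PKt y) \<and>
    (if d = 0 then ?tr PBi x = (?tr PBi y \<noteq> ?tr PKi y) else if d = 1 then ?tr PBi x = ?tr PBi y
    else ?tr PBi y = (?tr PBi x \<noteq> ?tr PKi x))"
  if d: "d < 3" and xy: "x \<in> elts" "y \<in> elts" "?eq d b x y" "?tr PPar x = b" "?tr PPar y = (\<not> b)"
   "\<forall>k<P. ?tr (PA k) x = ?tr (PA k) y" for d b x y
 proof -
  obtain t i j t' i' j' where e: "x = (t, i, j)" "y = (t', i', j')" by (cases x, cases y)
  note p = key_parent[OF xy(1-5)[unfolded e hold_simps]]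
  note l = xy(1)[unfolded e in_elts] xy(2)[unfolded e in_elts]
  have j: "j = j'" using adr[of j j'] l xy(6) unfolding e hold_simps by blast
  have "t = (t' + 1) mod 2 ^ N" using p l by simp
  then have 1: "bit t j' = (bit t' j' \<noteq> (\<forall>k<j'. bit t' k))" using bt_Suc[of t' N j'] l by simp
  consider "d = 0" | "d = 1" | "d = 2" using d by linarith
  then show ?thesis
  proof cases
   case 1
   have "int i = int ((i' + 1) mod 2 ^ N)" using p unfolding 1 by (simp add: zmod_int add.commute)
   then have "i = (i' + 1) mod 2 ^ N" by linarith
   then have "bit i j' = (bit i' j' \<noteq> (\<forall>k<j'. bit i' k))" using bt_Suc[of i' N j'] l by simp
   then show ?thesis using \<open>bit t j' = _\<close> 1 unfolding e hold_simps j by simp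
  next
   case 2
   have "i = i'" using p l unfolding 2 by simp
   then show ?thesis using \<open>bit t j' = _\<close> 2 unfolding e hold_simps j by simp
  next
   case 3
   have "(int i + 1) mod 2 ^ N = int i' mod 2 ^ N" using p mod_add_left_eq[of "int i' - 1" "2 ^ N" 1] unfolding 3 by simp
   then have "int ((i + 1) mod 2 ^ N) = int i'" using l by (simp add: zmod_int add.commute)
   then have "i' = (i + 1) mod 2 ^ N" by linarith
   then have "bit i' j' = (bit i j' \<noteq> (\<forall>k<j'. bit i k))" using bt_Suc[of i N j'] l by simp
   then show ?thesis using \<open>bit t j' = _\<close> 3 unfolding e hold_simps j by simp
  qed
 qed
 have 4: "(?eq 1 False x y --> ?tr PZt x --> ?tr PPar x = ?tr PPar y --> \<not> ?tr PBt y) \<and>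
   (?eq 1 False x y --> ?tr PZi x --> ?tr PPar x = ?tr PPar y --> \<not> ?tr PBi y)" if xy: "x \<in> elts" "y \<in> elts" for x y
 proof -
  obtain t i j t' i' j' where e: "x = (t, i, j)" "y = (t', i', j')" by (cases x, cases y)
  show ?thesis using key_same[OF xy[unfolded e], of False] unfolding e hold_simps by auto
 qed
 have w4: "(\<not> ?tr PZt x --> (\<exists>y\<in>elts. ?eq 1 False x y \<and> ?tr PPar x = ?tr PPar y \<and> ?tr PBt y)) \<and>
   (\<not> ?tr PZi x --> (\<exists>y\<in>elts. ?eq 1 False x y \<and> ?tr PPar x = ?tr PPar y \<and> ?tr PBi y))" if x: "x \<in> elts" for x
 proof -
  obtain t i j where tij: "x = (t, i, j)" by (cases x)
  note e = x[unfolded tij in_elts]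
  have "\<exists>y\<in>elts. ?eq 1 False x y \<and> ?tr PPar x = ?tr PPar y \<and> ?tr PBt y" if t: "t \<noteq> 0"
  proof -
   obtain k where "k < N" "bit t k" using ex_bit[OF _ t] e by blast
   then have "(t, i, k) \<in> elts" "?tr PBt (t, i, k)" "?tr PPar x = ?tr PPar (t, i, k)" using e unfolding tij in_elts hold_simps by auto
   then show ?thesis using key_refl[of 1 False t i j k] unfolding tij by blast
  qed
  moreover have "\<exists>y\<in>elts. ?eq 1 False x y \<and> ?tr PPar x = ?tr PPar y \<and> ?tr PBi y" if i: "i \<noteq> 0"
  proof -
   obtain k where "k < N" "bit i k" using ex_bit[OF _ i] e by blast
   then have "(t, i, k) \<in> elts" "?tr PBi (t, i, k)" "?tr PPar x = ?tr PPar (t, i, k)" using e unfolding tij in_elts hold_simps by auto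
   then show ?thesis using key_refl[of 1 False t i j k] unfolding tij by blast
  qed
  moreover have "?tr PZt x = (t = 0)" "?tr PZi x = (i = 0)" unfolding tij hold_simps by auto
  ultimately show ?thesis by blast
 qed
 have 5: "\<exists>y\<in>elts. ?eq d b x y \<and> ?tr PPar y = (\<not> b)" if x: "x \<in> elts" "\<not> ?tr PZt x" "?tr PPar x = b" for d b x
 proof -
  obtain t i j where tij: "x = (t, i, j)" by (cases x)
  note e = x(1)[unfolded tij in_elts]
  have t: "t \<noteq> 0" "odd t = b" using x unfolding tij hold_simps by auto
  define k where "k = (int i + int d - 1) mod 2 ^ N"
  have "(k + (1 - int d)) mod 2 ^ N = (int i + int d - 1 + (1 - int d)) mod 2 ^ N" unfolding k_def by (rule mod_add_left_eq)
  then have k: "0 \<le> k" "k < 2 ^ N" "(k - int d + 1) mod 2 ^ N = int i" using e by (simp_all add: k_def algebra_simps)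
  have "nat k < 2 ^ N" using k(1,2) by (simp add: nat_less_iff)
  then have y: "(t - 1, nat k, j) \<in> elts" using e less_imp_diff_less[of t "2 ^ N" 1] unfolding in_elts by blast
  have "odd (t - 1) = (\<not> b)" using t by (cases t) auto
  then have "key d b (t - 1, nat k, j) = key d b (t, i, j)" "?tr PPar (t - 1, nat k, j) = (\<not> b)"
   using t k unfolding key_def hold_simps by auto
  then show ?thesis using y unfolding tij by metis
 qed
 have 6: "(?tr PZt x --> ?tr (PS 0) x) \<and> (?tr PZt x --> ?tr PZi x --> ?tr (PQ (Suc (start_state M w))) x) \<and>
    (?tr PZt x --> \<not> ?tr PZi x --> ?tr (PQ 0) x) \<and>
    (?tr PZt x \<or> ?tr (PM 0) x \<or> ?tr (PM 1) x \<or> ?tr (PM 2) x \<or> ?tr (PQ 0) x)" if x: "x \<in> elts" for x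
 proof -
  obtain t i j where tij: "x = (t, i, j)" by (cases x)
  note e = x[unfolded tij in_elts]
  have "2 ^ N dvd int i \<longleftrightarrow> i = 0" using e dvd_imp_le_int[of "int i" "2 ^ N"]
   by (cases "i = 0") (auto simp flip: of_nat_power)
  moreover have "t \<noteq> 0 --> msg M w 0 (cell (t - 1) (int i + int 0 - 1)) = 0 -->
   msg M w 1 (cell (t - 1) (int i + int 1 - 1)) = 0 --> msg M w 2 (cell (t - 1) (int i + int 2 - 1)) = 0 --> snd (cell t (int i)) = 0"
  proof (intro impI)
   assume that: "t \<noteq> 0" "msg M w 0 (cell (t - 1) (int i + int 0 - 1)) = 0"
    "msg M w 1 (cell (t - 1) (int i + int 1 - 1)) = 0" "msg M w 2 (cell (t - 1) (int i + int 2 - 1)) = 0"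
   have "\<forall>d<3. msg M w d (cell (t - 1) (int i + int d - 1)) = 0" unfolding all_less_3 using that by blast
   then have "snd (cell (Suc (t - 1)) (int i)) = 0" by (intro next_state_0) blast
   then show "snd (cell t (int i)) = 0" using that(1) by simp
  qed
  ultimately show ?thesis unfolding tij hold_simps by (cases "t = 0") auto
 qed
 have 8: "(d = 1 --> ?tr (PS (wr M w (a, s))) x) \<and> (if msg M w d (a, s) = 0 then \<not> ?tr (PM d) x else ?tr (PQ (msg M w d (a, s))) x)"
  if d: "d < 3" and xy: "x \<in> elts" "y \<in> elts" "?eq d b x y" "?tr PPar x = b" "?tr PPar y = (\<not> b)" "?tr (PS a) y" "?tr (PQ s) y" for d b a s x y
 proof -
  obtain t i j t' i' j' where e: "x = (t, i, j)" "y = (t', i', j')" by (cases x, cases y)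
  note p = key_parent[OF xy(1-5)[unfolded e hold_simps]]
  have "2 ^ N dvd int i' - (int i + int d - 1)"
  proof -
   have "(int i' - int d + 1) mod 2 ^ N = int i mod 2 ^ N" using p by simp
   then have "2 ^ N dvd (int i' - int d + 1) - int i" by (simp only: mod_eq_dvd_iff)
   then show ?thesis by (simp add: algebra_simps)
  qed
  from cell_periodic[OF this, of t'] have as: "cell t' (int i + int d - 1) = (a, s)"
   using xy(6,7) unfolding e hold_simps by (metis prod.collapse)
  have t: "t = Suc t'" using p by simp
  have "d = 1 ==> fst (cell t (int i)) = wr M w (a, s)" using as unfolding t by (simp add: rule_def)
  moreover have "msg M w d (a, s) \<noteq> 0 ==> snd (cell t (int i)) = msg M w d (a, s)"
   using next_state[OF d, of t' "int i"] as unfolding t by simp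
  ultimately show ?thesis using as t unfolding e hold_simps by auto
 qed
 have 9: "\<exists>x\<in>elts. ?tr PRoot x \<and> ?tr (PQ (Suc (accept_state M))) x"
 proof (rule bexI[of _ "(2 ^ (N - 1) - 1, nat (z mod 2 ^ N), 0)"])
  have "cell (2 ^ (N - 1) - 1) (z mod 2 ^ N) = cell (2 ^ (N - 1) - 1) z"
   by (rule cell_periodic) (simp add: mod_eq_dvd_iff[symmetric])
  then show "?tr PRoot (2 ^ (N - 1) - 1, nat (z mod 2 ^ N), 0) \<and>
    ?tr (PQ (Suc (accept_state M))) (2 ^ (N - 1) - 1, nat (z mod 2 ^ N), 0)"
   using z zr(1) unfolding hold_simps by simp
  have "(2::nat) ^ (N - 1) \<le> 2 ^ N" by (rule power_increasing) auto
  then have "(2::nat) ^ (N - 1) - 1 < 2 ^ N" using zero_less_power[of "2::nat" "N - 1"] by linarith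
  moreover have "nat (z mod 2 ^ N) < 2 ^ N" using zr by (simp add: nat_less_iff)
  ultimately show "(2 ^ (N - 1) - 1, nat (z mod 2 ^ N), 0) \<in> elts" unfolding in_elts using NN by simp
 qed
 have 10: "?tr PBt y = (\<not> (\<forall>k<P. ?tr (PA k) y))" if xy: "x \<in> elts" "y \<in> elts" "?eq 1 False x y" "?tr PRoot x" "?tr PPar x = ?tr PPar y" for x y
 proof -
  obtain t i j t' i' j' where e: "x = (t, i, j)" "y = (t', i', j')" by (cases x, cases y)
  have t: "t' = 2 ^ (N - 1) - 1" and j: "j' < N" using key_same[OF xy(1-3)[unfolded e]] xy unfolding e hold_simps in_elts by auto
  have "t' < 2 ^ N" using xy(2) unfolding e in_elts by simp
  from bval_bt[OF this] have "bval (bit t') N = bval (%j. j \<noteq> N - 1) N" using t bval_but_last[OF NN] by simp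
  then have "bit t' j' = (j' \<noteq> N - 1)" using j unfolding bval_eq_iff[symmetric] by blast
  moreover have "(\<forall>k<P. bit j' k) \<longleftrightarrow> j' = N - 1" using bt_ones[of j' P] j unfolding NP[symmetric] by blast
  ultimately show ?thesis unfolding e hold_simps by simp
 qed
 have 7: "\<not> (?tr (PQ s) x \<and> ?tr (PQ s') x)" if "s \<noteq> s'" for s s' x
 proof -
  obtain t i j where tij: "x = (t, i, j)" by (cases x)
  show ?thesis using that unfolding tij hold_simps by simp
 qed
 show ?thesis unfolding tableau_def
  by (intro conjI ballI allI impI) ((rule 1 2[THEN conjunct1] 2[THEN conjunct2] 3[THEN conjunct1] 3[THEN conjunct2]
   4[THEN conjunct1, rule_format] 4[THEN conjunct2, rule_format] w4[THEN conjunct1, rule_format] w4[THEN conjunct2, rule_format]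
   5 6[THEN conjunct1, rule_format] 6[THEN conjunct2, THEN conjunct1, rule_format]
   6[THEN conjunct2, THEN conjunct2, THEN conjunct1, rule_format] 6[THEN conjunct2, THEN conjunct2, THEN conjunct2]
   7 8[THEN conjunct1, rule_format] 8[THEN conjunct2] 9 10; assumption)+)
qed

text \<open>The symbols with numbers 2u-1 and 2u receive the same equivalence, which is its own
  inverse.\<close>

definition grid :: "nat => elt struct" where
 "grid r = \<lparr>universe = elts, interp = (%R. case R of
   Base p n => if n = 1 then {[x] | x. x \<in> elts \<and> hold r p x} else {}
  | Dist u => {[x, y] | x y. x \<in> elts \<and> y \<in> elts \<and>
    key ((u - 1) div 4) (2 \<le> (u - 1) mod 4) x = key ((u - 1) div 4) (2 \<le> (u - 1) mod 4) y})\<rparr>"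

lemma elts_ne: "elts \<noteq> {}" "finite elts"
proof -
 have "(0, 0, 0) \<in> elts" unfolding in_elts using N by simp
 then show "elts \<noteq> {}" by blast
qed (simp add: elts_def)

lemma grid_admissible: "admissible 6 (grid r)"
proof -
 let ?e = "%u x. key ((u - 1) div 4) (2 \<le> (u - 1) mod 4) x"
 have rel: "dist_rel (grid r) u = {(x, y). x \<in> elts \<and> y \<in> elts \<and> ?e u x = ?e u y}" for u
  by (auto simp: dist_rel_def grid_def)
 have tr: "trans (dist_rel (grid r) u)" for u unfolding rel trans_def by auto
 have inv: "dist_rel (grid r) (2 * u) = (dist_rel (grid r) (2 * u - 1))\<inverse>" if "1 \<le> u" for u
 proof -
  define v where "v = u - 1"
  have v: "u = Suc v" using that unfolding v_def by simp
  have u: "2 * u - 1 = 2 * v + 1" "2 * u = 2 * v + 2" unfolding v by simp_all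
  have "(2 * v + 1) div 4 = 2 * v div 4" "2 \<le> (2 * v + 1) mod 4 \<longleftrightarrow> 2 \<le> 2 * v mod 4" by presburger+
  then have h: "(2 * v + 2 - 1) div 4 = (2 * v + 1 - 1) div 4" "2 \<le> (2 * v + 2 - 1) mod 4 \<longleftrightarrow> 2 \<le> (2 * v + 1 - 1) mod 4" by simp_all
  have "{(x, y). x \<in> elts \<and> y \<in> elts \<and> K x = K y} = {(x, y). x \<in> elts \<and> y \<in> elts \<and> K x = K y}\<inverse>" for K :: "elt => nat \<times> int"
   by auto
  then show ?thesis unfolding u(1) unfolding u(2) rel h .
 qed
 have "is_struct (grid r)" unfolding is_struct_def
 proof (intro conjI allI)
  show "universe (grid r) \<noteq> {}" using elts_ne by (simp add: grid_def)
  show "interp (grid r) R \<subseteq> {as. length as = arity R \<and> set as \<subseteq> universe (grid r)}" for R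
   by (cases R) (auto simp: grid_def split: if_splits)
 qed
 then show ?thesis unfolding admissible_def using tr inv by auto
qed

lemma tableau_cong:
 assumes "tableau M w P U tr eq" and tr: "\<And>p x. x \<in> U ==> tr' p x = tr p x" and eq: "\<And>d b x y. x \<in> U ==> y \<in> U ==> eq' d b x y = eq d b x y"
 shows "tableau M w P U tr' eq'"
proof -
 have "tableau M w P U tr' eq' = tableau M w P U tr eq"
  unfolding tableau_def by (simp add: tr eq cong: ball_cong_simp bex_cong_simp if_cong)
 then show ?thesis using assms(1) by simp
qed

theorem sentence_iff:
 assumes NP: "N = 2 ^ P" and dec: "decides_in_time M X T" and T: "length w + T (length w) \<le> 2 ^ (N - 1) - 1"
 shows "enc_fm (sentence M w P) \<in> UNFO2_S_FINSAT \<longleftrightarrow> w \<in> X"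
 unfolding accepting_cell[OF dec refl T, symmetric]
proof
 assume "enc_fm (sentence M w P) \<in> UNFO2_S_FINSAT"
 then obtain k where k: "unfo2_S_sentence k (sentence M w P)" "finitely_satisfiable k (sentence M w P)"
  unfolding UNFO2_S_FINSAT_def using injD[OF inj_enc_fm] by blast
 then obtain A :: "nat struct" where A: "admissible k A" "models A (sentence M w P)" unfolding finitely_satisfiable_def by blast
 have ne: "universe A \<noteq> {}" using A(1) unfolding admissible_def is_struct_def by blast
 then obtain a where "a \<in> universe A" by blast
 then have "sat A (%_. a) (sentence M w P)" using A(2) unfolding models_def by auto
 then have tab: "tableau M w P (universe A) (tru A) (%d b. eqv A (eu d b))" unfolding sat_sentence[OF ne] .
 \<comment> \<open>Membership in the language provides some unknown k. As symbol 11 occurs in the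
   sentence, all six relations fall under the transitivity demanded by this k.\<close>
 have "6 \<le> k"
 proof -
  have sy: "syms (conjs xs) = \<Union> (syms ` set xs)" for xs by (induction xs) (auto simp: conjs_simps)
  have "\<exists>q. all2 (eu 2 True) q \<in> set (off_axioms P)" unfolding off_axioms_def set_map
   by (rule exI, rule image_eqI[where x = "(2, True)"], unfold fst_conv snd_conv, rule refl, simp)
  then obtain q where "all2 (eu 2 True) q \<in> set (off_axioms P)" by blast
  moreover have "off_axioms P \<in> set (axioms M w P)" unfolding axioms_def by simp
  ultimately have "all2 (eu 2 True) q \<in> set (concat (axioms M w P))" unfolding set_concat by blast
  moreover have "Dist 11 \<in> syms (all2 (eu 2 True) q)" by (simp add: all2_def eqf_def eu_def)
  ultimately have "Dist 11 \<in> syms (sentence M w P)" unfolding sentence_def syms.simps sy by blast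
  then show ?thesis using k(1) unfolding unfo2_S_sentence_def over_signature_def by force
 qed
 have trans: "trans (dist_rel A (eu d b))" if "d < 3" for d b
  using A(1) \<open>6 \<le> k\<close> that unfolding admissible_def eu_def by auto
 show "\<exists>z. snd (cell (2 ^ (N - 1) - 1) z) = Suc (accept_state M)"
 proof (rule tableau_sound[OF NP tab])
  show "eqv A (eu d b) x z" if d: "d < 3" and "eqv A (eu d b) x y" "eqv A (eu d b) y z" for d b x y z
   using transD[OF trans[OF d, of b]] that(2,3) unfolding dist_rel_def by blast
 qed auto
next
 assume "\<exists>z. snd (cell (2 ^ (N - 1) - 1) z) = Suc (accept_state M)"
 then obtain z where z: "snd (cell (2 ^ (N - 1) - 1) z) = Suc (accept_state M)" by blast
 define r where "r = nat (z mod 2 ^ N)"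
 let ?A = "grid r"
 have U: "universe ?A = elts" by (simp add: grid_def)
 have "tableau M w P elts (tru ?A) (%d b. eqv ?A (eu d b))"
 proof (rule tableau_cong[OF tableau_complete[OF NP z]])
  show "x \<in> elts ==> tru ?A p x = hold (nat (z mod 2 ^ N)) p x" for p x by (simp add: grid_def r_def)
  have e: "eu d True - 1 = 4 * d + 2" "eu d False - 1 = 4 * d" for d by (simp_all add: eu_def)
  have f: "(4 * d + 2) div 4 = d" "2 \<le> (4 * d + 2) mod 4" "(4 * d) div 4 = d" "\<not> 2 \<le> (4 * d) mod 4" for d :: nat by presburger+
  have ee: "(eu d b - 1) div 4 = d" "2 \<le> (eu d b - 1) mod 4 \<longleftrightarrow> b" for d b by (cases b; simp only: e f simp_thms)+
  have "interp ?A (Dist (eu d b)) = {[x, y] | x y. x \<in> elts \<and> y \<in> elts \<and> key d b x = key d b y}" for d b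
   unfolding grid_def struct.simps rsym.case ee ..
  then show "x \<in> elts ==> y \<in> elts ==> eqv ?A (eu d b) x y = (key d b x = key d b y)" for d b x y by auto
 qed
 then have "sat ?A v (sentence M w P)" for v using sat_sentence[of ?A v M w P] elts_ne(1) unfolding U by blast
 then have "models ?A (sentence M w P)" unfolding models_def by blast
 then have "finitely_satisfiable 6 (sentence M w P)" by (rule finitely_satisfiableI[OF grid_admissible, rotated 1]) (simp add: U elts_ne)
 then show "enc_fm (sentence M w P) \<in> UNFO2_S_FINSAT" unfolding UNFO2_S_FINSAT_def using sentence_ok by blast
qed

end

subsection \<open>The reduction is computable in polynomial time\<close>

lemma FP_drop: "FP n ==> FP l ==> FP (%x. drop (n x) (l x))" for l :: "'x::enc => 'a::enc list"
proof -
 let ?h = "%acc (_::unit). case acc of [] => [] | y # ys => ys"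
 have eq: "foldl ?h l us = drop (length us) l" for l :: "'a list" and us
  by (induction us arbitrary: l) (auto split: list.split)
 have sz: "sz (drop m l) \<le> sz l" for m and l :: "'a list"
 proof -
  have "1 \<le> sz (take m l)" by (cases "take m l") auto
  then show ?thesis using sz_append[of "take m l" "drop m l"] unfolding append_take_drop_id by linarith
 qed
 have "FP (%q. foldl ?h (snd q :: 'a list) (replicate (fst q) ()))"
  by (rule FP_foldl[where B = "%q. sz (snd q)" and h = "%_. ?h"])
   (intro FP_intros | intro FP_size FP_snd FP_id | simp add: eq sz)+
 then have "FP (%q. drop (fst q) (snd q :: 'a list))" unfolding eq length_replicate .
 then show "FP n ==> FP l ==> FP (%x. drop (n x) (l x))" by (rule FP_comp2[where f = drop])
qed

lemma FP_minus: "FP f ==> FP g ==> FP (%x. f x - g x :: nat)"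
 using FP_length[OF FP_drop[OF _ FP_unary, of g f]] by simp

lemma FP_letter: "FP f ==> FP g ==> FP (%x. letter (f x) (g x))"
 unfolding letter_def by (intro FP_case_list FP_drop FP_const FP_fst FP_snd FP_id)

text \<open>A finite table is part of the program, so arbitrary values such as those of the
  transition function of M can be built in.\<close>

lemma FP_table: "FP d ==> FP (%x. if x \<in> set ks then h x else d x)"
proof (induction ks)
 case (Cons k ks)
 have "FP (%x. if x = k then h k else if x \<in> set ks then h x else d x)"
  by (rule FP_if[OF FP_eq[OF FP_id FP_const] FP_const Cons.IH[OF Cons.prems]])
 moreover have "(%x. if x = k then h k else if x \<in> set ks then h x else d x) = (%x. if x \<in> set (k # ks) then h x else d x)"
  by auto
 ultimately show ?case by simp
qed simp

lemma FP_xdelta: "FP f ==> FP g ==> FP h ==> FP (%x. xdelta M (f x) (g x) (h x))"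
proof -
 let ?H = "%y. case trans_fun M (fst y) (snd y) of (q', b, d) => (q', b, dcode d)"
 let ?tb = "%y. if y \<in> set (List.product [0..<num_states M] [0..<num_symbols M]) then ?H y else (0, 0, 0)"
 let ?f = "%w q a. if q = accept_state M \<or> q = reject_state M then (q, a, 1)
   else if q < num_states M then (if a < num_symbols M then ?tb (q, a) else (q, a, 1))
   else (if q = num_states M then 0 else q - 1, if letter w (q - num_states M) then 2 else 1,
    if q = num_states M then 1 else 2)"
 have tb: "FP ?tb" by (rule FP_table) (rule FP_const)
 have "FP (%p. ?f (fst p) (fst (snd p)) (snd (snd p)))"
  by (intro FP_if FP_disj FP_eq FP_less FP_pair FP_letter FP_minus FP_comp[OF tb] FP_const FP_fst FP_snd FP_id)
 moreover have "?f w q a = xdelta M w q a" for w q a unfolding xdelta_def by auto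
 ultimately have "FP (%p. xdelta M (fst p) (fst (snd p)) (snd (snd p)))" by simp
 then show "FP f ==> FP g ==> FP h ==> FP (%x. xdelta M (f x) (g x) (h x))" by (rule FP_comp3[where f = "xdelta M"])
qed

lemma FP_wr: "FP f ==> FP c ==> FP (%x. wr M (f x) (c x))"
 unfolding wr_def by (intro FP_if FP_eq FP_xdelta FP_pred FP_const FP_fst FP_snd)

lemma FP_msg: "FP f ==> FP d ==> FP c ==> FP (%x. msg M (f x) (d x) (c x))"
 unfolding msg_def by (intro FP_if FP_eq FP_Suc FP_xdelta FP_pred FP_const FP_fst FP_snd)

lemma FP_start_state: "FP f ==> FP (%x. start_state M (f x))"
 unfolding start_state_def by (intro FP_if FP_null FP_add FP_pred FP_length FP_const)

lemma FP_conjs: "FP l ==> FP (%x. conjs (l x))" "FP l ==> FP (%x. disjs (l x))"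
proof -
 have sz1: "sz (foldl (%acc x. And x acc) a ys) \<le> sz a + 8 * sz ys" for a ys
 proof (induction ys arbitrary: a)
  case (Cons y ys)
  have "sz (And y a) \<le> 7 + sz y + sz a" by (simp add: sz_def ec_prod_def eval_nat_numeral)
  then show ?case using Cons[of "And y a"] by simp
 qed simp
 have sz2: "sz (foldl (%acc x. Or x acc) a ys) \<le> sz a + 12 * sz ys" for a ys
 proof (induction ys arbitrary: a)
  case (Cons y ys)
  have "sz (Or y a) \<le> 9 + sz y + sz a" by (simp add: sz_def ec_prod_def eval_nat_numeral)
  then show ?case using Cons[of "Or y a"] by simp
 qed simp
 have pre: "sz ys \<le> sz (ys @ zs)" for ys zs :: "fm list" using sz_append[of ys zs] by (cases zs) auto
 have 1: "FP (%l. foldl (%acc x. And x acc) (Eq 0 0) (rev l))"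
 proof (rule FP_foldl[where B = "%l. sz (Eq 0 0) + 8 * sz (rev l)" and h = "%_ acc x. And x acc"])
  show "sz (foldl (%acc x. And x acc) (Eq 0 0) ys) \<le> sz (Eq 0 0) + 8 * sz (rev l)" if "rev l = ys @ zs" for l ys zs
   using sz1[of "Eq 0 0" ys] pre[of ys zs] unfolding that by linarith
 qed (intro pbound_intros FP_size FP_intros FP_fm_intros)+
 have 2: "FP (%l. foldl (%acc x. Or x acc) (Neg (Eq 0 0)) (rev l))"
 proof (rule FP_foldl[where B = "%l. sz (Neg (Eq 0 0)) + 12 * sz (rev l)" and h = "%_ acc x. Or x acc"])
  show "sz (foldl (%acc x. Or x acc) (Neg (Eq 0 0)) ys) \<le> sz (Neg (Eq 0 0)) + 12 * sz (rev l)" if "rev l = ys @ zs" for l ys zs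
   using sz2[of "Neg (Eq 0 0)" ys] pre[of ys zs] unfolding that by linarith
 qed (intro pbound_intros FP_size FP_intros FP_fm_intros)+
 show "FP l ==> FP (%x. conjs (l x))" unfolding conjs_def by (rule FP_comp[OF 1])
 show "FP l ==> FP (%x. disjs (l x))" unfolding disjs_def by (rule FP_comp[OF 2])
qed

lemma FP_lit: "FP p ==> FP v ==> FP (%x. lit (p x) (v x))"
 unfolding lit_def by (intro FP_pair FP_Neg FP_Atom FP_Base FP_Cons FP_const)
lemma FP_conjb: "FP l ==> FP (%x. conjb (l x))"
 unfolding conjb_def by (intro FP_pair FP_conjs FP_map FP_fst FP_snd FP_id)
lemma FP_notb: "FP q ==> FP (%x. notb (q x))"
 unfolding notb_def by (intro FP_pair FP_fst FP_snd)
lemma FP_disjb: "FP l ==> FP (%x. disjb (l x))"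
 unfolding disjb_def by (intro FP_notb FP_conjb FP_map FP_snd FP_id)
lemma FP_impb: "FP a ==> FP b ==> FP (%x. impb (a x) (b x))"
 unfolding impb_def by (intro FP_notb FP_disjb FP_Cons FP_const)
lemma FP_iffb: "FP a ==> FP b ==> FP (%x. iffb (a x) (b x))"
 unfolding iffb_def by (intro FP_impb FP_conjb FP_Cons FP_const)
lemma FP_isb: "FP p ==> FP v ==> FP c ==> FP (%x. isb (p x) (v x) (c x))"
 unfolding isb_def by (intro FP_if FP_lit FP_notb)
lemma FP_same: "FP p ==> FP (%x. same (p x))"
 unfolding same_def by (intro FP_iffb FP_lit FP_const)
lemma FP_preds: "FP f ==> FP (%x. PM (f x))" "FP f ==> FP (%x. PA (f x))" "FP f ==> FP (%x. PS (f x))" "FP f ==> FP (%x. PQ (f x))"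
 unfolding PM_def PA_def PS_def PQ_def by (intro FP_add FP_mult FP_const; assumption)+
lemma FP_sameaddr: "FP f ==> FP (%x. sameaddr (f x))"
 unfolding sameaddr_def by (intro FP_conjb FP_map FP_same FP_preds FP_upt FP_snd FP_id)
lemma FP_incb: "FP B ==> FP K ==> FP u ==> FP v ==> FP (%x. incb (B x) (K x) (u x) (v x))"
 unfolding incb_def by (intro FP_iffb FP_notb FP_lit)
lemma FP_succb: "FP f ==> FP (%x. succb (f x))"
 unfolding succb_def by (intro FP_conjb FP_map FP_iffb FP_notb FP_lit FP_preds FP_upt FP_const FP_fst FP_snd FP_id)
lemma FP_carryb: "FP f ==> FP (%x. carryb (f x) K B)"
 unfolding carryb_def by (intro FP_iffb FP_disjb FP_conjb FP_map FP_notb FP_lit FP_preds FP_upt FP_Cons FP_const FP_fst FP_snd FP_id)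
lemma FP_parent: "FP b ==> FP (%x. parent (b x))"
 unfolding parent_def by (intro FP_isb FP_Cons FP_not FP_const)
lemma FP_eu: "FP d ==> FP b ==> FP (%x. eu (d x) (b x))"
 unfolding eu_def by (intro FP_add FP_mult FP_if FP_const)
lemma FP_all2: "FP u ==> FP q ==> FP (%x. all2 (u x) (q x))"
 unfolding all2_def eqf_def by (intro FP_fm_intros FP_Cons FP_snd FP_const)
lemma FP_all1: "FP q ==> FP (%x. all1 (q x))"
 unfolding all1_def by (intro FP_fm_intros FP_snd FP_const)
lemma FP_allex: "FP a ==> FP us ==> FP q ==> FP (%x. allex (a x) (us x) (q x))"
 unfolding allex_def eqf_def by (intro FP_fm_intros FP_conjs FP_map FP_Cons FP_fst FP_snd FP_id FP_const)

lemma FP_sentence: "FP P ==> FP (%w. sentence M w (P w))"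
proof -
 have "FP (%t. sentence M (fst t) (snd t))"
  unfolding sentence_def axioms_def off_axioms_def
  by (intro FP_Exists FP_conjs FP_concat FP_Cons FP_append FP_map FP_filter FP_product FP_upt FP_all2 FP_all1 FP_allex FP_eu
    FP_impb FP_iffb FP_conjb FP_disjb FP_notb FP_lit FP_isb FP_same FP_preds FP_sameaddr FP_incb FP_succb FP_carryb FP_parent
    FP_if FP_not FP_eq FP_wr FP_msg FP_start_state FP_add FP_Suc FP_length FP_fst FP_snd FP_id FP_const)
 then show "FP P ==> FP (%w. sentence M w (P w))" by (rule FP_comp2[where f = "sentence M"]) (rule FP_id)
qed

lemma FP_poly: "FP f ==> FP (%x. poly p (f x) :: nat)"
proof (induction p)
 case (pCons a p) then show ?case by (simp, intro FP_add FP_mult FP_const)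
qed (simp add: FP_const)

theorem hardness: "X \<in> TWO_EXPTIME ==> polytime_reducible X UNFO2_S_FINSAT"
proof -
 assume "X \<in> TWO_EXPTIME"
 then obtain M and p :: "nat poly" where M: "is_tm M" "decides_in_time M X (%n. 2 ^ 2 ^ poly p n)" unfolding TWO_EXPTIME_def by blast
 \<comment> \<open>With a the value of the polynomial and n the length of the word, N = 2^P
   satisfies 2^a + n + 2 \<le> N - 1, so the time 2^(N-1) - 1 covers both the prelude and the run of
   M. Addresses have P bits, which keeps the sentence polynomial.\<close>
 define P where "P w = poly p (length w) + length w + 2" for w :: "bool list"
 have "FP P" unfolding P_def[abs_def] by (intro FP_add FP_poly FP_length FP_id FP_const)
 then have "polytime_computable (%w. enc_fm (sentence M w (P w)))"
  by (intro FP_polytime_computable FP_enc_fm FP_sentence)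
 moreover have "enc_fm (sentence M w (P w)) \<in> UNFO2_S_FINSAT \<longleftrightarrow> w \<in> X" for w
 proof -
  let ?n = "length w" let ?a = "poly p (length w)" let ?N = "(2::nat) ^ P w"
  have xy: "x + y \<le> 2 * (x * y)" if "1 \<le> x" "1 \<le> y" for x y :: nat
  proof -
   have "x \<le> x * y" "y \<le> x * y" using that by simp_all
   then show ?thesis by linarith
  qed
  have n: "?n + 1 \<le> 2 ^ ?n" using less_exp[of ?n] by (simp add: Suc_le_eq)
  have N: "?N = 4 * (2 ^ ?a * 2 ^ ?n)" unfolding P_def by (simp add: power_add)
  have A1: "1 \<le> (2::nat) ^ ?a" by simp
  have "2 ^ ?a + ?n + 3 \<le> ?N" using xy[of "2 ^ ?a" "2 ^ ?n"] n A1 unfolding N by linarith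
  then have "2 ^ ?a + ?n + 2 \<le> ?N - 1" by simp
  then have "(2::nat) ^ (2 ^ ?a + ?n + 2) \<le> 2 ^ (?N - 1)" by (rule power_increasing) simp
  then have "4 * (2 ^ 2 ^ ?a * 2 ^ ?n) \<le> (2::nat) ^ (?N - 1)" by (simp add: power_add)
  moreover have "(2::nat) ^ 2 ^ ?a + 2 ^ ?n \<le> 2 * (2 ^ 2 ^ ?a * 2 ^ ?n)" by (rule xy) simp_all
  ultimately have T: "?n + 2 ^ 2 ^ ?a \<le> 2 ^ (?N - 1) - 1" using n by linarith
  have "2 \<le> ?N" using \<open>2 ^ ?a + ?n + 3 \<le> ?N\<close> by linarith
  with M(1) interpret simulation M w ?N by (rule simulation.intro)
  show ?thesis by (rule sentence_iff[OF refl M(2) T])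
 qed
 ultimately show ?thesis unfolding polytime_reducible_def by blast
qed

theorem theorem8: "complete_for TWO_EXPTIME UNFO2_S_FINSAT"
 unfolding complete_for_def using finsat_in_TWO_EXPTIME hardness by blast

end
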